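(* The functor $K\colon \mathrm{ShMulti}_{lr}\to \mathrm{SkMon}_{ln}$ from left representable short multicategories to left normal skew monoidal categories (defined in the context) is an equivalence of categories, and so is the forgetful functor $U_{lr}\colon \mathrm{Multi}_{lr}\to \mathrm{ShMulti}_{lr}$ from left representable multicategories to left representable short multicategories.
   Context: **Short multicategories.** A short multicategory $\mathbb C$ consists of a category $\mathcal C$; for $0\le n\le 4$ a functor $\mathbb C_n(-;-)\colon(\mathcal C^n)^{op}\times\mathcal C\to\mathrm{Set}$ (elements of $\mathbb C_n(a_1,\dots,a_n;b)$ are called $n$-ary maps), with $\mathbb C_1(-;-)=\mathcal C(-,-)$; one writes $q\circ f$ and $f\circ_i p$ for the functorial action of a unary map $q$ on the codomain and of a unary map $p$ on the $i$-th input. Furthermore there are substitution functions $\circ_i\colon\mathbb C_n(\bar b;c)\times\mathbb C_m(\bar a;b_i)\to\mathbb C_{n+m-1}(\bar b_{<i},\bar a,\bar b_{>i};c)$ for $1\le i\le n$ and $(n,m)\in\{(2,2),(3,2),(2,3),(2,0),(3,0)\}$, natural in all $a_k$, all $b_k$ with $k\ne i$, and $c$, and dinatural in $b_i$. For $f$ binary, $g$ $n$-ary and $h$ $p$-ary, one requires: (A) $f\circ_i(g\circ_j h)=(f\circ_i g)\circ_{j+i-1}h$ for $1\le i\le 2$, $1\le j\le n$, when $(n,p)\in\{(2,2),(2,0)\}$; (B) $(f\circ_1 g)\circ_{n+1}h=(f\circ_2 h)\circ_1 g$ when $(n,p)\in\{(2,2),(2,0),(0,2),(0,0)\}$. A morphism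 $F\colon\mathbb C\to\mathbb D$ is a functor $F\colon\mathcal C\to\mathcal D$ with natural families $F_n\colon\mathbb C_n(\bar a;b)\to\mathbb D_n(F\bar a;Fb)$, $0\le n\le4$, $F_1$ being the functor action, commuting with all substitutions $\circ_i$. **Left representability (short).** A short multicategory is left representable if there are binary maps $\theta_{a,b}\colon a,b\to ab$ (for all $a,b$) and a nullary map $u\in\mathbb C_0(\,;i)$ such that $-\circ_1\theta_{a,b}\colon\mathbb C_n(ab,\bar x;d)\to\mathbb C_{n+1}(a,b,\bar x;d)$ is bijective for $n=1,2,3$ and $-\circ_1u\colon\mathbb C_{n+1}(i,\bar x;d)\to\mathbb C_n(\bar x;d)$ is bijective for $n=0,1,2$ (all $\bar x,d$); such maps are called left universal binary/nullary map classifiers. $\mathrm{ShMulti}_{lr}$ is the category of left representable short multicategories and all morphisms of short multicategories. **Multicategories.** $\mathrm{Multi}_{lr}$ is the category of left representable multicategories (non-symmetric, $\mathrm{Set}$-valued homs) and multifunctors. A multicategory is left representable if for every list $\bar a=a_1,\dots,a_n$ ($n\ge0$) there is a multimap $\theta_{\bar a}\colon\bar a\to m\bar a$ such that $-\circ_1\theta_{\bar a}\colon\mathbb C_{1+r}(m\bar a,\bar y;d)\to\mathbb C_{n+r}(\bar a,\bar y;d)$ is bijective for all $r\ge 0$, $\bar y$ of length $r$, and $d$. $U_{lr}$ keeps the category of unary maps, the $n$-ary maps for $n\le4$, and the substitutions listed above, and forgets the rest. **Skew monoidal categories.** A (left) skew monoidal category is a category $\mathcal C$ with a functor $(a,b)\mapsto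 ab$, $\mathcal C\times\mathcal C\to\mathcal C$, an object $i$, and natural families $\alpha_{a,b,c}\colon(ab)c\to a(bc)$, $\lambda_a\colon ia\to a$, $\rho_a\colon a\to ai$ (not necessarily invertible) satisfying $\alpha_{a,b,cd}\alpha_{ab,c,d}=(a\,\alpha_{b,c,d})\alpha_{a,bc,d}(\alpha_{a,b,c}\,d)$, $\lambda_{ab}\alpha_{i,a,b}=\lambda_a b$, $\alpha_{a,b,i}\rho_{ab}=a\rho_b$, $(a\lambda_b)\alpha_{a,i,b}(\rho_a b)=1_{ab}$, $\lambda_i\rho_i=1_i$. It is left normal if $\lambda$ is invertible. A lax monoidal functor is a functor $F$ with a map $f_0\colon i\to Fi$ and a natural family $f_2\colon FaFb\to F(ab)$ such that $F\alpha\circ f_2\circ(f_2\cdot Fc)=f_2\circ(Fa\cdot f_2)\circ\alpha$, $F\lambda\circ f_2\circ(f_0\cdot Fa)=\lambda$, $f_2\circ(Fa\cdot f_0)\circ\rho=F\rho$. $\mathrm{SkMon}_{ln}$ is the category of left normal skew monoidal categories and lax monoidal functors. **The functor $K$.** For each left representable short multicategory fix a choice of left universal $\theta_{a,b}$ and $u$. $K\mathbb C$ has underlying category $\mathcal C$, tensor $ab$, unit $i$; for $f\colon a\to b$, $g\colon c\to d$, $fg\colon ac\to bd$ is the unique map with $(fg)\circ\theta_{a,c}=(\theta_{b,d}\circ_1f)\circ_2g$; $\alpha$ is the unique map with $(\alpha\circ\theta_{ab,c})\circ_1\theta_{a,b}=\theta_{a,bc}\circ_2\theta_{b,c}$; $\lambda_a$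 is the unique map with $(\lambda_a\circ\theta_{i,a})\circ_1u=1_a$; $\rho_a=\theta_{a,i}\circ_2u$. On a morphism $F$, $KF=(F,f_0,f_2)$ where $f_2$ is the unique map with $f_2\circ\theta_{Fa,Fb}=F_2(\theta_{a,b})$ and $f_0$ the unique map with $f_0\circ u=F_0(u)$. *)

theory Defs
  imports Main
begin

text \<open>
  Conventions. Hom-sets are families of sets indexed by their (lists of) objects and are not
  assumed disjoint, as for Set-valued homs; hence every operation on maps carries the relevant
  objects as arguments, listed before the maps. Small structures have their objects in a set over
  a type \<open>'o\<close> and all their maps in a type \<open>'m\<close>; both types are arbitrary.

  Outside its carriers an operation of a structure may take any value. Morphisms between
  structures, in contrast, are required to be \<open>undefined\<close> outside their carriers, so that
  equality of morphisms in HOL is equality of functors and of families of maps.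

  Inputs are counted from 0, so the substitution \<open>\<circ>\<^sub>i\<close> of the literature is the one at
  position \<open>i - 1\<close> here.
\<close>


section \<open>Categories, functors, equivalences\<close>

record ('o, 'm) cat =
  Ob :: "'o set"
  Hom :: "'o \<Rightarrow> 'o \<Rightarrow> 'm set"
  Idn :: "'o \<Rightarrow> 'm"
  Comp :: "'o \<Rightarrow> 'o \<Rightarrow> 'o \<Rightarrow> 'm \<Rightarrow> 'm \<Rightarrow> 'm"
    \<comment> \<open>\<open>Comp C a b c g f\<close> is \<open>g \<circ> f\<close> for \<open>f : a \<rightarrow> b\<close> and \<open>g : b \<rightarrow> c\<close>\<close>

locale category =
  fixes C :: "('o, 'm, 'z) cat_scheme" (structure)
  assumes idn_closed: "a \<in> Ob C \<Longrightarrow> Idn C a \<in> Hom C a a"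
    and comp_closed: "\<lbrakk>a \<in> Ob C; b \<in> Ob C; c \<in> Ob C; f \<in> Hom C a b; g \<in> Hom C b c\<rbrakk>
      \<Longrightarrow> Comp C a b c g f \<in> Hom C a c"
    and idn_left: "\<lbrakk>a \<in> Ob C; b \<in> Ob C; f \<in> Hom C a b\<rbrakk> \<Longrightarrow> Comp C a b b (Idn C b) f = f"
    and idn_right: "\<lbrakk>a \<in> Ob C; b \<in> Ob C; f \<in> Hom C a b\<rbrakk> \<Longrightarrow> Comp C a a b f (Idn C a) = f"
    and comp_assoc: "\<lbrakk>a \<in> Ob C; b \<in> Ob C; c \<in> Ob C; d \<in> Ob C;
        f \<in> Hom C a b; g \<in> Hom C b c; h \<in> Hom C c d\<rbrakk>
      \<Longrightarrow> Comp C a c d h (Comp C a b c g f) = Comp C a b d (Comp C b c d h g) f"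

definition iso :: "('o, 'm, 'z) cat_scheme \<Rightarrow> 'o \<Rightarrow> 'o \<Rightarrow> 'm \<Rightarrow> bool" where
  "iso C a b f \<longleftrightarrow> f \<in> Hom C a b \<and>
     (\<exists>g\<in>Hom C b a. Comp C a b a g f = Idn C a \<and> Comp C b a b f g = Idn C b)"

record ('o, 'm, 'p, 'n) functr =
  FOb :: "'o \<Rightarrow> 'p"
  FHom :: "'o \<Rightarrow> 'o \<Rightarrow> 'm \<Rightarrow> 'n"

definition is_functor ::
  "('o, 'm, 'z) cat_scheme \<Rightarrow> ('p, 'n, 'y) cat_scheme \<Rightarrow> ('o, 'm, 'p, 'n, 'x) functr_scheme \<Rightarrow> bool"
where
  "is_functor C D F \<longleftrightarrow>
     (\<forall>a\<in>Ob C. FOb F a \<in> Ob D) \<and>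
     (\<forall>a\<in>Ob C. \<forall>b\<in>Ob C. \<forall>f\<in>Hom C a b. FHom F a b f \<in> Hom D (FOb F a) (FOb F b)) \<and>
     (\<forall>a\<in>Ob C. FHom F a a (Idn C a) = Idn D (FOb F a)) \<and>
     (\<forall>a\<in>Ob C. \<forall>b\<in>Ob C. \<forall>c\<in>Ob C. \<forall>f\<in>Hom C a b. \<forall>g\<in>Hom C b c.
        FHom F a c (Comp C a b c g f)
          = Comp D (FOb F a) (FOb F b) (FOb F c) (FHom F b c g) (FHom F a b f))"

definition functr_ext ::
  "('o, 'm, 'z) cat_scheme \<Rightarrow> ('o, 'm, 'p, 'n, 'x) functr_scheme \<Rightarrow> bool"
where
  "functr_ext C F \<longleftrightarrow>
     (\<forall>a. a \<notin> Ob C \<longrightarrow> FOb F a = undefined) \<and>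
     (\<forall>a b f. \<not> (a \<in> Ob C \<and> b \<in> Ob C \<and> f \<in> Hom C a b) \<longrightarrow> FHom F a b f = undefined)"

definition id_functr :: "('o, 'm, 'o, 'm) functr" where
  "id_functr = \<lparr>FOb = (\<lambda>a. a), FHom = (\<lambda>a b f. f)\<rparr>"

definition comp_functr ::
  "('p, 'n, 'q, 'k, 'y) functr_scheme \<Rightarrow> ('o, 'm, 'p, 'n, 'x) functr_scheme
    \<Rightarrow> ('o, 'm, 'q, 'k) functr"
where
  "comp_functr G F =
     \<lparr>FOb = (\<lambda>a. FOb G (FOb F a)),
      FHom = (\<lambda>a b f. FHom G (FOb F a) (FOb F b) (FHom F a b f))\<rparr>"

definition nat_iso ::
  "('o, 'm, 'z) cat_scheme \<Rightarrow> ('p, 'n, 'y) cat_scheme \<Rightarrow> ('o, 'm, 'p, 'n, 'x) functr_scheme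
    \<Rightarrow> ('o, 'm, 'p, 'n, 'w) functr_scheme \<Rightarrow> ('o \<Rightarrow> 'n) \<Rightarrow> bool"
where
  "nat_iso C D F G t \<longleftrightarrow>
     (\<forall>a\<in>Ob C. iso D (FOb F a) (FOb G a) (t a)) \<and>
     (\<forall>a\<in>Ob C. \<forall>b\<in>Ob C. \<forall>f\<in>Hom C a b.
        Comp D (FOb F a) (FOb F b) (FOb G b) (t b) (FHom F a b f)
          = Comp D (FOb F a) (FOb G a) (FOb G b) (FHom G a b f) (t a))"

definition equivalence_of_categories ::
  "('o, 'm, 'z) cat_scheme \<Rightarrow> ('p, 'n, 'y) cat_scheme \<Rightarrow> ('o, 'm, 'p, 'n) functr \<Rightarrow> bool"
where
  "equivalence_of_categories C D F \<longleftrightarrow>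
     category C \<and> category D \<and> is_functor C D F \<and>
     (\<exists>G :: ('p, 'n, 'o, 'm) functr. is_functor D C G \<and>
        (\<exists>s. nat_iso C C id_functr (comp_functr G F) s) \<and>
        (\<exists>t. nat_iso D D (comp_functr F G) id_functr t))"


section \<open>Short multicategories\<close>

text \<open>
  \<open>MHom C as b\<close> is the set of multimaps with inputs \<open>as\<close> and output \<open>b\<close>; only lists of length at
  most 4 matter. \<open>Act C as b as' b' ps q\<close> is the map \<open>MHom C as b \<rightarrow> MHom C as' b'\<close> assigned by the
  functor \<open>MHom C\<close> to the tuple \<open>ps : as' \<rightarrow> as\<close> and \<open>q : b \<rightarrow> b'\<close>. \<open>Sub C bs c i as g f\<close> substitutes
  \<open>f \<in> MHom C as (bs ! i)\<close> at position \<open>i\<close> of \<open>g \<in> MHom C bs c\<close>; it is used only for the arities in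
  \<open>sub_arities\<close>, where both maps are non-unary.
\<close>

record ('o, 'm) shmulti = "('o, 'm) cat" +
  MHom :: "'o list \<Rightarrow> 'o \<Rightarrow> 'm set"
  Act :: "'o list \<Rightarrow> 'o \<Rightarrow> 'o list \<Rightarrow> 'o \<Rightarrow> 'm list \<Rightarrow> 'm \<Rightarrow> 'm \<Rightarrow> 'm"
  Sub :: "'o list \<Rightarrow> 'o \<Rightarrow> nat \<Rightarrow> 'o list \<Rightarrow> 'm \<Rightarrow> 'm \<Rightarrow> 'm"

definition plug :: "'a list \<Rightarrow> nat \<Rightarrow> 'a list \<Rightarrow> 'a list" where
  "plug bs i as = take i bs @ as @ drop (Suc i) bs"

definition sub_arities :: "(nat \<times> nat) set" where
  "sub_arities = {(2, 2), (3, 2), (2, 3), (2, 0), (3, 0)}"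

text \<open>Hom-sets and composition of the power categories \<open>C\<^sup>n\<close>, \<open>n\<close> being the length of the lists.\<close>

definition Homs :: "('o, 'm, 'z) cat_scheme \<Rightarrow> 'o list \<Rightarrow> 'o list \<Rightarrow> 'm list set" where
  "Homs C as' as = {ps. length as' = length as \<and> length ps = length as \<and>
     (\<forall>k<length as. ps ! k \<in> Hom C (as' ! k) (as ! k))}"

definition Comps ::
  "('o, 'm, 'z) cat_scheme \<Rightarrow> 'o list \<Rightarrow> 'o list \<Rightarrow> 'o list \<Rightarrow> 'm list \<Rightarrow> 'm list \<Rightarrow> 'm list"
where
  "Comps C as'' as' as ps ps' =
     map (\<lambda>k. Comp C (as'' ! k) (as' ! k) (as ! k) (ps ! k) (ps' ! k)) [0..<length as]"

text \<open>The one-variable actions: \<open>post C as b b' q f\<close> is \<open>q \<circ> f\<close> for \<open>q : b \<rightarrow> b'\<close>, and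
  \<open>pre C as b i a' f p\<close> is \<open>f \<circ>\<^sub>i p\<close> for \<open>p : a' \<rightarrow> as ! i\<close>.\<close>

definition post ::
  "('o, 'm, 'z) shmulti_scheme \<Rightarrow> 'o list \<Rightarrow> 'o \<Rightarrow> 'o \<Rightarrow> 'm \<Rightarrow> 'm \<Rightarrow> 'm"
where
  "post C as b b' q f = Act C as b as b' (map (Idn C) as) q f"

definition pre ::
  "('o, 'm, 'z) shmulti_scheme \<Rightarrow> 'o list \<Rightarrow> 'o \<Rightarrow> nat \<Rightarrow> 'o \<Rightarrow> 'm \<Rightarrow> 'm \<Rightarrow> 'm"
where
  "pre C as b i a' f p =
     Act C as b (as[i := a']) b ((map (Idn C) as)[i := p]) (Idn C b) f"

text \<open>The notation \<open>g \<circ>\<^sub>i f\<close> in general: the functorial action if one of the maps is unary,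
  substitution otherwise.\<close>

definition subst ::
  "('o, 'm, 'z) shmulti_scheme \<Rightarrow> 'o list \<Rightarrow> 'o \<Rightarrow> nat \<Rightarrow> 'o list \<Rightarrow> 'm \<Rightarrow> 'm \<Rightarrow> 'm"
where
  "subst C bs c i as g f =
     (if length as = 1 then pre C bs c i (hd as) g f
      else if length bs = 1 then post C as (hd bs) c g f
      else Sub C bs c i as g f)"

locale short_multicategory = category C for C :: "('o, 'm, 'z) shmulti_scheme" (structure) +
  assumes act_closed: "\<lbrakk>as \<in> lists (Ob C); length as \<le> 4; as' \<in> lists (Ob C); b \<in> Ob C; b' \<in> Ob C;
        ps \<in> Homs C as' as; q \<in> Hom C b b'; f \<in> MHom C as b\<rbrakk>
      \<Longrightarrow> Act C as b as' b' ps q f \<in> MHom C as' b'"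
    and act_idn: "\<lbrakk>as \<in> lists (Ob C); length as \<le> 4; b \<in> Ob C; f \<in> MHom C as b\<rbrakk>
      \<Longrightarrow> Act C as b as b (map (Idn C) as) (Idn C b) f = f"
    and act_comp: "\<lbrakk>as \<in> lists (Ob C); length as \<le> 4; as' \<in> lists (Ob C); as'' \<in> lists (Ob C);
        b \<in> Ob C; b' \<in> Ob C; b'' \<in> Ob C;
        ps \<in> Homs C as' as; ps' \<in> Homs C as'' as'; q \<in> Hom C b b'; q' \<in> Hom C b' b'';
        f \<in> MHom C as b\<rbrakk>
      \<Longrightarrow> Act C as b as'' b'' (Comps C as'' as' as ps ps') (Comp C b b' b'' q' q) f
          = Act C as' b' as'' b'' ps' q' (Act C as b as' b' ps q f)"
    and unary_hom: "\<lbrakk>a \<in> Ob C; b \<in> Ob C\<rbrakk> \<Longrightarrow> MHom C [a] b = Hom C a b"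
    and unary_act: "\<lbrakk>a \<in> Ob C; a' \<in> Ob C; b \<in> Ob C; b' \<in> Ob C;
        p \<in> Hom C a' a; q \<in> Hom C b b'; f \<in> Hom C a b\<rbrakk>
      \<Longrightarrow> Act C [a] b [a'] b' [p] q f = Comp C a' b b' q (Comp C a' a b f p)"
    and sub_closed: "\<lbrakk>bs \<in> lists (Ob C); as \<in> lists (Ob C); c \<in> Ob C;
        (length bs, length as) \<in> sub_arities; i < length bs;
        g \<in> MHom C bs c; f \<in> MHom C as (bs ! i)\<rbrakk>
      \<Longrightarrow> Sub C bs c i as g f \<in> MHom C (plug bs i as) c"
    and sub_natural: "\<lbrakk>bs \<in> lists (Ob C); bs' \<in> lists (Ob C); as \<in> lists (Ob C); as' \<in> lists (Ob C);
        c \<in> Ob C; c' \<in> Ob C;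
        (length bs, length as) \<in> sub_arities; i < length bs;
        rs \<in> Homs C bs' bs; bs' ! i = bs ! i; rs ! i = Idn C (bs ! i);
        ps \<in> Homs C as' as; q \<in> Hom C c c';
        g \<in> MHom C bs c; f \<in> MHom C as (bs ! i)\<rbrakk>
      \<Longrightarrow> Act C (plug bs i as) c (plug bs' i as') c' (plug rs i ps) q (Sub C bs c i as g f)
          = Sub C bs' c' i as' (Act C bs c bs' c' rs q g)
              (Act C as (bs ! i) as' (bs ! i) ps (Idn C (bs ! i)) f)"
    and sub_dinatural: "\<lbrakk>bs \<in> lists (Ob C); as \<in> lists (Ob C); c \<in> Ob C; b' \<in> Ob C;
        (length bs, length as) \<in> sub_arities; i < length bs;
        p \<in> Hom C b' (bs ! i); g \<in> MHom C bs c; f \<in> MHom C as b'\<rbrakk>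
      \<Longrightarrow> Sub C (bs[i := b']) c i as (pre C bs c i b' g p) f
          = Sub C bs c i as g (post C as b' (bs ! i) p f)"
    and assoc_seq: "\<lbrakk>as \<in> lists (Ob C); bs \<in> lists (Ob C); cs \<in> lists (Ob C); d \<in> Ob C;
        length as = 2; (length bs, length cs) \<in> {(2, 2), (2, 0)}; i < length as; j < length bs;
        f \<in> MHom C as d; g \<in> MHom C bs (as ! i); h \<in> MHom C cs (bs ! j)\<rbrakk>
      \<Longrightarrow> subst C as d i (plug bs j cs) f (subst C bs (as ! i) j cs g h)
          = subst C (plug as i bs) d (j + i) cs (subst C as d i bs f g) h"
    and assoc_par: "\<lbrakk>a \<in> Ob C; a' \<in> Ob C; bs \<in> lists (Ob C); cs \<in> lists (Ob C); d \<in> Ob C;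
        (length bs, length cs) \<in> {(2, 2), (2, 0), (0, 2), (0, 0)};
        f \<in> MHom C [a, a'] d; g \<in> MHom C bs a; h \<in> MHom C cs a'\<rbrakk>
      \<Longrightarrow> subst C (bs @ [a']) d (length bs) cs (subst C [a, a'] d 0 bs f g) h
          = subst C (a # cs) d 0 bs (subst C [a, a'] d 1 cs f h) g"

record ('o, 'm, 'p, 'n) shmor = "('o, 'm, 'p, 'n) functr" +
  FM :: "'o list \<Rightarrow> 'o \<Rightarrow> 'm \<Rightarrow> 'n"

definition FHoms ::
  "('o, 'm, 'p, 'n, 'x) functr_scheme \<Rightarrow> 'o list \<Rightarrow> 'o list \<Rightarrow> 'm list \<Rightarrow> 'n list"
where
  "FHoms F as' as ps = map (\<lambda>k. FHom F (as' ! k) (as ! k) (ps ! k)) [0..<length as]"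

definition sh_morphism ::
  "('o, 'm) shmulti \<Rightarrow> ('p, 'n) shmulti \<Rightarrow> ('o, 'm, 'p, 'n) shmor \<Rightarrow> bool"
where
  "sh_morphism C D F \<longleftrightarrow>
     is_functor C D F \<and>
     (\<forall>as\<in>lists (Ob C). \<forall>b\<in>Ob C. \<forall>f\<in>MHom C as b. length as \<le> 4 \<longrightarrow>
        FM F as b f \<in> MHom D (map (FOb F) as) (FOb F b)) \<and>
     (\<forall>as\<in>lists (Ob C). \<forall>as'\<in>lists (Ob C). \<forall>b\<in>Ob C. \<forall>b'\<in>Ob C.
        \<forall>ps\<in>Homs C as' as. \<forall>q\<in>Hom C b b'. \<forall>f\<in>MHom C as b. length as \<le> 4 \<longrightarrow>
        FM F as' b' (Act C as b as' b' ps q f)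
          = Act D (map (FOb F) as) (FOb F b) (map (FOb F) as') (FOb F b')
              (FHoms F as' as ps) (FHom F b b' q) (FM F as b f)) \<and>
     (\<forall>a\<in>Ob C. \<forall>b\<in>Ob C. \<forall>f\<in>Hom C a b. FM F [a] b f = FHom F a b f) \<and>
     (\<forall>bs\<in>lists (Ob C). \<forall>as\<in>lists (Ob C). \<forall>c\<in>Ob C. \<forall>i<length bs.
        \<forall>g\<in>MHom C bs c. \<forall>f\<in>MHom C as (bs ! i). (length bs, length as) \<in> sub_arities \<longrightarrow>
        FM F (plug bs i as) c (Sub C bs c i as g f)
          = Sub D (map (FOb F) bs) (FOb F c) i (map (FOb F) as)
              (FM F bs c g) (FM F as (bs ! i) f))"

definition shmor_ext :: "('o, 'm) shmulti \<Rightarrow> ('o, 'm, 'p, 'n) shmor \<Rightarrow> bool" where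
  "shmor_ext C F \<longleftrightarrow> functr_ext C F \<and>
     (\<forall>as b f. \<not> (as \<in> lists (Ob C) \<and> length as \<le> 4 \<and> b \<in> Ob C \<and> f \<in> MHom C as b)
        \<longrightarrow> FM F as b f = undefined)"

definition shmor_restrict :: "('o, 'm) shmulti \<Rightarrow> ('o, 'm, 'p, 'n) shmor \<Rightarrow> ('o, 'm, 'p, 'n) shmor"
where
  "shmor_restrict C F =
     \<lparr>FOb = (\<lambda>a. if a \<in> Ob C then FOb F a else undefined),
      FHom = (\<lambda>a b f. if a \<in> Ob C \<and> b \<in> Ob C \<and> f \<in> Hom C a b then FHom F a b f else undefined),
      FM = (\<lambda>as b f. if as \<in> lists (Ob C) \<and> length as \<le> 4 \<and> b \<in> Ob C \<and> f \<in> MHom C as b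
              then FM F as b f else undefined)\<rparr>"

subsection \<open>Left representability\<close>

text \<open>A choice of binary maps \<open>\<theta>\<close> and of a nullary map \<open>u\<close>, with their codomains.\<close>

record ('o, 'm) lrchoice =
  tobj :: "'o \<Rightarrow> 'o \<Rightarrow> 'o"
  theta :: "'o \<Rightarrow> 'o \<Rightarrow> 'm"
  uobj :: "'o"
  umap :: "'m"

definition left_universal :: "('o, 'm) shmulti \<Rightarrow> ('o, 'm) lrchoice \<Rightarrow> bool" where
  "left_universal C r \<longleftrightarrow>
     (\<forall>a\<in>Ob C. \<forall>b\<in>Ob C. tobj r a b \<in> Ob C \<and> theta r a b \<in> MHom C [a, b] (tobj r a b)) \<and>
     uobj r \<in> Ob C \<and> umap r \<in> MHom C [] (uobj r) \<and>
     (\<forall>a\<in>Ob C. \<forall>b\<in>Ob C. \<forall>xs\<in>lists (Ob C). \<forall>d\<in>Ob C. length xs \<le> 2 \<longrightarrow>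
        bij_betw (\<lambda>f. subst C (tobj r a b # xs) d 0 [a, b] f (theta r a b))
          (MHom C (tobj r a b # xs) d) (MHom C (a # b # xs) d)) \<and>
     (\<forall>xs\<in>lists (Ob C). \<forall>d\<in>Ob C. length xs \<le> 2 \<longrightarrow>
        bij_betw (\<lambda>f. subst C (uobj r # xs) d 0 [] f (umap r))
          (MHom C (uobj r # xs) d) (MHom C xs d))"

definition sh_left_representable :: "('o, 'm) shmulti \<Rightarrow> bool" where
  "sh_left_representable C \<longleftrightarrow> (\<exists>r. left_universal C r)"

definition ShMulti_lr :: "(('o, 'm) shmulti, ('o, 'm, 'o, 'm) shmor) cat" where
  "ShMulti_lr =
     \<lparr>Ob = {C. short_multicategory C \<and> sh_left_representable C},
      Hom = (\<lambda>C D. {F. sh_morphism C D F \<and> shmor_ext C F}),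
      Idn = (\<lambda>C. shmor_restrict C
        \<lparr>FOb = (\<lambda>a. a), FHom = (\<lambda>a b f. f), FM = (\<lambda>as b f. f)\<rparr>),
      Comp = (\<lambda>C D E G F. shmor_restrict C
        \<lparr>FOb = (\<lambda>a. FOb G (FOb F a)),
         FHom = (\<lambda>a b f. FHom G (FOb F a) (FOb F b) (FHom F a b f)),
         FM = (\<lambda>as b f. FM G (map (FOb F) as) (FOb F b) (FM F as b f))\<rparr>)\<rparr>"


section \<open>Multicategories\<close>

record ('o, 'm) multi =
  mOb :: "'o set"
  mHom :: "'o list \<Rightarrow> 'o \<Rightarrow> 'm set"
  mIdn :: "'o \<Rightarrow> 'm"
  mSub :: "'o list \<Rightarrow> 'o \<Rightarrow> nat \<Rightarrow> 'o list \<Rightarrow> 'm \<Rightarrow> 'm \<Rightarrow> 'm"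

locale multicategory =
  fixes M :: "('o, 'm, 'z) multi_scheme" (structure)
  assumes midn_closed: "a \<in> mOb M \<Longrightarrow> mIdn M a \<in> mHom M [a] a"
    and msub_closed: "\<lbrakk>bs \<in> lists (mOb M); as \<in> lists (mOb M); c \<in> mOb M; i < length bs;
        g \<in> mHom M bs c; f \<in> mHom M as (bs ! i)\<rbrakk>
      \<Longrightarrow> mSub M bs c i as g f \<in> mHom M (plug bs i as) c"
    and midn_left: "\<lbrakk>as \<in> lists (mOb M); b \<in> mOb M; f \<in> mHom M as b\<rbrakk>
      \<Longrightarrow> mSub M [b] b 0 as (mIdn M b) f = f"
    and midn_right: "\<lbrakk>as \<in> lists (mOb M); b \<in> mOb M; f \<in> mHom M as b; i < length as\<rbrakk>
      \<Longrightarrow> mSub M as b i [as ! i] f (mIdn M (as ! i)) = f"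
    and massoc_seq: "\<lbrakk>as \<in> lists (mOb M); bs \<in> lists (mOb M); cs \<in> lists (mOb M); d \<in> mOb M;
        i < length as; j < length bs;
        f \<in> mHom M as d; g \<in> mHom M bs (as ! i); h \<in> mHom M cs (bs ! j)\<rbrakk>
      \<Longrightarrow> mSub M as d i (plug bs j cs) f (mSub M bs (as ! i) j cs g h)
          = mSub M (plug as i bs) d (j + i) cs (mSub M as d i bs f g) h"
    and massoc_par: "\<lbrakk>as \<in> lists (mOb M); bs \<in> lists (mOb M); cs \<in> lists (mOb M); d \<in> mOb M;
        i < k; k < length as;
        f \<in> mHom M as d; g \<in> mHom M bs (as ! i); h \<in> mHom M cs (as ! k)\<rbrakk>
      \<Longrightarrow> mSub M (plug as i bs) d (k + length bs - 1) cs (mSub M as d i bs f g) h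
          = mSub M (plug as k cs) d i bs (mSub M as d k cs f h) g"

definition multi_left_representable :: "('o, 'm) multi \<Rightarrow> bool" where
  "multi_left_representable M \<longleftrightarrow>
     (\<forall>as\<in>lists (mOb M). \<exists>m\<in>mOb M. \<exists>th\<in>mHom M as m. \<forall>ys\<in>lists (mOb M). \<forall>d\<in>mOb M.
        bij_betw (\<lambda>f. mSub M (m # ys) d 0 as f th) (mHom M (m # ys) d) (mHom M (as @ ys) d))"

record ('o, 'm, 'p, 'n) mfun =
  mFOb :: "'o \<Rightarrow> 'p"
  mFM :: "'o list \<Rightarrow> 'o \<Rightarrow> 'm \<Rightarrow> 'n"

definition multifunctor :: "('o, 'm) multi \<Rightarrow> ('p, 'n) multi \<Rightarrow> ('o, 'm, 'p, 'n) mfun \<Rightarrow> bool" where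
  "multifunctor M N F \<longleftrightarrow>
     (\<forall>a\<in>mOb M. mFOb F a \<in> mOb N) \<and>
     (\<forall>as\<in>lists (mOb M). \<forall>b\<in>mOb M. \<forall>f\<in>mHom M as b.
        mFM F as b f \<in> mHom N (map (mFOb F) as) (mFOb F b)) \<and>
     (\<forall>a\<in>mOb M. mFM F [a] a (mIdn M a) = mIdn N (mFOb F a)) \<and>
     (\<forall>bs\<in>lists (mOb M). \<forall>as\<in>lists (mOb M). \<forall>c\<in>mOb M. \<forall>i<length bs.
        \<forall>g\<in>mHom M bs c. \<forall>f\<in>mHom M as (bs ! i).
        mFM F (plug bs i as) c (mSub M bs c i as g f)
          = mSub N (map (mFOb F) bs) (mFOb F c) i (map (mFOb F) as)
              (mFM F bs c g) (mFM F as (bs ! i) f))"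

definition mfun_ext :: "('o, 'm) multi \<Rightarrow> ('o, 'm, 'p, 'n) mfun \<Rightarrow> bool" where
  "mfun_ext M F \<longleftrightarrow>
     (\<forall>a. a \<notin> mOb M \<longrightarrow> mFOb F a = undefined) \<and>
     (\<forall>as b f. \<not> (as \<in> lists (mOb M) \<and> b \<in> mOb M \<and> f \<in> mHom M as b) \<longrightarrow> mFM F as b f = undefined)"

definition mfun_restrict :: "('o, 'm) multi \<Rightarrow> ('o, 'm, 'p, 'n) mfun \<Rightarrow> ('o, 'm, 'p, 'n) mfun" where
  "mfun_restrict M F =
     \<lparr>mFOb = (\<lambda>a. if a \<in> mOb M then mFOb F a else undefined),
      mFM = (\<lambda>as b f. if as \<in> lists (mOb M) \<and> b \<in> mOb M \<and> f \<in> mHom M as b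
              then mFM F as b f else undefined)\<rparr>"

definition Multi_lr :: "(('o, 'm) multi, ('o, 'm, 'o, 'm) mfun) cat" where
  "Multi_lr =
     \<lparr>Ob = {M. multicategory M \<and> multi_left_representable M},
      Hom = (\<lambda>M N. {F. multifunctor M N F \<and> mfun_ext M F}),
      Idn = (\<lambda>M. mfun_restrict M \<lparr>mFOb = (\<lambda>a. a), mFM = (\<lambda>as b f. f)\<rparr>),
      Comp = (\<lambda>M N P G F. mfun_restrict M
        \<lparr>mFOb = (\<lambda>a. mFOb G (mFOb F a)),
         mFM = (\<lambda>as b f. mFM G (map (mFOb F) as) (mFOb F b) (mFM F as b f))\<rparr>)\<rparr>"

subsection \<open>The forgetful functor\<close>

text \<open>\<open>mpre M as b as' ps f\<close> substitutes the unary maps \<open>ps ! k : as' ! k \<rightarrow> as ! k\<close> into all inputs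
  of \<open>f\<close>, from left to right.\<close>

definition mpre ::
  "('o, 'm, 'z) multi_scheme \<Rightarrow> 'o list \<Rightarrow> 'o \<Rightarrow> 'o list \<Rightarrow> 'm list \<Rightarrow> 'm \<Rightarrow> 'm"
where
  "mpre M as b as' ps f =
     foldl (\<lambda>g k. mSub M (take k as' @ drop k as) b k [as' ! k] g (ps ! k)) f [0..<length as]"

definition U_obj :: "('o, 'm) multi \<Rightarrow> ('o, 'm) shmulti" where
  "U_obj M =
     \<lparr>Ob = mOb M,
      Hom = (\<lambda>a b. mHom M [a] b),
      Idn = mIdn M,
      Comp = (\<lambda>a b c g f. mSub M [b] c 0 [a] g f),
      MHom = (\<lambda>as b. if length as \<le> 4 then mHom M as b else {}),
      Act = (\<lambda>as b as' b' ps q f. if length as \<le> 4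
               then mSub M [b] b' 0 as' q (mpre M as b as' ps f) else undefined),
      Sub = (\<lambda>bs c i as g f. if (length bs, length as) \<in> sub_arities
               then mSub M bs c i as g f else undefined)\<rparr>"

definition U_mor :: "('o, 'm, 'p, 'n) mfun \<Rightarrow> ('o, 'm, 'p, 'n) shmor" where
  "U_mor F =
     \<lparr>FOb = mFOb F,
      FHom = (\<lambda>a b f. mFM F [a] b f),
      FM = (\<lambda>as b f. if length as \<le> 4 then mFM F as b f else undefined)\<rparr>"

definition U_lr ::
  "(('o, 'm) multi, ('o, 'm, 'o, 'm) mfun, ('o, 'm) shmulti, ('o, 'm, 'o, 'm) shmor) functr"
where
  "U_lr = \<lparr>FOb = U_obj, FHom = (\<lambda>M N F. U_mor F)\<rparr>"


section \<open>Skew monoidal categories\<close>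

text \<open>\<open>TenM C a b c d f g : a \<otimes> c \<rightarrow> b \<otimes> d\<close> for \<open>f : a \<rightarrow> b\<close> and \<open>g : c \<rightarrow> d\<close>.\<close>

record ('o, 'm) skmon = "('o, 'm) cat" +
  Ten :: "'o \<Rightarrow> 'o \<Rightarrow> 'o" (infixl "\<otimes>\<index>" 70)
  TenM :: "'o \<Rightarrow> 'o \<Rightarrow> 'o \<Rightarrow> 'o \<Rightarrow> 'm \<Rightarrow> 'm \<Rightarrow> 'm"
  Unit :: "'o"
  Assoc :: "'o \<Rightarrow> 'o \<Rightarrow> 'o \<Rightarrow> 'm"
  LUnit :: "'o \<Rightarrow> 'm"
  RUnit :: "'o \<Rightarrow> 'm"

locale skew_monoidal = category C for C :: "('o, 'm, 'z) skmon_scheme" (structure) +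
  assumes ten_closed: "\<lbrakk>a \<in> Ob C; b \<in> Ob C\<rbrakk> \<Longrightarrow> a \<otimes> b \<in> Ob C"
    and tenM_closed: "\<lbrakk>a \<in> Ob C; b \<in> Ob C; c \<in> Ob C; d \<in> Ob C; f \<in> Hom C a b; g \<in> Hom C c d\<rbrakk>
      \<Longrightarrow> TenM C a b c d f g \<in> Hom C (a \<otimes> c) (b \<otimes> d)"
    and tenM_idn: "\<lbrakk>a \<in> Ob C; b \<in> Ob C\<rbrakk>
      \<Longrightarrow> TenM C a a b b (Idn C a) (Idn C b) = Idn C (a \<otimes> b)"
    and tenM_comp: "\<lbrakk>a \<in> Ob C; b \<in> Ob C; c \<in> Ob C; a' \<in> Ob C; b' \<in> Ob C; c' \<in> Ob C;
        f \<in> Hom C a b; g \<in> Hom C b c; f' \<in> Hom C a' b'; g' \<in> Hom C b' c'\<rbrakk>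
      \<Longrightarrow> TenM C a c a' c' (Comp C a b c g f) (Comp C a' b' c' g' f')
          = Comp C (a \<otimes> a') (b \<otimes> b') (c \<otimes> c') (TenM C b c b' c' g g') (TenM C a b a' b' f f')"
    and unit_closed: "Unit C \<in> Ob C"
    and assoc_closed: "\<lbrakk>a \<in> Ob C; b \<in> Ob C; c \<in> Ob C\<rbrakk>
      \<Longrightarrow> Assoc C a b c \<in> Hom C ((a \<otimes> b) \<otimes> c) (a \<otimes> (b \<otimes> c))"
    and lunit_closed: "a \<in> Ob C \<Longrightarrow> LUnit C a \<in> Hom C (Unit C \<otimes> a) a"
    and runit_closed: "a \<in> Ob C \<Longrightarrow> RUnit C a \<in> Hom C a (a \<otimes> Unit C)"
    and assoc_natural: "\<lbrakk>a \<in> Ob C; b \<in> Ob C; c \<in> Ob C; a' \<in> Ob C; b' \<in> Ob C; c' \<in> Ob C;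
        f \<in> Hom C a a'; g \<in> Hom C b b'; h \<in> Hom C c c'\<rbrakk>
      \<Longrightarrow> Comp C ((a \<otimes> b) \<otimes> c) ((a' \<otimes> b') \<otimes> c') (a' \<otimes> (b' \<otimes> c')) (Assoc C a' b' c')
            (TenM C (a \<otimes> b) (a' \<otimes> b') c c' (TenM C a a' b b' f g) h)
          = Comp C ((a \<otimes> b) \<otimes> c) (a \<otimes> (b \<otimes> c)) (a' \<otimes> (b' \<otimes> c'))
            (TenM C a a' (b \<otimes> c) (b' \<otimes> c') f (TenM C b b' c c' g h)) (Assoc C a b c)"
    and lunit_natural: "\<lbrakk>a \<in> Ob C; b \<in> Ob C; f \<in> Hom C a b\<rbrakk>
      \<Longrightarrow> Comp C (Unit C \<otimes> a) (Unit C \<otimes> b) b (LUnit C b)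
            (TenM C (Unit C) (Unit C) a b (Idn C (Unit C)) f)
          = Comp C (Unit C \<otimes> a) a b f (LUnit C a)"
    and runit_natural: "\<lbrakk>a \<in> Ob C; b \<in> Ob C; f \<in> Hom C a b\<rbrakk>
      \<Longrightarrow> Comp C a b (b \<otimes> Unit C) (RUnit C b) f
          = Comp C a (a \<otimes> Unit C) (b \<otimes> Unit C)
            (TenM C a b (Unit C) (Unit C) f (Idn C (Unit C))) (RUnit C a)"
    and pentagon: "\<lbrakk>a \<in> Ob C; b \<in> Ob C; c \<in> Ob C; d \<in> Ob C\<rbrakk>
      \<Longrightarrow> Comp C (((a \<otimes> b) \<otimes> c) \<otimes> d) ((a \<otimes> b) \<otimes> (c \<otimes> d)) (a \<otimes> (b \<otimes> (c \<otimes> d)))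
            (Assoc C a b (c \<otimes> d)) (Assoc C (a \<otimes> b) c d)
          = Comp C (((a \<otimes> b) \<otimes> c) \<otimes> d) (a \<otimes> ((b \<otimes> c) \<otimes> d)) (a \<otimes> (b \<otimes> (c \<otimes> d)))
            (TenM C a a ((b \<otimes> c) \<otimes> d) (b \<otimes> (c \<otimes> d)) (Idn C a) (Assoc C b c d))
            (Comp C (((a \<otimes> b) \<otimes> c) \<otimes> d) ((a \<otimes> (b \<otimes> c)) \<otimes> d) (a \<otimes> ((b \<otimes> c) \<otimes> d))
              (Assoc C a (b \<otimes> c) d)
              (TenM C ((a \<otimes> b) \<otimes> c) (a \<otimes> (b \<otimes> c)) d d (Assoc C a b c) (Idn C d)))"
    and lunit_assoc: "\<lbrakk>a \<in> Ob C; b \<in> Ob C\<rbrakk>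
      \<Longrightarrow> Comp C ((Unit C \<otimes> a) \<otimes> b) (Unit C \<otimes> (a \<otimes> b)) (a \<otimes> b)
            (LUnit C (a \<otimes> b)) (Assoc C (Unit C) a b)
          = TenM C (Unit C \<otimes> a) a b b (LUnit C a) (Idn C b)"
    and runit_assoc: "\<lbrakk>a \<in> Ob C; b \<in> Ob C\<rbrakk>
      \<Longrightarrow> Comp C (a \<otimes> b) ((a \<otimes> b) \<otimes> Unit C) (a \<otimes> (b \<otimes> Unit C))
            (Assoc C a b (Unit C)) (RUnit C (a \<otimes> b))
          = TenM C a a b (b \<otimes> Unit C) (Idn C a) (RUnit C b)"
    and lunit_runit_assoc: "\<lbrakk>a \<in> Ob C; b \<in> Ob C\<rbrakk>
      \<Longrightarrow> Comp C (a \<otimes> b) (a \<otimes> (Unit C \<otimes> b)) (a \<otimes> b)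
            (TenM C a a (Unit C \<otimes> b) b (Idn C a) (LUnit C b))
            (Comp C (a \<otimes> b) ((a \<otimes> Unit C) \<otimes> b) (a \<otimes> (Unit C \<otimes> b))
              (Assoc C a (Unit C) b)
              (TenM C a (a \<otimes> Unit C) b b (RUnit C a) (Idn C b)))
          = Idn C (a \<otimes> b)"
    and lunit_runit: "Comp C (Unit C) (Unit C \<otimes> Unit C) (Unit C)
            (LUnit C (Unit C)) (RUnit C (Unit C)) = Idn C (Unit C)"

definition left_normal :: "('o, 'm) skmon \<Rightarrow> bool" where
  "left_normal C \<longleftrightarrow> (\<forall>a\<in>Ob C. iso C (Unit C \<otimes>\<^bsub>C\<^esub> a) a (LUnit C a))"

record ('o, 'm, 'p, 'n) laxfun = "('o, 'm, 'p, 'n) functr" +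
  F0 :: "'n"
  F2 :: "'o \<Rightarrow> 'o \<Rightarrow> 'n"

definition lax_monoidal ::
  "('o, 'm) skmon \<Rightarrow> ('p, 'n) skmon \<Rightarrow> ('o, 'm, 'p, 'n) laxfun \<Rightarrow> bool"
where
  "lax_monoidal C D F \<longleftrightarrow>
     is_functor C D F \<and>
     F0 F \<in> Hom D (Unit D) (FOb F (Unit C)) \<and>
     (\<forall>a\<in>Ob C. \<forall>b\<in>Ob C. F2 F a b \<in> Hom D (FOb F a \<otimes>\<^bsub>D\<^esub> FOb F b) (FOb F (a \<otimes>\<^bsub>C\<^esub> b))) \<and>
     (\<forall>a\<in>Ob C. \<forall>a'\<in>Ob C. \<forall>b\<in>Ob C. \<forall>b'\<in>Ob C. \<forall>f\<in>Hom C a a'. \<forall>g\<in>Hom C b b'.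
        Comp D (FOb F a \<otimes>\<^bsub>D\<^esub> FOb F b) (FOb F a' \<otimes>\<^bsub>D\<^esub> FOb F b') (FOb F (a' \<otimes>\<^bsub>C\<^esub> b'))
          (F2 F a' b')
          (TenM D (FOb F a) (FOb F a') (FOb F b) (FOb F b') (FHom F a a' f) (FHom F b b' g))
        = Comp D (FOb F a \<otimes>\<^bsub>D\<^esub> FOb F b) (FOb F (a \<otimes>\<^bsub>C\<^esub> b)) (FOb F (a' \<otimes>\<^bsub>C\<^esub> b'))
          (FHom F (a \<otimes>\<^bsub>C\<^esub> b) (a' \<otimes>\<^bsub>C\<^esub> b') (TenM C a a' b b' f g))
          (F2 F a b)) \<and>
     (\<forall>a\<in>Ob C. \<forall>b\<in>Ob C. \<forall>c\<in>Ob C.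
        Comp D ((FOb F a \<otimes>\<^bsub>D\<^esub> FOb F b) \<otimes>\<^bsub>D\<^esub> FOb F c)
          (FOb F ((a \<otimes>\<^bsub>C\<^esub> b) \<otimes>\<^bsub>C\<^esub> c)) (FOb F (a \<otimes>\<^bsub>C\<^esub> (b \<otimes>\<^bsub>C\<^esub> c)))
          (FHom F ((a \<otimes>\<^bsub>C\<^esub> b) \<otimes>\<^bsub>C\<^esub> c) (a \<otimes>\<^bsub>C\<^esub> (b \<otimes>\<^bsub>C\<^esub> c)) (Assoc C a b c))
          (Comp D ((FOb F a \<otimes>\<^bsub>D\<^esub> FOb F b) \<otimes>\<^bsub>D\<^esub> FOb F c)
            (FOb F (a \<otimes>\<^bsub>C\<^esub> b) \<otimes>\<^bsub>D\<^esub> FOb F c) (FOb F ((a \<otimes>\<^bsub>C\<^esub> b) \<otimes>\<^bsub>C\<^esub> c))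
            (F2 F (a \<otimes>\<^bsub>C\<^esub> b) c)
            (TenM D (FOb F a \<otimes>\<^bsub>D\<^esub> FOb F b) (FOb F (a \<otimes>\<^bsub>C\<^esub> b)) (FOb F c) (FOb F c)
              (F2 F a b) (Idn D (FOb F c))))
        = Comp D ((FOb F a \<otimes>\<^bsub>D\<^esub> FOb F b) \<otimes>\<^bsub>D\<^esub> FOb F c)
          (FOb F a \<otimes>\<^bsub>D\<^esub> FOb F (b \<otimes>\<^bsub>C\<^esub> c)) (FOb F (a \<otimes>\<^bsub>C\<^esub> (b \<otimes>\<^bsub>C\<^esub> c)))
          (F2 F a (b \<otimes>\<^bsub>C\<^esub> c))
          (Comp D ((FOb F a \<otimes>\<^bsub>D\<^esub> FOb F b) \<otimes>\<^bsub>D\<^esub> FOb F c)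
            (FOb F a \<otimes>\<^bsub>D\<^esub> (FOb F b \<otimes>\<^bsub>D\<^esub> FOb F c)) (FOb F a \<otimes>\<^bsub>D\<^esub> FOb F (b \<otimes>\<^bsub>C\<^esub> c))
            (TenM D (FOb F a) (FOb F a) (FOb F b \<otimes>\<^bsub>D\<^esub> FOb F c) (FOb F (b \<otimes>\<^bsub>C\<^esub> c))
              (Idn D (FOb F a)) (F2 F b c))
            (Assoc D (FOb F a) (FOb F b) (FOb F c)))) \<and>
     (\<forall>a\<in>Ob C.
        Comp D (Unit D \<otimes>\<^bsub>D\<^esub> FOb F a) (FOb F (Unit C \<otimes>\<^bsub>C\<^esub> a)) (FOb F a)
          (FHom F (Unit C \<otimes>\<^bsub>C\<^esub> a) a (LUnit C a))
          (Comp D (Unit D \<otimes>\<^bsub>D\<^esub> FOb F a) (FOb F (Unit C) \<otimes>\<^bsub>D\<^esub> FOb F a) (FOb F (Unit C \<otimes>\<^bsub>C\<^esub> a))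
            (F2 F (Unit C) a)
            (TenM D (Unit D) (FOb F (Unit C)) (FOb F a) (FOb F a) (F0 F) (Idn D (FOb F a))))
        = LUnit D (FOb F a)) \<and>
     (\<forall>a\<in>Ob C.
        Comp D (FOb F a) (FOb F a \<otimes>\<^bsub>D\<^esub> FOb F (Unit C)) (FOb F (a \<otimes>\<^bsub>C\<^esub> Unit C))
          (F2 F a (Unit C))
          (Comp D (FOb F a) (FOb F a \<otimes>\<^bsub>D\<^esub> Unit D) (FOb F a \<otimes>\<^bsub>D\<^esub> FOb F (Unit C))
            (TenM D (FOb F a) (FOb F a) (Unit D) (FOb F (Unit C)) (Idn D (FOb F a)) (F0 F))
            (RUnit D (FOb F a)))
        = FHom F a (a \<otimes>\<^bsub>C\<^esub> Unit C) (RUnit C a))"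

definition laxfun_ext :: "('o, 'm) skmon \<Rightarrow> ('o, 'm, 'p, 'n) laxfun \<Rightarrow> bool" where
  "laxfun_ext C F \<longleftrightarrow> functr_ext C F \<and>
     (\<forall>a b. \<not> (a \<in> Ob C \<and> b \<in> Ob C) \<longrightarrow> F2 F a b = undefined)"

definition laxfun_restrict :: "('o, 'm) skmon \<Rightarrow> ('o, 'm, 'p, 'n) laxfun \<Rightarrow> ('o, 'm, 'p, 'n) laxfun"
where
  "laxfun_restrict C F =
     \<lparr>FOb = (\<lambda>a. if a \<in> Ob C then FOb F a else undefined),
      FHom = (\<lambda>a b f. if a \<in> Ob C \<and> b \<in> Ob C \<and> f \<in> Hom C a b then FHom F a b f else undefined),
      F0 = F0 F,
      F2 = (\<lambda>a b. if a \<in> Ob C \<and> b \<in> Ob C then F2 F a b else undefined)\<rparr>"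

definition SkMon_ln :: "(('o, 'm) skmon, ('o, 'm, 'o, 'm) laxfun) cat" where
  "SkMon_ln =
     \<lparr>Ob = {C. skew_monoidal C \<and> left_normal C},
      Hom = (\<lambda>C D. {F. lax_monoidal C D F \<and> laxfun_ext C F}),
      Idn = (\<lambda>C. laxfun_restrict C
        \<lparr>FOb = (\<lambda>a. a), FHom = (\<lambda>a b f. f),
         F0 = Idn C (Unit C), F2 = (\<lambda>a b. Idn C (a \<otimes>\<^bsub>C\<^esub> b))\<rparr>),
      Comp = (\<lambda>C D E G F. laxfun_restrict C
        \<lparr>FOb = (\<lambda>a. FOb G (FOb F a)),
         FHom = (\<lambda>a b f. FHom G (FOb F a) (FOb F b) (FHom F a b f)),
         F0 = Comp E (Unit E) (FOb G (Unit D)) (FOb G (FOb F (Unit C)))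
                (FHom G (Unit D) (FOb F (Unit C)) (F0 F)) (F0 G),
         F2 = (\<lambda>a b. Comp E (FOb G (FOb F a) \<otimes>\<^bsub>E\<^esub> FOb G (FOb F b))
                (FOb G (FOb F a \<otimes>\<^bsub>D\<^esub> FOb F b)) (FOb G (FOb F (a \<otimes>\<^bsub>C\<^esub> b)))
                (FHom G (FOb F a \<otimes>\<^bsub>D\<^esub> FOb F b) (FOb F (a \<otimes>\<^bsub>C\<^esub> b)) (F2 F a b))
                (F2 G (FOb F a) (FOb F b)))\<rparr>)\<rparr>"


section \<open>The functor from left representable short multicategories\<close>

definition K_obj :: "('o, 'm) shmulti \<Rightarrow> ('o, 'm) lrchoice \<Rightarrow> ('o, 'm) skmon" where
  "K_obj C r = (let t = tobj r; th = theta r; i = uobj r; u = umap r in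
     \<lparr>Ob = Ob C, Hom = Hom C, Idn = Idn C, Comp = Comp C,
      Ten = t,
      TenM = (\<lambda>a b c d f g. THE h. h \<in> Hom C (t a c) (t b d) \<and>
        post C [a, c] (t a c) (t b d) h (th a c)
          = subst C [a, d] (t b d) 1 [c] (subst C [b, d] (t b d) 0 [a] (th b d) f) g),
      Unit = i,
      Assoc = (\<lambda>a b c. THE h. h \<in> Hom C (t (t a b) c) (t a (t b c)) \<and>
        subst C [t a b, c] (t a (t b c)) 0 [a, b]
            (post C [t a b, c] (t (t a b) c) (t a (t b c)) h (th (t a b) c)) (th a b)
          = subst C [a, t b c] (t a (t b c)) 1 [b, c] (th a (t b c)) (th b c)),
      LUnit = (\<lambda>a. THE h. h \<in> Hom C (t i a) a \<and>
        subst C [i, a] a 0 [] (post C [i, a] (t i a) a h (th i a)) u = Idn C a),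
      RUnit = (\<lambda>a. subst C [a, i] (t a i) 1 [] (th a i) u)\<rparr>)"

definition K_mor ::
  "('o, 'm) shmulti \<Rightarrow> ('o, 'm) lrchoice \<Rightarrow> ('p, 'n) shmulti \<Rightarrow> ('p, 'n) lrchoice
    \<Rightarrow> ('o, 'm, 'p, 'n) shmor \<Rightarrow> ('o, 'm, 'p, 'n) laxfun"
where
  "K_mor C r D s F =
     \<lparr>FOb = FOb F, FHom = FHom F,
      F0 = (THE h. h \<in> Hom D (uobj s) (FOb F (uobj r)) \<and>
        post D [] (uobj s) (FOb F (uobj r)) h (umap s) = FM F [] (uobj r) (umap r)),
      F2 = (\<lambda>a b. if a \<in> Ob C \<and> b \<in> Ob C
        then THE h. h \<in> Hom D (tobj s (FOb F a) (FOb F b)) (FOb F (tobj r a b)) \<and>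
          post D [FOb F a, FOb F b] (tobj s (FOb F a) (FOb F b)) (FOb F (tobj r a b))
              h (theta s (FOb F a) (FOb F b))
            = FM F [a, b] (tobj r a b) (theta r a b)
        else undefined)\<rparr>"

text \<open>The argument \<open>ch\<close> is the fixed choice of left universal maps for each short multicategory.\<close>

definition K_lr ::
  "(('o, 'm) shmulti \<Rightarrow> ('o, 'm) lrchoice) \<Rightarrow>
   (('o, 'm) shmulti, ('o, 'm, 'o, 'm) shmor, ('o, 'm) skmon, ('o, 'm, 'o, 'm) laxfun) functr"
where
  "K_lr ch =
     \<lparr>FOb = (\<lambda>C. K_obj C (ch C)), FHom = (\<lambda>C D F. K_mor C (ch C) D (ch D) F)\<rparr>"

end

theory Submission
  imports Defs
begin


text \<open>
  In a left representable multicategory every multimap \<open>a\<^sub>1, \<dots>, a\<^sub>n \<rightarrow> b\<close> is obtained in exactly one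
  way from a unary map \<open>(a\<^sub>1 a\<^sub>2) \<dots> a\<^sub>n \<rightarrow> b\<close> by substituting binary classifiers \<open>\<theta>\<close> into the first
  input, or from a map \<open>i \<rightarrow> b\<close> by substituting \<open>u\<close> if \<open>n = 0\<close>. In the short case this holds for
  \<open>n \<le> 4\<close>. The whole proof rests on this normal form.

  \<^bold>\<open>Both functors are fully faithful.\<close> A morphism \<open>F\<close> out of such a structure is determined by its
  values on unary maps and by the images \<open>t a b\<close> of \<open>\<theta>\<close> and \<open>v\<close> of \<open>u\<close>
  (\<open>multi_morphism_unique\<close>). Conversely a functor \<open>H\<close> on unary maps together with candidates \<open>t\<close>
  and \<open>v\<close> extends to a morphism as soon as \<open>t\<close> is natural and \<open>t\<close>, \<open>v\<close> are compatible with the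
  associator and the two unit constraints (\<open>extension_data\<close>, \<open>ext_morphism\<close>): define the extension by
  removing classifiers from the left, and check that it preserves a substitution by decomposing the
  substituted map in the same way. These equations involve only multimaps of arity at most 3, and the
  argument uses only substitutions that exist in a short multicategory whenever the substitution to
  be preserved does. Hence it is carried out once, for a notion with a flag \<open>full\<close> of which
  multicategories and short multicategories are the two instances.

  If \<open>H\<close> is the functor underlying a lax monoidal functor between \<open>K C\<close> and \<open>K D\<close>, and \<open>t\<close>, \<open>v\<close>
  are the composites of \<open>f\<^sub>2\<close>, \<open>f\<^sub>0\<close> with the classifiers of \<open>D\<close>, then the equations for \<open>t\<close> and \<open>v\<close>
  are the axioms of a lax monoidal functor (\<open>lax_monoidal_iff\<close>); so \<open>K\<close> is fully faithful. If \<open>H\<close>, \<open>t\<close>,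
  \<open>v\<close> come from a morphism \<open>U M \<rightarrow> U N\<close>, then the equations hold because this morphism preserves the
  substitutions in them; so \<open>U\<close> is fully faithful.

  \<^bold>\<open>Both functors are essentially surjective.\<close> Let \<open>C\<close> be a left normal skew monoidal category. Take
  as multimaps \<open>a\<^sub>1, \<dots>, a\<^sub>n \<rightarrow> b\<close> the maps \<open>((i a\<^sub>1) a\<^sub>2) \<dots> a\<^sub>n \<rightarrow> b\<close> of \<open>C\<close>. Substitution is defined
  with the canonical maps \<open>(x a\<^sub>1) \<dots> a\<^sub>n \<rightarrow> x ((i a\<^sub>1) \<dots> a\<^sub>n)\<close> composed of \<open>\<rho>\<close> and associators; its
  associativity is a consequence of the skew monoidal axioms (\<open>ins_ins\<close>, \<open>ins_nat\<close>). The result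
  is a left representable multicategory \<open>M\<close>. As \<open>\<lambda>\<close> is invertible, its unary maps \<open>i a \<rightarrow> b\<close>
  are the same as maps \<open>a \<rightarrow> b\<close>, and \<open>K (U M)\<close> is isomorphic to \<open>C\<close> (\<open>K_canonical_iso\<close>). Two choices
  of classifiers give isomorphic results (\<open>K_change_of_choice\<close>), so this holds for the given choice.
  Hence \<open>K\<close> is essentially surjective. For a left representable short multicategory \<open>S\<close> the same
  construction applied to \<open>C = K S\<close> gives \<open>K (U M) \<cong> K S\<close>; being fully faithful, \<open>K\<close> reflects this
  isomorphism to \<open>U M \<cong> S\<close>, and \<open>U\<close> is essentially surjective as well.
\<close>


section \<open>Fully faithful and essentially surjective functors\<close>

definition full_faithful ::
  "('o, 'm, 'z) cat_scheme \<Rightarrow> ('p, 'n, 'y) cat_scheme \<Rightarrow> ('o, 'm, 'p, 'n) functr \<Rightarrow> bool"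
where
  "full_faithful C D F \<longleftrightarrow>
     (\<forall>a\<in>Ob C. \<forall>b\<in>Ob C. bij_betw (FHom F a b) (Hom C a b) (Hom D (FOb F a) (FOb F b)))"

definition ess_surjective ::
  "('o, 'm, 'z) cat_scheme \<Rightarrow> ('p, 'n, 'y) cat_scheme \<Rightarrow> ('o, 'm, 'p, 'n) functr \<Rightarrow> bool"
where
  "ess_surjective C D F \<longleftrightarrow> (\<forall>d\<in>Ob D. \<exists>c\<in>Ob C. \<exists>e. iso D (FOb F c) d e)"

lemma iso_reflected:
  assumes C: "category C" and F: "is_functor C D F" "full_faithful C D F"
    and ab: "a \<in> Ob C" "b \<in> Ob C" and f: "iso D (FOb F a) (FOb F b) f"
  shows "\<exists>f'. iso C a b f' \<and> FHom F a b f' = f"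
proof -
  interpret category C by fact
  obtain g where g: "f \<in> Hom D (FOb F a) (FOb F b)" "g \<in> Hom D (FOb F b) (FOb F a)"
    "Comp D (FOb F a) (FOb F b) (FOb F a) g f = Idn D (FOb F a)"
    "Comp D (FOb F b) (FOb F a) (FOb F b) f g = Idn D (FOb F b)"
    using f by (auto simp: iso_def)
  have bij: "bij_betw (FHom F x y) (Hom C x y) (Hom D (FOb F x) (FOb F y))"
    if "x \<in> Ob C" "y \<in> Ob C" for x y
    using F(2) that by (auto simp: full_faithful_def)
  obtain f' where f': "f' \<in> Hom C a b" "FHom F a b f' = f"
    using bij[OF ab] g(1) by (metis bij_betw_def imageE)
  obtain g' where g': "g' \<in> Hom C b a" "FHom F b a g' = g"
    using bij[OF ab(2,1)] g(2) by (metis bij_betw_def imageE)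
  have "FHom F a a (Comp C a b a g' f') = FHom F a a (Idn C a)"
    using F(1) ab f' g' g by (auto simp: is_functor_def)
  moreover have "FHom F b b (Comp C b a b f' g') = FHom F b b (Idn C b)"
    using F(1) ab f' g' g by (auto simp: is_functor_def)
  ultimately have "Comp C a b a g' f' = Idn C a" "Comp C b a b f' g' = Idn C b"
    using bij[OF ab(1,1)] bij[OF ab(2,2)] ab f' g'
    by (auto simp: bij_betw_def inj_on_def idn_closed comp_closed)
  then show ?thesis using f' g' by (auto simp: iso_def)
qed

text \<open>The inverse functor picks for every object \<open>d\<close> some \<open>c\<close> with an isomorphism
  \<open>e d : F c \<rightarrow> d\<close>; on maps it conjugates with these isomorphisms and uses fullness. The unit
  is the preimage under \<open>F\<close> of the inverse of \<open>e (F c)\<close>.\<close>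

lemma equivalence_if_full_faithful_ess_surjective:
  assumes C: "category C" and D: "category D"
    and F: "is_functor C D F" and ff: "full_faithful C D F" and es: "ess_surjective C D F"
  shows "equivalence_of_categories C D F"
proof -
  interpret C: category C by fact
  interpret D: category D by fact
  define o' where "o' d = (SOME c. c \<in> Ob C \<and> (\<exists>e. iso D (FOb F c) d e))" for d
  have o': "o' d \<in> Ob C \<and> (\<exists>e. iso D (FOb F (o' d)) d e)" if "d \<in> Ob D" for d
    unfolding o'_def
    by (rule someI_ex[of "\<lambda>c. c \<in> Ob C \<and> (\<exists>e. iso D (FOb F c) d e)"])
      (use es that in \<open>simp add: ess_surjective_def Bex_def\<close>)
  define e where "e d = (SOME e. iso D (FOb F (o' d)) d e)" for d
  have e: "iso D (FOb F (o' d)) d (e d)" if "d \<in> Ob D" for d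
    unfolding e_def using o'[OF that] by (intro someI_ex[of "iso D (FOb F (o' d)) d"]) simp
  define e' where "e' d = (SOME g. g \<in> Hom D d (FOb F (o' d)) \<and>
      Comp D (FOb F (o' d)) d (FOb F (o' d)) g (e d) = Idn D (FOb F (o' d)) \<and>
      Comp D d (FOb F (o' d)) d (e d) g = Idn D d)" for d
  have e': "e' d \<in> Hom D d (FOb F (o' d)) \<and>
      Comp D (FOb F (o' d)) d (FOb F (o' d)) (e' d) (e d) = Idn D (FOb F (o' d)) \<and>
      Comp D d (FOb F (o' d)) d (e d) (e' d) = Idn D d" if "d \<in> Ob D" for d
    unfolding e'_def
    by (rule someI_ex[of "\<lambda>g. g \<in> Hom D d (FOb F (o' d)) \<and>
        Comp D (FOb F (o' d)) d (FOb F (o' d)) g (e d) = Idn D (FOb F (o' d)) \<and>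
        Comp D d (FOb F (o' d)) d (e d) g = Idn D d"])
      (use e[OF that] in \<open>simp add: iso_def Bex_def\<close>)
  have eh[simp]: "e d \<in> Hom D (FOb F (o' d)) d" "e' d \<in> Hom D d (FOb F (o' d))"
    and ee[simp]: "Comp D (FOb F (o' d)) d (FOb F (o' d)) (e' d) (e d) = Idn D (FOb F (o' d))"
      "Comp D d (FOb F (o' d)) d (e d) (e' d) = Idn D d" if "d \<in> Ob D" for d
    using e[OF that] e'[OF that] by (auto simp: iso_def)
  have Fo[simp]: "FOb F c \<in> Ob D" if "c \<in> Ob C" for c
    using F that by (auto simp: is_functor_def)
  have Fh[simp]: "FHom F a b f \<in> Hom D (FOb F a) (FOb F b)"
    if "a \<in> Ob C" "b \<in> Ob C" "f \<in> Hom C a b" for a b f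
    using F that by (auto simp: is_functor_def)
  have Fc: "FHom F a c (Comp C a b c g f)
      = Comp D (FOb F a) (FOb F b) (FOb F c) (FHom F b c g) (FHom F a b f)"
    if "a \<in> Ob C" "b \<in> Ob C" "c \<in> Ob C" "f \<in> Hom C a b" "g \<in> Hom C b c" for a b c f g
    using F that by (auto simp: is_functor_def)
  have Fi: "FHom F a a (Idn C a) = Idn D (FOb F a)" if "a \<in> Ob C" for a
    using F that by (auto simp: is_functor_def)
  have oo[simp]: "o' d \<in> Ob C" if "d \<in> Ob D" for d using o'[OF that] by simp
  have bij: "bij_betw (FHom F x y) (Hom C x y) (Hom D (FOb F x) (FOb F y))"
    if "x \<in> Ob C" "y \<in> Ob C" for x y
    using ff that by (auto simp: full_faithful_def)
  have inj: "f = g" if "x \<in> Ob C" "y \<in> Ob C" "f \<in> Hom C x y" "g \<in> Hom C x y"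
      "FHom F x y f = FHom F x y g" for x y f g
    using bij[OF that(1,2)] that(3-) by (auto simp: bij_betw_def inj_on_def)
  define R where "R x y = inv_into (Hom C x y) (FHom F x y)" for x y
  have R[simp]: "R x y h \<in> Hom C x y" "FHom F x y (R x y h) = h"
    if "x \<in> Ob C" "y \<in> Ob C" "h \<in> Hom D (FOb F x) (FOb F y)" for x y h
    using bij[OF that(1,2)] that(3) unfolding R_def
    by (auto simp: bij_betw_def inv_into_into f_inv_into_f)
  define cj where "cj a b f = Comp D (FOb F (o' a)) b (FOb F (o' b)) (e' b)
      (Comp D (FOb F (o' a)) a b f (e a))" for a b f
  have cj[simp]: "cj a b f \<in> Hom D (FOb F (o' a)) (FOb F (o' b))"
    if "a \<in> Ob D" "b \<in> Ob D" "f \<in> Hom D a b" for a b f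
    unfolding cj_def using that by (meson D.comp_closed eh Fo oo)
  have cj_eq: "Comp D (FOb F (o' a)) (FOb F (o' b)) b (e b) (cj a b f)
      = Comp D (FOb F (o' a)) a b f (e a)"
    if "a \<in> Ob D" "b \<in> Ob D" "f \<in> Hom D a b" for a b f
  proof -
    let ?k = "Comp D (FOb F (o' a)) a b f (e a)"
    have k: "?k \<in> Hom D (FOb F (o' a)) b" using that by (meson D.comp_closed eh Fo oo)
    have "Comp D (FOb F (o' a)) (FOb F (o' b)) b (e b) (cj a b f)
        = Comp D (FOb F (o' a)) b b (Comp D b (FOb F (o' b)) b (e b) (e' b)) ?k"
      unfolding cj_def using that k by (intro D.comp_assoc) auto
    then show ?thesis using that k by (simp add: D.idn_left)
  qed
  \<comment> \<open>An equation between maps into \<open>F (o' b)\<close> may be checked after composition with \<open>e b\<close>.\<close>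
  have e_mono: "x = y" if "Comp D a (FOb F (o' b)) b (e b) x = Comp D a (FOb F (o' b)) b (e b) y"
    "a \<in> Ob D" "b \<in> Ob D" "x \<in> Hom D a (FOb F (o' b))" "y \<in> Hom D a (FOb F (o' b))" for a b x y
  proof -
    have "Comp D a b (FOb F (o' b)) (e' b) (Comp D a (FOb F (o' b)) b (e b) z) = z"
      if "z \<in> Hom D a (FOb F (o' b))" for z
      using that \<open>a \<in> Ob D\<close> \<open>b \<in> Ob D\<close> by (subst D.comp_assoc) (auto simp: D.idn_left)
    then show ?thesis using that by metis
  qed
  define G where "G = \<lparr>FOb = o', FHom = (\<lambda>a b f. R (o' a) (o' b) (cj a b f))\<rparr>"
  have G: "is_functor D C G"
    unfolding is_functor_def
  proof (intro conjI ballI)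
    fix a assume a: "a \<in> Ob D"
    show "FOb G a \<in> Ob C" using a by (simp add: G_def)
    have "cj a a (Idn D a) = Idn D (FOb F (o' a))"
      unfolding cj_def using a by (simp add: D.idn_left)
    then show "FHom G a a (Idn D a) = Idn C (FOb G a)"
      using a by (intro inj[of "o' a" "o' a"]) (auto simp: G_def Fi C.idn_closed D.idn_closed)
  next
    fix a b f assume *: "a \<in> Ob D" "b \<in> Ob D" "f \<in> Hom D a b"
    then show "FHom G a b f \<in> Hom C (FOb G a) (FOb G b)" by (simp add: G_def)
  next
    fix a b c f g assume *: "a \<in> Ob D" "b \<in> Ob D" "c \<in> Ob D" "f \<in> Hom D a b" "g \<in> Hom D b c"
    have gf: "Comp D a b c g f \<in> Hom D a c" using * by (meson D.comp_closed)
    have "cj a c (Comp D a b c g f)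
        = Comp D (FOb F (o' a)) (FOb F (o' b)) (FOb F (o' c)) (cj b c g) (cj a b f)"
    proof (rule e_mono[of "FOb F (o' a)" c])
      have "Comp D (FOb F (o' a)) (FOb F (o' c)) c (e c)
          (Comp D (FOb F (o' a)) (FOb F (o' b)) (FOb F (o' c)) (cj b c g) (cj a b f))
        = Comp D (FOb F (o' a)) (FOb F (o' b)) c
            (Comp D (FOb F (o' b)) b c g (e b)) (cj a b f)"
        using * by (subst D.comp_assoc) (auto simp: cj_eq)
      also have "\<dots> = Comp D (FOb F (o' a)) b c g (Comp D (FOb F (o' a)) a b f (e a))"
        using * by (subst D.comp_assoc[symmetric]) (auto simp: cj_eq)
      also have "\<dots> = Comp D (FOb F (o' a)) a c (Comp D a b c g f) (e a)"
        using * by (subst D.comp_assoc) auto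
      also have "\<dots> = Comp D (FOb F (o' a)) (FOb F (o' c)) c (e c) (cj a c (Comp D a b c g f))"
        using * gf by (simp add: cj_eq)
      finally show "Comp D (FOb F (o' a)) (FOb F (o' c)) c (e c) (cj a c (Comp D a b c g f))
        = Comp D (FOb F (o' a)) (FOb F (o' c)) c (e c)
          (Comp D (FOb F (o' a)) (FOb F (o' b)) (FOb F (o' c)) (cj b c g) (cj a b f))" ..
    next
      show "Comp D (FOb F (o' a)) (FOb F (o' b)) (FOb F (o' c)) (cj b c g) (cj a b f)
        \<in> Hom D (FOb F (o' a)) (FOb F (o' c))"
        using * by (intro D.comp_closed) auto
    qed (use * gf in auto)
    then show "FHom G a c (Comp D a b c g f)
      = Comp C (FOb G a) (FOb G b) (FOb G c) (FHom G b c g) (FHom G a b f)"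
      using * gf
      by (intro inj[of "o' a" "o' c"]) (auto simp: G_def Fc C.comp_closed[of _ "o' b"] D.comp_closed[of _ "FOb F (o' b)"])
  qed
  define s where "s c = R c (o' (FOb F c)) (e' (FOb F c))" for c
  have "nat_iso C C id_functr (comp_functr G F) s"
    unfolding nat_iso_def
  proof (intro conjI ballI)
    fix a assume a: "a \<in> Ob C"
    have "iso D (FOb F a) (FOb F (o' (FOb F a))) (e' (FOb F a))"
      unfolding iso_def using a by (auto intro!: bexI[of _ "e (FOb F a)"])
    then obtain f' where f': "iso C a (o' (FOb F a)) f'"
        "FHom F a (o' (FOb F a)) f' = e' (FOb F a)"
      using iso_reflected[OF C F ff a, of "o' (FOb F a)"] a by auto
    then have "s a = f'"
      using a by (intro inj[of a "o' (FOb F a)"]) (auto simp: s_def iso_def)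
    then show "iso C (FOb id_functr a) (FOb (comp_functr G F) a) (s a)"
      using f' by (simp add: id_functr_def comp_functr_def G_def)
  next
    fix a b f assume *: "a \<in> Ob C" "b \<in> Ob C" "f \<in> Hom C a b"
    let ?a = "FOb F (o' (FOb F a))" and ?b = "FOb F (o' (FOb F b))"
    have "Comp D (FOb F a) ?a ?b (cj (FOb F a) (FOb F b) (FHom F a b f)) (e' (FOb F a))
        = Comp D (FOb F a) (FOb F b) ?b (e' (FOb F b)) (FHom F a b f)" (is "?l = ?r")
    proof (rule e_mono[of "FOb F a" "FOb F b"])
      have "Comp D (FOb F a) ?b (FOb F b) (e (FOb F b)) ?l
          = Comp D (FOb F a) ?a (FOb F b)
              (Comp D ?a (FOb F a) (FOb F b) (FHom F a b f) (e (FOb F a))) (e' (FOb F a))"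
        using * by (subst D.comp_assoc) (auto simp: cj_eq)
      also have "\<dots> = FHom F a b f"
        using * by (subst D.comp_assoc[symmetric]) (auto simp: D.idn_right)
      also have "\<dots> = Comp D (FOb F a) ?b (FOb F b) (e (FOb F b)) ?r"
        using * by (subst D.comp_assoc) (auto simp: D.idn_left)
      finally show "Comp D (FOb F a) ?b (FOb F b) (e (FOb F b)) ?l
        = Comp D (FOb F a) ?b (FOb F b) (e (FOb F b)) ?r" .
    next
      show "?l \<in> Hom D (FOb F a) ?b" "?r \<in> Hom D (FOb F a) ?b"
        using * by (auto intro!: D.comp_closed[of _ ?a] D.comp_closed[of _ "FOb F b"])
    qed (use * in auto)
    then have "Comp C a b (o' (FOb F b)) (s b) f
        = Comp C a (o' (FOb F a)) (o' (FOb F b))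
            (R (o' (FOb F a)) (o' (FOb F b)) (cj (FOb F a) (FOb F b) (FHom F a b f))) (s a)"
      using * by (intro inj[of a "o' (FOb F b)"])
        (auto simp: s_def Fc C.comp_closed[of _ b] C.comp_closed[of _ "o' (FOb F a)"])
    then show "Comp C (FOb id_functr a) (FOb id_functr b) (FOb (comp_functr G F) b) (s b)
          (FHom id_functr a b f)
        = Comp C (FOb id_functr a) (FOb (comp_functr G F) a) (FOb (comp_functr G F) b)
          (FHom (comp_functr G F) a b f) (s a)"
      by (simp add: id_functr_def comp_functr_def G_def)
  qed
  moreover have "nat_iso D D (comp_functr F G) id_functr e"
    unfolding nat_iso_def
    using e by (auto simp: comp_functr_def id_functr_def G_def cj_eq)
  ultimately show ?thesis
    unfolding equivalence_of_categories_def using C D F G by blast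
qed


section \<open>Multicategories of bounded arity\<close>

lemma plug_Cons_0 [simp]: "plug (b # bs) 0 as = as @ bs"
  and plug_Cons_Suc [simp]: "plug (b # bs) (Suc i) as = b # plug bs i as"
  by (simp_all add: plug_def)

lemma plug_append: "plug (xs @ b # ys) (length xs) as = xs @ as @ ys"
  by (simp add: plug_def)

lemma length_plug [simp]: "i < length bs \<Longrightarrow> length (plug bs i as) = length bs + length as - 1"
  by (simp add: plug_def)

lemma map_plug: "map F (plug bs i as) = plug (map F bs) i (map F as)"
  by (simp add: plug_def take_map drop_map)

lemma set_plug: "set (plug bs i as) \<subseteq> set bs \<union> set as"
  unfolding plug_def using set_take_subset set_drop_subset by fastforce

lemma nth_plug_mid: "i < length bs \<Longrightarrow> j < length as \<Longrightarrow> plug bs i as ! (j + i) = as ! j"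
  by (simp add: plug_def nth_append)

lemma nth_plug_left: "j < i \<Longrightarrow> i < length bs \<Longrightarrow> plug bs i as ! j = bs ! j"
  by (simp add: plug_def nth_append)

lemma nth_plug_right: "i < k \<Longrightarrow> k < length bs \<Longrightarrow> plug bs i as ! (k + length as - 1) = bs ! k"
  by (auto simp: plug_def nth_append min_def)

lemma plug_self [simp]: "i < length as \<Longrightarrow> plug as i [as ! i] = as"
  by (simp add: plug_def id_take_nth_drop[symmetric])

text \<open>The domains of the two sides of the sequential and of the parallel associativity law agree.\<close>

lemma plug_seq:
  assumes "i < length as" "j < length bs"
  shows "plug (plug as i bs) (j + i) cs = plug as i (plug bs j cs)"
proof -
  obtain xs a ys where as: "as = xs @ a # ys" "i = length xs"
    using assms(1) id_take_nth_drop[of i as] by (metis length_take min.absorb4)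
  obtain us b vs where bs: "bs = us @ b # vs" "j = length us"
    using assms(2) id_take_nth_drop[of j bs] by (metis length_take min.absorb4)
  show ?thesis
    unfolding as bs using plug_append[of "xs @ us" b "vs @ ys" cs]
    by (simp add: plug_append add.commute)
qed

lemma plug_par:
  assumes "i < k" "k < length as"
  shows "plug (plug as i bs) (k + length bs - 1) cs = plug (plug as k cs) i bs"
proof -
  obtain xs a zs where as: "as = xs @ a # zs" "i = length xs"
    using assms id_take_nth_drop[of i as] by (metis length_take min.absorb4 order.strict_trans)
  then have "k - Suc i < length zs" using assms by simp
  then obtain ys c ws where zs: "zs = ys @ c # ws" "k - Suc i = length ys"
    using id_take_nth_drop[of "k - Suc i" zs] by (metis length_take min.absorb4)
  have k: "k = length xs + Suc (length ys)" using zs(2) assms as by simp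
  have "plug (plug as i bs) (k + length bs - 1) cs = xs @ bs @ ys @ cs @ ws"
    unfolding as zs plug_append k using plug_append[of "xs @ bs @ ys" c ws cs]
    by (simp add: add.assoc add.commute add.left_commute)
  moreover have "plug (plug as k cs) i bs = xs @ bs @ ys @ cs @ ws"
    unfolding as zs k using plug_append[of "xs @ a # ys" c ws cs] plug_append[of xs a "ys @ cs @ ws" bs]
    by (simp add: plug_append)
  ultimately show ?thesis by simp
qed

text \<open>The pairs of arities that can be substituted. A short multicategory (\<open>full\<close> being false) has the
  substitutions of \<open>sub_arities\<close>; if one of the two maps is unary, the functorial action plays the
  role of substitution.\<close>

definition ok_ar :: "bool \<Rightarrow> nat \<Rightarrow> nat \<Rightarrow> bool" where
  "ok_ar full n m \<longleftrightarrow> full \<or> n \<le> 4 \<and> m \<le> 4 \<and> (n = 1 \<or> m = 1 \<or> (n, m) \<in> sub_arities)"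

lemma ok_ar_simps [simp]:
  "ok_ar full (Suc 0) 0" "ok_ar full (Suc 0) (Suc 0)" "ok_ar full (Suc 0) (Suc (Suc 0))"
  "ok_ar full (Suc 0) (Suc (Suc (Suc 0)))" "ok_ar full (Suc 0) (Suc (Suc (Suc (Suc 0))))"
  "ok_ar full (Suc (Suc 0)) 0" "ok_ar full (Suc (Suc 0)) (Suc 0)"
  "ok_ar full (Suc (Suc 0)) (Suc (Suc 0))" "ok_ar full (Suc (Suc 0)) (Suc (Suc (Suc 0)))"
  "ok_ar full (Suc (Suc (Suc 0))) 0" "ok_ar full (Suc (Suc (Suc 0))) (Suc 0)"
  "ok_ar full (Suc (Suc (Suc 0))) (Suc (Suc 0))"
  by (auto simp: ok_ar_def sub_arities_def numeral_2_eq_2 numeral_3_eq_3)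

text \<open>Multicategories are the case in which \<open>full\<close> holds, short multicategories the other one. A map is
  an element of \<open>Arr\<close> that knows its domain and codomain, which frees the laws from lists of objects.
  The sequential law holds whenever the four substitutions in it exist. This fails to be an axiom for
  the parallel law: for a ternary \<open>f\<close> and nullary \<open>g\<close>, \<open>h\<close> all substitutions exist, but a short
  multicategory has the law for non-unary \<open>g\<close>, \<open>h\<close> only if \<open>f\<close> is binary.\<close>

locale bounded_multicategory =
  fixes Obj :: "'o set" and Arr :: "'a set" and dm :: "'a \<Rightarrow> 'o list" and cd :: "'a \<Rightarrow> 'o"
    and idn :: "'o \<Rightarrow> 'a"
    and sb :: "'a \<Rightarrow> nat \<Rightarrow> 'a \<Rightarrow> 'a"  ("(_ \<cdot>[_] _)" [70, 0, 71] 70)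
    and full :: bool
  assumes dm_Obj: "f \<in> Arr \<Longrightarrow> set (dm f) \<subseteq> Obj"
    and cd_Obj: "f \<in> Arr \<Longrightarrow> cd f \<in> Obj"
    and arity: "f \<in> Arr \<Longrightarrow> full \<or> length (dm f) \<le> 4"
    and idn_Arr [simp]: "a \<in> Obj \<Longrightarrow> idn a \<in> Arr"
    and dm_idn [simp]: "dm (idn a) = [a]"
    and cd_idn [simp]: "cd (idn a) = a"
    and dm_sb [simp]: "dm (g \<cdot>[i] f) = plug (dm g) i (dm f)"
    and cd_sb [simp]: "cd (g \<cdot>[i] f) = cd g"
    and sb_Arr [simp]: "\<lbrakk>g \<in> Arr; f \<in> Arr; i < length (dm g); dm g ! i = cd f;
        ok_ar full (length (dm g)) (length (dm f))\<rbrakk> \<Longrightarrow> g \<cdot>[i] f \<in> Arr"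
    and idn_left: "f \<in> Arr \<Longrightarrow> idn (cd f) \<cdot>[0] f = f"
    and idn_right: "f \<in> Arr \<Longrightarrow> i < length (dm f) \<Longrightarrow> f \<cdot>[i] idn (dm f ! i) = f"
    and seq: "\<lbrakk>f \<in> Arr; g \<in> Arr; h \<in> Arr; i < length (dm f); dm f ! i = cd g;
        j < length (dm g); dm g ! j = cd h;
        ok_ar full (length (dm f)) (length (dm g)); ok_ar full (length (dm g)) (length (dm h));
        ok_ar full (length (dm f) + length (dm g) - 1) (length (dm h));
        ok_ar full (length (dm f)) (length (dm g) + length (dm h) - 1)\<rbrakk>
      \<Longrightarrow> f \<cdot>[i] (g \<cdot>[j] h) = f \<cdot>[i] g \<cdot>[j + i] h"
    and par: "\<lbrakk>f \<in> Arr; g \<in> Arr; h \<in> Arr; i < k; k < length (dm f); dm f ! i = cd g;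
        dm f ! k = cd h;
        full \<or> length (dm f) = 2 \<or> length (dm g) = 1 \<or> length (dm h) = 1;
        ok_ar full (length (dm f)) (length (dm g)); ok_ar full (length (dm f)) (length (dm h));
        ok_ar full (length (dm f) + length (dm g) - 1) (length (dm h));
        ok_ar full (length (dm f) + length (dm h) - 1) (length (dm g))\<rbrakk>
      \<Longrightarrow> f \<cdot>[i] g \<cdot>[k + length (dm g) - 1] h = f \<cdot>[k] h \<cdot>[i] g"
begin

definition hom :: "'o list \<Rightarrow> 'o \<Rightarrow> 'a set" where
  "hom as b = {f \<in> Arr. dm f = as \<and> cd f = b}"

lemma hom_iff: "f \<in> hom as b \<longleftrightarrow> f \<in> Arr \<and> dm f = as \<and> cd f = b"
  by (simp add: hom_def)

lemma homD:
  assumes "f \<in> hom as b"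
  shows "f \<in> Arr" "dm f = as" "cd f = b" "set as \<subseteq> Obj" "b \<in> Obj"
  using assms dm_Obj cd_Obj by (auto simp: hom_def)

lemma idl [simp]: "f \<in> Arr \<Longrightarrow> cd f = b \<Longrightarrow> idn b \<cdot>[0] f = f"
  using idn_left by blast

lemma idr [simp]: "f \<in> Arr \<Longrightarrow> i < length (dm f) \<Longrightarrow> dm f ! i = a \<Longrightarrow> f \<cdot>[i] idn a = f"
  using idn_right by blast

lemma ok_unary [simp]:
  "f \<in> Arr \<Longrightarrow> ok_ar full (length (dm f)) (Suc 0)"
  "f \<in> Arr \<Longrightarrow> ok_ar full (Suc 0) (length (dm f))"
  using arity[of f] by (auto simp: ok_ar_def)

end

text \<open>Left representability by binary and nullary classifiers \<open>th a b\<close> and \<open>u\<close>: the first two inputs can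
  be merged, and a unit can be added as first input. Bijectivity is split into existence and
  uniqueness; the arity conditions express that in the short case it is demanded only as long as both
  sides have arity at most 4, and at most 3 when \<open>u\<close> is involved.\<close>

locale lr_multi = bounded_multicategory +
  fixes ten :: "'a \<Rightarrow> 'a \<Rightarrow> 'a"  (infixl "\<odot>" 75)
    and th :: "'a \<Rightarrow> 'a \<Rightarrow> 'b" and e :: 'a and u :: 'b
  assumes ten_Obj [simp]: "a \<in> Obj \<Longrightarrow> b \<in> Obj \<Longrightarrow> a \<odot> b \<in> Obj"
    and th_Arr [simp]: "a \<in> Obj \<Longrightarrow> b \<in> Obj \<Longrightarrow> th a b \<in> Arr"
    and dm_th [simp]: "dm (th a b) = [a, b]"
    and cd_th [simp]: "cd (th a b) = a \<odot> b"
    and e_Obj [simp]: "e \<in> Obj"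
    and u_Arr [simp]: "u \<in> Arr" and dm_u [simp]: "dm u = []" and cd_u [simp]: "cd u = e"
    and th_ex: "\<lbrakk>f \<in> Arr; dm f = a # b # xs\<rbrakk>
      \<Longrightarrow> \<exists>h\<in>Arr. dm h = a \<odot> b # xs \<and> cd h = cd f \<and> h \<cdot>[0] th a b = f"
    and th_inj: "\<lbrakk>h \<cdot>[0] th a b = h' \<cdot>[0] th a b; a \<in> Obj; b \<in> Obj; h \<in> Arr; h' \<in> Arr;
        dm h = a \<odot> b # xs; dm h' = a \<odot> b # xs; cd h = cd h'; ok_ar full (length (dm h)) 2\<rbrakk>
      \<Longrightarrow> h = h'"
    and u_ex: "\<lbrakk>f \<in> Arr; ok_ar full (Suc (length (dm f))) 0\<rbrakk>
      \<Longrightarrow> \<exists>h\<in>Arr. dm h = e # dm f \<and> cd h = cd f \<and> h \<cdot>[0] u = f"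
    and u_inj: "\<lbrakk>h \<cdot>[0] u = h' \<cdot>[0] u; h \<in> Arr; h' \<in> Arr;
        dm h = e # xs; dm h' = e # xs; cd h = cd h'; ok_ar full (length (dm h)) 0\<rbrakk>
      \<Longrightarrow> h = h'"
begin

subsection \<open>The skew monoidal structure\<close>

text \<open>The tensor product and the constraints that \<open>K\<close> defines, as unary multimaps. The map \<open>li a\<close> is the
  inverse of \<open>la a\<close>.\<close>

definition tn :: "'b \<Rightarrow> 'b \<Rightarrow> 'b" where
  "tn p q = (THE h. h \<in> hom [hd (dm p) \<odot> hd (dm q)] (cd p \<odot> cd q) \<and>
     h \<cdot>[0] th (hd (dm p)) (hd (dm q)) = th (cd p) (cd q) \<cdot>[0] p \<cdot>[1] q)"

definition al :: "'a \<Rightarrow> 'a \<Rightarrow> 'a \<Rightarrow> 'b" where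
  "al a b c = (THE h. h \<in> hom [a \<odot> b \<odot> c] (a \<odot> (b \<odot> c)) \<and>
     h \<cdot>[0] th (a \<odot> b) c \<cdot>[0] th a b = th a (b \<odot> c) \<cdot>[1] th b c)"

definition la :: "'a \<Rightarrow> 'b" where
  "la a = (THE h. h \<in> hom [e \<odot> a] a \<and> h \<cdot>[0] th e a \<cdot>[0] u = idn a)"

definition li :: "'a \<Rightarrow> 'b" where "li a = th e a \<cdot>[0] u"

definition ro :: "'a \<Rightarrow> 'b" where "ro a = th a e \<cdot>[1] u"

lemma th_inj1:
  "\<lbrakk>h \<cdot>[0] th a b = h' \<cdot>[0] th a b; a \<in> Obj; b \<in> Obj; h \<in> hom [a \<odot> b] d; h' \<in> hom [a \<odot> b] d\<rbrakk>
    \<Longrightarrow> h = h'"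
  by (rule th_inj[where xs = "[]"]) (auto simp: hom_def numeral_2_eq_2)

lemma th_inj2:
  "\<lbrakk>h \<cdot>[0] th a b = h' \<cdot>[0] th a b; a \<in> Obj; b \<in> Obj;
    h \<in> hom [a \<odot> b, x] d; h' \<in> hom [a \<odot> b, x] d\<rbrakk> \<Longrightarrow> h = h'"
  by (rule th_inj[where xs = "[x]"]) (auto simp: hom_def numeral_2_eq_2)

lemma th_inj3:
  "\<lbrakk>h \<cdot>[0] th a b = h' \<cdot>[0] th a b; a \<in> Obj; b \<in> Obj;
    h \<in> hom [a \<odot> b, x, y] d; h' \<in> hom [a \<odot> b, x, y] d\<rbrakk> \<Longrightarrow> h = h'"
  by (rule th_inj[where xs = "[x, y]"]) (auto simp: hom_def numeral_2_eq_2)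

lemma u_inj1: "\<lbrakk>h \<cdot>[0] u = h' \<cdot>[0] u; h \<in> hom [e] d; h' \<in> hom [e] d\<rbrakk> \<Longrightarrow> h = h'"
  by (rule u_inj[where xs = "[]"]) (auto simp: hom_def)

lemma u_inj2: "\<lbrakk>h \<cdot>[0] u = h' \<cdot>[0] u; h \<in> hom [e, a] d; h' \<in> hom [e, a] d\<rbrakk> \<Longrightarrow> h = h'"
  by (rule u_inj[where xs = "[a]"]) (auto simp: hom_def)

text \<open>Equations between unary maps out of a left-nested product, such as the two sides of the pentagon,
  may be checked after all classifiers have been substituted.\<close>

lemma th_th_inj:
  "\<lbrakk>h \<cdot>[0] th (a \<odot> b) c \<cdot>[0] th a b = h' \<cdot>[0] th (a \<odot> b) c \<cdot>[0] th a b;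
    a \<in> Obj; b \<in> Obj; c \<in> Obj; h \<in> hom [a \<odot> b \<odot> c] d; h' \<in> hom [a \<odot> b \<odot> c] d\<rbrakk> \<Longrightarrow> h = h'"
  by (rule th_inj1, rule th_inj2[of _ a b _ c d]) (auto simp: hom_iff)

lemma th_th_th_inj:
  "\<lbrakk>h \<cdot>[0] th (a \<odot> b \<odot> c) x \<cdot>[0] th (a \<odot> b) c \<cdot>[0] th a b
      = h' \<cdot>[0] th (a \<odot> b \<odot> c) x \<cdot>[0] th (a \<odot> b) c \<cdot>[0] th a b;
    a \<in> Obj; b \<in> Obj; c \<in> Obj; x \<in> Obj;
    h \<in> hom [a \<odot> b \<odot> c \<odot> x] d; h' \<in> hom [a \<odot> b \<odot> c \<odot> x] d\<rbrakk> \<Longrightarrow> h = h'"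
  by (rule th_inj1, rule th_inj2[of _ "a \<odot> b" c _ x d], rule th_inj3[of _ a b _ c x d])
    (auto simp: hom_iff)

lemma th_u_inj:
  "\<lbrakk>h \<cdot>[0] th e a \<cdot>[0] u = h' \<cdot>[0] th e a \<cdot>[0] u; a \<in> Obj;
    h \<in> hom [e \<odot> a] d; h' \<in> hom [e \<odot> a] d\<rbrakk> \<Longrightarrow> h = h'"
  by (rule th_inj1, rule u_inj2[of _ _ a d]) (auto simp: hom_iff)

lemma tn_ex1:
  assumes "p \<in> hom [a] b" "q \<in> hom [c] d"
  shows "\<exists>!h. h \<in> hom [a \<odot> c] (b \<odot> d) \<and> h \<cdot>[0] th a c = th b d \<cdot>[0] p \<cdot>[1] q"
proof -
  have [simp]: "p \<in> Arr" "dm p = [a]" "cd p = b" "a \<in> Obj" "b \<in> Obj"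
    "q \<in> Arr" "dm q = [c]" "cd q = d" "c \<in> Obj" "d \<in> Obj"
    using homD[OF assms(1)] homD[OF assms(2)] by auto
  show ?thesis
    using th_ex[of "th b d \<cdot>[0] p \<cdot>[1] q" a c "[]"] th_inj1[of _ a c _ "b \<odot> d"]
    by (auto simp: hom_iff ex_ex1I)
qed

lemma tn:
  assumes "p \<in> hom [a] b" "q \<in> hom [c] d"
  shows "tn p q \<in> hom [a \<odot> c] (b \<odot> d)" "tn p q \<cdot>[0] th a c = th b d \<cdot>[0] p \<cdot>[1] q"
  using theI'[OF tn_ex1[OF assms]] homD[OF assms(1)] homD[OF assms(2)] by (auto simp: tn_def)

lemma al_ex1:
  assumes [simp]: "a \<in> Obj" "b \<in> Obj" "c \<in> Obj"
  shows "\<exists>!h. h \<in> hom [a \<odot> b \<odot> c] (a \<odot> (b \<odot> c)) \<and>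
     h \<cdot>[0] th (a \<odot> b) c \<cdot>[0] th a b = th a (b \<odot> c) \<cdot>[1] th b c"
proof (rule ex_ex1I)
  obtain k where [simp]: "k \<in> Arr" "dm k = [a \<odot> b, c]" "cd k = a \<odot> (b \<odot> c)"
      and k: "k \<cdot>[0] th a b = th a (b \<odot> c) \<cdot>[1] th b c"
    using th_ex[of "th a (b \<odot> c) \<cdot>[1] th b c" a b "[c]"] by auto
  obtain h where "h \<in> Arr" "dm h = [a \<odot> b \<odot> c]" "cd h = a \<odot> (b \<odot> c)" "h \<cdot>[0] th (a \<odot> b) c = k"
    using th_ex[of k "a \<odot> b" c "[]"] by auto
  then show "\<exists>h. h \<in> hom [a \<odot> b \<odot> c] (a \<odot> (b \<odot> c)) \<and>
     h \<cdot>[0] th (a \<odot> b) c \<cdot>[0] th a b = th a (b \<odot> c) \<cdot>[1] th b c"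
    using k by (auto simp: hom_iff)
next
  fix h h'
  assume "h \<in> hom [a \<odot> b \<odot> c] (a \<odot> (b \<odot> c)) \<and>
     h \<cdot>[0] th (a \<odot> b) c \<cdot>[0] th a b = th a (b \<odot> c) \<cdot>[1] th b c"
    and "h' \<in> hom [a \<odot> b \<odot> c] (a \<odot> (b \<odot> c)) \<and>
     h' \<cdot>[0] th (a \<odot> b) c \<cdot>[0] th a b = th a (b \<odot> c) \<cdot>[1] th b c"
  then show "h = h'"
    by (intro th_th_inj[of h a b c h' "a \<odot> (b \<odot> c)"]) auto
qed

lemma al:
  assumes "a \<in> Obj" "b \<in> Obj" "c \<in> Obj"
  shows "al a b c \<in> hom [a \<odot> b \<odot> c] (a \<odot> (b \<odot> c))"
    "al a b c \<cdot>[0] th (a \<odot> b) c \<cdot>[0] th a b = th a (b \<odot> c) \<cdot>[1] th b c"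
  using theI'[OF al_ex1[OF assms]] by (auto simp: al_def)

lemma al_simps [simp]:
  assumes "a \<in> Obj" "b \<in> Obj" "c \<in> Obj"
  shows "al a b c \<in> Arr" "dm (al a b c) = [a \<odot> b \<odot> c]" "cd (al a b c) = a \<odot> (b \<odot> c)"
  using al[OF assms] by (auto simp: hom_iff)

lemma la_ex1:
  assumes [simp]: "a \<in> Obj"
  shows "\<exists>!h. h \<in> hom [e \<odot> a] a \<and> h \<cdot>[0] th e a \<cdot>[0] u = idn a"
proof (rule ex_ex1I)
  obtain k where [simp]: "k \<in> Arr" "dm k = [e, a]" "cd k = a" and k: "k \<cdot>[0] u = idn a"
    using u_ex[of "idn a"] by auto
  obtain h where "h \<in> Arr" "dm h = [e \<odot> a]" "cd h = a" "h \<cdot>[0] th e a = k"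
    using th_ex[of k e a "[]"] by auto
  then show "\<exists>h. h \<in> hom [e \<odot> a] a \<and> h \<cdot>[0] th e a \<cdot>[0] u = idn a"
    using k by (auto simp: hom_iff)
next
  fix h h'
  assume "h \<in> hom [e \<odot> a] a \<and> h \<cdot>[0] th e a \<cdot>[0] u = idn a"
    and "h' \<in> hom [e \<odot> a] a \<and> h' \<cdot>[0] th e a \<cdot>[0] u = idn a"
  then show "h = h'"
    by (intro th_u_inj[of h a h' a]) (auto simp: hom_iff)
qed

lemma la:
  assumes "a \<in> Obj"
  shows "la a \<in> hom [e \<odot> a] a" "la a \<cdot>[0] th e a \<cdot>[0] u = idn a"
  using theI'[OF la_ex1[OF assms]] by (auto simp: la_def)

lemma la_simps [simp]:
  assumes "a \<in> Obj"
  shows "la a \<in> Arr" "dm (la a) = [e \<odot> a]" "cd (la a) = a"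
  using la[OF assms] by (auto simp: hom_iff)

lemma li_simps [simp]:
  "a \<in> Obj \<Longrightarrow> li a \<in> Arr" "dm (li a) = [a]" "cd (li a) = e \<odot> a"
  by (auto simp: li_def)

lemma ro_simps [simp]:
  "a \<in> Obj \<Longrightarrow> ro a \<in> Arr" "dm (ro a) = [a]" "cd (ro a) = a \<odot> e"
  by (auto simp: ro_def)

lemma tn_simps [simp]:
  assumes "p \<in> Arr" "dm p = [a]" "q \<in> Arr" "dm q = [c]"
  shows "tn p q \<in> Arr" "dm (tn p q) = [a \<odot> c]" "cd (tn p q) = cd p \<odot> cd q"
  using tn[of p a "cd p" q c "cd q"] assms by (auto simp: hom_iff)

lemma tn_th:
  assumes "p \<in> Arr" "dm p = [a]" "q \<in> Arr" "dm q = [c]"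
  shows "tn p q \<cdot>[0] th a c = th (cd p) (cd q) \<cdot>[0] p \<cdot>[1] q"
  using tn[of p a "cd p" q c "cd q"] assms by (auto simp: hom_iff)

lemma tn_th_left:
  assumes "p \<in> Arr" "dm p = [a]" "c \<in> Obj"
  shows "tn p (idn c) \<cdot>[0] th a c = th (cd p) c \<cdot>[0] p"
  using tn_th[of p a "idn c" c] assms cd_Obj[of p] by simp

lemma tn_th_right:
  assumes "q \<in> Arr" "dm q = [c]" "a \<in> Obj"
  shows "tn (idn a) q \<cdot>[0] th a c = th a (cd q) \<cdot>[1] q"
  using tn_th[of "idn a" a q c] assms cd_Obj[of q] by simp

lemma unary_assoc:
  assumes "f \<in> Arr" "g \<in> Arr" "h \<in> Arr" "i < length (dm f)" "dm f ! i = cd g"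
    "length (dm g) = 1" "dm g ! 0 = cd h" "ok_ar full (length (dm f)) (length (dm h))"
  shows "f \<cdot>[i] (g \<cdot>[0] h) = f \<cdot>[i] g \<cdot>[i] h"
  using seq[of f g h i 0] assms by simp

lemma tn_idn: "a \<in> Obj \<Longrightarrow> b \<in> Obj \<Longrightarrow> tn (idn a) (idn b) = idn (a \<odot> b)"
  by (rule th_inj1[of _ a b _ "a \<odot> b"]) (auto simp: hom_iff tn_th)

lemma tn_comp:
  assumes "f \<in> hom [a] b" "g \<in> hom [b] c" "f' \<in> hom [a'] b'" "g' \<in> hom [b'] c'"
  shows "tn (g \<cdot>[0] f) (g' \<cdot>[0] f') = tn g g' \<cdot>[0] tn f f'"
proof (rule th_inj1[of _ a a' _ "c \<odot> c'"])
  have [simp]: "f \<in> Arr" "dm f = [a]" "cd f = b" "g \<in> Arr" "dm g = [b]" "cd g = c"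
    "f' \<in> Arr" "dm f' = [a']" "cd f' = b'" "g' \<in> Arr" "dm g' = [b']" "cd g' = c'"
    and [simp]: "a \<in> Obj" "b \<in> Obj" "c \<in> Obj" "a' \<in> Obj" "b' \<in> Obj" "c' \<in> Obj"
    using assms[THEN homD(1)] assms[THEN homD(2)] assms[THEN homD(3)] assms[THEN homD(4)]
      assms[THEN homD(5)] by auto
  show "a \<in> Obj" "a' \<in> Obj" by simp_all
  show "tn (g \<cdot>[0] f) (g' \<cdot>[0] f') \<in> hom [a \<odot> a'] (c \<odot> c')"
    "tn g g' \<cdot>[0] tn f f' \<in> hom [a \<odot> a'] (c \<odot> c')" by (auto simp: hom_iff)
  have "tn g g' \<cdot>[0] tn f f' \<cdot>[0] th a a' = tn g g' \<cdot>[0] (th b b' \<cdot>[0] f \<cdot>[1] f')"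
    using tn_th[of f a f' a'] by (simp flip: unary_assoc)
  also have "\<dots> = tn g g' \<cdot>[0] th b b' \<cdot>[0] f \<cdot>[1] f'"
    using seq[of "tn g g'" "th b b' \<cdot>[0] f" f' 0 1] seq[of "tn g g'" "th b b'" f 0 0] by simp
  also have "\<dots> = th c c' \<cdot>[0] g \<cdot>[1] g' \<cdot>[0] f \<cdot>[1] f'"
    using tn_th[of g b g' b'] by simp
  also have "\<dots> = th c c' \<cdot>[0] g \<cdot>[0] f \<cdot>[1] g' \<cdot>[1] f'"
    using par[of "th c c' \<cdot>[0] g" f g' 0 1] by simp
  also have "\<dots> = tn (g \<cdot>[0] f) (g' \<cdot>[0] f') \<cdot>[0] th a a'"
    by (simp add: tn_th unary_assoc)
  finally show "tn (g \<cdot>[0] f) (g' \<cdot>[0] f') \<cdot>[0] th a a' = tn g g' \<cdot>[0] tn f f' \<cdot>[0] th a a'" ..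
qed

text \<open>The next four lemmas translate the axioms of a lax monoidal functor into equations between
  multimaps. The functor itself does not occur: \<open>f\<close>, \<open>g\<close>, \<open>h\<close>, \<open>k\<close> stand for components of \<open>f\<^sub>2\<close> and
  \<open>f\<^sub>0\<close>, and \<open>m\<close> for the image of a map of its source. On the right-hand sides tensor products and
  constraints have disappeared, because the defining equations of the latter apply as soon as the
  classifiers are substituted, and by universality nothing is lost.\<close>

lemma hexagon_iff:
  assumes f: "f \<in> hom [A \<odot> B] X" and g: "g \<in> hom [X \<odot> C] Y" and h: "h \<in> hom [B \<odot> C] W"
    and k: "k \<in> hom [A \<odot> W] Z" and m: "m \<in> hom [Y] Z" and [simp]: "A \<in> Obj" "B \<in> Obj" "C \<in> Obj"
  shows "m \<cdot>[0] (g \<cdot>[0] tn f (idn C)) = k \<cdot>[0] (tn (idn A) h \<cdot>[0] al A B C)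
    \<longleftrightarrow> m \<cdot>[0] (g \<cdot>[0] th X C) \<cdot>[0] (f \<cdot>[0] th A B) = (k \<cdot>[0] th A W) \<cdot>[1] (h \<cdot>[0] th B C)"
    (is "?l = ?r \<longleftrightarrow> ?l' = ?r'")
proof -
  have [simp]: "f \<in> Arr" "dm f = [A \<odot> B]" "cd f = X" "g \<in> Arr" "dm g = [X \<odot> C]" "cd g = Y"
    "h \<in> Arr" "dm h = [B \<odot> C]" "cd h = W" "k \<in> Arr" "dm k = [A \<odot> W]" "cd k = Z"
    "m \<in> Arr" "dm m = [Y]" "cd m = Z" "X \<in> Obj" "Y \<in> Obj" "Z \<in> Obj" "W \<in> Obj"
    using homD[OF f] homD[OF g] homD[OF h] homD[OF k] homD[OF m] by auto
  have "?l \<cdot>[0] th (A \<odot> B) C \<cdot>[0] th A B = m \<cdot>[0] (g \<cdot>[0] (th X C \<cdot>[0] f)) \<cdot>[0] th A B"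
    using tn_th_left[of f "A \<odot> B" C] by (simp flip: unary_assoc)
  also have "\<dots> = ?l'"
    using seq[of "m \<cdot>[0] g" "th X C" f 0 0] seq[of m g "th X C \<cdot>[0] f" 0 0]
      seq[of m g "th X C" 0 0] seq[of "m \<cdot>[0] g \<cdot>[0] th X C" f "th A B" 0 0] by simp
  finally have l: "?l \<cdot>[0] th (A \<odot> B) C \<cdot>[0] th A B = ?l'" .
  have "?r \<cdot>[0] th (A \<odot> B) C \<cdot>[0] th A B
      = k \<cdot>[0] tn (idn A) h \<cdot>[0] (al A B C \<cdot>[0] th (A \<odot> B) C \<cdot>[0] th A B)"
    using seq[of "k \<cdot>[0] tn (idn A) h" "al A B C \<cdot>[0] th (A \<odot> B) C" "th A B" 0 0]
      seq[of "k \<cdot>[0] tn (idn A) h" "al A B C" "th (A \<odot> B) C" 0 0]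
      seq[of k "tn (idn A) h" "al A B C" 0 0] by simp
  also have "\<dots> = k \<cdot>[0] tn (idn A) h \<cdot>[0] th A (B \<odot> C) \<cdot>[1] th B C"
    using seq[of "k \<cdot>[0] tn (idn A) h" "th A (B \<odot> C)" "th B C" 0 1] by (simp add: al)
  also have "\<dots> = k \<cdot>[0] (th A W \<cdot>[1] h) \<cdot>[1] th B C"
    using tn_th_right[of h "B \<odot> C" A] by (simp flip: unary_assoc)
  also have "\<dots> = k \<cdot>[0] th A W \<cdot>[1] h \<cdot>[1] th B C"
    using seq[of k "th A W" h 0 1] by simp
  also have "\<dots> = ?r'"
    by (simp add: unary_assoc)
  finally have r: "?r \<cdot>[0] th (A \<odot> B) C \<cdot>[0] th A B = ?r'" .
  have "?l = ?r" if "?l' = ?r'"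
  proof (rule th_inj1[of _ "A \<odot> B" C _ Z])
    show "?l \<cdot>[0] th (A \<odot> B) C = ?r \<cdot>[0] th (A \<odot> B) C"
      by (rule th_inj2[of _ A B _ C Z]) (use l r that in \<open>auto simp: hom_iff\<close>)
  qed (auto simp: hom_iff)
  then show ?thesis using l r by metis
qed

lemma left_unit_iff:
  assumes f: "f \<in> hom [e] X" and g: "g \<in> hom [X \<odot> A] Y" and m: "m \<in> hom [Y] A"
  shows "m \<cdot>[0] (g \<cdot>[0] tn f (idn A)) = la A
    \<longleftrightarrow> m \<cdot>[0] (g \<cdot>[0] th X A) \<cdot>[0] (f \<cdot>[0] u) = idn A" (is "?l = _ \<longleftrightarrow> ?l' = _")
proof -
  have [simp]: "f \<in> Arr" "dm f = [e]" "cd f = X" "g \<in> Arr" "dm g = [X \<odot> A]" "cd g = Y"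
    "m \<in> Arr" "dm m = [Y]" "cd m = A" "X \<in> Obj" "Y \<in> Obj" "A \<in> Obj"
    using homD[OF f] homD[OF g] homD[OF m] by auto
  have "?l \<cdot>[0] th e A \<cdot>[0] u = m \<cdot>[0] (g \<cdot>[0] (th X A \<cdot>[0] f)) \<cdot>[0] u"
    using tn_th_left[of f e A] by (simp flip: unary_assoc)
  also have "\<dots> = ?l'"
    using seq[of "m \<cdot>[0] g" "th X A" f 0 0] seq[of m g "th X A \<cdot>[0] f" 0 0]
      seq[of m g "th X A" 0 0] seq[of "m \<cdot>[0] g \<cdot>[0] th X A" f "u" 0 0] by simp
  finally have l: "?l \<cdot>[0] th e A \<cdot>[0] u = ?l'" .
  have "?l = la A" if "?l' = idn A"
  proof (rule th_inj1[of _ e A _ A])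
    show "?l \<cdot>[0] th e A = la A \<cdot>[0] th e A"
      by (rule u_inj2[of _ _ A A]) (use l that la in \<open>auto simp: hom_iff\<close>)
  qed (auto simp: hom_iff)
  then show ?thesis using l la by auto
qed

text \<open>As \<open>ro\<close> is itself defined by a substitution, the two sides are equal before any axiom is assumed.\<close>

lemma right_unit_eq:
  assumes f: "f \<in> hom [e] X" and g: "g \<in> hom [A \<odot> X] Y" and [simp]: "A \<in> Obj"
  shows "g \<cdot>[0] (tn (idn A) f \<cdot>[0] ro A) = g \<cdot>[0] th A X \<cdot>[1] (f \<cdot>[0] u)"
proof -
  have [simp]: "f \<in> Arr" "dm f = [e]" "cd f = X" "g \<in> Arr" "dm g = [A \<odot> X]" "cd g = Y" "X \<in> Obj"
    using homD[OF f] homD[OF g] by auto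
  have "g \<cdot>[0] (tn (idn A) f \<cdot>[0] ro A) = g \<cdot>[0] (tn (idn A) f \<cdot>[0] th A e) \<cdot>[1] u"
    using seq[of "g \<cdot>[0] tn (idn A) f" "th A e" u 0 1] by (simp add: ro_def unary_assoc)
  also have "\<dots> = g \<cdot>[0] th A X \<cdot>[1] f \<cdot>[1] u"
    using seq[of g "th A X" f 0 1] by (simp add: tn_th_right)
  finally show ?thesis by (simp add: unary_assoc)
qed

lemma tensor_square_iff:
  assumes p: "p \<in> hom [a] b" and q: "q \<in> hom [c] d" and f: "f \<in> hom [a \<odot> c] X"
    and g: "g \<in> hom [b \<odot> d] Y" and m: "m \<in> hom [X] Y"
  shows "g \<cdot>[0] tn p q = m \<cdot>[0] f
    \<longleftrightarrow> g \<cdot>[0] th b d \<cdot>[0] p \<cdot>[1] q = m \<cdot>[0] (f \<cdot>[0] th a c)"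
proof -
  have [simp]: "p \<in> Arr" "dm p = [a]" "cd p = b" "q \<in> Arr" "dm q = [c]" "cd q = d"
    "f \<in> Arr" "dm f = [a \<odot> c]" "cd f = X" "g \<in> Arr" "dm g = [b \<odot> d]" "cd g = Y"
    "m \<in> Arr" "dm m = [X]" "cd m = Y" "X \<in> Obj" "Y \<in> Obj" "a \<in> Obj" "b \<in> Obj" "c \<in> Obj" "d \<in> Obj"
    using homD[OF f] homD[OF g] homD[OF m] homD[OF p] homD[OF q] by auto
  have 1: "g \<cdot>[0] tn p q \<cdot>[0] th a c = g \<cdot>[0] th b d \<cdot>[0] p \<cdot>[1] q"
    using seq[of g "th b d \<cdot>[0] p" q 0 1] tn_th[of p a q c] seq[of g "th b d" p 0 0]
      seq[of g "tn p q" "th a c" 0 0] by simp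
  have 2: "m \<cdot>[0] f \<cdot>[0] th a c = m \<cdot>[0] (f \<cdot>[0] th a c)"
    by (simp add: unary_assoc)
  show ?thesis
    using 1 2 th_inj1[of "g \<cdot>[0] tn p q" a c "m \<cdot>[0] f" Y] by (auto simp: hom_iff)
qed

lemma la_li: "a \<in> Obj \<Longrightarrow> la a \<cdot>[0] li a = idn a"
  using la(2)[of a] seq[of "la a" "th e a" u 0 0] by (simp add: li_def)

text \<open>Left normality. Since \<open>th e a\<close> and \<open>u\<close> are universal, a map out of \<open>e \<odot> a\<close> is determined by its
  composite with \<open>li a\<close>.\<close>

lemma li_la:
  assumes [simp]: "a \<in> Obj"
  shows "li a \<cdot>[0] la a = idn (e \<odot> a)"
proof (rule th_inj1[of _ e a _ "e \<odot> a"])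
  show "li a \<cdot>[0] la a \<cdot>[0] th e a = idn (e \<odot> a) \<cdot>[0] th e a"
  proof (rule u_inj2[of _ _ a "e \<odot> a"])
    show "li a \<cdot>[0] la a \<cdot>[0] th e a \<cdot>[0] u = idn (e \<odot> a) \<cdot>[0] th e a \<cdot>[0] u"
      using la(2)[of a] seq[of "li a" "la a \<cdot>[0] th e a" u 0 0] seq[of "li a" "la a" "th e a" 0 0]
      by (simp flip: li_def)
  qed (auto simp: hom_iff)
qed (auto simp: hom_iff)

text \<open>Both sides become \<open>th a' (b' \<odot> c') \<cdot>[1] th b' c'\<close> with \<open>f\<close>, \<open>g\<close> and \<open>h\<close> substituted into its inputs.\<close>

lemma al_nat:
  assumes f: "f \<in> hom [a] a'" and g: "g \<in> hom [b] b'" and h: "h \<in> hom [c] c'"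
  shows "al a' b' c' \<cdot>[0] tn (tn f g) h = tn f (tn g h) \<cdot>[0] al a b c"
proof -
  have [simp]: "f \<in> Arr" "dm f = [a]" "cd f = a'" "g \<in> Arr" "dm g = [b]" "cd g = b'"
    "h \<in> Arr" "dm h = [c]" "cd h = c'" "a \<in> Obj" "b \<in> Obj" "c \<in> Obj" "a' \<in> Obj" "b' \<in> Obj" "c' \<in> Obj"
    using homD[OF f] homD[OF g] homD[OF h] by auto
  let ?l = "al a' b' c' \<cdot>[0] tn (tn f g) h" and ?r = "tn f (tn g h) \<cdot>[0] al a b c"
  have "?l \<cdot>[0] th (a \<odot> b) c = al a' b' c' \<cdot>[0] (th (a' \<odot> b') c' \<cdot>[0] tn f g \<cdot>[1] h)"
    using tn_th[of "tn f g" "a \<odot> b" h c] by (simp flip: unary_assoc)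
  also have "\<dots> = al a' b' c' \<cdot>[0] th (a' \<odot> b') c' \<cdot>[0] tn f g \<cdot>[1] h"
    using seq[of "al a' b' c'" "th (a' \<odot> b') c' \<cdot>[0] tn f g" h 0 1]
      seq[of "al a' b' c'" "th (a' \<odot> b') c'" "tn f g" 0 0] by simp
  finally have "?l \<cdot>[0] th (a \<odot> b) c \<cdot>[0] th a b
      = al a' b' c' \<cdot>[0] th (a' \<odot> b') c' \<cdot>[0] tn f g \<cdot>[1] h \<cdot>[0] th a b" by simp
  also have "\<dots> = al a' b' c' \<cdot>[0] th (a' \<odot> b') c' \<cdot>[0] (tn f g \<cdot>[0] th a b) \<cdot>[2] h"
    using par[of "al a' b' c' \<cdot>[0] th (a' \<odot> b') c' \<cdot>[0] tn f g" "th a b" h 0 1]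
      seq[of "al a' b' c' \<cdot>[0] th (a' \<odot> b') c'" "tn f g" "th a b" 0 0]
    by (simp add: numeral_2_eq_2)
  also have "\<dots> = al a' b' c' \<cdot>[0] th (a' \<odot> b') c' \<cdot>[0] th a' b' \<cdot>[0] f \<cdot>[1] g \<cdot>[2] h"
    using seq[of "al a' b' c' \<cdot>[0] th (a' \<odot> b') c'" "th a' b' \<cdot>[0] f" g 0 1]
      seq[of "al a' b' c' \<cdot>[0] th (a' \<odot> b') c'" "th a' b'" f 0 0] by (simp add: tn_th)
  also have "\<dots> = th a' (b' \<odot> c') \<cdot>[1] th b' c' \<cdot>[0] f \<cdot>[1] g \<cdot>[2] h"
    by (simp add: al)
  finally have l: "?l \<cdot>[0] th (a \<odot> b) c \<cdot>[0] th a b = \<dots>" .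
  have "?r \<cdot>[0] th (a \<odot> b) c \<cdot>[0] th a b = tn f (tn g h) \<cdot>[0] (th a (b \<odot> c) \<cdot>[1] th b c)"
    using seq[of "tn f (tn g h)" "al a b c \<cdot>[0] th (a \<odot> b) c" "th a b" 0 0]
      seq[of "tn f (tn g h)" "al a b c" "th (a \<odot> b) c" 0 0] by (simp add: al)
  also have "\<dots> = th a' (b' \<odot> c') \<cdot>[0] f \<cdot>[1] tn g h \<cdot>[1] th b c"
    using seq[of "tn f (tn g h)" "th a (b \<odot> c)" "th b c" 0 1] by (simp add: tn_th)
  also have "\<dots> = th a' (b' \<odot> c') \<cdot>[0] f \<cdot>[1] (th b' c' \<cdot>[0] g \<cdot>[1] h)"
    using seq[of "th a' (b' \<odot> c') \<cdot>[0] f" "tn g h" "th b c" 1 0] by (simp add: tn_th)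
  also have "\<dots> = th a' (b' \<odot> c') \<cdot>[0] f \<cdot>[1] th b' c' \<cdot>[1] g \<cdot>[2] h"
    using seq[of "th a' (b' \<odot> c') \<cdot>[0] f" "th b' c' \<cdot>[0] g" h 1 1]
      seq[of "th a' (b' \<odot> c') \<cdot>[0] f" "th b' c'" g 1 0] by (simp add: numeral_2_eq_2)
  also have "\<dots> = th a' (b' \<odot> c') \<cdot>[1] th b' c' \<cdot>[0] f \<cdot>[1] g \<cdot>[2] h"
    using par[of "th a' (b' \<odot> c')" f "th b' c'" 0 1] by simp
  finally have "?l \<cdot>[0] th (a \<odot> b) c \<cdot>[0] th a b = ?r \<cdot>[0] th (a \<odot> b) c \<cdot>[0] th a b"
    using l by simp
  then show ?thesis
    by (rule th_th_inj[of _ a b c _ "a' \<odot> (b' \<odot> c')"]) (auto simp: hom_iff)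
qed

lemma la_nat:
  assumes f: "f \<in> hom [a] b"
  shows "la b \<cdot>[0] tn (idn e) f = f \<cdot>[0] la a"
proof -
  have [simp]: "f \<in> Arr" "dm f = [a]" "cd f = b" "a \<in> Obj" "b \<in> Obj" using homD[OF f] by auto
  have "la b \<cdot>[0] tn (idn e) f \<cdot>[0] th e a \<cdot>[0] u = la b \<cdot>[0] th e b \<cdot>[1] f \<cdot>[0] u"
    using tn_th_right[of f a e] seq[of "la b" "th e b" f 0 1] by (simp flip: unary_assoc)
  also have "\<dots> = la b \<cdot>[0] th e b \<cdot>[0] u \<cdot>[0] f"
    using par[of "la b \<cdot>[0] th e b" u f 0 1] by simp
  also have "\<dots> = f \<cdot>[0] la a \<cdot>[0] th e a \<cdot>[0] u"
    using la(2)[of a] la(2)[of b] seq[of f "la a \<cdot>[0] th e a" u 0 0] seq[of f "la a" "th e a" 0 0]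
    by simp
  finally show ?thesis
    by (rule th_u_inj[of _ a _ b]) (auto simp: hom_iff)
qed

lemma ro_nat:
  assumes f: "f \<in> hom [a] b"
  shows "ro b \<cdot>[0] f = tn f (idn e) \<cdot>[0] ro a"
proof -
  have [simp]: "f \<in> Arr" "dm f = [a]" "cd f = b" "a \<in> Obj" "b \<in> Obj" using homD[OF f] by auto
  show ?thesis
    using seq[of "tn f (idn e)" "th a e" u 0 1] par[of "th b e" f u 0 1]
    by (simp add: ro_def tn_th_left)
qed

text \<open>In each of the five axioms of a skew monoidal category the two sides become the same multimap once
  the classifiers are substituted. In the pentagon this is the right-nested composite
  \<open>th a (b \<odot> (c \<odot> d)) \<cdot>[1] (th b (c \<odot> d) \<cdot>[1] th c d)\<close>; in the others it is \<open>th a b\<close>,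
  \<open>th a (b \<odot> e) \<cdot>[1] ro b\<close>, again \<open>th a b\<close>, and \<open>u\<close>.\<close>

lemma pentagon:
  assumes [simp]: "a \<in> Obj" "b \<in> Obj" "c \<in> Obj" "d \<in> Obj"
  shows "al a b (c \<odot> d) \<cdot>[0] al (a \<odot> b) c d
    = tn (idn a) (al b c d) \<cdot>[0] (al a (b \<odot> c) d \<cdot>[0] tn (al a b c) (idn d))"
    (is "?l = ?r")
proof -
  have "?l \<cdot>[0] th (a \<odot> b \<odot> c) d \<cdot>[0] th (a \<odot> b) c
      = al a b (c \<odot> d) \<cdot>[0] th (a \<odot> b) (c \<odot> d) \<cdot>[1] th c d"
    using seq[of "al a b (c \<odot> d)" "al (a \<odot> b) c d \<cdot>[0] th (a \<odot> b \<odot> c) d" "th (a \<odot> b) c" 0 0]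
      seq[of "al a b (c \<odot> d)" "al (a \<odot> b) c d" "th (a \<odot> b \<odot> c) d" 0 0]
      seq[of "al a b (c \<odot> d)" "th (a \<odot> b) (c \<odot> d)" "th c d" 0 1] by (simp add: al)
  then have "?l \<cdot>[0] th (a \<odot> b \<odot> c) d \<cdot>[0] th (a \<odot> b) c \<cdot>[0] th a b
      = al a b (c \<odot> d) \<cdot>[0] th (a \<odot> b) (c \<odot> d) \<cdot>[0] th a b \<cdot>[2] th c d"
    using par[of "al a b (c \<odot> d) \<cdot>[0] th (a \<odot> b) (c \<odot> d)" "th a b" "th c d" 0 1]
    by (simp add: numeral_2_eq_2)
  also have "\<dots> = th a (b \<odot> (c \<odot> d)) \<cdot>[1] (th b (c \<odot> d) \<cdot>[1] th c d)"
    using seq[of "th a (b \<odot> (c \<odot> d))" "th b (c \<odot> d)" "th c d" 1 1]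
    by (simp add: al numeral_2_eq_2)
  finally have l: "?l \<cdot>[0] th (a \<odot> b \<odot> c) d \<cdot>[0] th (a \<odot> b) c \<cdot>[0] th a b = \<dots>" .
  let ?k = "tn (idn a) (al b c d) \<cdot>[0] al a (b \<odot> c) d"
  have "?r \<cdot>[0] th (a \<odot> b \<odot> c) d = ?k \<cdot>[0] (tn (al a b c) (idn d) \<cdot>[0] th (a \<odot> b \<odot> c) d)"
    by (simp add: unary_assoc)
  also have "\<dots> = ?k \<cdot>[0] th (a \<odot> (b \<odot> c)) d \<cdot>[0] al a b c"
    using seq[of ?k "th (a \<odot> (b \<odot> c)) d" "al a b c" 0 0]
      tn_th_left[of "al a b c" "a \<odot> b \<odot> c" d] by simp
  finally have "?r \<cdot>[0] th (a \<odot> b \<odot> c) d = ?k \<cdot>[0] th (a \<odot> (b \<odot> c)) d \<cdot>[0] al a b c" .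
  then have "?r \<cdot>[0] th (a \<odot> b \<odot> c) d \<cdot>[0] th (a \<odot> b) c \<cdot>[0] th a b
      = ?k \<cdot>[0] th (a \<odot> (b \<odot> c)) d \<cdot>[0] (al a b c \<cdot>[0] th (a \<odot> b) c \<cdot>[0] th a b)"
    using seq[of "?k \<cdot>[0] th (a \<odot> (b \<odot> c)) d" "al a b c \<cdot>[0] th (a \<odot> b) c" "th a b" 0 0]
      seq[of "?k \<cdot>[0] th (a \<odot> (b \<odot> c)) d" "al a b c" "th (a \<odot> b) c" 0 0] by simp
  also have "\<dots> = ?k \<cdot>[0] th (a \<odot> (b \<odot> c)) d \<cdot>[0] th a (b \<odot> c) \<cdot>[1] th b c"
    using seq[of "?k \<cdot>[0] th (a \<odot> (b \<odot> c)) d" "th a (b \<odot> c)" "th b c" 0 1] by (simp add: al)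
  also have "\<dots> = tn (idn a) (al b c d)
      \<cdot>[0] (al a (b \<odot> c) d \<cdot>[0] th (a \<odot> (b \<odot> c)) d \<cdot>[0] th a (b \<odot> c)) \<cdot>[1] th b c"
    using seq[of "tn (idn a) (al b c d)" "al a (b \<odot> c) d \<cdot>[0] th (a \<odot> (b \<odot> c)) d" "th a (b \<odot> c)" 0 0]
      seq[of "tn (idn a) (al b c d)" "al a (b \<odot> c) d" "th (a \<odot> (b \<odot> c)) d" 0 0] by simp
  also have "\<dots> = th a (b \<odot> (c \<odot> d)) \<cdot>[1] al b c d \<cdot>[1] th (b \<odot> c) d \<cdot>[1] th b c"
    using seq[of "tn (idn a) (al b c d)" "th a (b \<odot> c \<odot> d)" "th (b \<odot> c) d" 0 1]
      tn_th_right[of "al b c d" "b \<odot> c \<odot> d" a] by (simp add: al)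
  also have "\<dots> = th a (b \<odot> (c \<odot> d)) \<cdot>[1] (al b c d \<cdot>[0] th (b \<odot> c) d \<cdot>[0] th b c)"
    using seq[of "th a (b \<odot> (c \<odot> d))" "al b c d \<cdot>[0] th (b \<odot> c) d" "th b c" 1 0]
      seq[of "th a (b \<odot> (c \<odot> d))" "al b c d" "th (b \<odot> c) d" 1 0] by simp
  also have "\<dots> = th a (b \<odot> (c \<odot> d)) \<cdot>[1] (th b (c \<odot> d) \<cdot>[1] th c d)"
    by (simp add: al)
  finally have "?l \<cdot>[0] th (a \<odot> b \<odot> c) d \<cdot>[0] th (a \<odot> b) c \<cdot>[0] th a b
    = ?r \<cdot>[0] th (a \<odot> b \<odot> c) d \<cdot>[0] th (a \<odot> b) c \<cdot>[0] th a b" using l by simp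
  then show ?thesis
    by (rule th_th_th_inj[of _ a b c d _ "a \<odot> (b \<odot> (c \<odot> d))"]) (auto simp: hom_iff)
qed

lemma la_al:
  assumes [simp]: "a \<in> Obj" "b \<in> Obj"
  shows "la (a \<odot> b) \<cdot>[0] al e a b = tn (la a) (idn b)" (is "?l = ?r")
proof -
  have "?l \<cdot>[0] th (e \<odot> a) b \<cdot>[0] th e a = la (a \<odot> b) \<cdot>[0] (th e (a \<odot> b) \<cdot>[1] th a b)"
    using seq[of "la (a \<odot> b)" "al e a b \<cdot>[0] th (e \<odot> a) b" "th e a" 0 0]
      seq[of "la (a \<odot> b)" "al e a b" "th (e \<odot> a) b" 0 0] by (simp add: al)
  also have "\<dots> = la (a \<odot> b) \<cdot>[0] th e (a \<odot> b) \<cdot>[1] th a b"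
    using seq[of "la (a \<odot> b)" "th e (a \<odot> b)" "th a b" 0 1] by simp
  finally have "?l \<cdot>[0] th (e \<odot> a) b \<cdot>[0] th e a \<cdot>[0] u
      = la (a \<odot> b) \<cdot>[0] th e (a \<odot> b) \<cdot>[0] u \<cdot>[0] th a b"
    using par[of "la (a \<odot> b) \<cdot>[0] th e (a \<odot> b)" u "th a b" 0 1] by simp
  also have "\<dots> = th a b"
    by (simp add: la)
  finally have l: "?l \<cdot>[0] th (e \<odot> a) b \<cdot>[0] th e a \<cdot>[0] u = th a b" .
  have "?r \<cdot>[0] th (e \<odot> a) b \<cdot>[0] th e a \<cdot>[0] u = th a b \<cdot>[0] la a \<cdot>[0] th e a \<cdot>[0] u"
    by (simp add: tn_th_left)
  also have "\<dots> = th a b \<cdot>[0] (la a \<cdot>[0] th e a \<cdot>[0] u)"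
    using seq[of "th a b" "la a \<cdot>[0] th e a" u 0 0] seq[of "th a b" "la a" "th e a" 0 0] by simp
  also have "\<dots> = th a b"
    by (simp add: la)
  finally have "?l \<cdot>[0] th (e \<odot> a) b \<cdot>[0] th e a \<cdot>[0] u
      = ?r \<cdot>[0] th (e \<odot> a) b \<cdot>[0] th e a \<cdot>[0] u" using l by simp
  then have "?l \<cdot>[0] th (e \<odot> a) b \<cdot>[0] th e a = ?r \<cdot>[0] th (e \<odot> a) b \<cdot>[0] th e a"
    by (rule u_inj[where xs = "[a, b]"]) auto
  then show ?thesis
    by (rule th_th_inj[of _ e a b _ "a \<odot> b"]) (auto simp: hom_iff)
qed

lemma ro_al:
  assumes [simp]: "a \<in> Obj" "b \<in> Obj"
  shows "al a b e \<cdot>[0] ro (a \<odot> b) = tn (idn a) (ro b)" (is "?l = ?r")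
proof (rule th_inj1[of _ a b _ "a \<odot> (b \<odot> e)"])
  have "?l \<cdot>[0] th a b = al a b e \<cdot>[0] th (a \<odot> b) e \<cdot>[1] u \<cdot>[0] th a b"
    using seq[of "al a b e" "th (a \<odot> b) e" u 0 1] by (simp add: ro_def)
  also have "\<dots> = al a b e \<cdot>[0] th (a \<odot> b) e \<cdot>[0] th a b \<cdot>[2] u"
    using par[of "al a b e \<cdot>[0] th (a \<odot> b) e" "th a b" u 0 1] by (simp add: numeral_2_eq_2)
  also have "\<dots> = th a (b \<odot> e) \<cdot>[1] ro b"
    using seq[of "th a (b \<odot> e)" "th b e" u 1 1] by (simp add: al ro_def numeral_2_eq_2)
  finally show "?l \<cdot>[0] th a b = ?r \<cdot>[0] th a b"
    by (simp add: tn_th_right)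
qed (auto simp: hom_iff)

lemma la_ro_al:
  assumes [simp]: "a \<in> Obj" "b \<in> Obj"
  shows "tn (idn a) (la b) \<cdot>[0] (al a e b \<cdot>[0] tn (ro a) (idn b)) = idn (a \<odot> b)" (is "?l = ?r")
proof (rule th_inj1[of _ a b _ "a \<odot> b"])
  let ?k = "tn (idn a) (la b) \<cdot>[0] al a e b"
  have "?l \<cdot>[0] th a b = ?k \<cdot>[0] (tn (ro a) (idn b) \<cdot>[0] th a b)"
    by (simp add: unary_assoc)
  also have "\<dots> = ?k \<cdot>[0] (th (a \<odot> e) b \<cdot>[0] ro a)"
    by (simp add: tn_th_left)
  also have "\<dots> = ?k \<cdot>[0] th (a \<odot> e) b \<cdot>[0] th a e \<cdot>[1] u"
    using seq[of ?k "th (a \<odot> e) b" "ro a" 0 0] seq[of "?k \<cdot>[0] th (a \<odot> e) b" "th a e" u 0 1]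
    by (simp add: ro_def)
  also have "\<dots> = tn (idn a) (la b) \<cdot>[0] (al a e b \<cdot>[0] th (a \<odot> e) b \<cdot>[0] th a e) \<cdot>[1] u"
    using seq[of "tn (idn a) (la b)" "al a e b \<cdot>[0] th (a \<odot> e) b" "th a e" 0 0]
      seq[of "tn (idn a) (la b)" "al a e b" "th (a \<odot> e) b" 0 0] by simp
  also have "\<dots> = th a b \<cdot>[1] la b \<cdot>[1] th e b \<cdot>[1] u"
    using seq[of "tn (idn a) (la b)" "th a (e \<odot> b)" "th e b" 0 1]
      tn_th_right[of "la b" "e \<odot> b" a] by (simp add: al)
  also have "\<dots> = th a b \<cdot>[1] (la b \<cdot>[0] th e b \<cdot>[0] u)"
    using seq[of "th a b" "la b \<cdot>[0] th e b" u 1 0] seq[of "th a b" "la b" "th e b" 1 0] by simp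
  finally show "?l \<cdot>[0] th a b = ?r \<cdot>[0] th a b"
    by (simp add: la)
qed (auto simp: hom_iff)

lemma la_ro: "la e \<cdot>[0] ro e = idn e"
proof (rule u_inj1[of _ _ e])
  have "la e \<cdot>[0] ro e \<cdot>[0] u = la e \<cdot>[0] th e e \<cdot>[0] u \<cdot>[0] u"
    using seq[of "la e" "th e e" u 0 1] par[of "la e \<cdot>[0] th e e" u u 0 1] by (simp add: ro_def)
  then show "la e \<cdot>[0] ro e \<cdot>[0] u = idn e \<cdot>[0] u"
    by (simp add: la)
qed (auto simp: hom_iff)

end


section \<open>Morphisms and their extension from unary maps\<close>

locale multi_morphism =
  S: bounded_multicategory Obj Arr dm cd idn sb full +
  T: bounded_multicategory Obj' Arr' dm' cd' idn' sb' full
  for Obj :: "'o set" and Arr :: "'a set" and dm cd idn and sb :: "'a \<Rightarrow> nat \<Rightarrow> 'a \<Rightarrow> 'a"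
    and full :: bool
    and Obj' :: "'p set" and Arr' :: "'b set" and dm' cd' idn' and sb' :: "'b \<Rightarrow> nat \<Rightarrow> 'b \<Rightarrow> 'b" +
  fixes \<phi> :: "'o \<Rightarrow> 'p" and E :: "'a \<Rightarrow> 'b"
  assumes \<phi>_Obj: "a \<in> Obj \<Longrightarrow> \<phi> a \<in> Obj'"
    and E_Arr: "f \<in> Arr \<Longrightarrow> E f \<in> Arr'"
    and dm_E: "f \<in> Arr \<Longrightarrow> dm' (E f) = map \<phi> (dm f)"
    and cd_E: "f \<in> Arr \<Longrightarrow> cd' (E f) = \<phi> (cd f)"
    and E_idn: "a \<in> Obj \<Longrightarrow> E (idn a) = idn' (\<phi> a)"
    and E_sb: "\<lbrakk>g \<in> Arr; f \<in> Arr; i < length (dm g); dm g ! i = cd f;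
        ok_ar full (length (dm g)) (length (dm f))\<rbrakk> \<Longrightarrow> E (sb g i f) = sb' (E g) i (E f)"

context lr_multi
begin

lemma ok_pair: "g \<in> Arr \<Longrightarrow> length (dm g) = Suc (Suc n) \<Longrightarrow> ok_ar full (Suc n) 2"
  using arity[of g] by (cases n) (auto simp: ok_ar_def sub_arities_def)

text \<open>Every map is obtained from a unary one by finitely many substitutions of \<open>th\<close> or one
  substitution of \<open>u\<close>, always into the first input.\<close>

lemma arrow_induct [consumes 1, case_names unary unit pair]:
  assumes "f \<in> Arr"
    and unary: "\<And>f a. f \<in> Arr \<Longrightarrow> dm f = [a] \<Longrightarrow> P f"
    and unit: "\<And>f. f \<in> Arr \<Longrightarrow> dm f = [e] \<Longrightarrow> P (f \<cdot>[0] u)"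
    and pair: "\<And>f a b xs. \<lbrakk>f \<in> Arr; a \<in> Obj; b \<in> Obj; dm f = a \<odot> b # xs;
        ok_ar full (Suc (length xs)) 2; P f\<rbrakk> \<Longrightarrow> P (f \<cdot>[0] th a b)"
  shows "P f"
  using assms(1)
proof (induction "length (dm f)" arbitrary: f rule: less_induct)
  case less
  consider "dm f = []" | a where "dm f = [a]" | a b xs where "dm f = a # b # xs"
    by (metis list.exhaust)
  then show ?case
  proof cases
    case 1
    then show ?thesis using u_ex[of f] unit less.prems by auto
  next
    case 2
    then show ?thesis using unary less.prems by auto
  next
    case (3 a b xs)
    obtain h where h: "h \<in> Arr" "dm h = a \<odot> b # xs" "h \<cdot>[0] th a b = f"
      using th_ex[OF less.prems 3] by auto
    have "a \<in> Obj" "b \<in> Obj" using dm_Obj[OF less.prems] 3 by auto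
    moreover have "P h" using less.hyps[of h] h 3 by simp
    ultimately show ?thesis
      using pair[of h a b xs] h ok_pair[OF less.prems, of "length xs"] 3 by auto
  qed
qed

end

text \<open>A map of arity \<open>m + 1 \<ge> 2\<close> can be substituted in two steps: first a map of arity \<open>m\<close>, then a
  binary classifier.\<close>

lemma ok_split:
  assumes "ok_ar full n (Suc m)" "1 \<le> m" "1 \<le> n"
  shows "ok_ar full n m" "ok_ar full m 2" "ok_ar full (n + m - 1) 2"
  using assms by (auto simp: ok_ar_def sub_arities_def)

text \<open>Morphisms preserve the substitutions by which every map is built from unary maps and
  classifiers.\<close>

lemma multi_morphism_unique:
  assumes "lr_multi Obj Arr dm cd idn sb full ten th e u"
    and "multi_morphism Obj Arr dm cd idn sb full Obj' Arr' dm' cd' idn' sb' \<phi> E"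
    and "multi_morphism Obj Arr dm cd idn sb full Obj' Arr' dm' cd' idn' sb' \<phi>' E'"
    and "\<And>f a. f \<in> Arr \<Longrightarrow> dm f = [a] \<Longrightarrow> E f = E' f"
    and "\<And>a b. a \<in> Obj \<Longrightarrow> b \<in> Obj \<Longrightarrow> E (th a b) = E' (th a b)" and "E u = E' u"
    and "f \<in> Arr"
  shows "E f = E' f"
proof -
  interpret S: lr_multi Obj Arr dm cd idn sb full ten th e u by fact
  interpret E: multi_morphism Obj Arr dm cd idn sb full Obj' Arr' dm' cd' idn' sb' \<phi> E by fact
  interpret E': multi_morphism Obj Arr dm cd idn sb full Obj' Arr' dm' cd' idn' sb' \<phi>' E' by fact
  show ?thesis using \<open>f \<in> Arr\<close>
  proof (induction rule: S.arrow_induct)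
    case (unary f a)
    then show ?case using assms by auto
  next
    case (unit f)
    then show ?case using assms by (simp add: E.E_sb E'.E_sb)
  next
    case (pair f a b xs)
    then show ?case using assms by (simp add: E.E_sb E'.E_sb numeral_2_eq_2)
  qed
qed

text \<open>A functor \<open>H\<close> on unary maps, with prospective images \<open>t a b\<close> of the binary classifiers and
  \<open>v\<close> of the nullary one. The assumptions are instances of the preservation of substitution. The maps \<open>k\<close> in them
  are tensor products with an identity, associators and left unit constraints; they are described by
  their characteristic equations, since these are what a morphism preserves.\<close>

locale extension_data =
  S: lr_multi Obj Arr dm cd idn sb full ten th e u +
  T: bounded_multicategory Obj' Arr' dm' cd' idn' sb' full
  for Obj :: "'o set" and Arr :: "'a set" and dm cd idn
    and sb :: "'a \<Rightarrow> nat \<Rightarrow> 'a \<Rightarrow> 'a"  ("(_ \<cdot>[_] _)" [70, 0, 71] 70) and full :: bool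
    and ten :: "'o \<Rightarrow> 'o \<Rightarrow> 'o"  (infixl "\<odot>" 75) and th e u
    and Obj' :: "'p set" and Arr' :: "'b set" and dm' cd' idn'
    and sb' :: "'b \<Rightarrow> nat \<Rightarrow> 'b \<Rightarrow> 'b"  ("(_ \<star>[_] _)" [70, 0, 71] 70) +
  fixes \<phi> :: "'o \<Rightarrow> 'p" and H :: "'a \<Rightarrow> 'b" and t :: "'o \<Rightarrow> 'o \<Rightarrow> 'b" and v :: 'b
  assumes \<phi>_Obj [simp]: "a \<in> Obj \<Longrightarrow> \<phi> a \<in> Obj'"
    and H_Arr [simp]: "f \<in> Arr \<Longrightarrow> dm f = [a] \<Longrightarrow> H f \<in> Arr'"
    and dm_H [simp]: "f \<in> Arr \<Longrightarrow> dm f = [a] \<Longrightarrow> dm' (H f) = [\<phi> a]"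
    and cd_H [simp]: "f \<in> Arr \<Longrightarrow> dm f = [a] \<Longrightarrow> cd' (H f) = \<phi> (cd f)"
    and H_idn: "a \<in> Obj \<Longrightarrow> H (idn a) = idn' (\<phi> a)"
    and H_comp: "\<lbrakk>f \<in> Arr; dm f = [a]; g \<in> Arr; dm g = [cd f]\<rbrakk> \<Longrightarrow> H (g \<cdot>[0] f) = H g \<star>[0] H f"
    and t_Arr [simp]: "a \<in> Obj \<Longrightarrow> b \<in> Obj \<Longrightarrow> t a b \<in> Arr'"
    and dm_t [simp]: "a \<in> Obj \<Longrightarrow> b \<in> Obj \<Longrightarrow> dm' (t a b) = [\<phi> a, \<phi> b]"
    and cd_t [simp]: "a \<in> Obj \<Longrightarrow> b \<in> Obj \<Longrightarrow> cd' (t a b) = \<phi> (a \<odot> b)"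
    and v_Arr [simp]: "v \<in> Arr'" and dm_v [simp]: "dm' v = []" and cd_v [simp]: "cd' v = \<phi> e"
    and t_nat_left: "\<lbrakk>p \<in> Arr; dm p = [a]; c \<in> Obj; k \<in> Arr; dm k = [a \<odot> c]; cd k = cd p \<odot> c;
        k \<cdot>[0] th a c = th (cd p) c \<cdot>[0] p\<rbrakk> \<Longrightarrow> H k \<star>[0] t a c = t (cd p) c \<star>[0] H p"
    and t_nat_right: "\<lbrakk>p \<in> Arr; dm p = [c]; a \<in> Obj; k \<in> Arr; dm k = [a \<odot> c]; cd k = a \<odot> cd p;
        k \<cdot>[0] th a c = th a (cd p) \<cdot>[1] p\<rbrakk> \<Longrightarrow> H k \<star>[0] t a c = t a (cd p) \<star>[1] H p"
    and t_al: "\<lbrakk>a \<in> Obj; b \<in> Obj; c \<in> Obj; k \<in> Arr; dm k = [a \<odot> b \<odot> c]; cd k = a \<odot> (b \<odot> c);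
        k \<cdot>[0] th (a \<odot> b) c \<cdot>[0] th a b = th a (b \<odot> c) \<cdot>[1] th b c\<rbrakk>
      \<Longrightarrow> H k \<star>[0] t (a \<odot> b) c \<star>[0] t a b = t a (b \<odot> c) \<star>[1] t b c"
    and t_la: "\<lbrakk>a \<in> Obj; k \<in> Arr; dm k = [e \<odot> a]; cd k = a; k \<cdot>[0] th e a \<cdot>[0] u = idn a\<rbrakk>
      \<Longrightarrow> H k \<star>[0] t e a \<star>[0] v = idn' (\<phi> a)"
    and t_ro: "a \<in> Obj \<Longrightarrow> H (th a e \<cdot>[1] u) = t a e \<star>[1] v"
begin

text \<open>By universality \<open>f\<close> of arity at least 2 is \<open>h \<cdot>[0] th a b\<close> for a unique \<open>h\<close>. The extension removes
  these classifiers one after the other and puts \<open>t\<close> in their place.\<close>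

definition unpair :: "'a \<Rightarrow> 'a" where
  "unpair f = (SOME h. h \<in> Arr \<and> dm h = dm f ! 0 \<odot> dm f ! 1 # drop 2 (dm f) \<and> cd h = cd f \<and>
     h \<cdot>[0] th (dm f ! 0) (dm f ! 1) = f)"

definition ununit :: "'a \<Rightarrow> 'a" where
  "ununit f = (SOME h. h \<in> Arr \<and> dm h = [e] \<and> cd h = cd f \<and> h \<cdot>[0] u = f)"

primrec ext_aux :: "nat \<Rightarrow> 'a \<Rightarrow> 'b" where
  "ext_aux 0 f = H f"
| "ext_aux (Suc n) f = ext_aux n (unpair f) \<star>[0] t (dm f ! 0) (dm f ! 1)"

definition ext :: "'a \<Rightarrow> 'b" where
  "ext f = (if dm f = [] then H (ununit f) \<star>[0] v else ext_aux (length (dm f) - 1) f)"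

lemma unpair:
  assumes "f \<in> Arr" "dm f = a \<odot> b # xs" "a \<in> Obj" "b \<in> Obj" "ok_ar full (Suc (length xs)) 2"
  shows "unpair (f \<cdot>[0] th a b) = f"
proof -
  let ?P = "\<lambda>h. h \<in> Arr \<and> dm h = a \<odot> b # xs \<and> cd h = cd f \<and> h \<cdot>[0] th a b = f \<cdot>[0] th a b"
  have "?P (SOME h. ?P h)" using assms by (intro someI[of ?P f]) auto
  then have "(SOME h. ?P h) = f" using assms by (intro S.th_inj[of _ a b f xs]) auto
  then show ?thesis using assms by (simp add: unpair_def)
qed

lemma ununit:
  assumes "f \<in> Arr" "dm f = [e]"
  shows "ununit (f \<cdot>[0] u) = f"
proof -
  let ?P = "\<lambda>h. h \<in> Arr \<and> dm h = [e] \<and> cd h = cd f \<and> h \<cdot>[0] u = f \<cdot>[0] u"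
  have "?P (SOME h. ?P h)" using assms by (intro someI[of ?P f]) auto
  then have "(SOME h. ?P h) = f" using assms by (intro S.u_inj[of _ f "[]"]) auto
  then show ?thesis using assms by (simp add: ununit_def)
qed

lemma ext_unary: "dm f = [a] \<Longrightarrow> ext f = H f"
  by (simp add: ext_def)

lemma ext_unit: "f \<in> Arr \<Longrightarrow> dm f = [e] \<Longrightarrow> ext (f \<cdot>[0] u) = H f \<star>[0] v"
  by (simp add: ext_def ununit)

lemma ext_pair:
  "\<lbrakk>f \<in> Arr; dm f = a \<odot> b # xs; a \<in> Obj; b \<in> Obj; ok_ar full (Suc (length xs)) 2\<rbrakk>
    \<Longrightarrow> ext (f \<cdot>[0] th a b) = ext f \<star>[0] t a b"
  by (simp add: ext_def unpair)

lemma ext_typed: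
  assumes "f \<in> Arr"
  shows "ext f \<in> Arr' \<and> dm' (ext f) = map \<phi> (dm f) \<and> cd' (ext f) = \<phi> (cd f)"
  using assms
proof (induction rule: S.arrow_induct)
  case (pair f a b xs)
  then show ?case by (simp add: ext_pair numeral_2_eq_2)
qed (simp_all add: ext_unary ext_unit)

lemma ext_simps [simp]:
  "f \<in> Arr \<Longrightarrow> ext f \<in> Arr'" "f \<in> Arr \<Longrightarrow> dm' (ext f) = map \<phi> (dm f)"
  "f \<in> Arr \<Longrightarrow> cd' (ext f) = \<phi> (cd f)"
  using ext_typed by auto

text \<open>Naturality of the extension. By induction on \<open>f\<close>: a unary map substituted into one of the two
  inputs merged last can be moved past the classifier because \<open>t\<close> is natural; at all other inputs
  it commutes with the classifier.\<close>

lemma ext_pre: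
  assumes "f \<in> Arr" "i < length (dm f)" "p \<in> Arr" "dm p = [a']" "dm f ! i = cd p"
  shows "ext (f \<cdot>[i] p) = ext f \<star>[i] H p"
  using assms
proof (induction arbitrary: i p a' rule: S.arrow_induct)
  case (unary f a)
  then show ?case by (simp add: ext_unary[of _ a] ext_unary[of _ a'] H_comp)
next
  case (unit f)
  then show ?case by simp
next
  case (pair f a b xs)
  note [simp] = pair.hyps(1-4) pair.prems(2,3)
  note ok [simp] = pair.hyps(5)[unfolded numeral_2_eq_2] pair.hyps(5)
  have fth: "f \<cdot>[0] th a b \<in> Arr" by simp
  have ok1 [simp]: "ok_ar full (Suc (Suc (length xs))) (Suc 0)" "ok_ar full (Suc (length xs)) (Suc 0)"
    using S.ok_unary(1)[OF fth] S.ok_unary(1)[of f] by simp_all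
  consider "i = 0" | "i = 1" | j where "i = Suc (Suc j)" by (metis One_nat_def not0_implies_Suc)
  then show ?case
  proof cases
    case 1
    then have [simp]: "cd p = a" using pair.prems by simp
    have [simp]: "a' \<in> Obj" using S.dm_Obj[of p] by simp
    let ?k = "S.tn p (idn b)"
    have k: "?k \<in> Arr" "dm ?k = [a' \<odot> b]" "cd ?k = a \<odot> b" and kt: "?k \<cdot>[0] th a' b = th a b \<cdot>[0] p"
      using S.tn_th_left[of p a' b] by simp_all
    note [simp] = k
    have "f \<cdot>[0] th a b \<cdot>[0] p = f \<cdot>[0] (?k \<cdot>[0] th a' b)"
      using S.seq[of f "th a b" p 0 0] kt by simp
    also have "\<dots> = f \<cdot>[0] ?k \<cdot>[0] th a' b"
      using S.seq[of f ?k "th a' b" 0 0] by simp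
    finally have "ext (f \<cdot>[0] th a b \<cdot>[0] p) = ext f \<star>[0] H ?k \<star>[0] t a' b"
      using pair.IH[of 0 ?k "a' \<odot> b"] by (simp add: ext_pair[of _ a' b xs])
    also have "\<dots> = ext f \<star>[0] (t a b \<star>[0] H p)"
      using T.seq[of "ext f" "H ?k" "t a' b" 0 0] t_nat_left[of p a' b ?k] kt
      by (simp add: H_Arr[of ?k "a' \<odot> b"])
    also have "\<dots> = ext f \<star>[0] t a b \<star>[0] H p"
      using T.seq[of "ext f" "t a b" "H p" 0 0] by simp
    finally show ?thesis using 1 by (simp add: ext_pair[of _ a b xs])
  next
    case 2
    then have [simp]: "cd p = b" using pair.prems by simp
    have [simp]: "a' \<in> Obj" using S.dm_Obj[of p] by simp
    let ?k = "S.tn (idn a) p"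
    have k: "?k \<in> Arr" "dm ?k = [a \<odot> a']" "cd ?k = a \<odot> b" and kt: "?k \<cdot>[0] th a a' = th a b \<cdot>[1] p"
      using S.tn_th_right[of p a' a] by simp_all
    note [simp] = k
    have "f \<cdot>[0] th a b \<cdot>[1] p = f \<cdot>[0] (?k \<cdot>[0] th a a')"
      using S.seq[of f "th a b" p 0 1] kt by simp
    also have "\<dots> = f \<cdot>[0] ?k \<cdot>[0] th a a'"
      using S.seq[of f ?k "th a a'" 0 0] by simp
    finally have "ext (f \<cdot>[0] th a b \<cdot>[1] p) = ext f \<star>[0] H ?k \<star>[0] t a a'"
      using pair.IH[of 0 ?k "a \<odot> a'"] by (simp add: ext_pair[of _ a a' xs])
    also have "\<dots> = ext f \<star>[0] (t a b \<star>[1] H p)"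
      using T.seq[of "ext f" "H ?k" "t a a'" 0 0] t_nat_right[of p a' a ?k] kt
      by (simp add: H_Arr[of ?k "a \<odot> a'"])
    also have "\<dots> = ext f \<star>[0] t a b \<star>[1] H p"
      using T.seq[of "ext f" "t a b" "H p" 0 1] by simp
    finally show ?thesis using 2 by (simp add: ext_pair[of _ a b xs])
  next
    case (3 j)
    then have j [simp]: "j < length xs" "xs ! j = cd p" using pair.prems by auto
    have "f \<cdot>[0] th a b \<cdot>[i] p = f \<cdot>[Suc j] p \<cdot>[0] th a b"
      using S.par[of f "th a b" p 0 "Suc j"] 3 by simp
    then have "ext (f \<cdot>[0] th a b \<cdot>[i] p) = ext f \<star>[Suc j] H p \<star>[0] t a b"
      using pair.IH[of "Suc j" p a'] by (simp add: ext_pair[of _ a b "plug xs j [a']"])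
    also have "\<dots> = ext f \<star>[0] t a b \<star>[i] H p"
      using T.par[of "ext f" "t a b" "H p" 0 "Suc j"] 3 by simp
    finally show ?thesis by (simp add: ext_pair[of _ a b xs])
  qed
qed

text \<open>\<open>H (la a)\<close> has \<open>H (li a)\<close> as left inverse, by functoriality, and \<open>t e a \<star>[0] v\<close> as right inverse, by
  \<open>t_la\<close>.\<close>

lemma H_li:
  assumes [simp]: "a \<in> Obj"
  shows "H (S.li a) = t e a \<star>[0] v"
proof -
  have "H (S.li a) \<star>[0] H (S.la a) = idn' (\<phi> (e \<odot> a))"
    using H_comp[of "S.la a" "e \<odot> a" "S.li a"] S.li_la[of a] H_idn[of "e \<odot> a"] by simp
  then have "t e a \<star>[0] v = H (S.li a) \<star>[0] H (S.la a) \<star>[0] (t e a \<star>[0] v)"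
    by simp
  also have "\<dots> = H (S.li a) \<star>[0] (H (S.la a) \<star>[0] t e a \<star>[0] v)"
    using T.seq[of "H (S.li a)" "H (S.la a) \<star>[0] t e a" v 0 0]
      T.seq[of "H (S.li a)" "H (S.la a)" "t e a" 0 0]
      T.seq[of "H (S.li a) \<star>[0] H (S.la a)" "t e a" v 0 0]
    by (simp add: H_Arr[of "S.la a" "e \<odot> a"] H_Arr[of "S.li a" a] dm_H[of "S.la a" "e \<odot> a"]
        cd_H[of "S.la a" "e \<odot> a"] dm_H[of "S.li a" a] cd_H[of "S.li a" a])
  also have "\<dots> = H (S.li a)"
    using t_la[of a "S.la a"] S.la[of a] by (simp add: H_Arr[of "S.li a" a] dm_H[of "S.li a" a])
  finally show ?thesis ..
qed

text \<open>Writing \<open>f = h \<cdot>[0] th e a\<close>, the substitution of \<open>u\<close> is the one of the unary map \<open>li a\<close> into \<open>h\<close>.\<close>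

lemma ext_u:
  assumes "f \<in> Arr" "dm f = e # xs" "ok_ar full (Suc (length xs)) 0"
  shows "ext (f \<cdot>[0] u) = ext f \<star>[0] v"
proof (cases xs)
  case Nil
  then show ?thesis using assms by (simp add: ext_unary[of f e] ext_unit)
next
  case (Cons a ys)
  obtain h where [simp]: "h \<in> Arr" "dm h = e \<odot> a # ys" and f: "f = h \<cdot>[0] th e a"
    using S.th_ex[of f e a ys] assms Cons by auto
  have [simp]: "a \<in> Obj" using S.dm_Obj[of f] assms Cons by auto
  have ok [simp]: "ok_ar full (Suc (length ys)) 2" "ok_ar full (Suc (length ys)) (Suc (Suc 0))"
    "ok_ar full (Suc (Suc (length ys))) 0" "ok_ar full (Suc (length ys)) (Suc 0)"
    using assms(3) S.ok_pair[OF assms(1), of "length ys"] S.ok_unary(1)[of h] assms(2) Cons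
    by (auto simp: numeral_2_eq_2)
  have "f \<cdot>[0] u = h \<cdot>[0] S.li a"
    unfolding f S.li_def using S.seq[of h "th e a" u 0 0] by simp
  then have "ext (f \<cdot>[0] u) = ext h \<star>[0] (t e a \<star>[0] v)"
    using ext_pre[of h 0 "S.li a" a] by (simp add: H_li)
  also have "\<dots> = ext f \<star>[0] v"
    unfolding f using T.seq[of "ext h" "t e a" v 0 0] by (simp add: ext_pair[of _ e a ys])
  finally show ?thesis .
qed

lemma ext_th_eq: "a \<in> Obj \<Longrightarrow> b \<in> Obj \<Longrightarrow> ext (th a b) = t a b"
  using ext_pair[of "idn (a \<odot> b)" a b "[]"]
  by (simp add: ext_unary[of _ "a \<odot> b"] H_idn numeral_2_eq_2)

lemma ext_u_eq: "ext u = v"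
  using ext_unit[of "idn e"] by (simp add: H_idn)

text \<open>The first input: build \<open>g\<close> from a unary map and classifiers and substitute these one by one.\<close>

lemma ext_sb_0:
  assumes "g \<in> Arr" "f \<in> Arr" "dm f = cd g # xs" "ok_ar full (length (dm f)) (length (dm g))"
  shows "ext (f \<cdot>[0] g) = ext f \<star>[0] ext g"
  using assms
proof (induction rule: S.arrow_induct)
  case (unary g a)
  then show ?case by (simp add: ext_pre[of f 0 g a] ext_unary[of g a])
next
  case (unit g)
  then have ok [simp]: "ok_ar full (Suc (length xs)) 0" "ok_ar full (Suc (length xs)) (Suc 0)"
    using S.ok_unary(1)[of f] by simp_all
  have "ext (f \<cdot>[0] (g \<cdot>[0] u)) = ext f \<star>[0] H g \<star>[0] v"
    using unit S.seq[of f g u 0 0] ext_u[of "f \<cdot>[0] g" xs] ext_pre[of f 0 g e] by simp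
  also have "\<dots> = ext f \<star>[0] (H g \<star>[0] v)"
    using unit T.seq[of "ext f" "H g" v 0 0] by simp
  finally show ?case using unit by (simp add: ext_unit)
next
  case (pair g a b ys)
  let ?n = "Suc (length xs)" and ?m = "Suc (length ys)"
  have "ok_ar full ?n (Suc ?m)" using pair.prems pair.hyps by simp
  note ok = ok_split[OF this, simplified]
  note [simp] = ok ok(2,3)[unfolded numeral_2_eq_2] \<open>ok_ar full ?n (Suc ?m)\<close>
  have "ext (f \<cdot>[0] (g \<cdot>[0] th a b)) = ext f \<star>[0] ext g \<star>[0] t a b"
    using pair S.seq[of f g "th a b" 0 0] ext_pair[of "f \<cdot>[0] g" a b "ys @ xs"]
    by (simp add: add.commute)
  also have "\<dots> = ext f \<star>[0] (ext g \<star>[0] t a b)"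
    using pair T.seq[of "ext f" "ext g" "t a b" 0 0] by (simp add: add.commute)
  finally show ?case using pair by (simp add: ext_pair[of g a b ys])
qed

text \<open>For a classifier substituted into the second input the associator enters: with \<open>h = k \<cdot>[0] th x (c \<odot> d)\<close>
  one has to know that \<open>ext\<close> preserves \<open>th x (c \<odot> d) \<cdot>[1] th c d\<close>, and this map is
  \<open>al x c d \<cdot>[0] th (x \<odot> c) d \<cdot>[0] th x c\<close>.\<close>

lemma ext_th_1:
  assumes "h \<in> Arr" "dm h = x # c \<odot> d # xs" and ok: "ok_ar full (Suc (Suc (length xs))) 2"
    and [simp]: "c \<in> Obj" "d \<in> Obj"
  shows "ext (h \<cdot>[1] th c d) = ext h \<star>[1] t c d"
proof -
  obtain k where [simp]: "k \<in> Arr" "dm k = x \<odot> (c \<odot> d) # xs" and h: "h = k \<cdot>[0] th x (c \<odot> d)"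
    using S.th_ex[of h x "c \<odot> d" xs] assms by auto
  have [simp]: "x \<in> Obj" using S.dm_Obj[of h] assms by auto
  have ok' [simp]: "ok_ar full (Suc (length xs)) 2" "ok_ar full (Suc (length xs)) (Suc (Suc 0))"
    "ok_ar full (Suc (length xs)) (Suc (Suc (Suc 0)))" "ok_ar full (Suc (Suc (length xs))) (Suc (Suc 0))"
    using ok by (auto simp: ok_ar_def sub_arities_def)
  have al: "ext (th x (c \<odot> d) \<cdot>[1] th c d) = t x (c \<odot> d) \<star>[1] t c d"
  proof -
    have "ext (S.al x c d \<cdot>[0] th (x \<odot> c) d \<cdot>[0] th x c) = H (S.al x c d) \<star>[0] t (x \<odot> c) d \<star>[0] t x c"
      by (simp add: ext_pair[of _ x c "[d]"] ext_pair[of _ "x \<odot> c" d "[]"] numeral_2_eq_2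
          ext_unary[of _ "x \<odot> c \<odot> d"])
    then show ?thesis using t_al[of x c d "S.al x c d"] by (simp add: S.al)
  qed
  have "ext (h \<cdot>[1] th c d) = ext k \<star>[0] (t x (c \<odot> d) \<star>[1] t c d)"
    unfolding h using S.seq[of k "th x (c \<odot> d)" "th c d" 0 1]
      ext_sb_0[of "th x (c \<odot> d) \<cdot>[1] th c d" k xs] al by simp
  also have "\<dots> = ext h \<star>[1] t c d"
    unfolding h using T.seq[of "ext k" "t x (c \<odot> d)" "t c d" 0 1]
    by (simp add: ext_pair[of _ _ _ xs])
  finally show ?thesis .
qed

text \<open>Likewise the right unit constraint enters for \<open>u\<close>.\<close>

lemma ext_u_1:
  assumes "h \<in> Arr" "dm h = x # e # xs" and ok: "ok_ar full (Suc (Suc (length xs))) 0"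
  shows "ext (h \<cdot>[1] u) = ext h \<star>[1] v"
proof -
  obtain k where [simp]: "k \<in> Arr" "dm k = x \<odot> e # xs" and h: "h = k \<cdot>[0] th x e"
    using S.th_ex[of h x e xs] assms by auto
  have [simp]: "x \<in> Obj" using S.dm_Obj[of h] assms by auto
  have ok' [simp]: "ok_ar full (Suc (length xs)) 2" "ok_ar full (Suc (length xs)) (Suc (Suc 0))"
    "ok_ar full (Suc (length xs)) (Suc 0)" "ok_ar full (Suc (Suc (length xs))) 0"
    using ok by (auto simp: ok_ar_def sub_arities_def)
  have "ext (h \<cdot>[1] u) = ext k \<star>[0] (t x e \<star>[1] v)"
    unfolding h using S.seq[of k "th x e" u 0 1]
      ext_pre[of k 0 "S.ro x" x] t_ro[of x] by (simp add: S.ro_def)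
  also have "\<dots> = ext h \<star>[1] v"
    unfolding h using T.seq[of "ext k" "t x e" v 0 1]
    by (simp add: ext_pair[of _ _ _ xs])
  finally show ?thesis .
qed

lemma ext_sb_1:
  assumes "g \<in> Arr" "f \<in> Arr" "dm f = x # cd g # xs" "ok_ar full (length (dm f)) (length (dm g))"
  shows "ext (f \<cdot>[1] g) = ext f \<star>[1] ext g"
  using assms
proof (induction rule: S.arrow_induct)
  case (unary g a)
  then show ?case by (simp add: ext_pre[of f "Suc 0" g a] ext_unary[of g a])
next
  case (unit g)
  then have ok [simp]: "ok_ar full (Suc (Suc (length xs))) 0" "ok_ar full (Suc (Suc (length xs))) (Suc 0)"
    using S.ok_unary(1)[of f] by simp_all
  have "ext (f \<cdot>[1] (g \<cdot>[0] u)) = ext f \<star>[1] H g \<star>[1] v"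
    using unit S.seq[of f g u 1 0] ext_u_1[of "f \<cdot>[1] g" x xs] ext_pre[of f 1 g e] by simp
  also have "\<dots> = ext f \<star>[1] (H g \<star>[0] v)"
    using unit T.seq[of "ext f" "H g" v 1 0] by simp
  finally show ?case using unit by (simp add: ext_unit)
next
  case (pair g a b ys)
  let ?n = "Suc (Suc (length xs))" and ?m = "Suc (length ys)"
  have "ok_ar full ?n (Suc ?m)" using pair.prems pair.hyps by simp
  note ok = ok_split[OF this, simplified]
  note [simp] = ok ok(2,3)[unfolded numeral_2_eq_2] \<open>ok_ar full ?n (Suc ?m)\<close>
  have "ext (f \<cdot>[1] (g \<cdot>[0] th a b)) = ext f \<star>[1] ext g \<star>[1] t a b"
    using pair S.seq[of f g "th a b" 1 0] ext_th_1[of "f \<cdot>[1] g" x a b "ys @ xs"]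
    by (simp add: add.commute)
  also have "\<dots> = ext f \<star>[1] (ext g \<star>[0] t a b)"
    using pair T.seq[of "ext f" "ext g" "t a b" 1 0] by (simp add: add.commute)
  finally show ?case using pair by (simp add: ext_pair[of g a b ys])
qed

text \<open>At a later input \<open>i + 1\<close> write \<open>f = h \<cdot>[0] th x y\<close> and substitute into \<open>h\<close> at \<open>i\<close>.\<close>

lemma ext_sb:
  assumes "f \<in> Arr" "g \<in> Arr" "i < length (dm f)" "dm f ! i = cd g"
    "ok_ar full (length (dm f)) (length (dm g))"
  shows "ext (f \<cdot>[i] g) = ext f \<star>[i] ext g"
  using assms(1,3-)
proof (induction i arbitrary: f)
  case 0
  then show ?case using ext_sb_0[of g f "tl (dm f)"] assms(2) by (cases "dm f") auto
next
  case (Suc i)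
  then obtain x y xs where dm: "dm f = x # y # xs"
    by (cases "dm f"; cases "tl (dm f)") auto
  show ?case
  proof (cases i)
    case 0
    then show ?thesis using ext_sb_1[of g f x xs] Suc.prems assms(2) dm by simp
  next
    case (Suc j)
    have j [simp]: "j < length xs" "xs ! j = cd g" and ok: "ok_ar full (Suc (Suc (length xs))) (length (dm g))"
      using Suc.prems Suc dm by auto
    have fA: "f \<in> Arr" by fact
    note [simp] = \<open>g \<in> Arr\<close>
    have xy [simp]: "x \<in> Obj" "y \<in> Obj" using S.dm_Obj[OF fA] dm by auto
    obtain h where [simp]: "h \<in> Arr" "dm h = x \<odot> y # xs" and f: "f = h \<cdot>[0] th x y"
      using S.th_ex[of f x y xs] fA dm by auto
    have ok1 [simp]: "ok_ar full (Suc (length xs)) 2"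
      using S.ok_pair[OF fA, of "length xs"] dm by simp
    have len: "length xs \<ge> 1" using j by linarith
    have len' [simp]: "Suc (length xs + length (dm g) - Suc 0) = length xs + length (dm g)"
      using len by simp
    have ok2 [simp]: "ok_ar full (Suc (length xs)) (length (dm g))"
      "ok_ar full (length xs + length (dm g)) 2"
      using ok ok1 len by (auto simp: ok_ar_def sub_arities_def)
    \<comment> \<open>In the short case \<open>f\<close> is ternary if \<open>g\<close> is not unary, so that \<open>h\<close> is binary.\<close>
    have ok3: "full \<or> length xs = 1 \<or> length (dm g) = 1"
      using ok len by (auto simp: ok_ar_def sub_arities_def)
    note [simp] = ok1[unfolded numeral_2_eq_2] ok2(2)[unfolded numeral_2_eq_2] ok
    have "f \<cdot>[Suc i] g = h \<cdot>[i] g \<cdot>[0] th x y"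
      unfolding f using S.par[of h "th x y" g 0 i] Suc ok3 by auto
    moreover have "ext (h \<cdot>[i] g) = ext h \<star>[i] ext g"
      using Suc.IH[of h] Suc by simp
    ultimately have "ext (f \<cdot>[Suc i] g) = ext h \<star>[i] ext g \<star>[0] t x y"
      using Suc len ext_pair[of "h \<cdot>[i] g" x y "plug xs j (dm g)"] by simp
    also have "\<dots> = ext f \<star>[Suc i] ext g"
      unfolding f using T.par[of "ext h" "t x y" "ext g" 0 i] Suc ok3
      by (auto simp: ext_pair[of _ x y xs])
    finally show ?thesis .
  qed
qed

lemma ext_morphism:
  "multi_morphism Obj Arr dm cd idn sb full Obj' Arr' dm' cd' idn' sb' \<phi> ext"
  by unfold_locales (auto simp: ext_unary H_idn ext_sb)

end


section \<open>Short multicategories have bounded arity\<close>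

(* Membership in a set of lists is reasoned about as a whole, not element by element. *)
declare in_listsD [rule del] in_listsI [rule del]

text \<open>A multimap together with its domain and its codomain.\<close>

type_synonym ('o, 'm) arrow = "'o list \<times> 'o \<times> 'm"

abbreviation cod :: "'a \<times> 'b \<times> 'c \<Rightarrow> 'b" where "cod f \<equiv> fst (snd f)"

abbreviation mor :: "'a \<times> 'b \<times> 'c \<Rightarrow> 'c" where "mor f \<equiv> snd (snd f)"

definition sh_arr :: "('o, 'm, 'z) shmulti_scheme \<Rightarrow> ('o, 'm) arrow set" where
  "sh_arr C = {(as, b, f). as \<in> lists (Ob C) \<and> length as \<le> 4 \<and> b \<in> Ob C \<and> f \<in> MHom C as b}"

definition sh_idn :: "('o, 'm, 'z) shmulti_scheme \<Rightarrow> 'o \<Rightarrow> ('o, 'm) arrow" where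
  "sh_idn C a = ([a], a, Idn C a)"

definition sh_sb ::
  "('o, 'm, 'z) shmulti_scheme \<Rightarrow> ('o, 'm) arrow \<Rightarrow> nat \<Rightarrow> ('o, 'm) arrow \<Rightarrow> ('o, 'm) arrow"
where
  "sh_sb C g i f = (plug (fst g) i (fst f), cod g,
     subst C (fst g) (cod g) i (fst f) (mor g) (mor f))"

lemma plug_lists [simp]: "bs \<in> lists A \<Longrightarrow> as \<in> lists A \<Longrightarrow> plug bs i as \<in> lists A"
  using set_plug[of bs i as] by (auto simp: in_lists_conv_set)

lemma list_update_lists [simp]: "as \<in> lists A \<Longrightarrow> a \<in> A \<Longrightarrow> as[i := a] \<in> lists A"
  using set_update_subset_insert[of as i a] by (auto simp: in_lists_conv_set)

lemma nth_lists: "as \<in> lists A \<Longrightarrow> i < length as \<Longrightarrow> as ! i \<in> A"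
  by (auto simp: in_lists_conv_set)

lemma plug_update_mid:
  "i < length bs \<Longrightarrow> j < length as \<Longrightarrow> plug bs i (as[j := x]) = (plug bs i as)[j + i := x]"
  by (simp add: plug_def list_update_append min_def)

lemma plug_update_left:
  "k < i \<Longrightarrow> i < length bs \<Longrightarrow> plug (bs[k := x]) i as = (plug bs i as)[k := x]"
  by (auto simp: plug_def list_update_append take_update_swap)

lemma plug_update_right:
  "i < k \<Longrightarrow> k < length bs \<Longrightarrow> plug (bs[k := x]) i as = (plug bs i as)[k + length as - 1 := x]"
  by (auto simp: plug_def list_update_append min_def drop_update_swap Suc_diff_Suc
      intro!: arg_cong2[where f = list_update])

lemma plug_single: "i < length bs \<Longrightarrow> plug bs i [a] = bs[i := a]"
  by (simp add: plug_def upd_conv_take_nth_drop)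

text \<open>The result of the first \<open>k\<close> steps when the maps \<open>ps ! i : as' ! i \<rightarrow> as ! i\<close> are
  substituted into the inputs of \<open>f\<close> from left to right.\<close>

primrec act_upto ::
  "('o, 'm, 'z) shmulti_scheme \<Rightarrow> 'o list \<Rightarrow> 'o \<Rightarrow> 'o list \<Rightarrow> 'm list \<Rightarrow> 'm \<Rightarrow> nat \<Rightarrow> 'm"
where
  "act_upto C as b as' ps f 0 = f"
| "act_upto C as b as' ps f (Suc k)
    = pre C (take k as' @ drop k as) b k (as' ! k) (act_upto C as b as' ps f k) (ps ! k)"

context short_multicategory
begin

abbreviation ids :: "'o list \<Rightarrow> 'm list" where "ids as \<equiv> map (Idn C) as"

lemma ids_Homs [simp]: "as \<in> lists (Ob C) \<Longrightarrow> ids as \<in> Homs C as as"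
  by (auto simp: Homs_def idn_closed nth_lists)

lemma ids_update_Homs [simp]:
  "\<lbrakk>as \<in> lists (Ob C); i < length as; p \<in> Hom C a (as ! i)\<rbrakk>
    \<Longrightarrow> (ids as)[i := p] \<in> Homs C (as[i := a]) as"
  by (auto simp: Homs_def idn_closed nth_lists nth_list_update)

declare idn_closed [simp] idn_left [simp] idn_right [simp]

lemma pre_closed:
  "\<lbrakk>as \<in> lists (Ob C); length as \<le> 4; b \<in> Ob C; i < length as; a \<in> Ob C; p \<in> Hom C a (as ! i);
    f \<in> MHom C as b\<rbrakk> \<Longrightarrow> pre C as b i a f p \<in> MHom C (as[i := a]) b"
  unfolding pre_def by (rule act_closed) auto

lemma post_closed:
  "\<lbrakk>as \<in> lists (Ob C); length as \<le> 4; b \<in> Ob C; b' \<in> Ob C; q \<in> Hom C b b'; f \<in> MHom C as b\<rbrakk>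
    \<Longrightarrow> post C as b b' q f \<in> MHom C as b'"
  unfolding post_def by (rule act_closed) auto

text \<open>Any two one-variable actions compose to the action of a tuple, by functoriality.\<close>

lemma pre_pre:
  assumes "as \<in> lists (Ob C)" "length as \<le> 4" "b \<in> Ob C" "i < length as" "j < length as" "i \<noteq> j"
    "a \<in> Ob C" "p \<in> Hom C a (as ! i)" "a' \<in> Ob C" "p' \<in> Hom C a' (as ! j)" "f \<in> MHom C as b"
  shows "pre C (as[i := a]) b j a' (pre C as b i a f p) p'
    = Act C as b (as[i := a, j := a']) b ((ids as)[i := p, j := p']) (Idn C b) f"
proof -
  have "Comps C (as[i := a, j := a']) (as[i := a]) as ((ids as)[i := p]) ((ids (as[i := a]))[j := p'])
      = (ids as)[i := p, j := p']"
    using assms by (intro nth_equalityI) (auto simp: Comps_def nth_list_update nth_lists)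
  then show ?thesis
    unfolding pre_def using assms
    by (subst act_comp[of as "as[i := a]" "as[i := a, j := a']", symmetric]) auto
qed

lemma pre_pre_swap:
  assumes "as \<in> lists (Ob C)" "length as \<le> 4" "b \<in> Ob C" "i < length as" "j < length as" "i \<noteq> j"
    "a \<in> Ob C" "p \<in> Hom C a (as ! i)" "a' \<in> Ob C" "p' \<in> Hom C a' (as ! j)" "f \<in> MHom C as b"
  shows "pre C (as[i := a]) b j a' (pre C as b i a f p) p'
    = pre C (as[j := a']) b i a (pre C as b j a' f p') p"
  using assms by (simp add: pre_pre list_update_swap)

lemma pre_pre_same:
  assumes "as \<in> lists (Ob C)" "length as \<le> 4" "b \<in> Ob C" "i < length as"
    "a \<in> Ob C" "p \<in> Hom C a (as ! i)" "a' \<in> Ob C" "p' \<in> Hom C a' a" "f \<in> MHom C as b"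
  shows "pre C (as[i := a]) b i a' (pre C as b i a f p) p'
    = pre C as b i a' f (Comp C a' a (as ! i) p p')"
proof -
  have "Comps C (as[i := a']) (as[i := a]) as ((ids as)[i := p]) ((ids (as[i := a]))[i := p'])
      = (ids as)[i := Comp C a' a (as ! i) p p']"
    using assms by (intro nth_equalityI) (auto simp: Comps_def nth_list_update nth_lists)
  moreover have "(ids (as[i := a]))[i := p'] \<in> Homs C (as[i := a']) (as[i := a])"
    using ids_update_Homs[of "as[i := a]" i p' a'] assms by simp
  ultimately show ?thesis
    unfolding pre_def using assms
      act_comp[of as "as[i := a]" "as[i := a']" b b b "(ids as)[i := p]" "(ids (as[i := a]))[i := p']"
        "Idn C b" "Idn C b" f] by simp
qed

lemma post_pre:
  assumes "as \<in> lists (Ob C)" "length as \<le> 4" "b \<in> Ob C" "i < length as" "b' \<in> Ob C"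
    "a \<in> Ob C" "p \<in> Hom C a (as ! i)" "q \<in> Hom C b b'" "f \<in> MHom C as b"
  shows "post C (as[i := a]) b b' q (pre C as b i a f p)
    = Act C as b (as[i := a]) b' ((ids as)[i := p]) q f"
proof -
  have "Comps C (as[i := a]) (as[i := a]) as ((ids as)[i := p]) (ids (as[i := a])) = (ids as)[i := p]"
    using assms by (intro nth_equalityI) (auto simp: Comps_def nth_list_update nth_lists)
  moreover have "ids (as[i := a]) \<in> Homs C (as[i := a]) (as[i := a])" using assms by simp
  ultimately show ?thesis
    unfolding pre_def post_def using assms
    by (subst act_comp[of as "as[i := a]" "as[i := a]", symmetric]) auto
qed

lemma pre_post:
  assumes "as \<in> lists (Ob C)" "length as \<le> 4" "b \<in> Ob C" "i < length as" "b' \<in> Ob C"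
    "a \<in> Ob C" "p \<in> Hom C a (as ! i)" "q \<in> Hom C b b'" "f \<in> MHom C as b"
  shows "pre C as b' i a (post C as b b' q f) p
    = Act C as b (as[i := a]) b' ((ids as)[i := p]) q f"
proof -
  have "Comps C (as[i := a]) as as (ids as) ((ids as)[i := p]) = (ids as)[i := p]"
    using assms by (intro nth_equalityI) (auto simp: Comps_def nth_list_update nth_lists)
  then show ?thesis
    unfolding pre_def post_def using assms
    by (subst act_comp[of as as "as[i := a]", symmetric]) auto
qed

lemma post_post:
  assumes "as \<in> lists (Ob C)" "length as \<le> 4" "b \<in> Ob C" "b' \<in> Ob C" "b'' \<in> Ob C"
    "q \<in> Hom C b b'" "q' \<in> Hom C b' b''" "f \<in> MHom C as b"
  shows "post C as b' b'' q' (post C as b b' q f) = post C as b b'' (Comp C b b' b'' q' q) f"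
proof -
  have "Comps C as as as (ids as) (ids as) = ids as"
    using assms by (intro nth_equalityI) (auto simp: Comps_def nth_lists)
  then show ?thesis
    unfolding post_def using assms by (subst act_comp[of as as as, symmetric]) auto
qed

lemma sub_arities_le: "(n, m) \<in> sub_arities \<Longrightarrow> n \<le> 4 \<and> m \<le> 4 \<and> n + m - 1 \<le> 4"
  by (auto simp: sub_arities_def)

text \<open>Naturality of substitution, one variable at a time.\<close>

lemma pre_Sub:
  assumes "bs \<in> lists (Ob C)" "as \<in> lists (Ob C)" "c \<in> Ob C" "(length bs, length as) \<in> sub_arities"
    "i < length bs" "j < length as" "a \<in> Ob C" "p \<in> Hom C a (as ! j)"
    "g \<in> MHom C bs c" "f \<in> MHom C as (bs ! i)"
  shows "pre C (plug bs i as) c (j + i) a (Sub C bs c i as g f) p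
    = Sub C bs c i (as[j := a]) g (pre C as (bs ! i) j a f p)"
  unfolding pre_def
  using sub_natural[of bs bs as "as[j := a]" c c i "ids bs" "(ids as)[j := p]" "Idn C c" g f] assms
    sub_arities_le[OF assms(4)] act_idn[of bs c g]
  by (simp add: plug_update_mid map_plug nth_lists)

lemma post_Sub:
  assumes "bs \<in> lists (Ob C)" "as \<in> lists (Ob C)" "c \<in> Ob C" "(length bs, length as) \<in> sub_arities"
    "i < length bs" "c' \<in> Ob C" "q \<in> Hom C c c'" "g \<in> MHom C bs c" "f \<in> MHom C as (bs ! i)"
  shows "post C (plug bs i as) c c' q (Sub C bs c i as g f) = Sub C bs c' i as (post C bs c c' q g) f"
  unfolding post_def
  using sub_natural[of bs bs as as c c' i "ids bs" "ids as" q g f] assms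
    sub_arities_le[OF assms(4)] act_idn[of as "bs ! i" f]
  by (simp add: map_plug nth_lists)

lemma pre_Sub_right:
  assumes "bs \<in> lists (Ob C)" "as \<in> lists (Ob C)" "c \<in> Ob C" "(length bs, length as) \<in> sub_arities"
    "i < k" "k < length bs" "a \<in> Ob C" "p \<in> Hom C a (bs ! k)"
    "g \<in> MHom C bs c" "f \<in> MHom C as (bs ! i)"
  shows "pre C (plug bs i as) c (k + length as - 1) a (Sub C bs c i as g f) p
    = Sub C (bs[k := a]) c i as (pre C bs c k a g p) f"
  unfolding pre_def
  using sub_natural[of bs "bs[k := a]" as as c c i "(ids bs)[k := p]" "ids as" "Idn C c" g f] assms
    sub_arities_le[OF assms(4)] act_idn[of as "bs ! i" f]
  by (simp add: plug_update_right[of i k "ids bs" p "ids as"] plug_update_right map_plug nth_lists)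

lemma pre_Sub_left:
  assumes "bs \<in> lists (Ob C)" "as \<in> lists (Ob C)" "c \<in> Ob C" "(length bs, length as) \<in> sub_arities"
    "k < i" "i < length bs" "a \<in> Ob C" "p \<in> Hom C a (bs ! k)"
    "g \<in> MHom C bs c" "f \<in> MHom C as (bs ! i)"
  shows "pre C (plug bs i as) c k a (Sub C bs c i as g f) p
    = Sub C (bs[k := a]) c i as (pre C bs c k a g p) f"
  unfolding pre_def
  using sub_natural[of bs "bs[k := a]" as as c c i "(ids bs)[k := p]" "ids as" "Idn C c" g f] assms
    sub_arities_le[OF assms(4)] act_idn[of as "bs ! i" f]
  by (simp add: plug_update_left map_plug nth_lists)

lemma subst_unary: "subst C bs c i [a] g f = pre C bs c i a g f"
  by (simp add: subst_def)

lemma pre_unary: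
  "\<lbrakk>a \<in> Ob C; b \<in> Ob C; c \<in> Ob C; g \<in> Hom C b c; f \<in> Hom C a b\<rbrakk>
    \<Longrightarrow> pre C [b] c 0 a g f = Comp C a b c g f"
  by (simp add: pre_def unary_act comp_closed[of a b c])

lemma post_unary:
  "\<lbrakk>a \<in> Ob C; b \<in> Ob C; c \<in> Ob C; g \<in> Hom C b c; f \<in> Hom C a b\<rbrakk>
    \<Longrightarrow> post C [a] b c g f = Comp C a b c g f"
  by (simp add: post_def unary_act)

lemma subst_post:
  assumes "b \<in> Ob C" "c \<in> Ob C" "as \<in> lists (Ob C)" "g \<in> Hom C b c" "f \<in> MHom C as b"
  shows "subst C [b] c 0 as g f = post C as b c g f"
proof (cases "length as = 1")
  case True
  then obtain a where "as = [a]" by (metis One_nat_def length_0_conv length_Suc_conv)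
  then show ?thesis using assms by (simp add: subst_unary pre_unary post_unary unary_hom)
qed (simp add: subst_def)

lemma subst_Sub:
  "length as \<noteq> 1 \<Longrightarrow> length bs \<noteq> 1 \<Longrightarrow> subst C bs c i as g f = Sub C bs c i as g f"
  by (simp add: subst_def)

lemma ok_cases:
  assumes "ok_ar False n m"
  obtains "m = 1" "n \<le> 4" | "n = 1" "m \<noteq> 1" "m \<le> 4" | "(n, m) \<in> sub_arities" "n \<noteq> 1" "m \<noteq> 1"
  using assms unfolding ok_ar_def sub_arities_def by fastforce

text \<open>The reason why \<open>assoc_seq\<close> suffices: its arities are the only ones for which three non-unary maps
  fit together.\<close>

lemma ok_triple:
  assumes nm: "ok_ar False n m" and mor: "ok_ar False m p" and nmp: "ok_ar False (n + m - 1) p"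
  shows "p = 1 \<or> m = 1 \<or> n = 1 \<or> n = 2 \<and> m = 2 \<and> (p = 2 \<or> p = 0)"
proof (rule ccontr)
  assume c: "\<not> ?thesis"
  then have "(n, m) \<in> sub_arities" "(m, p) \<in> sub_arities" using nm mor by (auto simp: ok_ar_def)
  then show False using nmp c by (auto simp: sub_arities_def ok_ar_def)
qed

lemma length1E:
  assumes "length as = 1" obtains a where "as = [a]"
  using assms by (metis One_nat_def length_0_conv length_Suc_conv)

lemma subst_closed:
  assumes "bs \<in> lists (Ob C)" "as \<in> lists (Ob C)" "c \<in> Ob C" "ok_ar False (length bs) (length as)"
    "i < length bs" "g \<in> MHom C bs c" "f \<in> MHom C as (bs ! i)"
  shows "subst C bs c i as g f \<in> MHom C (plug bs i as) c"
  using assms(4)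
proof (cases rule: ok_cases)
  case 1
  then obtain a where "as = [a]" using length1E by blast
  then show ?thesis
    using assms 1 pre_closed[of bs c i a f g] by (simp add: subst_unary plug_single unary_hom nth_lists)
next
  case 2
  then obtain b where "bs = [b]" using length1E by blast
  then show ?thesis
    using assms 2 post_closed[of as b c g f] by (simp add: subst_post unary_hom)
next
  case 3
  then show ?thesis using assms sub_closed[of bs as c i g f] by (simp add: subst_Sub)
qed

text \<open>For non-unary maps this is an axiom. Otherwise the law is functoriality or a form of naturality: in
  the inputs of \<open>g\<close> if \<open>h\<close> is unary, dinaturality if \<open>g\<close> is, and naturality in the codomain if \<open>f\<close>
  is.\<close>

lemma subst_seq:
  assumes L: "as \<in> lists (Ob C)" "bs \<in> lists (Ob C)" "cs \<in> lists (Ob C)" "d \<in> Ob C"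
    and i: "i < length as" and j: "j < length bs"
    and m: "f \<in> MHom C as d" "g \<in> MHom C bs (as ! i)" "h \<in> MHom C cs (bs ! j)"
    and ok: "ok_ar False (length as) (length bs)" "ok_ar False (length bs) (length cs)"
      "ok_ar False (length as + length bs - 1) (length cs)"
      "ok_ar False (length as) (length bs + length cs - 1)"
  shows "subst C as d i (plug bs j cs) f (subst C bs (as ! i) j cs g h)
    = subst C (plug as i bs) d (j + i) cs (subst C as d i bs f g) h"
proof -
  have ai: "as ! i \<in> Ob C" and bj: "bs ! j \<in> Ob C" using L i j by (auto simp: nth_lists)
  have len: "length as \<le> 4" "length bs \<le> 4" "length cs \<le> 4" using ok by (auto simp: ok_ar_def)
  consider (h1) "length cs = 1" | (g1) "length cs \<noteq> 1" "length bs = 1"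
    | (f1) "length cs \<noteq> 1" "length bs \<noteq> 1" "length as = 1"
    | (ax) "length as = 2" "(length bs, length cs) \<in> {(2, 2), (2, 0)}"
    using ok_triple[OF ok(1-3)] by auto
  then show ?thesis
  proof cases
    case h1
    then obtain c where cs: "cs = [c]" using length1E by blast
    have c: "c \<in> Ob C" "h \<in> Hom C c (bs ! j)" using L m cs bj by (auto simp: unary_hom)
    show ?thesis
      using ok(1)
    proof (cases rule: ok_cases)
      case 1
      then obtain b where bs: "bs = [b]" using length1E by blast
      have b: "b \<in> Ob C" "g \<in> Hom C b (as ! i)" "h \<in> Hom C c b" "j = 0"
        using L m bs ai c j by (auto simp: unary_hom)
      show ?thesis
        using pre_pre_same[of as d i b g c h f] L i m b c len ai bs cs
        by (simp add: subst_unary pre_unary plug_single)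
    next
      case 2
      then obtain a where as: "as = [a]" using length1E by blast
      then have "i = 0" using i by simp
      have f: "f \<in> Hom C a d" using m as L by (auto simp: unary_hom)
      have "pre C bs a j c g h \<in> MHom C (bs[j := c]) a"
        using L as m c j len \<open>i = 0\<close> by (intro pre_closed) auto
      then show ?thesis
        using pre_post[of bs a j d c h f g] post_pre[of bs a j d c h f g] L as m c j len f \<open>i = 0\<close> cs
          subst_post[of a d "bs[j := c]" f "pre C bs a j c g h"]
        by (simp add: subst_unary subst_post plug_single)
    next
      case 3
      then show ?thesis
        using pre_Sub[of as bs d i j c h f g] L i j m c cs
        by (simp add: subst_unary subst_Sub plug_single)
    qed
  next
    case g1
    then obtain b where bs: "bs = [b]" using length1E by blast
    have b: "b \<in> Ob C" "g \<in> Hom C b (as ! i)" "h \<in> MHom C cs b" "j = 0"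
      using L m bs ai j by (auto simp: unary_hom)
    show ?thesis
      using ok(4)
    proof (cases rule: ok_cases)
      case 2
      then obtain a where as: "as = [a]" using length1E by blast
      have "f \<in> Hom C a d" "a \<in> Ob C" "i = 0" using m as L i by (auto simp: unary_hom)
      then show ?thesis
        using post_post[of cs b a d g f h] L m b as bs len comp_closed[of b a d g f]
          post_closed[of cs b a g h]
        by (simp add: subst_unary subst_post pre_unary plug_single)
    next
      case 3
      then show ?thesis
        using sub_dinatural[of as cs d b i g f h] L i m b bs g1
        by (simp add: subst_unary subst_Sub subst_post ai plug_single)
    qed (use g1 bs in auto)
  next
    case f1
    then obtain a where as: "as = [a]" using length1E by blast
    have f: "f \<in> Hom C a d" "a \<in> Ob C" "i = 0" using m as L i by (auto simp: unary_hom)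
    have s: "(length bs, length cs) \<in> sub_arities" using f1 ok(2) by (auto simp: ok_ar_def)
    show ?thesis
      using post_Sub[of bs cs a j d f g h] sub_closed[of bs cs a j g h] L m s f as j f1
      by (simp add: subst_Sub subst_post)
  next
    case ax
    then show ?thesis using assoc_seq[of as bs cs d i j f g h] L i j m by blast
  qed
qed

text \<open>Again an axiom for non-unary \<open>g\<close> and \<open>h\<close>, and otherwise functoriality or naturality in an input
  of \<open>f\<close> that is left in place.\<close>

lemma subst_par:
  assumes L: "as \<in> lists (Ob C)" "bs \<in> lists (Ob C)" "cs \<in> lists (Ob C)" "d \<in> Ob C"
    and i: "i < k" and k: "k < length as"
    and m: "f \<in> MHom C as d" "g \<in> MHom C bs (as ! i)" "h \<in> MHom C cs (as ! k)"
    and okp: "length as = 2 \<or> length bs = 1 \<or> length cs = 1"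
    and ok: "ok_ar False (length as) (length bs)" "ok_ar False (length as) (length cs)"
      "ok_ar False (length as + length bs - 1) (length cs)"
      "ok_ar False (length as + length cs - 1) (length bs)"
  shows "subst C (plug as i bs) d (k + length bs - 1) cs (subst C as d i bs f g) h
    = subst C (plug as k cs) d i bs (subst C as d k cs f h) g"
proof -
  have ai: "as ! i \<in> Ob C" "as ! k \<in> Ob C" "i < length as" using L i k by (auto simp: nth_lists)
  have len: "length as \<le> 4" "length bs \<le> 4" "length cs \<le> 4" using ok by (auto simp: ok_ar_def)
  consider (h1) "length bs = 1" "length cs = 1" | (f1) "length bs \<noteq> 1" "length cs = 1"
    | (g1) "length bs = 1" "length cs \<noteq> 1" | (ax) "length as = 2" "length bs \<noteq> 1" "length cs \<noteq> 1"
    using okp by auto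
  then show ?thesis
  proof cases
    case h1
    then obtain b c where bs: "bs = [b]" "cs = [c]" using length1E by metis
    have "b \<in> Ob C" "g \<in> Hom C b (as ! i)" "c \<in> Ob C" "h \<in> Hom C c (as ! k)"
      using L m bs ai by (auto simp: unary_hom)
    then show ?thesis
      using pre_pre_swap[of as d i k b g c h f] L m bs ai len i k by (simp add: subst_unary plug_single)
  next
    case f1
    then obtain c where cs: "cs = [c]" using length1E by blast
    have c: "c \<in> Ob C" "h \<in> Hom C c (as ! k)" using L m cs ai by (auto simp: unary_hom)
    have "(length as, length bs) \<in> sub_arities" using ok(1) f1 i k by (auto simp: ok_ar_def)
    then show ?thesis
      using pre_Sub_right[of as bs d i k c h f g] L m i k f1 c cs
      by (simp add: subst_unary subst_Sub plug_single)
  next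
    case g1
    then obtain b where bs: "bs = [b]" using length1E by blast
    have b: "b \<in> Ob C" "g \<in> Hom C b (as ! i)" using L m bs ai by (auto simp: unary_hom)
    have "(length as, length cs) \<in> sub_arities" using ok(2) g1 i k by (auto simp: ok_ar_def)
    then show ?thesis
      using pre_Sub_left[of as cs d i k b g f h] L m i k g1 b bs
      by (simp add: subst_unary subst_Sub plug_single)
  next
    case ax
    then obtain a a' where as: "as = [a, a']" by (auto simp: numeral_2_eq_2 length_Suc_conv)
    have ik: "i = 0" "k = 1" using i k as by auto
    have "(length bs, length cs) \<in> {(2, 2), (2, 0), (0, 2), (0, 0)}"
      using ax ok by (auto simp: ok_ar_def sub_arities_def)
    then show ?thesis
      using assoc_par[of a a' bs cs d f g h] L m as ik by simp
  qed
qed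

lemma bounded: "bounded_multicategory (Ob C) (sh_arr C) fst cod (sh_idn C) (sh_sb C) False"
proof
  fix g f :: "('o, 'm) arrow" and i
  assume "g \<in> sh_arr C" "f \<in> sh_arr C" "i < length (fst g)" "fst g ! i = cod f"
    and ok: "ok_ar False (length (fst g)) (length (fst f))"
  moreover have "length (fst g) + length (fst f) - 1 \<le> 4"
    using ok \<open>i < length (fst g)\<close> by (auto simp: ok_ar_def sub_arities_def)
  ultimately show "sh_sb C g i f \<in> sh_arr C"
    using subst_closed[of "fst g" "fst f" "cod g" i "mor g" "mor f"]
    by (auto simp: sh_arr_def sh_sb_def)
next
  fix f :: "('o, 'm) arrow"
  assume "f \<in> sh_arr C"
  then show "sh_sb C (sh_idn C (cod f)) 0 f = f"
    by (auto simp: sh_arr_def sh_sb_def sh_idn_def subst_post post_def act_idn)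
next
  fix f :: "('o, 'm) arrow" and i
  assume "f \<in> sh_arr C" "i < length (fst f)"
  moreover have "(ids as)[i := Idn C (as ! i)] = ids as" for as
    by (metis list_update_id map_update)
  ultimately show "sh_sb C f i (sh_idn C (fst f ! i)) = f"
    by (auto simp: sh_arr_def sh_sb_def sh_idn_def subst_unary pre_def act_idn)
next
  fix f g h :: "('o, 'm) arrow" and i j
  assume "f \<in> sh_arr C" "g \<in> sh_arr C" "h \<in> sh_arr C" "i < length (fst f)" "fst f ! i = cod g"
    "j < length (fst g)" "fst g ! j = cod h"
    "ok_ar False (length (fst f)) (length (fst g))" "ok_ar False (length (fst g)) (length (fst h))"
    "ok_ar False (length (fst f) + length (fst g) - 1) (length (fst h))"
    "ok_ar False (length (fst f)) (length (fst g) + length (fst h) - 1)"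
  then show "sh_sb C f i (sh_sb C g j h) = sh_sb C (sh_sb C f i g) (j + i) h"
    using subst_seq[of "fst f" "fst g" "fst h" "cod f" i j "mor f" "mor g" "mor h"]
    by (auto simp: sh_arr_def sh_sb_def plug_seq)
next
  fix f g h :: "('o, 'm) arrow" and i k
  assume "f \<in> sh_arr C" "g \<in> sh_arr C" "h \<in> sh_arr C" "i < k" "k < length (fst f)"
    "fst f ! i = cod g" "fst f ! k = cod h"
    "False \<or> length (fst f) = 2 \<or> length (fst g) = 1 \<or> length (fst h) = 1"
    "ok_ar False (length (fst f)) (length (fst g))" "ok_ar False (length (fst f)) (length (fst h))"
    "ok_ar False (length (fst f) + length (fst g) - 1) (length (fst h))"
    "ok_ar False (length (fst f) + length (fst h) - 1) (length (fst g))"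
  then show "sh_sb C (sh_sb C f i g) (k + length (fst g) - 1) h = sh_sb C (sh_sb C f k h) i g"
    using subst_par[of "fst f" "fst g" "fst h" "cod f" i k "mor f" "mor g" "mor h"]
      plug_par[of i k "fst f" "fst g" "fst h"]
    by (auto simp: sh_arr_def sh_sb_def)
qed (auto simp: sh_arr_def sh_idn_def sh_sb_def unary_hom in_lists_conv_set)

text \<open>The action of a tuple of maps changes one input at a time, hence it is determined by the
  one-variable actions.\<close>

lemma Act_eq_post_act_upto:
  assumes as: "as \<in> lists (Ob C)" "length as \<le> 4" and as': "as' \<in> lists (Ob C)"
    and b: "b \<in> Ob C" "b' \<in> Ob C" and ps: "ps \<in> Homs C as' as" and q: "q \<in> Hom C b b'"
    and f: "f \<in> MHom C as b"
  shows "Act C as b as' b' ps q f = post C as' b b' q (act_upto C as b as' ps f (length as))"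
    and "k \<le> length as \<Longrightarrow> act_upto C as b as' ps f k \<in> MHom C (take k as' @ drop k as) b"
proof -
  let ?as = "\<lambda>k. take k as' @ drop k as" and ?ps = "\<lambda>k. take k ps @ drop k (ids as)"
  have len: "length as' = length as" "length ps = length as"
    and pn: "\<And>k. k < length as \<Longrightarrow> ps ! k \<in> Hom C (as' ! k) (as ! k)"
    using ps by (auto simp: Homs_def)
  have L: "?as k \<in> lists (Ob C)" for k
    using as as' by (auto simp: in_lists_conv_set dest: in_set_takeD in_set_dropD)
  have H: "?ps k \<in> Homs C (?as k) as" if "k \<le> length as" for k
    using that len pn as by (auto simp: Homs_def nth_append nth_lists)
  have *: "act_upto C as b as' ps f k = Act C as b (?as k) b (?ps k) (Idn C b) f"
    if "k \<le> length as" for k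
    using that
  proof (induction k)
    case 0
    then show ?case using as b f by (simp add: act_idn)
  next
    case (Suc k)
    then have k: "k < length as" by simp
    let ?g = "Act C as b (?as k) b (?ps k) (Idn C b) f"
    have g: "?g \<in> MHom C (?as k) b"
      using as b f L H Suc.prems by (intro act_closed) auto
    have upd: "(?as k)[k := as' ! k] = ?as (Suc k)"
      using k len by (intro nth_equalityI) (auto simp: nth_append nth_list_update min_def)
    have nthk: "?as k ! k = as ! k" using k len by (simp add: nth_append)
    have p: "ps ! k \<in> Hom C (as' ! k) (?as k ! k)" using pn k nthk by simp
    have a'k: "as' ! k \<in> Ob C" using as' k len by (simp add: nth_lists)
    have lenk: "length (?as k) = length as" using len k by simp
    have c: "Comps C (?as (Suc k)) (?as k) as (?ps k) ((ids (?as k))[k := ps ! k]) = ?ps (Suc k)"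
      (is "?l = ?r")
    proof (rule nth_equalityI)
      fix n assume "n < length ?l"
      then have n: "n < length as" by (simp add: Comps_def)
      consider "n < k" | "n = k" | "n > k" by linarith
      then show "?l ! n = ?r ! n"
        by cases (use n k len as as' pn in \<open>auto simp: Comps_def nth_append nth_list_update nth_lists\<close>)
    qed (use k len in \<open>simp add: Comps_def\<close>)
    have idu: "(ids (?as k))[k := ps ! k] \<in> Homs C (?as (Suc k)) (?as k)"
      using ids_update_Homs[OF L[of k], of k "ps ! k" "as' ! k"] p k lenk upd by simp
    have "Act C as b (?as (Suc k)) b (?ps (Suc k)) (Idn C b) f
        = pre C (?as k) b k (as' ! k) ?g (ps ! k)"
      using act_comp[OF as L L b(1) b(1) b(1) H[of k] idu _ _ f, of "Idn C b" "Idn C b"] k b c upd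
      by (simp add: pre_def)
    then show ?case using Suc.IH k by simp
  qed
  show "act_upto C as b as' ps f k \<in> MHom C (?as k) b" if "k \<le> length as"
    unfolding *[OF that] using as b f L H[OF that] by (intro act_closed) auto
  have "Comps C as' as' as ps (ids as') = ps"
    using len pn as as' by (intro nth_equalityI) (auto simp: Comps_def nth_lists)
  then show "Act C as b as' b' ps q f = post C as' b b' q (act_upto C as b as' ps f (length as))"
    unfolding post_def
    using act_comp[OF as as' as' b(1) b(1) b(2) ps, of "ids as'" "Idn C b" q f] as' b q f len
      *[of "length as"] by simp
qed

end


section \<open>Morphisms of short multicategories\<close>

definition lift :: "('o, 'm, 'p, 'n) shmor \<Rightarrow> ('o, 'm) arrow \<Rightarrow> ('p, 'n) arrow" where
  "lift F f = (map (FOb F) (fst f), FOb F (cod f), FM F (fst f) (cod f) (mor f))"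

abbreviation sh_multi_morphism ::
  "('o, 'm) shmulti \<Rightarrow> ('p, 'n) shmulti \<Rightarrow> ('o \<Rightarrow> 'p) \<Rightarrow> (('o, 'm) arrow \<Rightarrow> ('p, 'n) arrow) \<Rightarrow> bool"
where
  "sh_multi_morphism C D \<equiv> multi_morphism (Ob C) (sh_arr C) fst cod (sh_idn C) (sh_sb C) False
     (Ob D) (sh_arr D) fst cod (sh_idn D) (sh_sb D)"

definition mor_of ::
  "('o, 'm) shmulti \<Rightarrow> ('o \<Rightarrow> 'p) \<Rightarrow> (('o, 'm) arrow \<Rightarrow> ('p, 'n) arrow) \<Rightarrow> ('o, 'm, 'p, 'n) shmor"
where
  "mor_of C \<phi> E = shmor_restrict C
     \<lparr>FOb = \<phi>, FHom = (\<lambda>a b f. mor (E ([a], b, f))), FM = (\<lambda>as b f. mor (E (as, b, f)))\<rparr>"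

lemma sh_arr_iff:
  "(as, b, f) \<in> sh_arr C \<longleftrightarrow> as \<in> lists (Ob C) \<and> length as \<le> 4 \<and> b \<in> Ob C \<and> f \<in> MHom C as b"
  by (simp add: sh_arr_def)

lemma map_lists: "as \<in> lists A \<Longrightarrow> (\<And>a. a \<in> A \<Longrightarrow> F a \<in> B) \<Longrightarrow> map F as \<in> lists B"
  by (auto simp: in_lists_conv_set)

lemma map_cong_lists: "as \<in> lists A \<Longrightarrow> (\<And>a. a \<in> A \<Longrightarrow> F a = G a) \<Longrightarrow> map F as = map G as"
  by (auto simp: in_lists_conv_set)

lemma FHoms_ids_update:
  assumes F: "is_functor C D F" and as: "as \<in> lists (Ob C)" and i: "i < length as"
  shows "FHoms F (as[i := a]) as ((map (Idn C) as)[i := p])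
    = (map (Idn D) (map (FOb F) as))[i := FHom F a (as ! i) p]"
  using assms
  by (intro nth_equalityI) (auto simp: FHoms_def nth_list_update is_functor_def nth_lists)

lemma FHoms_ids:
  assumes F: "is_functor C D F" and as: "as \<in> lists (Ob C)"
  shows "FHoms F as as (map (Idn C) as) = map (Idn D) (map (FOb F) as)"
  using assms by (intro nth_equalityI) (auto simp: FHoms_def is_functor_def nth_lists)

text \<open>Extensional morphisms of short multicategories are the same as morphisms of the associated
  structures of bounded arity; \<open>lift\<close> and \<open>mor_of\<close> translate between the two.\<close>

lemma multi_morphism_lift:
  assumes C: "short_multicategory C" and D: "short_multicategory D" and F: "sh_morphism C D F"
  shows "sh_multi_morphism C D (FOb F) (lift F)"
proof -
  interpret C: short_multicategory C by fact
  interpret D: short_multicategory D by fact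
  interpret CB: bounded_multicategory "Ob C" "sh_arr C" fst cod "sh_idn C" "sh_sb C" False
    by (rule C.bounded)
  interpret DB: bounded_multicategory "Ob D" "sh_arr D" fst cod "sh_idn D" "sh_sb D" False
    by (rule D.bounded)
  have Ff: "is_functor C D F" using F by (simp add: sh_morphism_def)
  have FO: "FOb F a \<in> Ob D" if "a \<in> Ob C" for a using Ff that by (simp add: is_functor_def)
  have Fi: "FHom F a a (Idn C a) = Idn D (FOb F a)" if "a \<in> Ob C" for a
    using Ff that by (simp add: is_functor_def)
  have F1: "FM F [a] b f = FHom F a b f" if "a \<in> Ob C" "b \<in> Ob C" "f \<in> Hom C a b" for a b f
    using F that by (simp add: sh_morphism_def)
  have FMc: "FM F as b f \<in> MHom D (map (FOb F) as) (FOb F b)"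
    if "as \<in> lists (Ob C)" "length as \<le> 4" "b \<in> Ob C" "f \<in> MHom C as b" for as b f
    using F that by (simp add: sh_morphism_def)
  have FHc: "FHom F a b f \<in> Hom D (FOb F a) (FOb F b)"
    if "a \<in> Ob C" "b \<in> Ob C" "f \<in> Hom C a b" for a b f
    using Ff that by (simp add: is_functor_def)
  have Fact: "FM F as' b' (Act C as b as' b' ps q f)
          = Act D (map (FOb F) as) (FOb F b) (map (FOb F) as') (FOb F b')
              (FHoms F as' as ps) (FHom F b b' q) (FM F as b f)"
    if "as \<in> lists (Ob C)" "length as \<le> 4" "as' \<in> lists (Ob C)" "b \<in> Ob C" "b' \<in> Ob C"
      "ps \<in> Homs C as' as" "q \<in> Hom C b b'" "f \<in> MHom C as b" for as b as' b' ps q f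
    using F that unfolding sh_morphism_def by blast
  have Fpre: "FM F (as[i := a]) b (pre C as b i a f p)
      = pre D (map (FOb F) as) (FOb F b) i (FOb F a) (FM F as b f) (FHom F a (as ! i) p)"
    if "as \<in> lists (Ob C)" "length as \<le> 4" "i < length as" "a \<in> Ob C" "b \<in> Ob C"
      "p \<in> Hom C a (as ! i)" "f \<in> MHom C as b" for as i a b p f
    using Fact[of as "as[i := a]" b b "(map (Idn C) as)[i := p]" "Idn C b" f] that
      FHoms_ids_update[OF Ff, of as i a p] by (simp add: pre_def map_update Fi)
  have Fpost: "FM F as b' (post C as b b' q f)
      = post D (map (FOb F) as) (FOb F b) (FOb F b') (FHom F b b' q) (FM F as b f)"
    if "as \<in> lists (Ob C)" "length as \<le> 4" "b \<in> Ob C" "b' \<in> Ob C"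
      "q \<in> Hom C b b'" "f \<in> MHom C as b" for as b b' q f
    using Fact[of as as b b' "map (Idn C) as" q f] that
      FHoms_ids[OF Ff, of as] by (simp add: post_def)
  have Fsub: "FM F (plug bs i as) c (Sub C bs c i as g f)
          = Sub D (map (FOb F) bs) (FOb F c) i (map (FOb F) as) (FM F bs c g) (FM F as (bs ! i) f)"
    if "bs \<in> lists (Ob C)" "as \<in> lists (Ob C)" "c \<in> Ob C" "i < length bs" "g \<in> MHom C bs c"
      "f \<in> MHom C as (bs ! i)" "(length bs, length as) \<in> sub_arities" for bs as c i g f
    using F that unfolding sh_morphism_def by blast
  have sub: "FM F (plug bs i as) c (subst C bs c i as g f)
          = subst D (map (FOb F) bs) (FOb F c) i (map (FOb F) as) (FM F bs c g) (FM F as (bs ! i) f)"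
    if "bs \<in> lists (Ob C)" "as \<in> lists (Ob C)" "c \<in> Ob C" "i < length bs" "g \<in> MHom C bs c"
      "f \<in> MHom C as (bs ! i)" and ok: "ok_ar False (length bs) (length as)" for bs as c i g f
    using ok
  proof (cases rule: C.ok_cases)
    case 1
    then obtain a where as: "as = [a]" using C.length1E by blast
    then have "a \<in> Ob C" "f \<in> Hom C a (bs ! i)" "bs ! i \<in> Ob C"
      using that by (auto simp: C.unary_hom nth_lists)
    then show ?thesis
      using 1 that as Fpre[of bs i a c f g]
      by (simp add: C.subst_unary D.subst_unary plug_single F1)
  next
    case 2
    then obtain b where bs: "bs = [b]" using C.length1E by blast
    then have b: "b \<in> Ob C" "g \<in> Hom C b c" "i = 0" using that by (auto simp: C.unary_hom)
    then show ?thesis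
      using 2 that bs Fpost[of as b c g f] F1[of b c g] FHc[of b c g] FMc[of as b f]
      by (simp add: C.subst_post D.subst_post FO map_lists)
  next
    case 3
    then show ?thesis using that Fsub[of bs as c i g f] by (simp add: C.subst_Sub D.subst_Sub)
  qed
  show ?thesis
  proof (unfold_locales; (elim FO)?)
    fix f assume "f \<in> sh_arr C"
    then show "lift F f \<in> sh_arr D"
      by (auto simp: sh_arr_def lift_def FO FMc map_lists)
  next
    fix a assume "a \<in> Ob C"
    then show "lift F (sh_idn C a) = sh_idn D (FOb F a)" by (simp add: lift_def sh_idn_def F1 Fi)
  next
    fix g f :: "('a, 'b) arrow" and i
    assume "g \<in> sh_arr C" "f \<in> sh_arr C" "i < length (fst g)" "fst g ! i = cod f"
      "ok_ar False (length (fst g)) (length (fst f))"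
    then show "lift F (sh_sb C g i f) = sh_sb D (lift F g) i (lift F f)"
      using sub[of "fst g" "fst f" "cod g" i "mor g" "mor f"]
      by (auto simp: lift_def sh_sb_def sh_arr_def map_plug)
  qed (auto simp: lift_def)
qed

text \<open>The axioms of a morphism mention the action of tuples, a \<open>multi_morphism\<close> only the substitution of
  single unary maps; the former is reduced to the latter one input at a time.\<close>

lemma mor_of:
  assumes C: "short_multicategory C" and D: "short_multicategory D" and E: "sh_multi_morphism C D \<phi> E"
  shows "sh_morphism C D (mor_of C \<phi> E)" "shmor_ext C (mor_of C \<phi> E)"
    "f \<in> sh_arr C \<Longrightarrow> lift (mor_of C \<phi> E) f = E f"
proof -
  interpret C: short_multicategory C by fact
  interpret D: short_multicategory D by fact
  interpret E: multi_morphism "Ob C" "sh_arr C" fst cod "sh_idn C" "sh_sb C" False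
    "Ob D" "sh_arr D" fst cod "sh_idn D" "sh_sb D" \<phi> E by fact
  let ?F = "mor_of C \<phi> E"
  show ext: "shmor_ext C ?F"
    by (simp add: shmor_ext_def functr_ext_def mor_of_def shmor_restrict_def)
  have FO [simp]: "FOb ?F a = \<phi> a" if "a \<in> Ob C" for a
    using that by (simp add: mor_of_def shmor_restrict_def)
  have FOD [simp]: "\<phi> a \<in> Ob D" if "a \<in> Ob C" for a using that by (rule E.\<phi>_Obj)
  have mFO: "map (FOb ?F) as = map \<phi> as" if "as \<in> lists (Ob C)" for as
    using that by (intro map_cong_lists) auto
  have FM: "FM ?F as b f = mor (E (as, b, f))" if "(as, b, f) \<in> sh_arr C" for as b f
    using that by (simp add: mor_of_def shmor_restrict_def sh_arr_iff)
  have Eq: "E (as, b, f) = (map \<phi> as, \<phi> b, FM ?F as b f)" if "(as, b, f) \<in> sh_arr C" for as b f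
    using E.dm_E[OF that] E.cd_E[OF that] FM[OF that] by (simp add: prod_eq_iff)
  show lift: "lift ?F f = E f" if "f \<in> sh_arr C" for f
    using that Eq[of "fst f" "cod f" "mor f"] mFO[of "fst f"]
    by (auto simp: lift_def sh_arr_def)
  have FMc: "FM ?F as b f \<in> MHom D (map \<phi> as) (\<phi> b)" if "(as, b, f) \<in> sh_arr C" for as b f
    using E.E_Arr[OF that] Eq[OF that] by (simp add: sh_arr_iff)
  have FH: "FM ?F [a] b f = FHom ?F a b f" if "a \<in> Ob C" "b \<in> Ob C" "f \<in> Hom C a b" for a b f
    using that by (simp add: mor_of_def shmor_restrict_def C.unary_hom)
  have FHc: "FHom ?F a b f \<in> Hom D (\<phi> a) (\<phi> b)" if "a \<in> Ob C" "b \<in> Ob C" "f \<in> Hom C a b" for a b f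
    using FMc[of "[a]" b f] FH[of a b f] that by (simp add: sh_arr_iff C.unary_hom D.unary_hom)
  have sub: "FM ?F (plug bs i as) c (subst C bs c i as g f)
      = subst D (map \<phi> bs) (\<phi> c) i (map \<phi> as) (FM ?F bs c g) (FM ?F as (bs ! i) f)"
    if g: "(bs, c, g) \<in> sh_arr C" and f: "(as, bs ! i, f) \<in> sh_arr C" and i: "i < length bs"
      and ok: "ok_ar False (length bs) (length as)" for bs as c i g f
  proof -
    have "sh_sb C (bs, c, g) i (as, bs ! i, f) \<in> sh_arr C"
      using E.S.sb_Arr[OF g f] i ok by simp
    then show ?thesis
      using E.E_sb[OF g f, of i] i ok by (simp add: sh_sb_def Eq[OF g] Eq[OF f] Eq)
  qed
  have Fi: "FM ?F [a] a (Idn C a) = Idn D (\<phi> a)" if "a \<in> Ob C" for a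
    using E.E_idn[OF that] Eq[of "[a]" a "Idn C a"] that
    by (simp add: sh_arr_iff sh_idn_def C.unary_hom)
  have fn: "is_functor C D ?F"
    unfolding is_functor_def
  proof (intro conjI ballI)
    fix a b c f g assume *: "a \<in> Ob C" "b \<in> Ob C" "c \<in> Ob C" "f \<in> Hom C a b" "g \<in> Hom C b c"
    then show "FHom ?F a c (Comp C a b c g f)
      = Comp D (FOb ?F a) (FOb ?F b) (FOb ?F c) (FHom ?F b c g) (FHom ?F a b f)"
      using sub[of "[b]" c g "[a]" 0 f] FH[of a c "Comp C a b c g f"] C.comp_closed[of a b c f g]
      by (simp add: sh_arr_iff C.unary_hom C.subst_unary D.subst_unary C.pre_unary D.pre_unary FH FHc)
  qed (use Fi FH FHc in auto)
  have pre: "FM ?F (as[i := a]) b (pre C as b i a f p)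
      = pre D (map \<phi> as) (\<phi> b) i (\<phi> a) (FM ?F as b f) (FHom ?F a (as ! i) p)"
    if f: "(as, b, f) \<in> sh_arr C" and i: "i < length as" and a: "a \<in> Ob C" and p: "p \<in> Hom C a (as ! i)"
    for as b f i a p
    using sub[OF f, of "[a]" i p] FH[of a "as ! i" p] i p a f
    by (auto simp: sh_arr_iff ok_ar_def C.unary_hom nth_lists C.subst_unary D.subst_unary plug_single)
  have post: "FM ?F as b' (post C as b b' q f)
      = post D (map \<phi> as) (\<phi> b) (\<phi> b') (FHom ?F b b' q) (FM ?F as b f)"
    if f: "(as, b, f) \<in> sh_arr C" and q: "b' \<in> Ob C" "q \<in> Hom C b b'" for as b f b' q
    using sub[of "[b]" b' q as 0 f] FH[of b b' q] q f FHc[of b b' q] FMc[OF f]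
    by (auto simp: sh_arr_iff ok_ar_def C.unary_hom C.subst_post D.subst_post map_lists)
  show "sh_morphism C D ?F"
    unfolding sh_morphism_def
  proof (intro conjI ballI impI allI)
    show "is_functor C D ?F" by (rule fn)
  next
    fix as b f assume "as \<in> lists (Ob C)" "b \<in> Ob C" "f \<in> MHom C as b" "length as \<le> 4"
    then show "FM ?F as b f \<in> MHom D (map (FOb ?F) as) (FOb ?F b)"
      using FMc[of as b f] by (simp add: sh_arr_iff mFO)
  next
    fix as as' b b' ps q f
    assume as: "as \<in> lists (Ob C)" and as': "as' \<in> lists (Ob C)" and b: "b \<in> Ob C" "b' \<in> Ob C"
      and ps: "ps \<in> Homs C as' as" and q: "q \<in> Hom C b b'" and f: "f \<in> MHom C as b" and l: "length as \<le> 4"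
    have len: "length as' = length as" "length ps = length as"
      and pn: "\<And>k. k < length as \<Longrightarrow> ps ! k \<in> Hom C (as' ! k) (as ! k)"
      using ps by (auto simp: Homs_def)
    let ?ps = "FHoms ?F as' as ps"
    have ps': "?ps \<in> Homs D (map \<phi> as') (map \<phi> as)"
      using len pn as as' by (auto simp: Homs_def FHoms_def FHc nth_lists)
    have c: "(take k as' @ drop k as, b, act_upto C as b as' ps f k) \<in> sh_arr C" if "k \<le> length as" for k
      using C.Act_eq_post_act_upto(2)[OF as l as' b(1) b(1) ps _ f, of "Idn C b"] that as as' b l len
      by (auto simp: sh_arr_iff in_lists_conv_set dest: in_set_takeD in_set_dropD)
    have *: "FM ?F (take k as' @ drop k as) b (act_upto C as b as' ps f k)
        = act_upto D (map \<phi> as) (\<phi> b) (map \<phi> as') ?ps (FM ?F as b f) k" if "k \<le> length as" for k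
      using that
    proof (induction k)
      case (Suc k)
      then have k: "k < length as" "k < length as'" using len by auto
      have upd: "(take k as' @ drop k as)[k := as' ! k] = take (Suc k) as' @ drop (Suc k) as"
        using k len by (intro nth_equalityI) (auto simp: nth_append nth_list_update min_def)
      have nthk: "(take k as' @ drop k as) ! k = as ! k" using k by (simp add: nth_append)
      show ?case
        using pre[OF c, of k k "as' ! k" "ps ! k"] k Suc upd pn[of k] as'
        by (simp add: nthk nth_lists take_map drop_map FHoms_def)
    qed simp
    have "Act D (map \<phi> as) (\<phi> b) (map \<phi> as') (\<phi> b') ?ps (FHom ?F b b' q) (FM ?F as b f)
        = post D (map \<phi> as') (\<phi> b) (\<phi> b') (FHom ?F b b' q)
          (act_upto D (map \<phi> as) (\<phi> b) (map \<phi> as') ?ps (FM ?F as b f) (length as))"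
      using D.Act_eq_post_act_upto(1)[OF _ _ _ _ _ ps', of "\<phi> b" "\<phi> b'" "FHom ?F b b' q" "FM ?F as b f"]
        as as' b l q f FHc[of b b' q] FMc[of as b f] by (simp add: map_lists sh_arr_iff)
    also have "\<dots> = FM ?F as' b' (post C as' b b' q (act_upto C as b as' ps f (length as)))"
      using *[of "length as"] c[of "length as"] post[of as' b _ b' q] len b q by simp
    also have "\<dots> = FM ?F as' b' (Act C as b as' b' ps q f)"
      using C.Act_eq_post_act_upto(1)[OF as l as' b ps q f] by simp
    finally show "FM ?F as' b' (Act C as b as' b' ps q f)
      = Act D (map (FOb ?F) as) (FOb ?F b) (map (FOb ?F) as') (FOb ?F b')
          (FHoms ?F as' as ps) (FHom ?F b b' q) (FM ?F as b f)"
      using as as' b by (simp add: mFO)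
  next
    fix a b f assume "a \<in> Ob C" "b \<in> Ob C" "f \<in> Hom C a b"
    then show "FM ?F [a] b f = FHom ?F a b f" by (rule FH)
  next
    fix bs as c i g f
    assume "bs \<in> lists (Ob C)" "as \<in> lists (Ob C)" "c \<in> Ob C" and i: "i < length bs"
      and "g \<in> MHom C bs c" "f \<in> MHom C as (bs ! i)" and s: "(length bs, length as) \<in> sub_arities"
    moreover have "length bs \<noteq> 1" "length as \<noteq> 1" "ok_ar False (length bs) (length as)"
      using s by (auto simp: sub_arities_def ok_ar_def)
    moreover have "length bs \<le> 4" "length as \<le> 4" using C.sub_arities_le[OF s] by auto
    ultimately show "FM ?F (plug bs i as) c (Sub C bs c i as g f)
          = Sub D (map (FOb ?F) bs) (FOb ?F c) i (map (FOb ?F) as)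
              (FM ?F bs c g) (FM ?F as (bs ! i) f)"
      using sub[of bs c g as i f] by (simp add: sh_arr_iff nth_lists C.subst_Sub D.subst_Sub mFO)
  qed
qed

lemma shmor_eqI:
  assumes C: "short_multicategory C" and F: "sh_morphism C D F" "shmor_ext C F"
    and G: "sh_morphism C D' G" "shmor_ext C G"
    and O: "\<And>a. a \<in> Ob C \<Longrightarrow> FOb F a = FOb G a" and L: "\<And>f. f \<in> sh_arr C \<Longrightarrow> lift F f = lift G f"
  shows "F = (G :: ('o, 'm, 'p, 'n) shmor)"
proof -
  interpret C: short_multicategory C by fact
  have "FOb F = FOb G"
    using O F(2) G(2) by (intro ext) (metis shmor_ext_def functr_ext_def)
  moreover have FM: "FM F as b f = FM G as b f" for as b f
  proof (cases "(as, b, f) \<in> sh_arr C")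
    case True
    then show ?thesis using L[OF True] by (simp add: lift_def)
  next
    case False
    then show ?thesis using F(2) G(2) by (simp add: shmor_ext_def sh_arr_iff)
  qed
  moreover have "FHom F a b f = FHom G a b f" for a b f
  proof (cases "a \<in> Ob C \<and> b \<in> Ob C \<and> f \<in> Hom C a b")
    case True
    then show ?thesis using F(1) G(1) FM[of "[a]" b f] by (simp add: sh_morphism_def)
  next
    case False
    then show ?thesis using F(2) G(2) by (simp add: shmor_ext_def functr_ext_def)
  qed
  ultimately show ?thesis by (intro shmor.equality HOL.ext) auto
qed

lemma multi_morphism_id:
  "bounded_multicategory Obj Arr dm cd idn sb full
    \<Longrightarrow> multi_morphism Obj Arr dm cd idn sb full Obj Arr dm cd idn sb (\<lambda>a. a) (\<lambda>f. f)"
  by (simp add: multi_morphism_def multi_morphism_axioms_def)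

lemma multi_morphism_comp:
  assumes "multi_morphism Obj Arr dm cd idn sb full Obj' Arr' dm' cd' idn' sb' \<phi> E"
    and "multi_morphism Obj' Arr' dm' cd' idn' sb' full Obj'' Arr'' dm'' cd'' idn'' sb'' \<psi> E'"
  shows "multi_morphism Obj Arr dm cd idn sb full Obj'' Arr'' dm'' cd'' idn'' sb''
    (\<lambda>a. \<psi> (\<phi> a)) (\<lambda>f. E' (E f))"
proof -
  interpret E: multi_morphism Obj Arr dm cd idn sb full Obj' Arr' dm' cd' idn' sb' \<phi> E by fact
  interpret E': multi_morphism Obj' Arr' dm' cd' idn' sb' full Obj'' Arr'' dm'' cd'' idn'' sb'' \<psi> E'
    by fact
  show ?thesis
    by unfold_locales
      (auto simp: E.\<phi>_Obj E'.\<phi>_Obj E.E_Arr E'.E_Arr E.dm_E E'.dm_E E.cd_E E'.cd_E E.E_idn E'.E_idn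
        E.E_sb E'.E_sb)
qed

lemma ShMulti_sel:
  "C \<in> Ob ShMulti_lr \<longleftrightarrow> short_multicategory C \<and> sh_left_representable C"
  "F \<in> Hom ShMulti_lr C D \<longleftrightarrow> sh_morphism C D F \<and> shmor_ext C F"
  "Idn ShMulti_lr C = mor_of C (\<lambda>a. a) (\<lambda>f. f)"
  by (simp_all add: ShMulti_lr_def mor_of_def)

lemma ShMulti_Comp:
  assumes F: "sh_morphism C D F" and G: "sh_morphism D D' G"
  shows "Comp ShMulti_lr C D D' G F = mor_of C (\<lambda>a. FOb G (FOb F a)) (\<lambda>f. lift G (lift F f))"
proof -
  have "FHom G (FOb F a) (FOb F b) (FHom F a b f) = FM G [FOb F a] (FOb F b) (FM F [a] b f)"
    if "a \<in> Ob C" "b \<in> Ob C" "f \<in> Hom C a b" for a b f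
    using F G that by (auto simp: sh_morphism_def is_functor_def)
  then show ?thesis
    by (auto simp: ShMulti_lr_def mor_of_def shmor_restrict_def lift_def fun_eq_iff)
qed

lemma ShMulti_comp_lift:
  assumes C: "short_multicategory C" "short_multicategory D" "short_multicategory D'"
    and F: "sh_morphism C D F" and G: "sh_morphism D D' G"
  shows "sh_morphism C D' (Comp ShMulti_lr C D D' G F)" "shmor_ext C (Comp ShMulti_lr C D D' G F)"
    "a \<in> Ob C \<Longrightarrow> FOb (Comp ShMulti_lr C D D' G F) a = FOb G (FOb F a)"
    "f \<in> sh_arr C \<Longrightarrow> lift (Comp ShMulti_lr C D D' G F) f = lift G (lift F f)"
proof -
  have eq: "Comp ShMulti_lr C D D' G F = mor_of C (\<lambda>a. FOb G (FOb F a)) (\<lambda>f. lift G (lift F f))"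
    by (rule ShMulti_Comp[OF F G])
  have m: "sh_multi_morphism C D' (\<lambda>a. FOb G (FOb F a)) (\<lambda>f. lift G (lift F f))"
    using multi_morphism_comp[OF multi_morphism_lift[OF C(1,2) F] multi_morphism_lift[OF C(2,3) G]] .
  show "sh_morphism C D' (Comp ShMulti_lr C D D' G F)" "shmor_ext C (Comp ShMulti_lr C D D' G F)"
    "f \<in> sh_arr C \<Longrightarrow> lift (Comp ShMulti_lr C D D' G F) f = lift G (lift F f)"
    unfolding eq using mor_of[OF C(1,3) m] by auto
  show "FOb (Comp ShMulti_lr C D D' G F) a = FOb G (FOb F a)" if "a \<in> Ob C"
    unfolding eq using that by (simp add: mor_of_def shmor_restrict_def)
qed

lemma ShMulti_id_lift:
  assumes C: "short_multicategory C"
  shows "sh_morphism C C (Idn ShMulti_lr C)" "shmor_ext C (Idn ShMulti_lr C)"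
    "a \<in> Ob C \<Longrightarrow> FOb (Idn ShMulti_lr C) a = a" "f \<in> sh_arr C \<Longrightarrow> lift (Idn ShMulti_lr C) f = f"
  unfolding ShMulti_sel
  using mor_of[OF C C multi_morphism_id[OF short_multicategory.bounded[OF C]]]
  by (auto simp: mor_of_def shmor_restrict_def)

lemma category_ShMulti_lr: "category (ShMulti_lr :: (('o, 'm) shmulti, ('o, 'm, 'o, 'm) shmor) cat)"
proof
  fix C :: "('o, 'm) shmulti"
  assume "C \<in> Ob ShMulti_lr"
  then show "Idn ShMulti_lr C \<in> Hom ShMulti_lr C C"
    using ShMulti_id_lift[of C] by (simp only: ShMulti_sel)
next
  fix C D D' :: "('o, 'm) shmulti" and F G
  assume "C \<in> Ob ShMulti_lr" "D \<in> Ob ShMulti_lr" "D' \<in> Ob ShMulti_lr"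
    "F \<in> Hom ShMulti_lr C D" "G \<in> Hom ShMulti_lr D D'"
  then show "Comp ShMulti_lr C D D' G F \<in> Hom ShMulti_lr C D'"
    using ShMulti_comp_lift[of C D D' F G] by (simp add: ShMulti_sel)
next
  fix C D :: "('o, 'm) shmulti" and F
  assume "C \<in> Ob ShMulti_lr" "D \<in> Ob ShMulti_lr" "F \<in> Hom ShMulti_lr C D"
  then have *: "short_multicategory C" "short_multicategory D" "sh_morphism C D F" "shmor_ext C F"
    by (auto simp: ShMulti_sel)
  then interpret F: multi_morphism "Ob C" "sh_arr C" fst cod "sh_idn C" "sh_sb C" False
    "Ob D" "sh_arr D" fst cod "sh_idn D" "sh_sb D" "FOb F" "lift F"
    by (intro multi_morphism_lift)
  show "Comp ShMulti_lr C D D (Idn ShMulti_lr D) F = F"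
    using * ShMulti_comp_lift[OF *(1,2,2,3) ShMulti_id_lift(1)[OF *(2)]] ShMulti_id_lift[OF *(2)]
    by (intro shmor_eqI[of C D _ D]) (auto simp: F.E_Arr F.\<phi>_Obj)
  show "Comp ShMulti_lr C C D F (Idn ShMulti_lr C) = F"
    using * ShMulti_comp_lift[OF *(1,1,2) ShMulti_id_lift(1)[OF *(1)] *(3)] ShMulti_id_lift[OF *(1)]
    by (intro shmor_eqI[of C D _ D]) auto
next
  fix C D D' D'' :: "('o, 'm) shmulti" and F G K
  assume "C \<in> Ob ShMulti_lr" "D \<in> Ob ShMulti_lr" "D' \<in> Ob ShMulti_lr" "D'' \<in> Ob ShMulti_lr"
    "F \<in> Hom ShMulti_lr C D" "G \<in> Hom ShMulti_lr D D'" "K \<in> Hom ShMulti_lr D' D''"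
  then have *: "short_multicategory C" "short_multicategory D" "short_multicategory D'"
    "short_multicategory D''" "sh_morphism C D F" "sh_morphism D D' G" "sh_morphism D' D'' K"
    by (auto simp: ShMulti_sel)
  interpret F: multi_morphism "Ob C" "sh_arr C" fst cod "sh_idn C" "sh_sb C" False
    "Ob D" "sh_arr D" fst cod "sh_idn D" "sh_sb D" "FOb F" "lift F"
    using * by (intro multi_morphism_lift)
  note GF = ShMulti_comp_lift[OF *(1,2,3,5,6)] and KG = ShMulti_comp_lift[OF *(2,3,4,6,7)]
  note KGF = ShMulti_comp_lift[OF *(1,3,4) GF(1) *(7)] and KGF' = ShMulti_comp_lift[OF *(1,2,4,5) KG(1)]
  show "Comp ShMulti_lr C D' D'' K (Comp ShMulti_lr C D D' G F)
      = Comp ShMulti_lr C D D'' (Comp ShMulti_lr D D' D'' K G) F"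
    using GF KG KGF KGF' * by (intro shmor_eqI[of C D'' _ D'']) (auto simp: F.E_Arr F.\<phi>_Obj)
qed

lemma lr_multi_short:
  assumes C: "short_multicategory C" and r: "left_universal C r"
  shows "lr_multi (Ob C) (sh_arr C) fst cod (sh_idn C) (sh_sb C) False
    (tobj r) (\<lambda>a b. ([a, b], tobj r a b, theta r a b)) (uobj r) ([], uobj r, umap r)"
proof -
  interpret C: short_multicategory C by fact
  interpret CB: bounded_multicategory "Ob C" "sh_arr C" fst cod "sh_idn C" "sh_sb C" False
    by (rule C.bounded)
  have t: "tobj r a b \<in> Ob C" "theta r a b \<in> MHom C [a, b] (tobj r a b)"
    if "a \<in> Ob C" "b \<in> Ob C" for a b
    using r that by (auto simp: left_universal_def)
  have u: "uobj r \<in> Ob C" "umap r \<in> MHom C [] (uobj r)"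
    using r by (auto simp: left_universal_def)
  have bt: "bij_betw (\<lambda>f. subst C (tobj r a b # xs) d 0 [a, b] f (theta r a b))
          (MHom C (tobj r a b # xs) d) (MHom C (a # b # xs) d)"
    if "a \<in> Ob C" "b \<in> Ob C" "xs \<in> lists (Ob C)" "d \<in> Ob C" "length xs \<le> 2" for a b xs d
    using r that unfolding left_universal_def by blast
  have bu: "bij_betw (\<lambda>f. subst C (uobj r # xs) d 0 [] f (umap r))
          (MHom C (uobj r # xs) d) (MHom C xs d)"
    if "xs \<in> lists (Ob C)" "d \<in> Ob C" "length xs \<le> 2" for xs d
    using r that unfolding left_universal_def by blast
  show ?thesis
  proof
    fix f :: "('a, 'b) arrow" and a b xs assume "f \<in> sh_arr C" "fst f = a # b # xs"
    then obtain d m where f: "f = (a # b # xs, d, m)" "a \<in> Ob C" "b \<in> Ob C" "xs \<in> lists (Ob C)"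
        "d \<in> Ob C" "length xs \<le> 2" "m \<in> MHom C (a # b # xs) d"
      by (cases f) (auto simp: sh_arr_iff)
    then have "m \<in> (\<lambda>f. subst C (tobj r a b # xs) d 0 [a, b] f (theta r a b)) `
        MHom C (tobj r a b # xs) d"
      using bt[of a b xs d] by (simp add: bij_betw_def)
    then obtain h where "h \<in> MHom C (tobj r a b # xs) d"
        "m = subst C (tobj r a b # xs) d 0 [a, b] h (theta r a b)" by (rule imageE)
    then show "\<exists>h\<in>sh_arr C. fst h = tobj r a b # xs \<and> cod h = cod f \<and>
        sh_sb C h 0 ([a, b], tobj r a b, theta r a b) = f"
      using f t by (intro bexI[of _ "(tobj r a b # xs, d, h)"]) (auto simp: sh_sb_def sh_arr_iff)
  next
    fix h h' :: "('a, 'b) arrow" and a b xs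
    assume "sh_sb C h 0 ([a, b], tobj r a b, theta r a b) = sh_sb C h' 0 ([a, b], tobj r a b, theta r a b)"
      "a \<in> Ob C" "b \<in> Ob C" "h \<in> sh_arr C" "h' \<in> sh_arr C" "fst h = tobj r a b # xs"
      "fst h' = tobj r a b # xs" "cod h = cod h'" "ok_ar False (length (fst h)) 2"
    moreover from this have "length xs \<le> 2" by (auto simp: ok_ar_def sub_arities_def)
    ultimately show "h = h'"
      using bt[of a b xs "cod h"]
      by (cases h; cases h') (auto simp: sh_sb_def sh_arr_iff bij_betw_def inj_on_def)
  next
    fix f :: "('a, 'b) arrow" assume "f \<in> sh_arr C" "ok_ar False (Suc (length (fst f))) 0"
    then obtain xs d m where f: "f = (xs, d, m)" "xs \<in> lists (Ob C)" "d \<in> Ob C" "length xs \<le> 2"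
        "m \<in> MHom C xs d"
      by (cases f) (auto simp: sh_arr_iff ok_ar_def sub_arities_def)
    then have "m \<in> (\<lambda>f. subst C (uobj r # xs) d 0 [] f (umap r)) ` MHom C (uobj r # xs) d"
      using bu[of xs d] by (simp add: bij_betw_def)
    then obtain h where "h \<in> MHom C (uobj r # xs) d" "m = subst C (uobj r # xs) d 0 [] h (umap r)"
      by (rule imageE)
    then show "\<exists>h\<in>sh_arr C. fst h = uobj r # fst f \<and> cod h = cod f \<and>
        sh_sb C h 0 ([], uobj r, umap r) = f"
      using f u by (intro bexI[of _ "(uobj r # xs, d, h)"]) (auto simp: sh_sb_def sh_arr_iff)
  next
    fix h h' :: "('a, 'b) arrow" and xs
    assume "sh_sb C h 0 ([], uobj r, umap r) = sh_sb C h' 0 ([], uobj r, umap r)"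
      "h \<in> sh_arr C" "h' \<in> sh_arr C" "fst h = uobj r # xs"
      "fst h' = uobj r # xs" "cod h = cod h'" "ok_ar False (length (fst h)) 0"
    moreover from this have "length xs \<le> 2" by (auto simp: ok_ar_def sub_arities_def)
    ultimately show "h = h'"
      using bu[of xs "cod h"]
      by (cases h; cases h') (auto simp: sh_sb_def sh_arr_iff bij_betw_def inj_on_def)
  qed (use t u in \<open>auto simp: sh_arr_iff\<close>)
qed


section \<open>Arrows of skew monoidal categories\<close>

text \<open>A map together with its domain and codomain. In this form the axioms of a skew monoidal category
  contain no object arguments for composition and tensor product and serve as rewrite rules.\<close>

definition sk_arr :: "('o, 'm, 'z) cat_scheme \<Rightarrow> ('o \<times> 'o \<times> 'm) set" where
  "sk_arr C = {(a, b, f). a \<in> Ob C \<and> b \<in> Ob C \<and> f \<in> Hom C a b}"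

definition sk_idn :: "('o, 'm, 'z) cat_scheme \<Rightarrow> 'o \<Rightarrow> 'o \<times> 'o \<times> 'm" where
  "sk_idn C a = (a, a, Idn C a)"

definition sk_cmp ::
  "('o, 'm, 'z) cat_scheme \<Rightarrow> 'o \<times> 'o \<times> 'm \<Rightarrow> 'o \<times> 'o \<times> 'm \<Rightarrow> 'o \<times> 'o \<times> 'm"
where
  "sk_cmp C g f = (fst f, cod g, Comp C (fst f) (fst g) (cod g) (mor g) (mor f))"

definition sk_tns ::
  "('o, 'm, 'z) skmon_scheme \<Rightarrow> 'o \<times> 'o \<times> 'm \<Rightarrow> 'o \<times> 'o \<times> 'm \<Rightarrow> 'o \<times> 'o \<times> 'm"
where
  "sk_tns C f g = (Ten C (fst f) (fst g), Ten C (cod f) (cod g),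
     TenM C (fst f) (cod f) (fst g) (cod g) (mor f) (mor g))"

definition sk_al :: "('o, 'm, 'z) skmon_scheme \<Rightarrow> 'o \<Rightarrow> 'o \<Rightarrow> 'o \<Rightarrow> 'o \<times> 'o \<times> 'm" where
  "sk_al C a b c = (Ten C (Ten C a b) c, Ten C a (Ten C b c), Assoc C a b c)"

definition sk_la :: "('o, 'm, 'z) skmon_scheme \<Rightarrow> 'o \<Rightarrow> 'o \<times> 'o \<times> 'm" where
  "sk_la C a = (Ten C (Unit C) a, a, LUnit C a)"

definition sk_ro :: "('o, 'm, 'z) skmon_scheme \<Rightarrow> 'o \<Rightarrow> 'o \<times> 'o \<times> 'm" where
  "sk_ro C a = (a, Ten C a (Unit C), RUnit C a)"

lemma sk_arr_iff: "(a, b, f) \<in> sk_arr C \<longleftrightarrow> a \<in> Ob C \<and> b \<in> Ob C \<and> f \<in> Hom C a b"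
  by (simp add: sk_arr_def)

lemma fst_trg [simp]:
  "fst (sk_idn C a) = a" "cod (sk_idn C a) = a" "fst (sk_cmp C g f) = fst f" "cod (sk_cmp C g f) = cod g"
  "fst (sk_tns D f g) = Ten D (fst f) (fst g)" "cod (sk_tns D f g) = Ten D (cod f) (cod g)"
  "fst (sk_al D a b c) = Ten D (Ten D a b) c" "cod (sk_al D a b c) = Ten D a (Ten D b c)"
  "fst (sk_la D a) = Ten D (Unit D) a" "cod (sk_la D a) = a"
  "fst (sk_ro D a) = a" "cod (sk_ro D a) = Ten D a (Unit D)"
  by (simp_all add: sk_idn_def sk_cmp_def sk_tns_def sk_al_def sk_la_def sk_ro_def)

context category
begin

lemma sk_ObD [simp]: "f \<in> sk_arr C \<Longrightarrow> fst f \<in> Ob C" "f \<in> sk_arr C \<Longrightarrow> cod f \<in> Ob C"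
  by (auto simp: sk_arr_def)

lemma sk_idn_arr [simp]: "a \<in> Ob C \<Longrightarrow> sk_idn C a \<in> sk_arr C"
  by (simp add: sk_idn_def sk_arr_iff idn_closed)

lemma sk_cmp_arr [simp]: "g \<in> sk_arr C \<Longrightarrow> f \<in> sk_arr C \<Longrightarrow> fst g = cod f \<Longrightarrow> sk_cmp C g f \<in> sk_arr C"
  by (auto simp: sk_cmp_def sk_arr_def comp_closed)

lemma sk_idl [simp]: "f \<in> sk_arr C \<Longrightarrow> cod f = b \<Longrightarrow> sk_cmp C (sk_idn C b) f = f"
  by (auto simp: sk_cmp_def sk_idn_def sk_arr_def idn_left)

lemma sk_idr [simp]: "f \<in> sk_arr C \<Longrightarrow> fst f = a \<Longrightarrow> sk_cmp C f (sk_idn C a) = f"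
  by (auto simp: sk_cmp_def sk_idn_def sk_arr_def idn_right)

lemma sk_assoc [simp]:
  "h \<in> sk_arr C \<Longrightarrow> g \<in> sk_arr C \<Longrightarrow> f \<in> sk_arr C \<Longrightarrow> fst h = cod g \<Longrightarrow> fst g = cod f
    \<Longrightarrow> sk_cmp C (sk_cmp C h g) f = sk_cmp C h (sk_cmp C g f)"
  by (auto simp: sk_cmp_def sk_arr_def comp_assoc)

end

context skew_monoidal
begin

declare ten_closed [simp] unit_closed [simp]

lemma sk_tns_arr [simp]: "f \<in> sk_arr C \<Longrightarrow> g \<in> sk_arr C \<Longrightarrow> sk_tns C f g \<in> sk_arr C"
  by (auto simp: sk_tns_def sk_arr_def tenM_closed)

lemma sk_al_arr [simp]: "a \<in> Ob C \<Longrightarrow> b \<in> Ob C \<Longrightarrow> c \<in> Ob C \<Longrightarrow> sk_al C a b c \<in> sk_arr C"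
  by (auto simp: sk_al_def sk_arr_def assoc_closed)

lemma sk_la_arr [simp]: "a \<in> Ob C \<Longrightarrow> sk_la C a \<in> sk_arr C"
  by (auto simp: sk_la_def sk_arr_def lunit_closed)

lemma sk_ro_arr [simp]: "a \<in> Ob C \<Longrightarrow> sk_ro C a \<in> sk_arr C"
  by (auto simp: sk_ro_def sk_arr_def runit_closed)

lemma sk_tns_idn [simp]: "a \<in> Ob C \<Longrightarrow> b \<in> Ob C \<Longrightarrow> sk_tns C (sk_idn C a) (sk_idn C b) = sk_idn C (a \<otimes> b)"
  by (simp add: sk_tns_def sk_idn_def tenM_idn)

lemma sk_tns_cmp:
  "\<lbrakk>g \<in> sk_arr C; f \<in> sk_arr C; g' \<in> sk_arr C; f' \<in> sk_arr C; fst g = cod f; fst g' = cod f'\<rbrakk>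
    \<Longrightarrow> sk_tns C (sk_cmp C g f) (sk_cmp C g' f') = sk_cmp C (sk_tns C g g') (sk_tns C f f')"
  by (auto simp: sk_tns_def sk_cmp_def sk_arr_def tenM_comp)

lemma sk_al_nat:
  "\<lbrakk>f \<in> sk_arr C; g \<in> sk_arr C; h \<in> sk_arr C\<rbrakk>
    \<Longrightarrow> sk_cmp C (sk_al C (cod f) (cod g) (cod h)) (sk_tns C (sk_tns C f g) h)
      = sk_cmp C (sk_tns C f (sk_tns C g h)) (sk_al C (fst f) (fst g) (fst h))"
  by (auto simp: sk_tns_def sk_cmp_def sk_al_def sk_arr_def assoc_natural)

lemma sk_la_nat:
  "f \<in> sk_arr C \<Longrightarrow> sk_cmp C (sk_la C (cod f)) (sk_tns C (sk_idn C (Unit C)) f)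
      = sk_cmp C f (sk_la C (fst f))"
  by (auto simp: sk_tns_def sk_cmp_def sk_la_def sk_idn_def sk_arr_def lunit_natural)

lemma sk_ro_nat:
  "f \<in> sk_arr C \<Longrightarrow> sk_cmp C (sk_ro C (cod f)) f
      = sk_cmp C (sk_tns C f (sk_idn C (Unit C))) (sk_ro C (fst f))"
  by (auto simp: sk_tns_def sk_cmp_def sk_ro_def sk_idn_def sk_arr_def runit_natural)

lemma sk_pentagon:
  "\<lbrakk>a \<in> Ob C; b \<in> Ob C; c \<in> Ob C; d \<in> Ob C\<rbrakk>
    \<Longrightarrow> sk_cmp C (sk_al C a b (c \<otimes> d)) (sk_al C (a \<otimes> b) c d)
      = sk_cmp C (sk_tns C (sk_idn C a) (sk_al C b c d))
          (sk_cmp C (sk_al C a (b \<otimes> c) d) (sk_tns C (sk_al C a b c) (sk_idn C d)))"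
  using pentagon[of a b c d] by (simp add: sk_cmp_def sk_al_def sk_tns_def sk_idn_def)

lemma sk_la_al:
  "\<lbrakk>a \<in> Ob C; b \<in> Ob C\<rbrakk>
    \<Longrightarrow> sk_cmp C (sk_la C (a \<otimes> b)) (sk_al C (Unit C) a b) = sk_tns C (sk_la C a) (sk_idn C b)"
  using lunit_assoc[of a b] by (simp add: sk_cmp_def sk_al_def sk_tns_def sk_idn_def sk_la_def)

lemma sk_ro_al:
  "\<lbrakk>a \<in> Ob C; b \<in> Ob C\<rbrakk>
    \<Longrightarrow> sk_cmp C (sk_al C a b (Unit C)) (sk_ro C (a \<otimes> b)) = sk_tns C (sk_idn C a) (sk_ro C b)"
  using runit_assoc[of a b] by (simp add: sk_cmp_def sk_al_def sk_tns_def sk_idn_def sk_ro_def)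

lemma sk_la_ro_al:
  "\<lbrakk>a \<in> Ob C; b \<in> Ob C\<rbrakk>
    \<Longrightarrow> sk_cmp C (sk_tns C (sk_idn C a) (sk_la C b))
          (sk_cmp C (sk_al C a (Unit C) b) (sk_tns C (sk_ro C a) (sk_idn C b))) = sk_idn C (a \<otimes> b)"
  using lunit_runit_assoc[of a b]
  by (simp add: sk_cmp_def sk_al_def sk_tns_def sk_idn_def sk_ro_def sk_la_def)

lemma sk_la_ro: "sk_cmp C (sk_la C (Unit C)) (sk_ro C (Unit C)) = sk_idn C (Unit C)"
  using lunit_runit by (simp add: sk_cmp_def sk_idn_def sk_ro_def sk_la_def)

lemma sk_interchange:
  "\<lbrakk>f \<in> sk_arr C; g \<in> sk_arr C; a = fst f; b = cod f; c = fst g; d = cod g\<rbrakk>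
    \<Longrightarrow> sk_cmp C (sk_tns C f (sk_idn C d)) (sk_tns C (sk_idn C a) g)
      = sk_cmp C (sk_tns C (sk_idn C b) g) (sk_tns C f (sk_idn C c))"
  using sk_tns_cmp[of f "sk_idn C (fst f)" "sk_idn C (cod g)" g]
    sk_tns_cmp[of "sk_idn C (cod f)" f g "sk_idn C (fst g)"] by simp

end

definition sk_map :: "('o, 'm, 'p, 'n, 'x) functr_scheme \<Rightarrow> 'o \<times> 'o \<times> 'm \<Rightarrow> 'p \<times> 'p \<times> 'n" where
  "sk_map F f = (FOb F (fst f), FOb F (cod f), FHom F (fst f) (cod f) (mor f))"

definition sk_f2 ::
  "('o, 'm) skmon \<Rightarrow> ('p, 'n) skmon \<Rightarrow> ('o, 'm, 'p, 'n) laxfun \<Rightarrow> 'o \<Rightarrow> 'o \<Rightarrow> 'p \<times> 'p \<times> 'n"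
where
  "sk_f2 C D F a b = (Ten D (FOb F a) (FOb F b), FOb F (Ten C a b), F2 F a b)"

definition sk_f0 ::
  "('o, 'm) skmon \<Rightarrow> ('p, 'n) skmon \<Rightarrow> ('o, 'm, 'p, 'n) laxfun \<Rightarrow> 'p \<times> 'p \<times> 'n"
where
  "sk_f0 C D F = (Unit D, FOb F (Unit C), F0 F)"

lemma sk_map_simps [simp]:
  "fst (sk_map F f) = FOb F (fst f)" "cod (sk_map F f) = FOb F (cod f)"
  "fst (sk_f2 C D L a b) = Ten D (FOb L a) (FOb L b)" "cod (sk_f2 C D L a b) = FOb L (Ten C a b)"
  "fst (sk_f0 C D L) = Unit D" "cod (sk_f0 C D L) = FOb L (Unit C)"
  by (simp_all add: sk_map_def sk_f2_def sk_f0_def)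

definition lax_arrows :: "('o, 'm) skmon \<Rightarrow> ('p, 'n) skmon \<Rightarrow> ('o, 'm, 'p, 'n) laxfun \<Rightarrow> bool" where
  "lax_arrows C D F \<longleftrightarrow>
     (\<forall>a\<in>Ob C. FOb F a \<in> Ob D) \<and>
     (\<forall>f\<in>sk_arr C. sk_map F f \<in> sk_arr D) \<and>
     (\<forall>a\<in>Ob C. sk_map F (sk_idn C a) = sk_idn D (FOb F a)) \<and>
     (\<forall>f\<in>sk_arr C. \<forall>g\<in>sk_arr C. fst g = cod f
        \<longrightarrow> sk_map F (sk_cmp C g f) = sk_cmp D (sk_map F g) (sk_map F f)) \<and>
     sk_f0 C D F \<in> sk_arr D \<and>
     (\<forall>a\<in>Ob C. \<forall>b\<in>Ob C. sk_f2 C D F a b \<in> sk_arr D) \<and>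
     (\<forall>f\<in>sk_arr C. \<forall>g\<in>sk_arr C.
        sk_cmp D (sk_f2 C D F (cod f) (cod g)) (sk_tns D (sk_map F f) (sk_map F g))
          = sk_cmp D (sk_map F (sk_tns C f g)) (sk_f2 C D F (fst f) (fst g))) \<and>
     (\<forall>a\<in>Ob C. \<forall>b\<in>Ob C. \<forall>c\<in>Ob C.
        sk_cmp D (sk_map F (sk_al C a b c)) (sk_cmp D (sk_f2 C D F (Ten C a b) c)
            (sk_tns D (sk_f2 C D F a b) (sk_idn D (FOb F c))))
          = sk_cmp D (sk_f2 C D F a (Ten C b c)) (sk_cmp D (sk_tns D (sk_idn D (FOb F a)) (sk_f2 C D F b c))
            (sk_al D (FOb F a) (FOb F b) (FOb F c)))) \<and>
     (\<forall>a\<in>Ob C. sk_cmp D (sk_map F (sk_la C a)) (sk_cmp D (sk_f2 C D F (Unit C) a)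
            (sk_tns D (sk_f0 C D F) (sk_idn D (FOb F a)))) = sk_la D (FOb F a)) \<and>
     (\<forall>a\<in>Ob C. sk_cmp D (sk_f2 C D F a (Unit C)) (sk_cmp D (sk_tns D (sk_idn D (FOb F a)) (sk_f0 C D F))
            (sk_ro D (FOb F a))) = sk_map F (sk_ro C a))"

lemma lax_monoidal_arrows:
  assumes C: "skew_monoidal C" and D: "skew_monoidal D"
  shows "lax_monoidal C D F \<longleftrightarrow> lax_arrows C D F"
proof -
  interpret C: skew_monoidal C by fact
  interpret D: skew_monoidal D by fact
  have f: "is_functor C D F \<longleftrightarrow> (\<forall>a\<in>Ob C. FOb F a \<in> Ob D) \<and>
     (\<forall>f\<in>sk_arr C. sk_map F f \<in> sk_arr D) \<and>
     (\<forall>a\<in>Ob C. sk_map F (sk_idn C a) = sk_idn D (FOb F a)) \<and>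
     (\<forall>f\<in>sk_arr C. \<forall>g\<in>sk_arr C. fst g = cod f
        \<longrightarrow> sk_map F (sk_cmp C g f) = sk_cmp D (sk_map F g) (sk_map F f))"
    unfolding is_functor_def by (auto simp: sk_map_def sk_cmp_def sk_idn_def sk_arr_def)
  have n: "(\<forall>f\<in>sk_arr C. \<forall>g\<in>sk_arr C.
        sk_cmp D (sk_f2 C D F (cod f) (cod g)) (sk_tns D (sk_map F f) (sk_map F g))
          = sk_cmp D (sk_map F (sk_tns C f g)) (sk_f2 C D F (fst f) (fst g)))
    \<longleftrightarrow> (\<forall>a\<in>Ob C. \<forall>a'\<in>Ob C. \<forall>b\<in>Ob C. \<forall>b'\<in>Ob C. \<forall>f\<in>Hom C a a'. \<forall>g\<in>Hom C b b'.
        Comp D (Ten D (FOb F a) (FOb F b)) (Ten D (FOb F a') (FOb F b')) (FOb F (Ten C a' b'))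
          (F2 F a' b')
          (TenM D (FOb F a) (FOb F a') (FOb F b) (FOb F b') (FHom F a a' f) (FHom F b b' g))
        = Comp D (Ten D (FOb F a) (FOb F b)) (FOb F (Ten C a b)) (FOb F (Ten C a' b'))
          (FHom F (Ten C a b) (Ten C a' b') (TenM C a a' b b' f g))
          (F2 F a b))"
    by (auto simp: sk_map_def sk_cmp_def sk_tns_def sk_f2_def sk_arr_def)
  show ?thesis
  proof (cases "is_functor C D F")
    case True
    then have [simp]: "FOb F a \<in> Ob D" if "a \<in> Ob C" for a using that by (simp add: is_functor_def)
    show ?thesis
      unfolding lax_monoidal_def lax_arrows_def n using True f
      by (simp add: sk_map_def[of F "(a, b, f)" for a b f] sk_map_def[of F "sk_al C a b c" for a b c]
          sk_map_def[of F "sk_la C a" for a] sk_map_def[of F "sk_ro C a" for a]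
          sk_f0_def sk_f2_def sk_arr_iff, simp add: sk_cmp_def sk_tns_def sk_al_def sk_la_def sk_ro_def sk_idn_def)
  next
    case False
    then show ?thesis using f by (auto simp: lax_monoidal_def lax_arrows_def)
  qed
qed

lemma lax_arrowsD:
  assumes "lax_arrows C D F"
  shows "a \<in> Ob C \<Longrightarrow> FOb F a \<in> Ob D"
    "f \<in> sk_arr C \<Longrightarrow> sk_map F f \<in> sk_arr D"
    "a \<in> Ob C \<Longrightarrow> sk_map F (sk_idn C a) = sk_idn D (FOb F a)"
    "f \<in> sk_arr C \<Longrightarrow> g \<in> sk_arr C \<Longrightarrow> fst g = cod f
        \<Longrightarrow> sk_map F (sk_cmp C g f) = sk_cmp D (sk_map F g) (sk_map F f)"
    "sk_f0 C D F \<in> sk_arr D" "a \<in> Ob C \<Longrightarrow> b \<in> Ob C \<Longrightarrow> sk_f2 C D F a b \<in> sk_arr D"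
    "f \<in> sk_arr C \<Longrightarrow> g \<in> sk_arr C \<Longrightarrow>
        sk_cmp D (sk_f2 C D F (cod f) (cod g)) (sk_tns D (sk_map F f) (sk_map F g))
          = sk_cmp D (sk_map F (sk_tns C f g)) (sk_f2 C D F (fst f) (fst g))"
    "a \<in> Ob C \<Longrightarrow> b \<in> Ob C \<Longrightarrow> c \<in> Ob C \<Longrightarrow>
        sk_cmp D (sk_map F (sk_al C a b c)) (sk_cmp D (sk_f2 C D F (Ten C a b) c)
            (sk_tns D (sk_f2 C D F a b) (sk_idn D (FOb F c))))
          = sk_cmp D (sk_f2 C D F a (Ten C b c)) (sk_cmp D (sk_tns D (sk_idn D (FOb F a)) (sk_f2 C D F b c))
            (sk_al D (FOb F a) (FOb F b) (FOb F c)))"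
    "a \<in> Ob C \<Longrightarrow> sk_cmp D (sk_map F (sk_la C a)) (sk_cmp D (sk_f2 C D F (Unit C) a)
            (sk_tns D (sk_f0 C D F) (sk_idn D (FOb F a)))) = sk_la D (FOb F a)"
    "a \<in> Ob C \<Longrightarrow> sk_cmp D (sk_f2 C D F a (Unit C)) (sk_cmp D (sk_tns D (sk_idn D (FOb F a)) (sk_f0 C D F))
            (sk_ro D (FOb F a))) = sk_map F (sk_ro C a)"
  using assms unfolding lax_arrows_def by blast+

section \<open>The functor \<open>K\<close>\<close>

definition unary :: "'o \<times> 'o \<times> 'm \<Rightarrow> ('o, 'm) arrow" where
  "unary f = ([fst f], cod f, mor f)"

locale short_lr = short_multicategory C
  for C :: "('o, 'm) shmulti" and r :: "('o, 'm) lrchoice" +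
  assumes universal: "left_universal C r"
begin

abbreviation thA :: "'o \<Rightarrow> 'o \<Rightarrow> ('o, 'm) arrow" where
  "thA a b \<equiv> ([a, b], tobj r a b, theta r a b)"

sublocale L: lr_multi "Ob C" "sh_arr C" fst cod "sh_idn C" "sh_sb C" False
    "tobj r" thA "uobj r" "([], uobj r, umap r)"
  by (rule lr_multi_short) (unfold_locales, rule universal)

abbreviation K :: "('o, 'm) skmon" where "K \<equiv> K_obj C r"

lemma K_sel [simp]:
  "Ob K = Ob C" "Hom K = Hom C" "Idn K = Idn C" "Comp K = Comp C" "Ten K = tobj r" "Unit K = uobj r"
  by (simp_all add: K_obj_def Let_def)

lemma un_arr [simp]: "a \<in> Ob C \<Longrightarrow> b \<in> Ob C \<Longrightarrow> ([a], b, f) \<in> sh_arr C \<longleftrightarrow> f \<in> Hom C a b"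
  by (simp add: sh_arr_iff unary_hom)

lemma un_hom: "a \<in> Ob C \<Longrightarrow> b \<in> Ob C \<Longrightarrow> f \<in> Hom C a b \<Longrightarrow> ([a], b, f) \<in> L.hom [a] b"
  by (simp add: L.hom_iff)

lemma hom_un: "p \<in> L.hom [a] b \<Longrightarrow> p = ([a], b, mor p) \<and> mor p \<in> Hom C a b"
  using L.homD[of p "[a]" b] by (cases p) (auto simp: sh_arr_iff unary_hom)

lemma tobj_Ob [simp]: "a \<in> Ob C \<Longrightarrow> b \<in> Ob C \<Longrightarrow> tobj r a b \<in> Ob C"
  by (rule L.ten_Obj)

lemma uobj_Ob [simp]: "uobj r \<in> Ob C"
  by (rule L.e_Obj)

lemma Comp_arr:
  "\<lbrakk>a \<in> Ob C; b \<in> Ob C; c \<in> Ob C; f \<in> Hom C a b; g \<in> Hom C b c\<rbrakk>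
    \<Longrightarrow> ([a], c, Comp C a b c g f) = sh_sb C ([b], c, g) 0 ([a], b, f)"
  by (simp add: sh_sb_def subst_unary pre_unary)

lemma Idn_arr: "([a], a, Idn C a) = sh_idn C a"
  by (simp add: sh_idn_def)

lemma theta_in: "a \<in> Ob C \<Longrightarrow> b \<in> Ob C \<Longrightarrow> thA a b \<in> sh_arr C"
  by (rule L.th_Arr)

lemma umap_in: "([], uobj r, umap r) \<in> sh_arr C"
  by (rule L.u_Arr)

text \<open>The definite descriptions in the definition of \<open>K\<close> range over a hom-set of \<open>C\<close>, those of \<open>tn\<close>, \<open>al\<close>
  and \<open>la\<close> over multimaps with domain and codomain.\<close>

lemma the_unary:
  assumes ex1: "\<exists>!H. H \<in> L.hom [x] y \<and> P H"
    and eq: "\<And>h. Q h \<longleftrightarrow> ([x], y, h) \<in> L.hom [x] y \<and> P ([x], y, h)"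
  shows "([x], y, THE h. Q h) = (THE H. H \<in> L.hom [x] y \<and> P H)" and "(THE h. Q h) \<in> Hom C x y"
proof -
  let ?H = "THE H. H \<in> L.hom [x] y \<and> P H"
  note H = theI'[OF ex1]
  have Heq: "?H = ([x], y, mor ?H)" and in_Hom: "mor ?H \<in> Hom C x y"
    using hom_un[of ?H x y] H by auto
  have "(THE h. Q h) = mor ?H"
  proof (rule the_equality)
    show "Q (mor ?H)" unfolding eq using H Heq by simp
    show "h = mor ?H" if "Q h" for h
      using the1_equality[OF ex1 that[unfolded eq]] by simp
  qed
  then show "([x], y, THE h. Q h) = ?H" "(THE h. Q h) \<in> Hom C x y"
    using Heq in_Hom by simp_all
qed

lemma TenM_arr:
  assumes [simp]: "a \<in> Ob C" "b \<in> Ob C" "c \<in> Ob C" "d \<in> Ob C" "f \<in> Hom C a b" "g \<in> Hom C c d"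
  shows "([tobj r a c], tobj r b d, TenM K a b c d f g) = L.tn ([a], b, f) ([c], d, g)"
    and "TenM K a b c d f g \<in> Hom C (tobj r a c) (tobj r b d)"
proof -
  have pq: "([a], b, f) \<in> L.hom [a] b" "([c], d, g) \<in> L.hom [c] d" by (simp_all add: un_hom)
  have eq: "(h \<in> Hom C (tobj r a c) (tobj r b d) \<and> post C [a, c] (tobj r a c) (tobj r b d) h (theta r a c)
      = subst C [a, d] (tobj r b d) 1 [c] (subst C [b, d] (tobj r b d) 0 [a] (theta r b d) f) g)
    \<longleftrightarrow> ([tobj r a c], tobj r b d, h) \<in> L.hom [tobj r a c] (tobj r b d) \<and>
      sh_sb C ([tobj r a c], tobj r b d, h) 0 (thA a c)
        = sh_sb C (sh_sb C (thA b d) 0 ([a], b, f)) 1 ([c], d, g)" for h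
    using theta_in[of a c] by (auto simp: L.hom_iff sh_sb_def subst_post sh_arr_iff unary_hom)
  show "([tobj r a c], tobj r b d, TenM K a b c d f g) = L.tn ([a], b, f) ([c], d, g)"
    "TenM K a b c d f g \<in> Hom C (tobj r a c) (tobj r b d)"
    using the_unary[OF L.tn_ex1[OF pq] eq] by (simp_all add: K_obj_def Let_def L.tn_def)
qed

lemma Assoc_arr:
  assumes [simp]: "a \<in> Ob C" "b \<in> Ob C" "c \<in> Ob C"
  shows "([tobj r (tobj r a b) c], tobj r a (tobj r b c), Assoc K a b c) = L.al a b c"
    and "Assoc K a b c \<in> Hom C (tobj r (tobj r a b) c) (tobj r a (tobj r b c))"
proof -
  let ?x = "tobj r (tobj r a b) c" and ?y = "tobj r a (tobj r b c)"
  have eq: "(h \<in> Hom C ?x ?y \<and>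
        subst C [tobj r a b, c] ?y 0 [a, b]
            (post C [tobj r a b, c] ?x ?y h (theta r (tobj r a b) c)) (theta r a b)
          = subst C [a, tobj r b c] ?y 1 [b, c] (theta r a (tobj r b c)) (theta r b c))
    \<longleftrightarrow> ([?x], ?y, h) \<in> L.hom [?x] ?y \<and>
      sh_sb C (sh_sb C ([?x], ?y, h) 0 (thA (tobj r a b) c)) 0 (thA a b)
        = sh_sb C (thA a (tobj r b c)) 1 (thA b c)" for h
    using theta_in[of "tobj r a b" c]
    by (auto simp: L.hom_iff sh_sb_def subst_post sh_arr_iff unary_hom)
  show "([?x], ?y, Assoc K a b c) = L.al a b c" "Assoc K a b c \<in> Hom C ?x ?y"
    using the_unary[OF L.al_ex1[OF assms] eq] by (simp_all add: K_obj_def Let_def L.al_def)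
qed

lemma LUnit_arr:
  assumes [simp]: "a \<in> Ob C"
  shows "([tobj r (uobj r) a], a, LUnit K a) = L.la a"
    and "LUnit K a \<in> Hom C (tobj r (uobj r) a) a"
proof -
  let ?x = "tobj r (uobj r) a"
  have eq: "(h \<in> Hom C ?x a \<and>
        subst C [uobj r, a] a 0 [] (post C [uobj r, a] ?x a h (theta r (uobj r) a)) (umap r) = Idn C a)
    \<longleftrightarrow> ([?x], a, h) \<in> L.hom [?x] a \<and>
      sh_sb C (sh_sb C ([?x], a, h) 0 (thA (uobj r) a)) 0 ([], uobj r, umap r) = sh_idn C a" for h
    using theta_in[of "uobj r" a]
    by (auto simp: L.hom_iff sh_sb_def subst_post sh_arr_iff unary_hom sh_idn_def)
  show "([?x], a, LUnit K a) = L.la a" "LUnit K a \<in> Hom C ?x a"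
    using the_unary[OF L.la_ex1[OF assms] eq] by (simp_all add: K_obj_def Let_def L.la_def)
qed

lemma RUnit_arr:
  assumes [simp]: "a \<in> Ob C"
  shows "([a], tobj r a (uobj r), RUnit K a) = L.ro a"
    and "RUnit K a \<in> Hom C a (tobj r a (uobj r))"
proof -
  show eq: "([a], tobj r a (uobj r), RUnit K a) = L.ro a"
    by (simp add: K_obj_def Let_def L.ro_def sh_sb_def)
  have "([a], tobj r a (uobj r), RUnit K a) \<in> sh_arr C"
    unfolding eq by simp
  then show "RUnit K a \<in> Hom C a (tobj r a (uobj r))" by simp
qed

lemmas K_closed [simp] = TenM_arr(2) Assoc_arr(2) LUnit_arr(2) RUnit_arr(2)

lemmas K_arr = Comp_arr TenM_arr(1) Assoc_arr(1) LUnit_arr(1) RUnit_arr(1) Idn_arr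

lemma comp_in [simp]:
  "\<lbrakk>a \<in> Ob C; b \<in> Ob C; c \<in> Ob C; f \<in> Hom C a b; g \<in> Hom C b c\<rbrakk> \<Longrightarrow> Comp C a b c g f \<in> Hom C a c"
  by (rule comp_closed)

lemma un_eqI: "([x], y, h) = ([x], y, h') \<Longrightarrow> h = h'"
  by simp

lemma unary_cmp:
  "g \<in> sk_arr C \<Longrightarrow> f \<in> sk_arr C \<Longrightarrow> fst g = cod f \<Longrightarrow> unary (sk_cmp K g f) = sh_sb C (unary g) 0 (unary f)"
  using Comp_arr by (auto simp: unary_def sk_cmp_def sk_arr_def)

lemma unary_tns: "f \<in> sk_arr C \<Longrightarrow> g \<in> sk_arr C \<Longrightarrow> unary (sk_tns K f g) = L.tn (unary f) (unary g)"
  using TenM_arr(1) by (auto simp: unary_def sk_tns_def sk_arr_def)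

lemma unary_al: "a \<in> Ob C \<Longrightarrow> b \<in> Ob C \<Longrightarrow> c \<in> Ob C \<Longrightarrow> unary (sk_al K a b c) = L.al a b c"
  using Assoc_arr(1) by (simp add: unary_def sk_al_def)

lemma unary_la: "a \<in> Ob C \<Longrightarrow> unary (sk_la K a) = L.la a"
  using LUnit_arr(1) by (simp add: unary_def sk_la_def)

lemma unary_ro: "a \<in> Ob C \<Longrightarrow> unary (sk_ro K a) = L.ro a"
  using RUnit_arr(1) by (simp add: unary_def sk_ro_def)

lemma unary_idn: "unary (sk_idn C a) = sh_idn C a"
  by (simp add: unary_def sk_idn_def sh_idn_def)

lemma skew_monoidal_K: "skew_monoidal K"
proof
  fix a b assume [simp]: "a \<in> Ob K" "b \<in> Ob K"
  then have [simp]: "a \<in> Ob C" "b \<in> Ob C" by simp_all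
  show "TenM K a a b b (Idn K a) (Idn K b) = Idn K (Ten K a b)"
    by (rule un_eqI[of "tobj r a b" "tobj r a b"]) (simp add: K_arr L.tn_idn)
  show "Comp K (Ten K (Ten K (Unit K) a) b) (Ten K (Unit K) (Ten K a b)) (Ten K a b)
            (LUnit K (Ten K a b)) (Assoc K (Unit K) a b)
          = TenM K (Ten K (Unit K) a) a b b (LUnit K a) (Idn K b)"
    by (rule un_eqI[of "tobj r (tobj r (uobj r) a) b" "tobj r a b"]) (simp add: K_arr L.la_al)
  show "Comp K (Ten K a b) (Ten K (Ten K a b) (Unit K)) (Ten K a (Ten K b (Unit K)))
            (Assoc K a b (Unit K)) (RUnit K (Ten K a b))
          = TenM K a a b (Ten K b (Unit K)) (Idn K a) (RUnit K b)"
    by (rule un_eqI[of "tobj r a b" "tobj r a (tobj r b (uobj r))"]) (simp add: K_arr L.ro_al)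
  show "Comp K (Ten K a b) (Ten K a (Ten K (Unit K) b)) (Ten K a b)
            (TenM K a a (Ten K (Unit K) b) b (Idn K a) (LUnit K b))
            (Comp K (Ten K a b) (Ten K (Ten K a (Unit K)) b) (Ten K a (Ten K (Unit K) b))
              (Assoc K a (Unit K) b)
              (TenM K a (Ten K a (Unit K)) b b (RUnit K a) (Idn K b)))
          = Idn K (Ten K a b)"
    by (rule un_eqI[of "tobj r a b" "tobj r a b"]) (simp add: K_arr L.la_ro_al)
next
  show "Comp K (Unit K) (Ten K (Unit K) (Unit K)) (Unit K) (LUnit K (Unit K)) (RUnit K (Unit K))
      = Idn K (Unit K)"
    by (rule un_eqI[of "uobj r" "uobj r"]) (simp add: K_arr L.la_ro)
next
  fix a b c d assume "a \<in> Ob K" "b \<in> Ob K" "c \<in> Ob K" "d \<in> Ob K"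
  then have [simp]: "a \<in> Ob C" "b \<in> Ob C" "c \<in> Ob C" "d \<in> Ob C" by simp_all
  show "Comp K (Ten K (Ten K (Ten K a b) c) d) (Ten K (Ten K a b) (Ten K c d)) (Ten K a (Ten K b (Ten K c d)))
            (Assoc K a b (Ten K c d)) (Assoc K (Ten K a b) c d)
          = Comp K (Ten K (Ten K (Ten K a b) c) d) (Ten K a (Ten K (Ten K b c) d)) (Ten K a (Ten K b (Ten K c d)))
            (TenM K a a (Ten K (Ten K b c) d) (Ten K b (Ten K c d)) (Idn K a) (Assoc K b c d))
            (Comp K (Ten K (Ten K (Ten K a b) c) d) (Ten K (Ten K a (Ten K b c)) d) (Ten K a (Ten K (Ten K b c) d))
              (Assoc K a (Ten K b c) d)
              (TenM K (Ten K (Ten K a b) c) (Ten K a (Ten K b c)) d d (Assoc K a b c) (Idn K d)))"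
    by (rule un_eqI[of "tobj r (tobj r (tobj r a b) c) d" "tobj r a (tobj r b (tobj r c d))"])
      (simp add: K_arr L.pentagon)
next
  fix a b f assume "a \<in> Ob K" "b \<in> Ob K" "f \<in> Hom K a b"
  then have [simp]: "a \<in> Ob C" "b \<in> Ob C" "f \<in> Hom C a b" by simp_all
  have f: "([a], b, f) \<in> L.hom [a] b" by (simp add: un_hom)
  show "Comp K (Ten K (Unit K) a) (Ten K (Unit K) b) b (LUnit K b)
            (TenM K (Unit K) (Unit K) a b (Idn K (Unit K)) f)
          = Comp K (Ten K (Unit K) a) a b f (LUnit K a)"
    by (rule un_eqI[of "tobj r (uobj r) a" b]) (simp add: K_arr L.la_nat[OF f])
  show "Comp K a b (Ten K b (Unit K)) (RUnit K b) f
          = Comp K a (Ten K a (Unit K)) (Ten K b (Unit K))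
            (TenM K a b (Unit K) (Unit K) f (Idn K (Unit K))) (RUnit K a)"
    by (rule un_eqI[of a "tobj r b (uobj r)"]) (simp add: K_arr L.ro_nat[OF f])
next
  fix a b c a' b' c' f g h
  assume "a \<in> Ob K" "b \<in> Ob K" "c \<in> Ob K" "a' \<in> Ob K" "b' \<in> Ob K" "c' \<in> Ob K"
    "f \<in> Hom K a a'" "g \<in> Hom K b b'" "h \<in> Hom K c c'"
  then have [simp]: "a \<in> Ob C" "b \<in> Ob C" "c \<in> Ob C" "a' \<in> Ob C" "b' \<in> Ob C" "c' \<in> Ob C"
    "f \<in> Hom C a a'" "g \<in> Hom C b b'" "h \<in> Hom C c c'" by simp_all
  show "Comp K (Ten K (Ten K a b) c) (Ten K (Ten K a' b') c') (Ten K a' (Ten K b' c')) (Assoc K a' b' c')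
            (TenM K (Ten K a b) (Ten K a' b') c c' (TenM K a a' b b' f g) h)
          = Comp K (Ten K (Ten K a b) c) (Ten K a (Ten K b c)) (Ten K a' (Ten K b' c'))
            (TenM K a a' (Ten K b c) (Ten K b' c') f (TenM K b b' c c' g h)) (Assoc K a b c)"
    by (rule un_eqI[of "tobj r (tobj r a b) c" "tobj r a' (tobj r b' c')"])
      (simp add: K_arr L.al_nat[of "([a], a', f)" a a' "([b], b', g)" b b' "([c], c', h)" c c'] un_hom)
next
  fix a b c a' b' c' f g f' g'
  assume "a \<in> Ob K" "b \<in> Ob K" "c \<in> Ob K" "a' \<in> Ob K" "b' \<in> Ob K" "c' \<in> Ob K"
    "f \<in> Hom K a b" "g \<in> Hom K b c" "f' \<in> Hom K a' b'" "g' \<in> Hom K b' c'"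
  then have [simp]: "a \<in> Ob C" "b \<in> Ob C" "c \<in> Ob C" "a' \<in> Ob C" "b' \<in> Ob C" "c' \<in> Ob C"
    "f \<in> Hom C a b" "g \<in> Hom C b c" "f' \<in> Hom C a' b'" "g' \<in> Hom C b' c'" by simp_all
  show "TenM K a c a' c' (Comp K a b c g f) (Comp K a' b' c' g' f')
          = Comp K (Ten K a a') (Ten K b b') (Ten K c c') (TenM K b c b' c' g g') (TenM K a b a' b' f f')"
    by (rule un_eqI[of "tobj r a a'" "tobj r c c'"])
      (simp add: K_arr L.tn_comp[of "([a], b, f)" a b "([b], c, g)" c "([a'], b', f')" a' b' "([b'], c', g')" c']
        un_hom)
qed (simp_all add: comp_assoc)

lemma left_normal_K: "left_normal K"
proof -
  have "iso K (Ten K (Unit K) a) a (LUnit K a)" if "a \<in> Ob K" for a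
  proof -
    have [simp]: "a \<in> Ob C" using that by simp
    let ?x = "tobj r (uobj r) a"
    have "L.li a \<in> L.hom [a] ?x" by (simp add: L.hom_iff)
    then have li: "L.li a = ([a], ?x, mor (L.li a))" "mor (L.li a) \<in> Hom C a ?x"
      using hom_un by blast+
    have "([?x], ?x, Comp C ?x a ?x (mor (L.li a)) (LUnit K a)) = ([?x], ?x, Idn C ?x)"
      using li by (simp only: K_arr K_closed tobj_Ob uobj_Ob \<open>a \<in> Ob C\<close> L.li_la flip: li(1))
    moreover have "([a], a, Comp C a ?x a (LUnit K a) (mor (L.li a))) = ([a], a, Idn C a)"
      using li by (simp only: K_arr K_closed tobj_Ob uobj_Ob \<open>a \<in> Ob C\<close> L.la_li flip: li(1))
    ultimately show ?thesis using li by (auto simp: iso_def)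
  qed
  then show ?thesis by (simp add: left_normal_def)
qed

end

locale short_lr_pair = C: short_lr C r + D: short_lr D s
  for C :: "('o, 'm) shmulti" and r and D :: "('p, 'n) shmulti" and s
begin

text \<open>The data of a functor \<open>G\<close> from \<open>K_obj C r\<close> to \<open>K_obj D s\<close> as unary multimaps of \<open>D\<close>.\<close>

definition FA :: "('o, 'm, 'p, 'n, 'x) functr_scheme \<Rightarrow> ('o, 'm) arrow \<Rightarrow> ('p, 'n) arrow" where
  "FA G f = ([FOb G (hd (fst f))], FOb G (cod f), FHom G (hd (fst f)) (cod f) (mor f))"

definition f2 :: "('o, 'm, 'p, 'n) laxfun \<Rightarrow> 'o \<Rightarrow> 'o \<Rightarrow> ('p, 'n) arrow" where
  "f2 G a b = ([tobj s (FOb G a) (FOb G b)], FOb G (tobj r a b), F2 G a b)"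

definition f0 :: "('o, 'm, 'p, 'n) laxfun \<Rightarrow> ('p, 'n) arrow" where
  "f0 G = ([uobj s], FOb G (uobj r), F0 G)"

definition lax_t :: "('o, 'm, 'p, 'n) laxfun \<Rightarrow> 'o \<Rightarrow> 'o \<Rightarrow> ('p, 'n) arrow" where
  "lax_t G a b = sh_sb D (f2 G a b) 0 (D.thA (FOb G a) (FOb G b))"

definition lax_v :: "('o, 'm, 'p, 'n) laxfun \<Rightarrow> ('p, 'n) arrow" where
  "lax_v G = sh_sb D (f0 G) 0 ([], uobj s, umap s)"

definition lax_typed :: "('o, 'm, 'p, 'n) laxfun \<Rightarrow> bool" where
  "lax_typed G \<longleftrightarrow> is_functor C D G \<and> F0 G \<in> Hom D (uobj s) (FOb G (uobj r)) \<and>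
     (\<forall>a\<in>Ob C. \<forall>b\<in>Ob C. F2 G a b \<in> Hom D (tobj s (FOb G a) (FOb G b)) (FOb G (tobj r a b)))"

text \<open>In terms of multimaps, a lax monoidal functor consists of images \<open>lax_t G a b\<close> of the binary
  classifiers and an image \<open>lax_v G\<close> of the nullary one, and its axioms are the equations that make
  these data extend to a morphism of multicategories.\<close>

lemma lax_monoidal_iff:
  assumes G: "lax_typed G"
  shows "lax_monoidal (K_obj C r) (K_obj D s) G \<longleftrightarrow>
     (\<forall>f\<in>sk_arr C. \<forall>g\<in>sk_arr C.
        sh_sb D (sh_sb D (lax_t G (cod f) (cod g)) 0 (FA G (unary f))) 1 (FA G (unary g))
          = sh_sb D (FA G (C.L.tn (unary f) (unary g))) 0 (lax_t G (fst f) (fst g))) \<and>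
     (\<forall>a\<in>Ob C. \<forall>b\<in>Ob C. \<forall>c\<in>Ob C.
        sh_sb D (sh_sb D (FA G (C.L.al a b c)) 0 (lax_t G (tobj r a b) c)) 0 (lax_t G a b)
          = sh_sb D (lax_t G a (tobj r b c)) 1 (lax_t G b c)) \<and>
     (\<forall>a\<in>Ob C. sh_sb D (sh_sb D (FA G (C.L.la a)) 0 (lax_t G (uobj r) a)) 0 (lax_v G)
          = sh_idn D (FOb G a)) \<and>
     (\<forall>a\<in>Ob C. sh_sb D (lax_t G a (uobj r)) 1 (lax_v G) = FA G (C.L.ro a))"
proof -
  interpret CK: skew_monoidal C.K by (rule C.skew_monoidal_K)
  interpret DK: skew_monoidal D.K by (rule D.skew_monoidal_K)
  have fn: "is_functor C D G" using G by (simp add: lax_typed_def)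
  have FO [simp]: "FOb G a \<in> Ob D" if "a \<in> Ob C" for a using fn that by (simp add: is_functor_def)
  have f2_arr: "sk_f2 C.K D.K G a b \<in> sk_arr D" if "a \<in> Ob C" "b \<in> Ob C" for a b
    using G that by (simp add: lax_typed_def sk_f2_def sk_arr_iff)
  have f0_arr: "sk_f0 C.K D.K G \<in> sk_arr D"
    using G by (simp add: lax_typed_def sk_f0_def sk_arr_iff)
  have map_arr: "sk_map G f \<in> sk_arr D" if "f \<in> sk_arr C" for f
    using fn that by (auto simp: is_functor_def sk_map_def sk_arr_def)
  note [simp] = f2_arr f0_arr map_arr
  have sk: "sk_arr C.K = sk_arr C" "sk_arr D.K = sk_arr D" "sk_idn D.K = sk_idn D"
    by (simp_all add: sk_arr_def sk_idn_def fun_eq_iff)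
  have typed: "(\<forall>f\<in>sk_arr C. sk_map G f \<in> sk_arr D)"
     "(\<forall>a\<in>Ob C. sk_map G (sk_idn C.K a) = sk_idn D (FOb G a))"
     "(\<forall>f\<in>sk_arr C. \<forall>g\<in>sk_arr C. fst g = cod f
        \<longrightarrow> sk_map G (sk_cmp C.K g f) = sk_cmp D.K (sk_map G g) (sk_map G f))"
    using fn by (auto simp: is_functor_def sk_map_def sk_arr_def sk_idn_def sk_cmp_def)
  have FA: "FA G (unary f) = unary (sk_map G f)" for f
    by (simp add: FA_def unary_def sk_map_def)
  have f2: "f2 G a b = unary (sk_f2 C.K D.K G a b)" and f0: "f0 G = unary (sk_f0 C.K D.K G)" for a b
    by (simp_all add: f2_def f0_def sk_f2_def sk_f0_def unary_def)
  have un: "unary f \<in> D.L.hom [x] y" if "f \<in> sk_arr D" "fst f = x" "cod f = y" for f x y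
    using that by (auto simp: unary_def sk_arr_def intro: D.un_hom)
  note cmp = DK.sk_cmp_arr[unfolded sk] and tns = DK.sk_tns_arr[unfolded sk]
    and al = DK.sk_al_arr[unfolded sk] and ro = DK.sk_ro_arr[unfolded sk]
    and idn = DK.sk_idn_arr[unfolded sk]
  note conv = D.unary_cmp D.unary_tns D.unary_al D.unary_la D.unary_ro D.unary_idn
  note [simp] = cmp tns al ro idn conv
  have inj: "f = g \<longleftrightarrow> unary f = unary g" for f g :: "'p \<times> 'p \<times> 'n"
    by (simp add: unary_def prod_eq_iff)
  have N: "sk_cmp D.K (sk_f2 C.K D.K G (cod f) (cod g)) (sk_tns D.K (sk_map G f) (sk_map G g))
        = sk_cmp D.K (sk_map G (sk_tns C.K f g)) (sk_f2 C.K D.K G (fst f) (fst g))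
      \<longleftrightarrow> sh_sb D (sh_sb D (lax_t G (cod f) (cod g)) 0 (FA G (unary f))) 1 (FA G (unary g))
        = sh_sb D (FA G (C.L.tn (unary f) (unary g))) 0 (lax_t G (fst f) (fst g))"
    if [simp]: "f \<in> sk_arr C" "g \<in> sk_arr C" for f g
  proof -
    have [simp]: "fst f \<in> Ob C" "cod f \<in> Ob C" "fst g \<in> Ob C" "cod g \<in> Ob C"
      using CK.sk_ObD[unfolded sk] by auto
    have [simp]: "sk_tns C.K f g \<in> sk_arr C" using CK.sk_tns_arr[unfolded sk] by simp
    show ?thesis
      unfolding inj using D.L.tensor_square_iff[OF un un un un un,
          of "sk_map G f" "FOb G (fst f)" "FOb G (cod f)" "sk_map G g" "FOb G (fst g)" "FOb G (cod g)"
          "sk_f2 C.K D.K G (fst f) (fst g)" "FOb G (tobj r (fst f) (fst g))"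
          "sk_f2 C.K D.K G (cod f) (cod g)" "FOb G (tobj r (cod f) (cod g))" "sk_map G (sk_tns C.K f g)"]
      by (simp add: lax_t_def f2 FA flip: C.unary_tns)
  qed
  have A: "sk_cmp D.K (sk_map G (sk_al C.K a b c)) (sk_cmp D.K (sk_f2 C.K D.K G (tobj r a b) c)
          (sk_tns D.K (sk_f2 C.K D.K G a b) (sk_idn D (FOb G c))))
        = sk_cmp D.K (sk_f2 C.K D.K G a (tobj r b c)) (sk_cmp D.K
            (sk_tns D.K (sk_idn D (FOb G a)) (sk_f2 C.K D.K G b c)) (sk_al D.K (FOb G a) (FOb G b) (FOb G c)))
      \<longleftrightarrow> sh_sb D (sh_sb D (FA G (C.L.al a b c)) 0 (lax_t G (tobj r a b) c)) 0 (lax_t G a b)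
        = sh_sb D (lax_t G a (tobj r b c)) 1 (lax_t G b c)"
    if [simp]: "a \<in> Ob C" "b \<in> Ob C" "c \<in> Ob C" for a b c
  proof -
    have [simp]: "sk_al C.K a b c \<in> sk_arr C" using CK.sk_al_arr[unfolded sk] by simp
    show ?thesis
      unfolding inj using D.L.hexagon_iff[OF un un un un un,
          of "sk_f2 C.K D.K G a b" "FOb G a" "FOb G b" "FOb G (tobj r a b)"
          "sk_f2 C.K D.K G (tobj r a b) c" "FOb G c" "FOb G (tobj r (tobj r a b) c)"
          "sk_f2 C.K D.K G b c" "FOb G (tobj r b c)"
          "sk_f2 C.K D.K G a (tobj r b c)" "FOb G (tobj r a (tobj r b c))" "sk_map G (sk_al C.K a b c)"]
      by (simp add: lax_t_def f2 FA flip: C.unary_al)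
  qed
  have L: "sk_cmp D.K (sk_map G (sk_la C.K a)) (sk_cmp D.K (sk_f2 C.K D.K G (uobj r) a)
          (sk_tns D.K (sk_f0 C.K D.K G) (sk_idn D (FOb G a)))) = sk_la D.K (FOb G a)
      \<longleftrightarrow> sh_sb D (sh_sb D (FA G (C.L.la a)) 0 (lax_t G (uobj r) a)) 0 (lax_v G) = sh_idn D (FOb G a)"
    if [simp]: "a \<in> Ob C" for a
  proof -
    have [simp]: "sk_la C.K a \<in> sk_arr C" using CK.sk_la_arr[unfolded sk] by simp
    show ?thesis
      unfolding inj using D.L.left_unit_iff[OF un un un,
          of "sk_f0 C.K D.K G" "FOb G (uobj r)" "sk_f2 C.K D.K G (uobj r) a" "FOb G a"
          "FOb G (tobj r (uobj r) a)" "sk_map G (sk_la C.K a)"]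
      by (simp add: lax_t_def lax_v_def f2 f0 FA flip: C.unary_la)
  qed
  have R: "sk_cmp D.K (sk_f2 C.K D.K G a (uobj r)) (sk_cmp D.K
          (sk_tns D.K (sk_idn D (FOb G a)) (sk_f0 C.K D.K G)) (sk_ro D.K (FOb G a))) = sk_map G (sk_ro C.K a)
      \<longleftrightarrow> sh_sb D (lax_t G a (uobj r)) 1 (lax_v G) = FA G (C.L.ro a)"
    if [simp]: "a \<in> Ob C" for a
    unfolding inj using D.L.right_unit_eq[OF un un,
        of "sk_f0 C.K D.K G" "FOb G (uobj r)" "sk_f2 C.K D.K G a (uobj r)" "FOb G a"
        "FOb G (tobj r a (uobj r))"]
    by (simp add: lax_t_def lax_v_def f2 f0 FA flip: C.unary_ro)
  show ?thesis
    unfolding lax_monoidal_arrows[OF C.skew_monoidal_K D.skew_monoidal_K] lax_arrows_def sk C.K_sel D.K_sel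
    using typed by (simp add: N A L R)
qed

end


section \<open>The functor \<open>K\<close> is fully faithful\<close>

lemma SkMon_sel:
  "C \<in> Ob SkMon_ln \<longleftrightarrow> skew_monoidal C \<and> left_normal C"
  "F \<in> Hom SkMon_ln C D \<longleftrightarrow> lax_monoidal C D F \<and> laxfun_ext C F"
  by (simp_all add: SkMon_ln_def)

context short_lr_pair
begin

lemma lift_morphism:
  "sh_morphism C D F \<Longrightarrow> sh_multi_morphism C D (FOb F) (lift F)"
  by (rule multi_morphism_lift) unfold_locales

lemma FA_lift:
  assumes F: "sh_morphism C D F" and G: "FOb G = FOb F" "FHom G = FHom F"
    and p: "p \<in> sh_arr C" "fst p = [a]"
  shows "FA G p = lift F p"
  using F p G by (cases p) (auto simp: sh_morphism_def FA_def lift_def sh_arr_iff C.unary_hom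
      in_lists_conv_set)

lemma f2_arr:
  "lax_typed G \<Longrightarrow> a \<in> Ob C \<Longrightarrow> b \<in> Ob C
    \<Longrightarrow> f2 G a b \<in> D.L.hom [tobj s (FOb G a) (FOb G b)] (FOb G (tobj r a b))"
  by (auto simp: f2_def lax_typed_def is_functor_def intro!: D.un_hom)

lemma f0_arr: "lax_typed G \<Longrightarrow> f0 G \<in> D.L.hom [uobj s] (FOb G (uobj r))"
  by (auto simp: f0_def lax_typed_def is_functor_def intro!: D.un_hom)

text \<open>The classifiers of \<open>D\<close> being universal, \<open>F0\<close> and \<open>F2\<close> can be recovered from \<open>lax_v\<close> and \<open>lax_t\<close>.\<close>

lemma lax_eqI:
  assumes G: "lax_typed G" "laxfun_ext C.K G" and G': "lax_typed G'" "laxfun_ext C.K G'"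
    and eq: "FOb G = FOb G'" "FHom G = FHom G'" "lax_v G = lax_v G'"
      "\<And>a b. a \<in> Ob C \<Longrightarrow> b \<in> Ob C \<Longrightarrow> lax_t G a b = lax_t G' a b"
  shows "G = G'"
proof (intro laxfun.equality HOL.ext)
  have FO: "FOb G a \<in> Ob D" if "a \<in> Ob C" for a
    using G that by (simp add: lax_typed_def is_functor_def)
  have "f0 G = f0 G'"
    by (rule D.L.u_inj1[of _ _ "FOb G (uobj r)"])
      (use eq(1,3) f0_arr[OF G(1)] f0_arr[OF G'(1)] in \<open>simp_all add: lax_v_def\<close>)
  then show "F0 G = F0 G'" by (simp add: f0_def)
  fix a b
  show "F2 G a b = F2 G' a b"
  proof (cases "a \<in> Ob C \<and> b \<in> Ob C")
    case True
    have "f2 G a b = f2 G' a b"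
      by (rule D.L.th_inj1[of _ "FOb G a" "FOb G b" _ "FOb G (tobj r a b)"])
        (use True eq(1) eq(4)[of a b] f2_arr[OF G(1), of a b] f2_arr[OF G'(1), of a b] FO
          in \<open>simp_all add: lax_t_def\<close>)
    then show ?thesis by (simp add: f2_def)
  next
    case False
    then show ?thesis using G(2) G'(2) by (auto simp: laxfun_ext_def)
  qed
qed (use eq in auto)

text \<open>The maps \<open>F0\<close> and \<open>F2\<close> of \<open>K F\<close> are chosen such that \<open>lax_v\<close> and \<open>lax_t\<close> are the images under \<open>F\<close>
  of the classifiers of \<open>C\<close>.\<close>

lemma K_mor:
  assumes F: "sh_morphism C D F" "shmor_ext C F"
  defines "G \<equiv> K_mor C r D s F"
  shows "lax_typed G" "laxfun_ext C.K G" "lax_v G = lift F ([], uobj r, umap r)"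
    "\<And>a b. a \<in> Ob C \<Longrightarrow> b \<in> Ob C \<Longrightarrow> lax_t G a b = lift F (C.thA a b)"
proof -
  interpret E: multi_morphism "Ob C" "sh_arr C" fst cod "sh_idn C" "sh_sb C" False
    "Ob D" "sh_arr D" fst cod "sh_idn D" "sh_sb D" "FOb F" "lift F"
    by (rule lift_morphism) (rule F)
  have O [simp]: "FOb G = FOb F" "FHom G = FHom F" by (simp_all add: G_def K_mor_def)
  have FO [simp]: "FOb F a \<in> Ob D" if "a \<in> Ob C" for a using that by (rule E.\<phi>_Obj)
  have F2: "F2 G a b \<in> Hom D (tobj s (FOb F a) (FOb F b)) (FOb F (tobj r a b))"
    "sh_sb D ([tobj s (FOb F a) (FOb F b)], FOb F (tobj r a b), F2 G a b) 0 (D.thA (FOb F a) (FOb F b))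
      = lift F (C.thA a b)"
    if [simp]: "a \<in> Ob C" "b \<in> Ob C" for a b
  proof -
    let ?x = "tobj s (FOb F a) (FOb F b)" and ?y = "FOb F (tobj r a b)"
    let ?P = "\<lambda>h. h \<in> Hom D ?x ?y \<and> post D [FOb F a, FOb F b] ?x ?y h (theta s (FOb F a) (FOb F b))
        = FM F [a, b] (tobj r a b) (theta r a b)"
    have ex: "?P h \<longleftrightarrow> ([?x], ?y, h) \<in> D.L.hom [?x] ?y \<and>
        sh_sb D ([?x], ?y, h) 0 (D.thA (FOb F a) (FOb F b)) = lift F (C.thA a b)" for h
      using D.theta_in[of "FOb F a" "FOb F b"]
      by (auto simp: D.L.hom_iff sh_sb_def lift_def D.subst_post sh_arr_iff D.unary_hom)
    have "lift F (C.thA a b) \<in> sh_arr D" using E.E_Arr C.theta_in by simp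
    then have "\<exists>!h. h \<in> D.L.hom [?x] ?y \<and> sh_sb D h 0 (D.thA (FOb F a) (FOb F b)) = lift F (C.thA a b)"
      using D.L.th_ex[of "lift F (C.thA a b)" "FOb F a" "FOb F b" "[]"]
        D.L.th_inj1[of _ "FOb F a" "FOb F b" _ ?y]
      by (auto simp: D.L.hom_iff lift_def)
    from D.the_unary[OF this ex] theI'[OF this]
    have "?P (THE h. ?P h)" unfolding ex by simp
    then have "?P (F2 G a b)" by (simp add: G_def K_mor_def)
    then show "F2 G a b \<in> Hom D ?x ?y"
      "sh_sb D ([?x], ?y, F2 G a b) 0 (D.thA (FOb F a) (FOb F b)) = lift F (C.thA a b)"
      unfolding ex by (auto simp: D.L.hom_iff)
  qed
  have F0: "F0 G \<in> Hom D (uobj s) (FOb F (uobj r))"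
    "sh_sb D ([uobj s], FOb F (uobj r), F0 G) 0 ([], uobj s, umap s) = lift F ([], uobj r, umap r)"
  proof -
    let ?x = "uobj s" and ?y = "FOb F (uobj r)"
    let ?P = "\<lambda>h. h \<in> Hom D ?x ?y \<and> post D [] ?x ?y h (umap s) = FM F [] (uobj r) (umap r)"
    have ex: "?P h \<longleftrightarrow> ([?x], ?y, h) \<in> D.L.hom [?x] ?y \<and>
        sh_sb D ([?x], ?y, h) 0 ([], uobj s, umap s) = lift F ([], uobj r, umap r)" for h
      using D.umap_in
      by (auto simp: D.L.hom_iff sh_sb_def lift_def D.subst_post sh_arr_iff D.unary_hom)
    have "lift F ([], uobj r, umap r) \<in> sh_arr D" using E.E_Arr C.umap_in by simp
    then have "\<exists>!h. h \<in> D.L.hom [?x] ?y \<and> sh_sb D h 0 ([], uobj s, umap s) = lift F ([], uobj r, umap r)"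
      using D.L.u_ex[of "lift F ([], uobj r, umap r)"] D.L.u_inj1[of _ _ ?y]
      by (auto simp: D.L.hom_iff lift_def)
    from D.the_unary[OF this ex] theI'[OF this]
    have "?P (THE h. ?P h)" unfolding ex by simp
    then have "?P (F0 G)" by (simp add: G_def K_mor_def)
    then show "F0 G \<in> Hom D ?x ?y"
      "sh_sb D ([?x], ?y, F0 G) 0 ([], uobj s, umap s) = lift F ([], uobj r, umap r)"
      unfolding ex by (auto simp: D.L.hom_iff)
  qed
  show "lax_typed G"
    using F(1) F2(1) F0(1) by (simp add: lax_typed_def sh_morphism_def is_functor_def)
  show "laxfun_ext C.K G"
    using F(2) by (auto simp: laxfun_ext_def shmor_ext_def functr_ext_def G_def K_mor_def)
  show "lax_v G = lift F ([], uobj r, umap r)"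
    using F0(2) by (simp add: lax_v_def f0_def)
  show "lax_t G a b = lift F (C.thA a b)" if "a \<in> Ob C" "b \<in> Ob C" for a b
    using F2(2)[OF that] by (simp add: lax_t_def f2_def)
qed

text \<open>By \<open>lax_monoidal_iff\<close> each axiom is the image under \<open>F\<close> of the equation that defines a tensor
  product or a constraint in \<open>C\<close>.\<close>

lemma K_mor_lax:
  assumes F: "sh_morphism C D F" "shmor_ext C F"
  shows "lax_monoidal C.K D.K (K_mor C r D s F)"
proof -
  let ?G = "K_mor C r D s F"
  interpret E: multi_morphism "Ob C" "sh_arr C" fst cod "sh_idn C" "sh_sb C" False
    "Ob D" "sh_arr D" fst cod "sh_idn D" "sh_sb D" "FOb F" "lift F"
    by (rule lift_morphism) (rule F)
  have O: "FOb ?G = FOb F" "FHom ?G = FHom F" by (simp_all add: K_mor_def)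
  note FA = FA_lift[OF F(1) O]
  note [simp] = K_mor(3,4)[OF F]
  show ?thesis
    unfolding lax_monoidal_iff[OF K_mor(1)[OF F]]
  proof (intro conjI ballI)
    fix f g assume "f \<in> sk_arr C" "g \<in> sk_arr C"
    moreover obtain a a' f' b b' g' where "f = (a, a', f')" "g = (b, b', g')" by (cases f; cases g)
    ultimately show "sh_sb D (sh_sb D (lax_t ?G (cod f) (cod g)) 0 (FA ?G (unary f))) 1 (FA ?G (unary g))
          = sh_sb D (FA ?G (C.L.tn (unary f) (unary g))) 0 (lax_t ?G (fst f) (fst g))"
      using C.L.tn_th[of "([a], a', f')" a "([b], b', g')" b]
      by (simp add: unary_def sk_arr_iff FA[of _ a] FA[of _ b] FA[of _ "tobj r a b"] C.theta_in
          flip: E.E_sb)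
  next
    fix a b c assume "a \<in> Ob C" "b \<in> Ob C" "c \<in> Ob C"
    then show "sh_sb D (sh_sb D (FA ?G (C.L.al a b c)) 0 (lax_t ?G (tobj r a b) c)) 0 (lax_t ?G a b)
          = sh_sb D (lax_t ?G a (tobj r b c)) 1 (lax_t ?G b c)"
      using C.L.al(2)[of a b c]
      by (simp add: FA[of _ "tobj r (tobj r a b) c"] C.theta_in flip: E.E_sb)
  next
    fix a assume "a \<in> Ob C"
    then show "sh_sb D (sh_sb D (FA ?G (C.L.la a)) 0 (lax_t ?G (uobj r) a)) 0 (lax_v ?G)
          = sh_idn D (FOb ?G a)"
      using C.L.la(2)[of a] O
      by (simp add: FA[of _ "tobj r (uobj r) a"] C.theta_in C.umap_in flip: E.E_sb E.E_idn)
  next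
    fix a assume "a \<in> Ob C"
    then show "sh_sb D (lax_t ?G a (uobj r)) 1 (lax_v ?G) = FA ?G (C.L.ro a)"
      by (simp add: FA[of _ a] C.theta_in C.umap_in C.L.ro_def flip: E.E_sb)
  qed
qed

lemma K_mor_faithful:
  assumes F: "sh_morphism C D F" "shmor_ext C F" and F': "sh_morphism C D F'" "shmor_ext C F'"
    and eq: "K_mor C r D s F = K_mor C r D s F'"
  shows "F = F'"
proof (rule shmor_eqI[OF _ F F'])
  show "short_multicategory C" by unfold_locales
  have O: "FOb F = FOb F'" "FHom F = FHom F'"
    using arg_cong[OF eq, of FOb] arg_cong[OF eq, of FHom] by (simp_all add: K_mor_def)
  then show "FOb F a = FOb F' a" for a by simp
  fix f assume f: "f \<in> sh_arr C"
  show "lift F f = lift F' f"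
  proof (rule multi_morphism_unique[OF C.L.lr_multi_axioms lift_morphism[OF F(1)]
        lift_morphism[OF F'(1)] _ _ _ f])
    fix f a assume "f \<in> sh_arr C" "fst f = [a]"
    then show "lift F f = lift F' f"
      using FA_lift[OF F(1), of F f a] FA_lift[OF F'(1), of F f a] O by simp
  next
    show "lift F ([], uobj r, umap r) = lift F' ([], uobj r, umap r)"
      using K_mor(3)[OF F] K_mor(3)[OF F'] eq by simp
  next
    fix a b assume "a \<in> Ob C" "b \<in> Ob C"
    then show "lift F (C.thA a b) = lift F' (C.thA a b)"
      using K_mor(4)[OF F] K_mor(4)[OF F'] eq by metis
  qed
qed

text \<open>The preimage of \<open>G\<close> is the extension of its action on unary maps along \<open>lax_t G\<close> and \<open>lax_v G\<close>.\<close>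

lemma K_mor_full:
  assumes G: "lax_monoidal C.K D.K G" "laxfun_ext C.K G"
  shows "\<exists>F. sh_morphism C D F \<and> shmor_ext C F \<and> K_mor C r D s F = G"
proof -
  have typed: "lax_typed G"
    using G(1) by (simp add: lax_monoidal_def lax_typed_def is_functor_def)
  have fn: "is_functor C D G" using typed by (simp add: lax_typed_def)
  have FO [simp]: "FOb G a \<in> Ob D" if "a \<in> Ob C" for a using fn that by (simp add: is_functor_def)
  have FH [simp]: "FHom G a b f \<in> Hom D (FOb G a) (FOb G b)"
    if "a \<in> Ob C" "b \<in> Ob C" "f \<in> Hom C a b" for a b f using fn that by (simp add: is_functor_def)
  note lax = G(1)[unfolded lax_monoidal_iff[OF typed]]
  have laxN: "sh_sb D (sh_sb D (lax_t G a' b') 0 (FA G ([a], a', f))) 1 (FA G ([b], b', g))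
      = sh_sb D (FA G (C.L.tn ([a], a', f) ([b], b', g))) 0 (lax_t G a b)"
    if "a \<in> Ob C" "a' \<in> Ob C" "b \<in> Ob C" "b' \<in> Ob C" "f \<in> Hom C a a'" "g \<in> Hom C b b'"
    for a a' b b' f g
    using conjunct1[OF lax, rule_format, of "(a, a', f)" "(b, b', g)"] that
    by (simp add: unary_def sk_arr_iff)
  have f2 [simp]: "f2 G a b \<in> sh_arr D" "fst (f2 G a b) = [tobj s (FOb G a) (FOb G b)]"
    "cod (f2 G a b) = FOb G (tobj r a b)" if "a \<in> Ob C" "b \<in> Ob C" for a b
    using f2_arr[OF typed that] by (auto simp: D.L.hom_iff)
  have f0 [simp]: "f0 G \<in> sh_arr D" "fst (f0 G) = [uobj s]" "cod (f0 G) = FOb G (uobj r)"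
    using f0_arr[OF typed] by (auto simp: D.L.hom_iff)
  have un: "p = ([a], cod p, mor p) \<and> mor p \<in> Hom C a (cod p) \<and> a \<in> Ob C \<and> cod p \<in> Ob C"
    if "p \<in> sh_arr C" "fst p = [a]" for p a
    using that by (cases p) (auto simp: sh_arr_iff C.unary_hom in_lists_conv_set)
  interpret X: extension_data "Ob C" "sh_arr C" fst cod "sh_idn C" "sh_sb C" False
    "tobj r" C.thA "uobj r" "([], uobj r, umap r)" "Ob D" "sh_arr D" fst cod "sh_idn D" "sh_sb D"
    "FOb G" "FA G" "lax_t G" "lax_v G"
  proof
    fix p a assume "p \<in> sh_arr C" "fst p = [a]"
    then show "FA G p \<in> sh_arr D" "fst (FA G p) = [FOb G a]" "cod (FA G p) = FOb G (cod p)"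
      using un[of p a] by (auto simp: FA_def)
  next
    fix a assume "a \<in> Ob C"
    then show "FA G (sh_idn C a) = sh_idn D (FOb G a)"
      using fn by (simp add: FA_def sh_idn_def is_functor_def)
  next
    fix f g a assume "f \<in> sh_arr C" "fst f = [a]" "g \<in> sh_arr C" "fst g = [cod f]"
    then obtain b c f' g' where fg: "f = ([a], b, f')" "g = ([b], c, g')" "a \<in> Ob C" "b \<in> Ob C" "c \<in> Ob C"
        "f' \<in> Hom C a b" "g' \<in> Hom C b c"
      using un[of f a] un[of g "cod f"] by metis
    have "FHom G a c (Comp C a b c g' f')
        = Comp D (FOb G a) (FOb G b) (FOb G c) (FHom G b c g') (FHom G a b f')"
      using fn fg unfolding is_functor_def by blast
    then show "FA G (sh_sb C g 0 f) = sh_sb D (FA G g) 0 (FA G f)"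
      using fg by (simp add: FA_def flip: C.Comp_arr D.Comp_arr)
  next
    fix p a c k
    assume p: "p \<in> sh_arr C" "fst p = [a]" "c \<in> Ob C" and k: "k \<in> sh_arr C" "fst k = [tobj r a c]"
      "cod k = tobj r (cod p) c" "sh_sb C k 0 (C.thA a c) = sh_sb C (C.thA (cod p) c) 0 p"
    note u = un[OF p(1,2)]
    \<comment> \<open>The characteristic equation of \<open>k\<close> identifies it, here with a tensor product, so that an axiom of \<open>G\<close> applies.\<close>
    have "k = C.L.tn p (sh_idn C c)"
      by (rule C.L.th_inj1[of _ a c _ "tobj r (cod p) c"])
        (use p k u C.L.tn_th_left[of p a c] in \<open>auto simp: C.L.hom_iff\<close>)
    moreover have "sh_sb D (sh_sb D (lax_t G (cod p) c) 0 (FA G ([a], cod p, mor p))) 1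
        (FA G ([c], c, Idn C c))
        = sh_sb D (FA G (C.L.tn ([a], cod p, mor p) ([c], c, Idn C c))) 0 (lax_t G a c)"
      using p u by (intro laxN) auto
    moreover have "FA G (sh_idn C c) = sh_idn D (FOb G c)"
      using fn p by (simp add: FA_def sh_idn_def is_functor_def)
    ultimately have "sh_sb D (FA G k) 0 (lax_t G a c)
        = sh_sb D (sh_sb D (lax_t G (cod p) c) 0 (FA G p)) 1 (sh_idn D (FOb G c))"
      using u by (simp add: sh_idn_def)
    moreover have "FA G p \<in> sh_arr D" "fst (FA G p) = [FOb G a]" "cod (FA G p) = FOb G (cod p)"
      using u[THEN conjunct2] p(2) by (simp_all add: FA_def)
    ultimately show "sh_sb D (FA G k) 0 (lax_t G a c) = sh_sb D (lax_t G (cod p) c) 0 (FA G p)"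
      using p u by (simp add: lax_t_def D.theta_in)
  next
    fix p a c k
    assume p: "p \<in> sh_arr C" "fst p = [c]" "a \<in> Ob C" and k: "k \<in> sh_arr C" "fst k = [tobj r a c]"
      "cod k = tobj r a (cod p)" "sh_sb C k 0 (C.thA a c) = sh_sb C (C.thA a (cod p)) 1 p"
    note u = un[OF p(1,2)]
    have "k = C.L.tn (sh_idn C a) p"
      by (rule C.L.th_inj1[of _ a c _ "tobj r a (cod p)"])
        (use p k u C.L.tn_th_right[of p c a] in \<open>auto simp: C.L.hom_iff\<close>)
    moreover have "sh_sb D (sh_sb D (lax_t G a (cod p)) 0 (FA G ([a], a, Idn C a))) 1
        (FA G ([c], cod p, mor p))
        = sh_sb D (FA G (C.L.tn ([a], a, Idn C a) ([c], cod p, mor p))) 0 (lax_t G a c)"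
      using p u by (intro laxN) auto
    moreover have "FA G (sh_idn C a) = sh_idn D (FOb G a)"
      using fn p by (simp add: FA_def sh_idn_def is_functor_def)
    ultimately have "sh_sb D (FA G k) 0 (lax_t G a c)
        = sh_sb D (sh_sb D (lax_t G a (cod p)) 0 (sh_idn D (FOb G a))) 1 (FA G p)"
      using u by (simp add: sh_idn_def)
    then show "sh_sb D (FA G k) 0 (lax_t G a c) = sh_sb D (lax_t G a (cod p)) 1 (FA G p)"
      using p u by (simp add: lax_t_def D.theta_in)
  next
    fix a b c k
    assume abc: "a \<in> Ob C" "b \<in> Ob C" "c \<in> Ob C" and k: "k \<in> sh_arr C"
      "fst k = [tobj r (tobj r a b) c]" "cod k = tobj r a (tobj r b c)"
      "sh_sb C (sh_sb C k 0 (C.thA (tobj r a b) c)) 0 (C.thA a b) = sh_sb C (C.thA a (tobj r b c)) 1 (C.thA b c)"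
    have "k = C.L.al a b c"
      by (rule C.L.th_th_inj[of _ a b c _ "tobj r a (tobj r b c)"])
        (use abc k C.L.al(2)[of a b c] in \<open>auto simp: C.L.hom_iff\<close>)
    then show "sh_sb D (sh_sb D (FA G k) 0 (lax_t G (tobj r a b) c)) 0 (lax_t G a b)
      = sh_sb D (lax_t G a (tobj r b c)) 1 (lax_t G b c)"
      using lax abc by simp
  next
    fix a k
    assume a: "a \<in> Ob C" and k: "k \<in> sh_arr C" "fst k = [tobj r (uobj r) a]" "cod k = a"
      "sh_sb C (sh_sb C k 0 (C.thA (uobj r) a)) 0 ([], uobj r, umap r) = sh_idn C a"
    have "k = C.L.la a"
      by (rule C.L.th_u_inj[of _ a _ a]) (use a k C.L.la(2)[of a] in \<open>auto simp: C.L.hom_iff\<close>)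
    then show "sh_sb D (sh_sb D (FA G k) 0 (lax_t G (uobj r) a)) 0 (lax_v G) = sh_idn D (FOb G a)"
      using lax a by simp
  next
    fix a assume "a \<in> Ob C"
    then show "FA G (sh_sb C (C.thA a (uobj r)) 1 ([], uobj r, umap r))
        = sh_sb D (lax_t G a (uobj r)) 1 (lax_v G)"
      using lax by (simp add: C.L.ro_def)
  qed (auto simp: lax_t_def lax_v_def D.theta_in D.umap_in)
  have sC: "short_multicategory C" and sD: "short_multicategory D" by unfold_locales
  let ?F = "mor_of C (FOb G) X.ext"
  note F = mor_of[OF sC sD X.ext_morphism]
  have ext: "functr_ext C G" using G(2) by (simp add: laxfun_ext_def functr_ext_def)
  have O: "FOb ?F = FOb G"
    using ext by (auto simp: mor_of_def shmor_restrict_def functr_ext_def fun_eq_iff)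
  have H: "FHom ?F = FHom G"
  proof (intro HOL.ext)
    fix a b f
    show "FHom ?F a b f = FHom G a b f"
    proof (cases "a \<in> Ob C \<and> b \<in> Ob C \<and> f \<in> Hom C a b")
      case True
      then show ?thesis
        using X.ext_unary[of "([a], b, f)" a] by (simp add: mor_of_def shmor_restrict_def FA_def)
    next
      case False
      then show ?thesis using ext by (auto simp: mor_of_def shmor_restrict_def functr_ext_def)
    qed
  qed
  have "K_mor C r D s ?F = G"
  proof (rule lax_eqI[OF K_mor(1)[OF F(1,2)] K_mor(2)[OF F(1,2)] typed G(2)])
    show "FOb (K_mor C r D s ?F) = FOb G" "FHom (K_mor C r D s ?F) = FHom G"
      using O H by (simp_all add: K_mor_def)
    show "lax_v (K_mor C r D s ?F) = lax_v G"
      using K_mor(3)[OF F(1,2)] F(3) C.umap_in X.ext_u_eq by simp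
    show "lax_t (K_mor C r D s ?F) a b = lax_t G a b" if "a \<in> Ob C" "b \<in> Ob C" for a b
      using K_mor(4)[OF F(1,2) that] F(3) C.theta_in[OF that] X.ext_th_eq[OF that] by simp
  qed
  then show ?thesis using F(1,2) by blast
qed

end

lemma short_lr_pairI: "short_lr C r \<Longrightarrow> short_lr D s \<Longrightarrow> short_lr_pair C r D s"
  by (simp add: short_lr_pair_def)

lemma K_mor_Idn:
  assumes C: "short_lr C r"
  shows "K_mor C r C r (Idn ShMulti_lr C) = Idn SkMon_ln (K_obj C r)"
proof -
  interpret P: short_lr_pair C r C r using C by (simp add: short_lr_pairI)
  have sC: "short_multicategory C" by unfold_locales
  let ?F = "Idn ShMulti_lr C" and ?G = "Idn SkMon_ln (K_obj C r)"
  note F = ShMulti_id_lift[OF sC]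
  have O: "FOb ?G a = a" if "a \<in> Ob C" for a
    using that by (simp add: SkMon_ln_def laxfun_restrict_def)
  have H: "FHom ?G a b f = f" if "a \<in> Ob C" "b \<in> Ob C" "f \<in> Hom C a b" for a b f
    using that by (simp add: SkMon_ln_def laxfun_restrict_def)
  have F0: "F0 ?G = Idn C (uobj r)" and F2: "\<And>a b. a \<in> Ob C \<Longrightarrow> b \<in> Ob C \<Longrightarrow> F2 ?G a b = Idn C (tobj r a b)"
    by (simp_all add: SkMon_ln_def laxfun_restrict_def)
  have typed: "P.lax_typed ?G"
    by (simp add: P.lax_typed_def is_functor_def O H F0 F2)
  show ?thesis
  proof (rule P.lax_eqI[OF P.K_mor(1)[OF F(1,2)] P.K_mor(2)[OF F(1,2)] typed])
    show "laxfun_ext (K_obj C r) ?G"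
      by (simp add: laxfun_ext_def functr_ext_def SkMon_ln_def laxfun_restrict_def)
    show "FOb (K_mor C r C r ?F) = FOb ?G" "FHom (K_mor C r C r ?F) = FHom ?G"
      by (auto simp: K_mor_def SkMon_ln_def ShMulti_lr_def laxfun_restrict_def shmor_restrict_def
          fun_eq_iff)
    show "P.lax_v (K_mor C r C r ?F) = P.lax_v ?G"
      using P.K_mor(3)[OF F(1,2)] F(4)[OF P.C.umap_in]
      by (simp add: P.lax_v_def P.f0_def F0 O P.C.Idn_arr P.C.umap_in)
    show "P.lax_t (K_mor C r C r ?F) a b = P.lax_t ?G a b" if [simp]: "a \<in> Ob C" "b \<in> Ob C" for a b
      using P.K_mor(4)[OF F(1,2), of a b] F(4)[OF P.C.theta_in, of a b]
      by (simp add: P.lax_t_def P.f2_def F2 O P.C.Idn_arr P.C.theta_in)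
  qed
qed

text \<open>By \<open>lax_eqI\<close> it suffices that both sides send the classifiers of \<open>C\<close> to their images under the
  composite morphism.\<close>

lemma K_mor_Comp:
  assumes C: "short_lr C r" and D: "short_lr D s" and D': "short_lr D' s'"
    and F: "sh_morphism C D F" "shmor_ext C F" and F': "sh_morphism D D' F'" "shmor_ext D F'"
  shows "K_mor C r D' s' (Comp ShMulti_lr C D D' F' F)
    = Comp SkMon_ln (K_obj C r) (K_obj D s) (K_obj D' s') (K_mor D s D' s' F') (K_mor C r D s F)"
proof -
  interpret P: short_lr_pair C r D s using C D by (simp add: short_lr_pairI)
  interpret Q: short_lr_pair D s D' s' using D D' by (simp add: short_lr_pairI)
  interpret R: short_lr_pair C r D' s' using C D' by (simp add: short_lr_pairI)
  have S: "short_multicategory C" "short_multicategory D" "short_multicategory D'" by unfold_locales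
  interpret E': multi_morphism "Ob D" "sh_arr D" fst cod "sh_idn D" "sh_sb D" False
    "Ob D'" "sh_arr D'" fst cod "sh_idn D'" "sh_sb D'" "FOb F'" "lift F'"
    by (rule Q.lift_morphism) (rule F')
  let ?FF = "Comp ShMulti_lr C D D' F' F"
  let ?G = "K_mor C r D s F" and ?G' = "K_mor D s D' s' F'"
  let ?M = "Comp SkMon_ln (K_obj C r) (K_obj D s) (K_obj D' s') ?G' ?G"
  note FF = ShMulti_comp_lift[OF S F(1) F'(1)]
  have KO [simp]: "FOb ?G = FOb F" "FHom ?G = FHom F" "FOb ?G' = FOb F'" "FHom ?G' = FHom F'"
    by (simp_all add: K_mor_def)
  have FO [simp]: "FOb F a \<in> Ob D" if "a \<in> Ob C" for a
    using F(1) that by (simp add: sh_morphism_def is_functor_def)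
  have FO' [simp]: "FOb F' a \<in> Ob D'" if "a \<in> Ob D" for a
    using F'(1) that by (simp add: sh_morphism_def is_functor_def)
  have FH' [simp]: "FHom F' a b f \<in> Hom D' (FOb F' a) (FOb F' b)"
    if "a \<in> Ob D" "b \<in> Ob D" "f \<in> Hom D a b" for a b f
    using F'(1) that by (simp add: sh_morphism_def is_functor_def)
  have MO: "FOb ?M = FOb ?FF" and MH: "FHom ?M = FHom ?FF"
    by (auto simp: SkMon_ln_def ShMulti_lr_def laxfun_restrict_def shmor_restrict_def fun_eq_iff)
  have MOa: "FOb ?M a = FOb F' (FOb F a)" if "a \<in> Ob C" for a
    using MO FF(3)[OF that] by simp
  note t = P.K_mor(1)[OF F, unfolded P.lax_typed_def] and t' = Q.K_mor(1)[OF F', unfolded Q.lax_typed_def]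
  have f2: "F2 ?G a b \<in> Hom D (tobj s (FOb F a) (FOb F b)) (FOb F (tobj r a b))"
    if "a \<in> Ob C" "b \<in> Ob C" for a b using t that by simp
  have f2': "F2 ?G' a b \<in> Hom D' (tobj s' (FOb F' a) (FOb F' b)) (FOb F' (tobj s a b))"
    if "a \<in> Ob D" "b \<in> Ob D" for a b using t' that by simp
  have f0: "F0 ?G \<in> Hom D (uobj s) (FOb F (uobj r))" using t by simp
  have f0': "F0 ?G' \<in> Hom D' (uobj s') (FOb F' (uobj s))" using t' by simp
  have M0: "F0 ?M = Comp D' (uobj s') (FOb F' (uobj s)) (FOb F' (FOb F (uobj r)))
      (FHom F' (uobj s) (FOb F (uobj r)) (F0 ?G)) (F0 ?G')"
    by (simp add: SkMon_ln_def laxfun_restrict_def)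
  have M2: "F2 ?M a b = Comp D' (tobj s' (FOb F' (FOb F a)) (FOb F' (FOb F b)))
                (FOb F' (tobj s (FOb F a) (FOb F b))) (FOb F' (FOb F (tobj r a b)))
                (FHom F' (tobj s (FOb F a) (FOb F b)) (FOb F (tobj r a b)) (F2 ?G a b))
                (F2 ?G' (FOb F a) (FOb F b))" if "a \<in> Ob C" "b \<in> Ob C" for a b
    using that by (simp add: SkMon_ln_def laxfun_restrict_def)
  have fn: "is_functor C D' ?M"
    using FF(1) by (simp add: sh_morphism_def is_functor_def MO MH)
  have typed: "R.lax_typed ?M"
    using fn by (simp add: R.lax_typed_def M0 M2 MOa f0 f0' f2 f2')
  show ?thesis
  proof (rule R.lax_eqI[OF R.K_mor(1)[OF FF(1,2)] R.K_mor(2)[OF FF(1,2)] typed])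
    show "laxfun_ext (K_obj C r) ?M"
      by (simp add: laxfun_ext_def functr_ext_def SkMon_ln_def laxfun_restrict_def)
    show "FOb (K_mor C r D' s' ?FF) = FOb ?M" "FHom (K_mor C r D' s' ?FF) = FHom ?M"
      by (simp_all add: MO MH) (simp_all add: K_mor_def)
    have l0: "lift F' (P.f0 ?G) = ([FOb F' (uobj s)], FOb F' (FOb F (uobj r)),
        FHom F' (uobj s) (FOb F (uobj r)) (F0 ?G))"
      using Q.FA_lift[OF F'(1) refl refl, of "P.f0 ?G" "uobj s"] f0
      by (simp add: P.f0_def Q.FA_def)
    have "R.f0 ?M = sh_sb D' (lift F' (P.f0 ?G)) 0 (Q.f0 ?G')"
      unfolding l0 by (simp add: R.f0_def M0 MOa Q.f0_def f0 f0' Q.D.Comp_arr)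
    then have "R.lax_v ?M = sh_sb D' (lift F' (P.f0 ?G)) 0 (Q.lax_v ?G')"
      unfolding R.lax_v_def Q.lax_v_def
      using Q.D.L.seq[of "lift F' (P.f0 ?G)" "Q.f0 ?G'" "([], uobj s', umap s')" 0 0] f0 f0'
      by (simp add: l0 Q.f0_def Q.D.umap_in)
    also have "\<dots> = lift F' (P.lax_v ?G)"
      using E'.E_sb[of "P.f0 ?G" "([], uobj s, umap s)" 0] f0
      by (simp add: Q.K_mor(3)[OF F'] P.lax_v_def P.f0_def P.D.umap_in)
    finally show "R.lax_v (K_mor C r D' s' ?FF) = R.lax_v ?M"
      using R.K_mor(3)[OF FF(1,2)] FF(4)[OF P.C.umap_in] by (simp add: P.K_mor(3)[OF F])
    fix a b assume [simp]: "a \<in> Ob C" "b \<in> Ob C"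
    have l2: "lift F' (P.f2 ?G a b) = ([FOb F' (tobj s (FOb F a) (FOb F b))], FOb F' (FOb F (tobj r a b)),
        FHom F' (tobj s (FOb F a) (FOb F b)) (FOb F (tobj r a b)) (F2 ?G a b))"
      using Q.FA_lift[OF F'(1) refl refl, of "P.f2 ?G a b" "tobj s (FOb F a) (FOb F b)"] f2[of a b]
      by (simp add: P.f2_def Q.FA_def)
    have "R.f2 ?M a b = sh_sb D' (lift F' (P.f2 ?G a b)) 0 (Q.f2 ?G' (FOb F a) (FOb F b))"
      unfolding l2 by (simp add: R.f2_def M2 MOa Q.f2_def f2 f2' Q.D.Comp_arr)
    then have "R.lax_t ?M a b = sh_sb D' (lift F' (P.f2 ?G a b)) 0 (Q.lax_t ?G' (FOb F a) (FOb F b))"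
      unfolding R.lax_t_def Q.lax_t_def
      using Q.D.L.seq[of "lift F' (P.f2 ?G a b)" "Q.f2 ?G' (FOb F a) (FOb F b)"
          "Q.D.thA (FOb F' (FOb F a)) (FOb F' (FOb F b))" 0 0] f2[of a b] f2'[of "FOb F a" "FOb F b"]
      by (simp add: l2 Q.f2_def Q.D.theta_in MOa)
    also have "\<dots> = lift F' (P.lax_t ?G a b)"
      using E'.E_sb[of "P.f2 ?G a b" "P.D.thA (FOb F a) (FOb F b)" 0] f2[of a b]
      by (simp add: Q.K_mor(4)[OF F'] P.lax_t_def P.f2_def P.D.theta_in)
    finally show "R.lax_t (K_mor C r D' s' ?FF) a b = R.lax_t ?M a b"
      using R.K_mor(4)[OF FF(1,2), of a b] FF(4)[OF P.C.theta_in, of a b]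
      by (simp add: P.K_mor(4)[OF F])
  qed
qed


section \<open>The category of left normal skew monoidal categories\<close>

text \<open>Composites and identities, not yet restricted to the carriers.\<close>

definition lax_comp ::
  "('o, 'm) skmon \<Rightarrow> ('p, 'n) skmon \<Rightarrow> ('q, 'k) skmon \<Rightarrow> ('p, 'n, 'q, 'k) laxfun
    \<Rightarrow> ('o, 'm, 'p, 'n) laxfun \<Rightarrow> ('o, 'm, 'q, 'k) laxfun"
where
  "lax_comp C D E G F = \<lparr>FOb = (\<lambda>a. FOb G (FOb F a)),
     FHom = (\<lambda>a b f. FHom G (FOb F a) (FOb F b) (FHom F a b f)),
     F0 = mor (sk_cmp E (sk_map G (sk_f0 C D F)) (sk_f0 D E G)),
     F2 = (\<lambda>a b. mor (sk_cmp E (sk_map G (sk_f2 C D F a b)) (sk_f2 D E G (FOb F a) (FOb F b))))\<rparr>"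

lemma lax_comp_simps [simp]:
  "FOb (lax_comp C D E G F) a = FOb G (FOb F a)"
  "sk_map (lax_comp C D E G F) f = sk_map G (sk_map F f)"
  "sk_f0 C E (lax_comp C D E G F) = sk_cmp E (sk_map G (sk_f0 C D F)) (sk_f0 D E G)"
  "sk_f2 C E (lax_comp C D E G F) a b
    = sk_cmp E (sk_map G (sk_f2 C D F a b)) (sk_f2 D E G (FOb F a) (FOb F b))"
  by (simp_all add: lax_comp_def sk_map_def sk_f0_def sk_f2_def sk_cmp_def)

text \<open>Naturality of the structure map of \<open>G\<close> brings the images under \<open>G\<close> of the structure maps of \<open>F\<close>
  together. The axiom for \<open>F\<close> applies to them, and what remains is the axiom for \<open>G\<close>.\<close>

lemma lax_arrows_comp:
  assumes C: "skew_monoidal C" and D: "skew_monoidal D" and E: "skew_monoidal E"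
    and F: "lax_arrows C D F" and G: "lax_arrows D E G"
  shows "lax_arrows C E (lax_comp C D E G F)"
proof -
  interpret C: skew_monoidal C by fact
  interpret D: skew_monoidal D by fact
  interpret E: skew_monoidal E by fact
  note F' [simp] = lax_arrowsD(1-6)[OF F] and G' [simp] = lax_arrowsD(1-6)[OF G]
  note F7 = lax_arrowsD(7-)[OF F] and G7 = lax_arrowsD(7-)[OF G]
  let ?c = "sk_cmp E" and ?f2 = "sk_f2 C D F" and ?g2 = "sk_f2 D E G" and ?G = "sk_map G" and ?F = "sk_map F"
  let ?t = "sk_tns E" and ?i = "sk_idn E"
  show ?thesis
    unfolding lax_arrows_def lax_comp_simps
  proof (intro conjI ballI impI)
    fix f g assume [simp]: "f \<in> sk_arr C" "g \<in> sk_arr C"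
    have "?c (?c (?G (?f2 (cod f) (cod g))) (?g2 (FOb F (cod f)) (FOb F (cod g))))
        (?t (?G (?F f)) (?G (?F g)))
      = ?c (?G (?f2 (cod f) (cod g))) (?c (?g2 (cod (?F f)) (cod (?F g))) (?t (?G (?F f)) (?G (?F g))))"
      by simp
    also have "\<dots> = ?c (?G (?f2 (cod f) (cod g)))
        (?c (?G (sk_tns D (?F f) (?F g))) (?g2 (fst (?F f)) (fst (?F g))))"
      by (subst G7(1)) auto
    also have "\<dots> = ?c (?G (sk_cmp D (?f2 (cod f) (cod g)) (sk_tns D (?F f) (?F g))))
        (?g2 (FOb F (fst f)) (FOb F (fst g)))"
      by simp
    also have "\<dots> = ?c (?G (?F (sk_tns C f g)))
        (?c (?G (?f2 (fst f) (fst g))) (?g2 (FOb F (fst f)) (FOb F (fst g))))"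
      by (subst F7(1)) auto
    finally show "?c (?c (?G (?f2 (cod f) (cod g))) (?g2 (FOb F (cod f)) (FOb F (cod g))))
        (?t (?G (?F f)) (?G (?F g))) = \<dots>" .
  next
    fix a b c assume [simp]: "a \<in> Ob C" "b \<in> Ob C" "c \<in> Ob C"
    let ?a = "FOb F a" and ?b = "FOb F b" and ?d = "FOb F c"
    have "?c (?G (?F (sk_al C a b c)))
        (?c (?c (?G (?f2 (Ten C a b) c)) (?g2 (FOb F (Ten C a b)) ?d))
          (?t (?c (?G (?f2 a b)) (?g2 ?a ?b)) (?i (FOb G ?d))))
      = ?c (?G (?F (sk_al C a b c))) (?c (?G (?f2 (Ten C a b) c))
          (?c (?c (?g2 (cod (?f2 a b)) (cod (sk_idn D ?d))) (?t (?G (?f2 a b)) (?G (sk_idn D ?d))))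
            (?t (?g2 ?a ?b) (?i (FOb G ?d)))))"
      using E.sk_tns_cmp[of "?G (?f2 a b)" "?g2 ?a ?b" "?i (FOb G ?d)" "?i (FOb G ?d)"] by simp
    also have "\<dots> = ?c (?G (?F (sk_al C a b c))) (?c (?G (?f2 (Ten C a b) c))
          (?c (?c (?G (sk_tns D (?f2 a b) (sk_idn D ?d))) (?g2 (fst (?f2 a b)) (fst (sk_idn D ?d))))
            (?t (?g2 ?a ?b) (?i (FOb G ?d)))))"
      by (subst G7(1)) auto
    also have "\<dots> = ?c (?G (sk_cmp D (?F (sk_al C a b c)) (sk_cmp D (?f2 (Ten C a b) c)
          (sk_tns D (?f2 a b) (sk_idn D ?d)))))
          (?c (?g2 (Ten D ?a ?b) ?d) (?t (?g2 ?a ?b) (?i (FOb G ?d))))"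
      by simp
    also have "\<dots> = ?c (?c (?G (?f2 a (Ten C b c))) (?G (sk_tns D (sk_idn D ?a) (?f2 b c))))
          (?c (?G (sk_al D ?a ?b ?d)) (?c (?g2 (Ten D ?a ?b) ?d) (?t (?g2 ?a ?b) (?i (FOb G ?d)))))"
      by (subst F7(2)) auto
    also have "\<dots> = ?c (?G (?f2 a (Ten C b c))) (?c (?c (?G (sk_tns D (sk_idn D ?a) (?f2 b c)))
          (?g2 (fst (sk_idn D ?a)) (fst (?f2 b c))))
          (?c (?t (?i (FOb G ?a)) (?g2 ?b ?d)) (sk_al E (FOb G ?a) (FOb G ?b) (FOb G ?d))))"
      by (subst G7(2)) auto
    also have "\<dots> = ?c (?G (?f2 a (Ten C b c))) (?c (?c (?g2 (cod (sk_idn D ?a)) (cod (?f2 b c)))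
          (?t (?G (sk_idn D ?a)) (?G (?f2 b c))))
          (?c (?t (?i (FOb G ?a)) (?g2 ?b ?d)) (sk_al E (FOb G ?a) (FOb G ?b) (FOb G ?d))))"
      by (subst G7(1)) auto
    also have "\<dots> = ?c (?c (?G (?f2 a (Ten C b c))) (?g2 ?a (FOb F (Ten C b c))))
        (?c (?t (?i (FOb G ?a)) (?c (?G (?f2 b c)) (?g2 ?b ?d))) (sk_al E (FOb G ?a) (FOb G ?b) (FOb G ?d)))"
      using E.sk_tns_cmp[of "?i (FOb G ?a)" "?i (FOb G ?a)" "?G (?f2 b c)" "?g2 ?b ?d"] by simp
    finally show "?c (?G (?F (sk_al C a b c)))
        (?c (?c (?G (?f2 (Ten C a b) c)) (?g2 (FOb F (Ten C a b)) ?d))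
          (?t (?c (?G (?f2 a b)) (?g2 ?a ?b)) (?i (FOb G ?d)))) = \<dots>" .
  next
    fix a assume [simp]: "a \<in> Ob C"
    let ?a = "FOb F a" and ?f0 = "sk_f0 C D F" and ?g0 = "sk_f0 D E G"
    have "?c (?G (?F (sk_la C a))) (?c (?c (?G (?f2 (Unit C) a)) (?g2 (FOb F (Unit C)) ?a))
        (?t (?c (?G ?f0) ?g0) (?i (FOb G ?a))))
      = ?c (?G (?F (sk_la C a))) (?c (?G (?f2 (Unit C) a))
          (?c (?c (?g2 (cod ?f0) (cod (sk_idn D ?a))) (?t (?G ?f0) (?G (sk_idn D ?a))))
            (?t ?g0 (?i (FOb G ?a)))))"
      using E.sk_tns_cmp[of "?G ?f0" ?g0 "?i (FOb G ?a)" "?i (FOb G ?a)"] by simp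
    also have "\<dots> = ?c (?G (?F (sk_la C a))) (?c (?G (?f2 (Unit C) a))
          (?c (?c (?G (sk_tns D ?f0 (sk_idn D ?a))) (?g2 (fst ?f0) (fst (sk_idn D ?a))))
            (?t ?g0 (?i (FOb G ?a)))))"
      by (subst G7(1)) auto
    also have "\<dots> = ?c (?G (sk_cmp D (?F (sk_la C a)) (sk_cmp D (?f2 (Unit C) a)
          (sk_tns D ?f0 (sk_idn D ?a))))) (?c (?g2 (Unit D) ?a) (?t ?g0 (?i (FOb G ?a))))"
      by simp
    also have "\<dots> = sk_la E (FOb G ?a)"
      by (subst F7(3)) (auto simp: G7(3))
    finally show "?c (?G (?F (sk_la C a))) (?c (?c (?G (?f2 (Unit C) a)) (?g2 (FOb F (Unit C)) ?a))
        (?t (?c (?G ?f0) ?g0) (?i (FOb G ?a)))) = sk_la E (FOb G ?a)" .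
    have "?c (?c (?G (?f2 a (Unit C))) (?g2 ?a (FOb F (Unit C))))
        (?c (?t (?i (FOb G ?a)) (?c (?G ?f0) ?g0)) (sk_ro E (FOb G ?a)))
      = ?c (?G (?f2 a (Unit C))) (?c (?c (?g2 (cod (sk_idn D ?a)) (cod ?f0)) (?t (?G (sk_idn D ?a)) (?G ?f0)))
          (?c (?t (?i (FOb G ?a)) ?g0) (sk_ro E (FOb G ?a))))"
      using E.sk_tns_cmp[of "?i (FOb G ?a)" "?i (FOb G ?a)" "?G ?f0" ?g0] by simp
    also have "\<dots> = ?c (?G (?f2 a (Unit C))) (?c (?c (?G (sk_tns D (sk_idn D ?a) ?f0))
          (?g2 (fst (sk_idn D ?a)) (fst ?f0))) (?c (?t (?i (FOb G ?a)) ?g0) (sk_ro E (FOb G ?a))))"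
      by (subst G7(1)) auto
    also have "\<dots> = ?c (?G (?f2 a (Unit C))) (?c (?G (sk_tns D (sk_idn D ?a) ?f0)) (?G (sk_ro D ?a)))"
      by (subst G7(4)[symmetric]) auto
    also have "\<dots> = ?G (sk_cmp D (?f2 a (Unit C)) (sk_cmp D (sk_tns D (sk_idn D ?a) ?f0) (sk_ro D ?a)))"
      by simp
    also have "\<dots> = ?G (?F (sk_ro C a))"
      by (subst F7(4)) auto
    finally show "?c (?c (?G (?f2 a (Unit C))) (?g2 ?a (FOb F (Unit C))))
        (?c (?t (?i (FOb G ?a)) (?c (?G ?f0) ?g0)) (sk_ro E (FOb G ?a))) = ?G (?F (sk_ro C a))" .
  qed auto
qed

lemma laxfun_restrict_arrows:
  assumes "skew_monoidal C"
  shows "lax_arrows C D (laxfun_restrict C F) \<longleftrightarrow> lax_arrows C D F"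
proof -
  interpret C: skew_monoidal C by fact
  have "sk_map (laxfun_restrict C F) f = sk_map F f" if "f \<in> sk_arr C" for f
    using that by (auto simp: sk_map_def laxfun_restrict_def sk_arr_def)
  moreover have "FOb (laxfun_restrict C F) a = FOb F a" if "a \<in> Ob C" for a
    using that by (simp add: laxfun_restrict_def)
  moreover have "sk_f2 C D (laxfun_restrict C F) a b = sk_f2 C D F a b" if "a \<in> Ob C" "b \<in> Ob C" for a b
    using that by (simp add: laxfun_restrict_def sk_f2_def)
  moreover have "sk_f0 C D (laxfun_restrict C F) = sk_f0 C D F"
    by (simp add: laxfun_restrict_def sk_f0_def)
  ultimately show ?thesis by (simp add: lax_arrows_def)
qed

lemma laxfun_ext_restrict [simp]: "laxfun_ext C (laxfun_restrict C F)"
  by (simp add: laxfun_ext_def functr_ext_def laxfun_restrict_def)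

lemma laxfun_eqI:
  assumes F: "laxfun_ext C F" and G: "laxfun_ext C G"
    and "\<And>a. a \<in> Ob C \<Longrightarrow> FOb F a = FOb G a"
    and "\<And>a b f. a \<in> Ob C \<Longrightarrow> b \<in> Ob C \<Longrightarrow> f \<in> Hom C a b \<Longrightarrow> FHom F a b f = FHom G a b f"
    and "F0 F = F0 G" and "\<And>a b. a \<in> Ob C \<Longrightarrow> b \<in> Ob C \<Longrightarrow> F2 F a b = F2 G a b"
  shows "F = (G :: ('o, 'm, 'p, 'n) laxfun)"
proof (intro laxfun.equality HOL.ext)
  show "FOb F a = FOb G a" for a
    using assms by (cases "a \<in> Ob C") (auto simp: laxfun_ext_def functr_ext_def)
  show "FHom F a b f = FHom G a b f" for a b f
    using assms
    by (cases "a \<in> Ob C \<and> b \<in> Ob C \<and> f \<in> Hom C a b") (auto simp: laxfun_ext_def functr_ext_def)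
  show "F2 F a b = F2 G a b" for a b
    using assms by (cases "a \<in> Ob C \<and> b \<in> Ob C") (auto simp: laxfun_ext_def)
qed (use assms in auto)

lemma SkMon_Comp: "Comp SkMon_ln C D E G F = laxfun_restrict C (lax_comp C D E G F)"
  by (simp add: SkMon_ln_def lax_comp_def sk_cmp_def sk_map_def sk_f0_def sk_f2_def)

lemma lax_comp_sel:
  "F0 (lax_comp C D E G F) = mor (sk_cmp E (sk_map G (sk_f0 C D F)) (sk_f0 D E G))"
  "F2 (lax_comp C D E G F) a b = mor (sk_cmp E (sk_map G (sk_f2 C D F a b)) (sk_f2 D E G (FOb F a) (FOb F b)))"
  "FHom (lax_comp C D E G F) a b f = FHom G (FOb F a) (FOb F b) (FHom F a b f)"
  by (simp_all add: lax_comp_def)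

lemma laxfun_restrict_sel:
  "a \<in> Ob C \<Longrightarrow> FOb (laxfun_restrict C F) a = FOb F a"
  "a \<in> Ob C \<Longrightarrow> b \<in> Ob C \<Longrightarrow> f \<in> Hom C a b \<Longrightarrow> FHom (laxfun_restrict C F) a b f = FHom F a b f"
  "F0 (laxfun_restrict C F) = F0 F"
  "a \<in> Ob C \<Longrightarrow> b \<in> Ob C \<Longrightarrow> F2 (laxfun_restrict C F) a b = F2 F a b"
  by (simp_all add: laxfun_restrict_def)

definition lax_id :: "('o, 'm) skmon \<Rightarrow> ('o, 'm, 'o, 'm) laxfun" where
  "lax_id C = \<lparr>FOb = (\<lambda>a. a), FHom = (\<lambda>a b f. f), F0 = Idn C (Unit C),
     F2 = (\<lambda>a b. Idn C (Ten C a b))\<rparr>"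

lemma SkMon_Idn: "Idn SkMon_ln C = laxfun_restrict C (lax_id C)"
  by (simp add: SkMon_ln_def lax_id_def)

lemma lax_id_simps [simp]:
  "FOb (lax_id C) a = a" "sk_map (lax_id C) f = f" "sk_f0 C C (lax_id C) = sk_idn C (Unit C)"
  "sk_f2 C C (lax_id C) a b = sk_idn C (Ten C a b)"
  by (simp_all add: lax_id_def sk_map_def sk_f0_def sk_f2_def sk_idn_def)

lemma category_SkMon_ln: "category (SkMon_ln :: (('o, 'm) skmon, ('o, 'm, 'o, 'm) laxfun) cat)"
proof
  fix C :: "('o, 'm) skmon"
  assume "C \<in> Ob SkMon_ln"
  then interpret C: skew_monoidal C by (simp add: SkMon_sel)
  have "lax_arrows C C (lax_id C)"
    unfolding lax_arrows_def by (simp add: C.sk_la_nat)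
  then show "Idn SkMon_ln C \<in> Hom SkMon_ln C C"
    by (simp add: SkMon_sel SkMon_Idn lax_monoidal_arrows laxfun_restrict_arrows C.skew_monoidal_axioms)
next
  fix C D E :: "('o, 'm) skmon" and F G
  assume "C \<in> Ob SkMon_ln" "D \<in> Ob SkMon_ln" "E \<in> Ob SkMon_ln" "F \<in> Hom SkMon_ln C D" "G \<in> Hom SkMon_ln D E"
  then show "Comp SkMon_ln C D E G F \<in> Hom SkMon_ln C E"
    using lax_arrows_comp[of C D E F G]
    by (simp add: SkMon_sel SkMon_Comp lax_monoidal_arrows laxfun_restrict_arrows)
next
  fix C D :: "('o, 'm) skmon" and F
  assume *: "C \<in> Ob SkMon_ln" "D \<in> Ob SkMon_ln" "F \<in> Hom SkMon_ln C D"
  then interpret C: skew_monoidal C by (simp add: SkMon_sel)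
  interpret D: skew_monoidal D using * by (simp add: SkMon_sel)
  have F: "lax_arrows C D F" "laxfun_ext C F"
    using * by (simp_all add: SkMon_sel lax_monoidal_arrows)
  note F' [simp] = lax_arrowsD(1-6)[OF F(1)]
  have FH [simp]: "FHom F a b f \<in> Hom D (FOb F a) (FOb F b)" if "a \<in> Ob C" "b \<in> Ob C" "f \<in> Hom C a b" for a b f
    using F'(2)[of "(a, b, f)"] that by (simp add: sk_arr_iff sk_map_def)
  have i: "sk_map (laxfun_restrict D (lax_id D)) f = f" if "f \<in> sk_arr D" for f
    using that by (auto simp: sk_map_def laxfun_restrict_def lax_id_def sk_arr_def)
  have i2: "sk_f2 D D (laxfun_restrict D (lax_id D)) a b = sk_idn D (Ten D a b)"
    if "a \<in> Ob D" "b \<in> Ob D" for a b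
    using that by (simp add: sk_f2_def laxfun_restrict_def lax_id_def sk_idn_def)
  have i0: "sk_f0 D D (laxfun_restrict D (lax_id D)) = sk_idn D (Unit D)"
    by (simp add: sk_f0_def laxfun_restrict_def lax_id_def sk_idn_def)
  show "Comp SkMon_ln C D D (Idn SkMon_ln D) F = F"
    by (rule laxfun_eqI[of C])
      (simp_all add: F SkMon_Comp SkMon_Idn laxfun_restrict_sel lax_comp_sel i i2 i0,
        simp_all add: lax_id_def sk_f0_def sk_f2_def)
  have j0: "sk_map F (sk_f0 C C (laxfun_restrict C (lax_id C))) = sk_idn D (FOb F (Unit C))"
    using F'(3)[of "Unit C"] by (simp add: sk_f0_def laxfun_restrict_def lax_id_def sk_idn_def)
  have j2: "sk_map F (sk_f2 C C (laxfun_restrict C (lax_id C)) a b) = sk_idn D (FOb F (Ten C a b))"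
    if "a \<in> Ob C" "b \<in> Ob C" for a b
    using F'(3)[of "Ten C a b"] that by (simp add: sk_f2_def laxfun_restrict_def lax_id_def sk_idn_def)
  show "Comp SkMon_ln C C D F (Idn SkMon_ln C) = F"
    by (rule laxfun_eqI[of C])
      (simp_all add: F SkMon_Comp SkMon_Idn laxfun_restrict_sel lax_comp_sel j0 j2,
        simp_all add: lax_id_def sk_f0_def sk_f2_def)
next
  fix C D E H :: "('o, 'm) skmon" and F G K
  assume *: "C \<in> Ob SkMon_ln" "D \<in> Ob SkMon_ln" "E \<in> Ob SkMon_ln" "H \<in> Ob SkMon_ln"
    "F \<in> Hom SkMon_ln C D" "G \<in> Hom SkMon_ln D E" "K \<in> Hom SkMon_ln E H"
  then interpret C: skew_monoidal C by (simp add: SkMon_sel)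
  interpret D: skew_monoidal D using * by (simp add: SkMon_sel)
  interpret E: skew_monoidal E using * by (simp add: SkMon_sel)
  interpret H: skew_monoidal H using * by (simp add: SkMon_sel)
  have F: "lax_arrows C D F" and G: "lax_arrows D E G" and K: "lax_arrows E H K"
    using * by (simp_all add: SkMon_sel lax_monoidal_arrows)
  note [simp] = lax_arrowsD(1-6)[OF F] lax_arrowsD(1-6)[OF G] lax_arrowsD(1-6)[OF K]
  have FH [simp]: "FHom F a b f \<in> Hom D (FOb F a) (FOb F b)" if "a \<in> Ob C" "b \<in> Ob C" "f \<in> Hom C a b" for a b f
    using lax_arrowsD(2)[OF F, of "(a, b, f)"] that by (simp add: sk_arr_iff sk_map_def)
  let ?GF = "laxfun_restrict C (lax_comp C D E G F)" and ?KG = "laxfun_restrict D (lax_comp D E H K G)"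
  have f2: "sk_f2 C E ?GF a b = sk_f2 C E (lax_comp C D E G F) a b" if "a \<in> Ob C" "b \<in> Ob C" for a b
    using that by (simp only: sk_f2_def laxfun_restrict_sel C.ten_closed)
  have f0: "sk_f0 C E ?GF = sk_f0 C E (lax_comp C D E G F)"
    by (simp only: sk_f0_def laxfun_restrict_sel C.unit_closed)
  have g2: "sk_f2 D H ?KG a b = sk_f2 D H (lax_comp D E H K G) a b" if "a \<in> Ob D" "b \<in> Ob D" for a b
    using that by (simp only: sk_f2_def laxfun_restrict_sel D.ten_closed)
  have g0: "sk_f0 D H ?KG = sk_f0 D H (lax_comp D E H K G)"
    by (simp only: sk_f0_def laxfun_restrict_sel D.unit_closed)
  have gm: "sk_map ?KG f = sk_map K (sk_map G f)" if "f \<in> sk_arr D" for f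
    using that by (auto simp: sk_map_def laxfun_restrict_def lax_comp_def sk_arr_def)
  show "Comp SkMon_ln C E H K (Comp SkMon_ln C D E G F) = Comp SkMon_ln C D H (Comp SkMon_ln D E H K G) F"
    unfolding SkMon_Comp
    by (rule laxfun_eqI[of C])
      (simp_all add: laxfun_restrict_sel lax_comp_sel f2 f0 g2 g0 gm)
qed


section \<open>Multicategories and the functor \<open>U\<close>\<close>

definition m_arr :: "('o, 'm) multi \<Rightarrow> ('o, 'm) arrow set" where
  "m_arr M = {(as, b, f). as \<in> lists (mOb M) \<and> b \<in> mOb M \<and> f \<in> mHom M as b}"

definition m_idn :: "('o, 'm) multi \<Rightarrow> 'o \<Rightarrow> ('o, 'm) arrow" where
  "m_idn M a = ([a], a, mIdn M a)"

definition m_sb :: "('o, 'm) multi \<Rightarrow> ('o, 'm) arrow \<Rightarrow> nat \<Rightarrow> ('o, 'm) arrow \<Rightarrow> ('o, 'm) arrow" where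
  "m_sb M g i f = (plug (fst g) i (fst f), cod g,
     mSub M (fst g) (cod g) i (fst f) (mor g) (mor f))"

abbreviation m_multi_morphism ::
  "('o, 'm) multi \<Rightarrow> ('p, 'n) multi \<Rightarrow> ('o \<Rightarrow> 'p) \<Rightarrow> (('o, 'm) arrow \<Rightarrow> ('p, 'n) arrow) \<Rightarrow> bool"
where
  "m_multi_morphism M N \<equiv> multi_morphism (mOb M) (m_arr M) fst cod (m_idn M) (m_sb M) True
     (mOb N) (m_arr N) fst cod (m_idn N) (m_sb N)"

lemma ok_True [simp]: "ok_ar True n m"
  by (simp add: ok_ar_def)

lemma m_arr_iff: "(as, b, f) \<in> m_arr M \<longleftrightarrow> as \<in> lists (mOb M) \<and> b \<in> mOb M \<and> f \<in> mHom M as b"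
  by (simp add: m_arr_def)

lemma multi_bounded:
  assumes "multicategory M"
  shows "bounded_multicategory (mOb M) (m_arr M) fst cod (m_idn M) (m_sb M) True"
proof -
  interpret multicategory M by fact
  show ?thesis
  proof
    fix f g h :: "('a, 'b) arrow" and i j
    assume "f \<in> m_arr M" "g \<in> m_arr M" "h \<in> m_arr M" "i < length (fst f)" "fst f ! i = cod g"
      "j < length (fst g)" "fst g ! j = cod h"
    then show "m_sb M f i (m_sb M g j h) = m_sb M (m_sb M f i g) (j + i) h"
      using massoc_seq[of "fst f" "fst g" "fst h" "cod f" i j "mor f" "mor g" "mor h"]
      by (auto simp: m_arr_def m_sb_def plug_seq)
  next
    fix f g h :: "('a, 'b) arrow" and i k
    assume "f \<in> m_arr M" "g \<in> m_arr M" "h \<in> m_arr M" "i < k" "k < length (fst f)"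
      "fst f ! i = cod g" "fst f ! k = cod h"
    then show "m_sb M (m_sb M f i g) (k + length (fst g) - 1) h = m_sb M (m_sb M f k h) i g"
      using massoc_par[of "fst f" "fst g" "fst h" "cod f" i k "mor f" "mor g" "mor h"]
        plug_par[of i k "fst f" "fst g" "fst h"]
      by (auto simp: m_arr_def m_sb_def)
  next
    fix g f :: "('a, 'b) arrow" and i
    assume "g \<in> m_arr M" "f \<in> m_arr M" "i < length (fst g)" "fst g ! i = cod f"
    then show "m_sb M g i f \<in> m_arr M"
      using msub_closed[of "fst g" "fst f" "cod g" i "mor g" "mor f"]
      by (auto simp: m_arr_def m_sb_def)
  qed (auto simp: m_arr_def m_idn_def m_sb_def midn_closed midn_left midn_right in_lists_conv_set)
qed

text \<open>Precomposition with a list of unary maps at consecutive inputs, the first of them being the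
  input \<open>i\<close>. The action of a tuple of maps in the forgetful functor is of this form.\<close>

context bounded_multicategory
begin

primrec pc :: "'a \<Rightarrow> nat \<Rightarrow> 'a list \<Rightarrow> 'a" where
  pc_Nil: "pc f i [] = f"
| pc_Cons: "pc f i (p # ps) = pc (f \<cdot>[i] p) (Suc i) ps"

end

locale full_multicategory = bounded_multicategory Obj Arr dm cd idn sb True
  for Obj :: "'o set" and Arr :: "'a set" and dm cd idn
    and sb :: "'a \<Rightarrow> nat \<Rightarrow> 'a \<Rightarrow> 'a"  ("(_ \<cdot>[_] _)" [70, 0, 71] 70)
begin

definition fits :: "'a \<Rightarrow> nat \<Rightarrow> 'a list \<Rightarrow> bool" where
  "fits f i ps \<longleftrightarrow> f \<in> Arr \<and> i + length ps \<le> length (dm f) \<and>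
     (\<forall>k<length ps. ps ! k \<in> Arr \<and> length (dm (ps ! k)) = 1 \<and> cd (ps ! k) = dm f ! (i + k))"

lemma fits_Cons:
  assumes "fits f i (p # ps)"
  shows "p \<in> Arr" "length (dm p) = 1" "cd p = dm f ! i" "f \<in> Arr" "i < length (dm f)"
    "f \<cdot>[i] p \<in> Arr" "fits (f \<cdot>[i] p) (Suc i) ps"
proof -
  show *: "p \<in> Arr" "length (dm p) = 1" "cd p = dm f ! i" "f \<in> Arr" "i < length (dm f)"
    using assms by (auto simp: fits_def dest: spec[of _ 0])
  show **: "f \<cdot>[i] p \<in> Arr" using * by simp
  have "ps ! k \<in> Arr \<and> length (dm (ps ! k)) = 1 \<and> cd (ps ! k) = dm f ! (Suc i + k)"
    if "k < length ps" for k
    using assms that unfolding fits_def by (auto dest: spec[of _ "Suc k"])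
  moreover have "Suc i + length ps \<le> length (dm f)" using assms by (simp add: fits_def)
  moreover have "plug (dm f) i (dm p) ! (Suc i + k) = dm f ! (Suc i + k)" if "k < length ps" for k
    using nth_plug_right[of i "Suc i + k" "dm f" "dm p"] * that calculation(2) by simp
  ultimately show "fits (f \<cdot>[i] p) (Suc i) ps"
    using * ** by (simp add: fits_def)
qed

lemma pc_Arr: "fits f i ps \<Longrightarrow> pc f i ps \<in> Arr \<and> cd (pc f i ps) = cd f"
proof (induction ps arbitrary: f i)
  case (Cons p ps)
  then show ?case using fits_Cons[OF Cons.prems] Cons.IH[of "f \<cdot>[i] p" "Suc i"] by simp
qed (simp add: fits_def)

lemma dm_pc:
  "fits f i ps \<Longrightarrow> length (dm (pc f i ps)) = length (dm f) \<and>
    (\<forall>j<length (dm f). dm (pc f i ps) ! j = (if i \<le> j \<and> j < i + length ps then hd (dm (ps ! (j - i))) else dm f ! j))"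
proof (induction ps arbitrary: f i)
  case (Cons p ps)
  note f = fits_Cons[OF Cons.prems]
  obtain a where p: "dm p = [a]" using f(2) by (auto simp: length_Suc_conv)
  have "dm (f \<cdot>[i] p) = (dm f)[i := a]" using f p by (simp add: plug_single)
  then show ?case
    using Cons.IH[OF f(7)] f p by (auto simp: nth_list_update nth_Cons' Suc_diff_Suc)
qed auto

lemma pc_append: "pc f i (ps @ qs) = pc (pc f i ps) (i + length ps) qs"
  by (induction ps arbitrary: f i) auto

text \<open>The next three lemmas say how precomposition distributes over the parts of a composite \<open>g \<cdot>[j] f\<close>:
  the inputs of \<open>f\<close>, and the inputs of \<open>g\<close> to the left and to the right of \<open>j\<close>.\<close>

lemma pc_inside:
  assumes "fits f i ps" "g \<in> Arr" "j < length (dm g)" "dm g ! j = cd f"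
  shows "pc (g \<cdot>[j] f) (i + j) ps = g \<cdot>[j] pc f i ps"
  using assms
proof (induction ps arbitrary: f i)
  case (Cons p ps)
  note f = fits_Cons[OF Cons.prems(1)]
  have "g \<cdot>[j] f \<cdot>[i + j] p = g \<cdot>[j] (f \<cdot>[i] p)"
    using f Cons.prems seq[of g f p j i] by simp
  then show ?case using Cons.IH[OF f(7)] Cons.prems by simp
qed simp

lemma pc_left:
  assumes "fits g i ps" "f \<in> Arr" "i + length ps \<le> j" "j < length (dm g)" "dm g ! j = cd f"
  shows "pc (g \<cdot>[j] f) i ps = pc g i ps \<cdot>[j] f"
  using assms
proof (induction ps arbitrary: g i)
  case (Cons p ps)
  note g = fits_Cons[OF Cons.prems(1)]
  have "g \<cdot>[j] f \<cdot>[i] p = g \<cdot>[i] p \<cdot>[j] f"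
    using g Cons.prems par[of g p f i j] by simp
  moreover have "pc (g \<cdot>[i] p \<cdot>[j] f) (Suc i) ps = pc (g \<cdot>[i] p) (Suc i) ps \<cdot>[j] f"
    using Cons.prems g nth_plug_right[of i j "dm g" "dm p"] by (intro Cons.IH) auto
  ultimately show ?case by simp
qed simp

lemma pc_right:
  assumes "fits g i ps" "f \<in> Arr" "j < i" "j < length (dm g)" "dm g ! j = cd f"
  shows "pc (g \<cdot>[j] f) (i + length (dm f) - 1) ps = pc g i ps \<cdot>[j] f"
  using assms
proof (induction ps arbitrary: g i)
  case (Cons p ps)
  note g = fits_Cons[OF Cons.prems(1)]
  have "g \<cdot>[j] f \<cdot>[i + length (dm f) - 1] p = g \<cdot>[i] p \<cdot>[j] f"
    using g Cons.prems par[of g f p j i] by simp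
  moreover have "pc (g \<cdot>[i] p \<cdot>[j] f) (Suc i + length (dm f) - 1) ps = pc (g \<cdot>[i] p) (Suc i) ps \<cdot>[j] f"
    using Cons.prems g nth_plug_left[of j i "dm g" "dm p"] by (intro Cons.IH) auto
  moreover have "Suc (i + length (dm f) - 1) = Suc i + length (dm f) - 1" using Cons.prems by simp
  ultimately show ?case by simp
qed simp

lemma pc_idns:
  assumes "f \<in> Arr" "i + length ps \<le> length (dm f)" "\<forall>k<length ps. ps ! k = idn (dm f ! (i + k))"
  shows "pc f i ps = f"
  using assms
proof (induction ps arbitrary: i)
  case (Cons p ps)
  have "p = idn (dm f ! i)" using Cons.prems(3) by (auto dest: spec[of _ 0])
  then have "f \<cdot>[i] p = f" using Cons.prems by simp
  moreover have "\<forall>k<length ps. ps ! k = idn (dm f ! (Suc i + k))"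
    using Cons.prems(3) by (auto dest: spec[of _ "Suc _"])
  ultimately show ?case using Cons.IH[of "Suc i"] Cons.prems by simp
qed simp

text \<open>Substituting \<open>p\<close> and \<open>q\<close> input by input, or all \<open>p\<close> first, differs by exchanging maps at distinct
  inputs.\<close>

lemma pc_comp:
  assumes "fits f i ps" "length qs = length ps"
    "\<forall>k<length ps. qs ! k \<in> Arr \<and> length (dm (qs ! k)) = 1 \<and> cd (qs ! k) = hd (dm (ps ! k))"
  shows "pc f i (map2 (\<lambda>p q. p \<cdot>[0] q) ps qs) = pc (pc f i ps) i qs"
  using assms
proof (induction ps arbitrary: f i qs)
  case (Cons p ps)
  note f = fits_Cons[OF Cons.prems(1)]
  obtain a where p: "dm p = [a]" using f(2) by (auto simp: length_Suc_conv)
  obtain q qs' where qs: "qs = q # qs'" "length qs' = length ps" using Cons.prems(2) by (cases qs) auto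
  have q: "q \<in> Arr" "length (dm q) = 1" "cd q = a"
    using Cons.prems(3) qs p by (auto dest: spec[of _ 0])
  obtain a' where q': "dm q = [a']" using q(2) by (auto simp: length_Suc_conv)
  have rest: "\<forall>k<length ps. qs' ! k \<in> Arr \<and> length (dm (qs' ! k)) = 1 \<and> cd (qs' ! k) = hd (dm (ps ! k))"
    using Cons.prems(3) qs by (auto dest: spec[of _ "Suc _"])
  have pq: "f \<cdot>[i] (p \<cdot>[0] q) = f \<cdot>[i] p \<cdot>[i] q"
    using f q p seq[of f p q i 0] by simp
  have "fits f i (p \<cdot>[0] q # ps)"
    using Cons.prems(1) f q p q' by (auto simp: fits_def nth_Cons')
  then have fits': "fits (f \<cdot>[i] p \<cdot>[i] q) (Suc i) ps" using fits_Cons(7)[of f i "p \<cdot>[0] q" ps] pq by simp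
  have "pc f i (map2 (\<lambda>p q. p \<cdot>[0] q) (p # ps) qs) = pc (pc (f \<cdot>[i] p \<cdot>[i] q) (Suc i) ps) (Suc i) qs'"
    using Cons.IH[OF fits' qs(2) rest] pq qs by simp
  also have "pc (f \<cdot>[i] p \<cdot>[i] q) (Suc i) ps = pc (f \<cdot>[i] p) (Suc i) ps \<cdot>[i] q"
    using pc_right[OF f(7), of q i] f q q' p by (simp add: plug_single)
  finally show ?case using qs by simp
qed simp

end

definition unaries :: "'o list \<Rightarrow> 'o list \<Rightarrow> 'm list \<Rightarrow> ('o, 'm) arrow list" where
  "unaries as' as ps = map (\<lambda>k. ([as' ! k], as ! k, ps ! k)) [0..<length as]"

lemma length_unaries [simp]: "length (unaries as' as ps) = length as"
  by (simp add: unaries_def)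

lemma nth_unaries [simp]: "k < length as \<Longrightarrow> unaries as' as ps ! k = ([as' ! k], as ! k, ps ! k)"
  by (simp add: unaries_def)

lemma unaries_plug:
  assumes "length bs' = length bs" "length rs = length bs" "length as' = length as" "length ps = length as"
    "i < length bs"
  shows "unaries (plug bs' i as') (plug bs i as) (plug rs i ps)
    = take i (unaries bs' bs rs) @ unaries as' as ps @ drop (Suc i) (unaries bs' bs rs)"
  using assms
  by (intro nth_equalityI) (auto simp: nth_append plug_def min_def Suc_diff_le add.commute)

locale multicategory_arrows = multicategory M for M :: "('o, 'm) multi"
begin

sublocale full_multicategory "mOb M" "m_arr M" fst cod "m_idn M" "m_sb M"
  unfolding full_multicategory_def by (rule multi_bounded) unfold_locales

abbreviation U :: "('o, 'm) shmulti" where "U \<equiv> U_obj M"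

lemma U_sel [simp]:
  "Ob U = mOb M" "Hom U = (\<lambda>a b. mHom M [a] b)" "Idn U = mIdn M"
  "Comp U = (\<lambda>a b c g f. mSub M [b] c 0 [a] g f)"
  "MHom U = (\<lambda>as b. if length as \<le> 4 then mHom M as b else {})"
  by (simp_all add: U_obj_def)

lemma fits_unaries:
  assumes "as \<in> lists (mOb M)" "as' \<in> lists (mOb M)" "b \<in> mOb M" "ps \<in> Homs U as' as" "f \<in> mHom M as b"
  shows "fits (as, b, f) 0 (unaries as' as ps)"
  using assms by (auto simp: fits_def Homs_def m_arr_iff nth_lists)

lemma mpre_pc:
  assumes "as \<in> lists (mOb M)" "as' \<in> lists (mOb M)" "b \<in> mOb M" "ps \<in> Homs U as' as" "f \<in> mHom M as b"
  shows "(as', b, mpre M as b as' ps f) = pc (as, b, f) 0 (unaries as' as ps)"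
proof -
  let ?f = "\<lambda>k. foldl (\<lambda>g k. mSub M (take k as' @ drop k as) b k [as' ! k] g (ps ! k)) f [0..<k]"
  have len: "length as' = length as" "length ps = length as" using assms by (auto simp: Homs_def)
  have "(take k as' @ drop k as, b, ?f k) = pc (as, b, f) 0 (take k (unaries as' as ps))"
    if "k \<le> length as" for k
    using that
  proof (induction k)
    case (Suc k)
    then have k: "k < length as" by simp
    have upd: "(take k as' @ drop k as)[k := as' ! k] = take (Suc k) as' @ drop (Suc k) as"
      using k len by (intro nth_equalityI) (auto simp: nth_append nth_list_update min_def)
    have nthk: "(take k as' @ drop k as) ! k = as ! k" using k len by (simp add: nth_append)
    have "pc (as, b, f) 0 (take (Suc k) (unaries as' as ps))
        = m_sb M (take k as' @ drop k as, b, ?f k) k ([as' ! k], as ! k, ps ! k)"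
      using Suc k by (simp add: take_Suc_conv_app_nth pc_append)
    also have "\<dots> = (take (Suc k) as' @ drop (Suc k) as, b, ?f (Suc k))"
      using k len upd by (simp add: m_sb_def plug_single)
    finally show ?case ..
  qed simp
  from this[of "length as"] show ?thesis by (simp add: mpre_def len)
qed

lemma Act_pc:
  assumes "as \<in> lists (mOb M)" "as' \<in> lists (mOb M)" "b \<in> mOb M" "ps \<in> Homs U as' as" "f \<in> mHom M as b"
    "length as \<le> 4" "b' \<in> mOb M" "q \<in> mHom M [b] b'"
  shows "(as', b', Act U as b as' b' ps q f)
    = m_sb M ([b], b', q) 0 (pc (as, b, f) 0 (unaries as' as ps))"
proof -
  have "length as' = length as" using assms by (auto simp: Homs_def)
  then show ?thesis
    using assms by (simp add: U_obj_def m_sb_def flip: mpre_pc[OF assms(1-5)])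
qed

lemma pc_in:
  assumes "as \<in> lists (mOb M)" "as' \<in> lists (mOb M)" "b \<in> mOb M" "ps \<in> Homs U as' as" "f \<in> mHom M as b"
  shows "pc (as, b, f) 0 (unaries as' as ps) \<in> m_arr M"
    "fst (pc (as, b, f) 0 (unaries as' as ps)) = as'" "cod (pc (as, b, f) 0 (unaries as' as ps)) = b"
  using pc_Arr[OF fits_unaries[OF assms]] arg_cong[OF mpre_pc[OF assms], of fst] by simp_all

lemma midn_Hom [simp]: "a \<in> mOb M \<Longrightarrow> mIdn M a \<in> mHom M [a] a"
  by (rule midn_closed)

lemma m_idn_arr: "([a], a, mIdn M a) = m_idn M a"
  by (simp add: m_idn_def)

lemma unaries_ids: "unaries as as (map (mIdn M) as) = map (m_idn M) as"
  by (intro nth_equalityI) (auto simp: m_idn_def)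

lemma pc_ids: "f \<in> m_arr M \<Longrightarrow> fst f = as \<Longrightarrow> pc f 0 (map (m_idn M) as) = f"
  by (rule pc_idns) auto

lemma ids_Homs_U: "as \<in> lists (mOb M) \<Longrightarrow> map (mIdn M) as \<in> Homs U as as"
  by (auto simp: Homs_def nth_lists)

lemma pre_U:
  assumes as: "as \<in> lists (mOb M)" and i: "i < length as" and b: "b \<in> mOb M" and a: "a \<in> mOb M"
    and p: "p \<in> mHom M [a] (as ! i)" and f: "f \<in> mHom M as b" and l: "length as \<le> 4"
  shows "(as[i := a], b, pre U as b i a f p) = m_sb M (as, b, f) i ([a], as ! i, p)"
proof -
  let ?ps = "(map (mIdn M) as)[i := p]"
  have ps: "?ps \<in> Homs U (as[i := a]) as"
    using as i p by (auto simp: Homs_def nth_list_update nth_lists)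
  have fA: "(as, b, f) \<in> m_arr M" using as b f by (simp add: m_arr_iff)
  have ai: "as ! i \<in> mOb M" using as i by (simp add: nth_lists)
  let ?X = "map (m_idn M) (take i as)" and ?Y = "map (m_idn M) (drop (Suc i) as)"
  have "unaries (as[i := a]) as ?ps = ?X @ ([a], as ! i, p) # ?Y"
    using i by (intro nth_equalityI) (auto simp: nth_append nth_Cons' nth_list_update m_idn_def min_def)
  moreover have "pc (as, b, f) 0 ?X = (as, b, f)"
    using fA i by (intro pc_idns) (auto simp: min_def)
  moreover have "pc (m_sb M (as, b, f) i ([a], as ! i, p)) (Suc i) ?Y = m_sb M (as, b, f) i ([a], as ! i, p)"
  proof (rule pc_idns)
    show "m_sb M (as, b, f) i ([a], as ! i, p) \<in> m_arr M"
      using fA i p a ai by (intro sb_Arr) (auto simp: m_arr_iff)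
  qed (use i in \<open>auto simp: plug_single nth_list_update\<close>)
  ultimately have "pc (as, b, f) 0 (unaries (as[i := a]) as ?ps) = m_sb M (as, b, f) i ([a], as ! i, p)"
    using i by (simp add: pc_append)
  moreover have "m_sb M (as, b, f) i ([a], as ! i, p) \<in> m_arr M"
    using fA i p a ai by (intro sb_Arr) (auto simp: m_arr_iff)
  ultimately show ?thesis
    unfolding pre_def using Act_pc[of as "as[i := a]" b ?ps f b "mIdn M b"] as b a ps f l
    by (simp add: m_idn_arr)
qed

lemma post_U:
  assumes as: "as \<in> lists (mOb M)" and b: "b \<in> mOb M" "b' \<in> mOb M"
    and q: "q \<in> mHom M [b] b'" and f: "f \<in> mHom M as b" and l: "length as \<le> 4"
  shows "(as, b', post U as b b' q f) = m_sb M ([b], b', q) 0 (as, b, f)"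
  unfolding post_def U_sel
  using Act_pc[OF as as b(1) ids_Homs_U[OF as] f l b(2) q] as b f
  by (simp add: unaries_ids pc_ids m_arr_iff)

lemma subst_U:
  assumes g: "(bs, c, g) \<in> m_arr M" and f: "(as, bs ! i, f) \<in> m_arr M" and i: "i < length bs"
    and ok: "ok_ar False (length bs) (length as)"
  shows "(plug bs i as, c, subst U bs c i as g f) = m_sb M (bs, c, g) i (as, bs ! i, f)"
proof -
  consider a where "as = [a]" "length bs \<le> 4" | b where "bs = [b]" "length as \<noteq> 1" "length as \<le> 4"
    | "(length bs, length as) \<in> sub_arities" "length as \<noteq> 1" "length bs \<noteq> 1"
    using ok by (auto simp: ok_ar_def length_Suc_conv sub_arities_def)
  then show ?thesis
  proof cases
    case 1
    then show ?thesis
      using pre_U[of bs i c a f g] assms by (simp add: subst_def m_arr_iff plug_single)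
  next
    case 2
    then show ?thesis
      using post_U[of as b c g f] assms by (simp add: subst_def m_arr_iff)
  next
    case 3
    then show ?thesis by (simp add: subst_def U_obj_def m_sb_def)
  qed
qed

text \<open>Functoriality of the action is \<open>pc_comp\<close>, naturality of substitution follows from the distribution
  of precomposition over a composite, and the other laws are instances of associativity.\<close>

lemma short_U: "short_multicategory U"
proof
  fix a b f assume "a \<in> Ob U" "b \<in> Ob U" "f \<in> Hom U a b"
  then show "Comp U a b b (Idn U b) f = f" "Comp U a a b f (Idn U a) = f"
    using midn_left[of "[a]" b f] midn_right[of "[a]" b f 0] by simp_all
next
  fix a b c f g assume "a \<in> Ob U" "b \<in> Ob U" "c \<in> Ob U" "f \<in> Hom U a b" "g \<in> Hom U b c"
  then show "Comp U a b c g f \<in> Hom U a c"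
    using msub_closed[of "[b]" "[a]" c 0 g f] by simp
next
  fix a b c d f g h
  assume "a \<in> Ob U" "b \<in> Ob U" "c \<in> Ob U" "d \<in> Ob U" "f \<in> Hom U a b" "g \<in> Hom U b c" "h \<in> Hom U c d"
  then show "Comp U a c d h (Comp U a b c g f) = Comp U a b d (Comp U b c d h g) f"
    using massoc_seq[of "[c]" "[b]" "[a]" d 0 0 h g f] by simp
next
  fix as as' :: "'o list" and b b' f ps q
  assume "as \<in> lists (Ob U)" "length as \<le> 4" "as' \<in> lists (Ob U)" "b \<in> Ob U" "b' \<in> Ob U"
    "ps \<in> Homs U as' as" "q \<in> Hom U b b'" "f \<in> MHom U as b"
  then have *: "as \<in> lists (mOb M)" "as' \<in> lists (mOb M)" "b \<in> mOb M" "ps \<in> Homs U as' as"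
    "f \<in> mHom M as b" "length as \<le> 4" "b' \<in> mOb M" "q \<in> mHom M [b] b'" by simp_all
  have "m_sb M ([b], b', q) 0 (pc (as, b, f) 0 (unaries as' as ps)) \<in> m_arr M"
    using pc_in[OF *(1-5)] * by (intro sb_Arr) (auto simp: m_arr_iff)
  moreover have "length as' = length as" using *(4) by (simp add: Homs_def)
  ultimately show "Act U as b as' b' ps q f \<in> MHom U as' b'"
    using * by (simp add: m_arr_iff flip: Act_pc[OF *])
next
  fix as :: "'o list" and b f
  assume "as \<in> lists (Ob U)" "length as \<le> 4" "b \<in> Ob U" "f \<in> MHom U as b"
  then have *: "as \<in> lists (mOb M)" "b \<in> mOb M" "f \<in> mHom M as b" "length as \<le> 4" by simp_all
  show "Act U as b as b (map (Idn U) as) (Idn U b) f = f"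
    using Act_pc[OF *(1,1,2) ids_Homs_U[OF *(1)] *(3,4,2) midn_Hom[OF *(2)]] *
    by (simp add: unaries_ids pc_ids m_arr_iff m_idn_arr)
next
  fix as as' as'' :: "'o list" and b b' b'' f ps ps' q q'
  assume "as \<in> lists (Ob U)" "length as \<le> 4" "as' \<in> lists (Ob U)" "as'' \<in> lists (Ob U)"
    "b \<in> Ob U" "b' \<in> Ob U" "b'' \<in> Ob U" "ps \<in> Homs U as' as" "ps' \<in> Homs U as'' as'"
    "q \<in> Hom U b b'" "q' \<in> Hom U b' b''" "f \<in> MHom U as b"
  then have *: "as \<in> lists (mOb M)" "as' \<in> lists (mOb M)" "b \<in> mOb M" "ps \<in> Homs U as' as"
    "f \<in> mHom M as b" "length as \<le> 4" "b' \<in> mOb M" "q \<in> mHom M [b] b'"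
    and **: "as'' \<in> lists (mOb M)" "b'' \<in> mOb M" "ps' \<in> Homs U as'' as'" "q' \<in> mHom M [b'] b''"
    by simp_all
  have len: "length as' = length as" "length ps = length as" "length ps' = length as" "length as'' = length as"
    using * ** by (auto simp: Homs_def)
  have Act': "Act U as b as' b' ps q f \<in> mHom M as' b'"
  proof -
    have "m_sb M ([b], b', q) 0 (pc (as, b, f) 0 (unaries as' as ps)) \<in> m_arr M"
      using pc_in[OF *(1-5)] * by (intro sb_Arr) (auto simp: m_arr_iff)
    then show ?thesis by (simp add: m_arr_iff flip: Act_pc[OF *])
  qed
  have qq: "mSub M [b'] b'' 0 [b] q' q \<in> mHom M [b] b''"
    using msub_closed[of "[b']" "[b]" b'' 0 q' q] * ** by simp
  have H: "Comps U as'' as' as ps ps' \<in> Homs U as'' as"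
    using * ** len msub_closed[of "[_]" "[_]" _ 0]
    by (auto simp: Homs_def Comps_def nth_lists intro!: msub_closed[of "[_]" "[_]" _ 0, simplified])
  have ul: "unaries as'' as (Comps U as'' as' as ps ps')
      = map2 (\<lambda>p q. m_sb M p 0 q) (unaries as' as ps) (unaries as'' as' ps')"
    using len by (intro nth_equalityI) (auto simp: Comps_def m_sb_def)
  have "(as'', b'', Act U as b as'' b'' (Comps U as'' as' as ps ps') (Comp U b b' b'' q' q) f)
      = m_sb M (m_sb M ([b'], b'', q') 0 ([b], b', q)) 0
          (pc (pc (as, b, f) 0 (unaries as' as ps)) 0 (unaries as'' as' ps'))"
    using Act_pc[OF *(1) **(1) *(3) H *(5,6) **(2) qq]
      pc_comp[OF fits_unaries[OF *(1-5)], of "unaries as'' as' ps'"] ** len ul *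
    by (simp add: m_sb_def[of _ "([b'], b'', q')"] Homs_def m_arr_iff nth_lists)
  also have "\<dots> = m_sb M ([b'], b'', q') 0 (m_sb M ([b], b', q) 0
          (pc (pc (as, b, f) 0 (unaries as' as ps)) 0 (unaries as'' as' ps')))"
  proof -
    have "pc (as, b, f) 0 (unaries as' as ps) = (as', b, mor (pc (as, b, f) 0 (unaries as' as ps)))"
      using pc_in[OF *(1-5)] by (metis prod.collapse)
    moreover have "mor (pc (as, b, f) 0 (unaries as' as ps)) \<in> mHom M as' b"
      using pc_in[OF *(1-5)] by (auto simp: m_arr_def)
    ultimately have "pc (pc (as, b, f) 0 (unaries as' as ps)) 0 (unaries as'' as' ps') \<in> m_arr M"
      "cod (pc (pc (as, b, f) 0 (unaries as' as ps)) 0 (unaries as'' as' ps')) = b"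
      using pc_in[OF *(2) **(1) *(3) **(3)] by metis+
    then show ?thesis
      using seq[of "([b'], b'', q')" "([b], b', q)"
          "pc (pc (as, b, f) 0 (unaries as' as ps)) 0 (unaries as'' as' ps')" 0 0] * **
      by (simp add: m_arr_iff)
  qed
  also have "m_sb M ([b], b', q) 0 (pc (pc (as, b, f) 0 (unaries as' as ps)) 0 (unaries as'' as' ps'))
      = pc (m_sb M ([b], b', q) 0 (pc (as, b, f) 0 (unaries as' as ps))) 0 (unaries as'' as' ps')"
    using pc_inside[of "pc (as, b, f) 0 (unaries as' as ps)" 0 "unaries as'' as' ps'" "([b], b', q)" 0]
      pc_in[OF *(1-5)] * ** len by (simp add: m_arr_iff fits_def Homs_def nth_lists)
  also have "m_sb M ([b'], b'', q') 0 \<dots> = (as'', b'', Act U as' b' as'' b'' ps' q' (Act U as b as' b' ps q f))"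
    using Act_pc[OF *(2) **(1) *(7) **(3) Act' _ **(2) **(4)] Act_pc[OF *] *(6) len by simp
  finally show "Act U as b as'' b'' (Comps U as'' as' as ps ps') (Comp U b b' b'' q' q) f
          = Act U as' b' as'' b'' ps' q' (Act U as b as' b' ps q f)" by simp
next
  fix a a' b b' f p q
  assume "a \<in> Ob U" "a' \<in> Ob U" "b \<in> Ob U" "b' \<in> Ob U" "p \<in> Hom U a' a" "q \<in> Hom U b b'" "f \<in> Hom U a b"
  then show "Act U [a] b [a'] b' [p] q f = Comp U a' b b' q (Comp U a' a b f p)"
    by (simp add: U_obj_def mpre_def)
next
  fix bs as :: "'o list" and c g f and i :: nat
  assume "bs \<in> lists (Ob U)" "as \<in> lists (Ob U)" "c \<in> Ob U" "(length bs, length as) \<in> sub_arities"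
    "i < length bs" "g \<in> MHom U bs c" "f \<in> MHom U as (bs ! i)"
  then show "Sub U bs c i as g f \<in> MHom U (plug bs i as) c"
    using msub_closed[of bs as c i g f]
    by (auto simp: U_obj_def sub_arities_def split: if_splits)
next
  fix bs bs' as as' :: "'o list" and c c' g f rs ps q and i :: nat
  assume "bs \<in> lists (Ob U)" "bs' \<in> lists (Ob U)" "as \<in> lists (Ob U)" "as' \<in> lists (Ob U)"
    "c \<in> Ob U" "c' \<in> Ob U" and ar: "(length bs, length as) \<in> sub_arities" and i: "i < length bs"
    and rs: "rs \<in> Homs U bs' bs" "bs' ! i = bs ! i" "rs ! i = Idn U (bs ! i)"
    and ps: "ps \<in> Homs U as' as" and "q \<in> Hom U c c'" "g \<in> MHom U bs c" "f \<in> MHom U as (bs ! i)"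
  then have L: "bs \<in> lists (mOb M)" "bs' \<in> lists (mOb M)" "as \<in> lists (mOb M)" "as' \<in> lists (mOb M)"
    "c \<in> mOb M" "c' \<in> mOb M" and q: "q \<in> mHom M [c] c'" and g: "g \<in> mHom M bs c" and f: "f \<in> mHom M as (bs ! i)"
    and l4: "length bs \<le> 4" "length as \<le> 4"
    by (auto split: if_splits)
  have l4': "length bs + length as - 1 \<le> 4" using ar by (auto simp: sub_arities_def)
  have bi: "bs ! i \<in> mOb M" using L i by (simp add: nth_lists)
  have len: "length bs' = length bs" "length rs = length bs" "length as' = length as" "length ps = length as"
    using rs ps by (auto simp: Homs_def)
  let ?g = "(bs, c, g)" and ?f = "(as, bs ! i, f)" and ?q = "([c], c', q)"
  have gA: "?g \<in> m_arr M" and fA: "?f \<in> m_arr M" and qA: "?q \<in> m_arr M"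
    using L g f q bi by (auto simp: m_arr_iff)
  let ?R = "unaries bs' bs rs" and ?P = "unaries as' as ps"
  \<comment> \<open>The tuple acting on \<open>g\<close> is an identity at the position \<open>i\<close> of the substitution.\<close>
  let ?R1 = "take i ?R" and ?R2 = "drop (Suc i) ?R"
  have fitg: "fits ?g 0 ?R" and fitf: "fits ?f 0 ?P"
    using fits_unaries L rs ps g f bi by auto
  have R: "?R = ?R1 @ m_idn M (bs ! i) # ?R2"
    using id_take_nth_drop[of i ?R] i rs by (simp add: m_idn_def)
  have fit1: "fits ?g 0 ?R1" using fitg by (auto simp: fits_def)
  have g1: "pc ?g 0 ?R1 \<in> m_arr M" "cod (pc ?g 0 ?R1) = c" using pc_Arr[OF fit1] by simp_all
  have d1: "length (fst (pc ?g 0 ?R1)) = length bs"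
    "\<And>j. j \<ge> i \<Longrightarrow> j < length bs \<Longrightarrow> fst (pc ?g 0 ?R1) ! j = bs ! j"
    using dm_pc[OF fit1] by auto
  have fit2: "fits (pc ?g 0 ?R1) (Suc i) ?R2"
    using fitg g1 d1 i by (auto simp: fits_def)
  have mg: "pc ?g 0 ?R = pc (pc ?g 0 ?R1) (Suc i) ?R2"
    using g1 d1(1) d1(2)[of i] i by (subst R) (simp add: pc_append)
  have f1: "pc ?f 0 ?P \<in> m_arr M" "cod (pc ?f 0 ?P) = bs ! i" "fst (pc ?f 0 ?P) = as'"
    using pc_in[OF L(3,4) bi ps f] by simp_all
  have gf: "(plug bs i as, c, mSub M bs c i as g f) = m_sb M ?g i ?f" by (simp add: m_sb_def)
  have gf': "mSub M bs c i as g f \<in> mHom M (plug bs i as) c"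
    using msub_closed[of bs as c i g f] L i g f by simp
  have H: "plug rs i ps \<in> Homs U (plug bs' i as') (plug bs i as)"
  proof -
    have "fits (m_sb M ?g i ?f) 0 (?R1 @ ?P @ ?R2)"
      using fitg fitf i len sb_Arr[OF gA fA, of i]
      by (auto simp: fits_def nth_append plug_def min_def)
    then have "fits (plug bs i as, c, mSub M bs c i as g f) 0
        (unaries (plug bs' i as') (plug bs i as) (plug rs i ps))"
      unfolding gf using unaries_plug[of bs' bs rs as' as ps i] len i by simp
    then show ?thesis
      using len i by (auto simp: fits_def Homs_def m_arr_iff)
  qed
  have "pc (m_sb M ?g i ?f) 0 (unaries (plug bs' i as') (plug bs i as) (plug rs i ps))
      = pc (pc (pc (m_sb M ?g i ?f) 0 ?R1) i ?P) (i + length as) ?R2"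
    using unaries_plug[of bs' bs rs as' as ps i] len i by (simp add: pc_append min_def)
  also have "pc (m_sb M ?g i ?f) 0 ?R1 = m_sb M (pc ?g 0 ?R1) i ?f"
    using pc_left[OF fit1 fA, of i] i by simp
  also have "pc (m_sb M (pc ?g 0 ?R1) i ?f) i ?P = m_sb M (pc ?g 0 ?R1) i (pc ?f 0 ?P)"
    using pc_inside[OF fitf g1(1), of i] d1 i by simp
  also have "pc (m_sb M (pc ?g 0 ?R1) i (pc ?f 0 ?P)) (i + length as) ?R2
      = m_sb M (pc ?g 0 ?R) i (pc ?f 0 ?P)"
    using pc_right[OF fit2 f1(1), of i] d1 i f1 len mg by simp
  finally have main: "pc (m_sb M ?g i ?f) 0 (unaries (plug bs' i as') (plug bs i as) (plug rs i ps))
      = m_sb M (pc ?g 0 ?R) i (pc ?f 0 ?P)" .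
  have gR: "pc ?g 0 ?R \<in> m_arr M" "cod (pc ?g 0 ?R) = c" "fst (pc ?g 0 ?R) = bs'"
    using pc_in[OF L(1,2,5) rs(1) g] by simp_all
  have Ag: "(bs', c', Act U bs c bs' c' rs q g) = m_sb M ?q 0 (pc ?g 0 ?R)"
    by (rule Act_pc) (use L rs g l4 q in auto)
  have Af: "(as', bs ! i, Act U as (bs ! i) as' (bs ! i) ps (Idn U (bs ! i)) f) = pc ?f 0 ?P"
    using Act_pc[OF L(3,4) bi ps f l4(2) bi midn_Hom[OF bi]] f1 by (simp add: m_idn_arr)
  have "(plug bs' i as', c', Act U (plug bs i as) c (plug bs' i as') c' (plug rs i ps) q
        (mSub M bs c i as g f))
      = m_sb M ?q 0 (m_sb M (pc ?g 0 ?R) i (pc ?f 0 ?P))"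
    using Act_pc[OF _ _ L(5) H gf' _ L(6) q] L l4' i by (simp add: gf main)
  also have "\<dots> = m_sb M (m_sb M ?q 0 (pc ?g 0 ?R)) i (pc ?f 0 ?P)"
    using seq[of ?q "pc ?g 0 ?R" "pc ?f 0 ?P" 0 i] qA gR f1 i len rs(2) by simp
  also have "\<dots> = m_sb M (bs', c', Act U bs c bs' c' rs q g) i
      (as', bs ! i, Act U as (bs ! i) as' (bs ! i) ps (Idn U (bs ! i)) f)"
    by (simp only: Ag Af)
  finally show "Act U (plug bs i as) c (plug bs' i as') c' (plug rs i ps) q (Sub U bs c i as g f)
          = Sub U bs' c' i as' (Act U bs c bs' c' rs q g)
              (Act U as (bs ! i) as' (bs ! i) ps (Idn U (bs ! i)) f)"
    using ar len by (simp add: m_sb_def) (simp add: U_obj_def)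
next
  fix bs as :: "'o list" and c b' p g f and i :: nat
  assume "bs \<in> lists (Ob U)" "as \<in> lists (Ob U)" "c \<in> Ob U" "b' \<in> Ob U"
    and ar: "(length bs, length as) \<in> sub_arities" and i: "i < length bs"
    and "p \<in> Hom U b' (bs ! i)" "g \<in> MHom U bs c" "f \<in> MHom U as b'"
  then have L: "bs \<in> lists (mOb M)" "as \<in> lists (mOb M)" "c \<in> mOb M" "b' \<in> mOb M"
    "p \<in> mHom M [b'] (bs ! i)" "g \<in> mHom M bs c" "f \<in> mHom M as b'" "length bs \<le> 4" "length as \<le> 4"
    by (auto split: if_splits)
  have bi: "bs ! i \<in> mOb M" using L i by (simp add: nth_lists)
  have "m_sb M (bs[i := b'], c, pre U bs c i b' g p) i (as, b', f)
      = m_sb M (bs, c, g) i (as, bs ! i, post U as b' (bs ! i) p f)"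
    using pre_U[of bs i c b' p g] post_U[of as b' "bs ! i" p f] L bi i
      seq[of "(bs, c, g)" "([b'], bs ! i, p)" "(as, b', f)" i 0] by (simp add: m_arr_iff)
  then show "Sub U (bs[i := b']) c i as (pre U bs c i b' g p) f = Sub U bs c i as g (post U as b' (bs ! i) p f)"
    using ar by (simp add: m_sb_def) (simp add: U_obj_def)
next
  fix as bs cs :: "'o list" and d f g h and i j :: nat
  assume "as \<in> lists (Ob U)" "bs \<in> lists (Ob U)" "cs \<in> lists (Ob U)" "d \<in> Ob U"
    and l: "length as = 2" "(length bs, length cs) \<in> {(2, 2), (2, 0)}" and ij: "i < length as" "j < length bs"
    and "f \<in> MHom U as d" "g \<in> MHom U bs (as ! i)" "h \<in> MHom U cs (bs ! j)"
  then have A: "(as, d, f) \<in> m_arr M" "(bs, as ! i, g) \<in> m_arr M" "(cs, bs ! j, h) \<in> m_arr M"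
    by (auto simp: m_arr_iff nth_lists split: if_splits)
  note ok = ok_ar_def sub_arities_def
  have gh: "(plug bs j cs, as ! i, subst U bs (as ! i) j cs g h) = m_sb M (bs, as ! i, g) j (cs, bs ! j, h)"
    and fg: "(plug as i bs, d, subst U as d i bs f g) = m_sb M (as, d, f) i (bs, as ! i, g)"
    using A l ij by (auto intro!: subst_U simp: ok)
  have ghA: "(plug bs j cs, as ! i, subst U bs (as ! i) j cs g h) \<in> m_arr M"
    and fgA: "(plug as i bs, d, subst U as d i bs f g) \<in> m_arr M"
    unfolding gh fg using A ij by auto
  have n: "plug as i bs ! (j + i) = bs ! j" using ij by (simp add: nth_plug_mid)
  have "(plug as i (plug bs j cs), d, subst U as d i (plug bs j cs) f (subst U bs (as ! i) j cs g h))
      = m_sb M (as, d, f) i (m_sb M (bs, as ! i, g) j (cs, bs ! j, h))"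
    using subst_U[OF A(1) ghA ij(1)] l ij gh by (auto simp: ok)
  also have "\<dots> = m_sb M (m_sb M (as, d, f) i (bs, as ! i, g)) (j + i) (cs, bs ! j, h)"
    using seq[of "(as, d, f)" "(bs, as ! i, g)" "(cs, bs ! j, h)" i j] A ij by simp
  also have "\<dots> = (plug (plug as i bs) (j + i) cs, d, subst U (plug as i bs) d (j + i) cs (subst U as d i bs f g) h)"
    using subst_U[OF fgA, of cs "j + i" h] n A(3) l ij fg by (auto simp: ok)
  finally show "subst U as d i (plug bs j cs) f (subst U bs (as ! i) j cs g h)
      = subst U (plug as i bs) d (j + i) cs (subst U as d i bs f g) h" by simp
next
  fix a a' d f g h and bs cs :: "'o list"
  assume "a \<in> Ob U" "a' \<in> Ob U" "bs \<in> lists (Ob U)" "cs \<in> lists (Ob U)" "d \<in> Ob U"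
    and l: "(length bs, length cs) \<in> {(2, 2), (2, 0), (0, 2), (0, 0)}"
    and "f \<in> MHom U [a, a'] d" "g \<in> MHom U bs a" "h \<in> MHom U cs a'"
  then have A: "([a, a'], d, f) \<in> m_arr M" "(bs, a, g) \<in> m_arr M" "(cs, a', h) \<in> m_arr M"
    by (auto simp: m_arr_iff split: if_splits)
  note ok = ok_ar_def sub_arities_def
  have fg: "(bs @ [a'], d, subst U [a, a'] d 0 bs f g) = m_sb M ([a, a'], d, f) 0 (bs, a, g)"
    and fh: "(a # cs, d, subst U [a, a'] d 1 cs f h) = m_sb M ([a, a'], d, f) 1 (cs, a', h)"
    using subst_U[OF A(1), of bs 0 g] subst_U[OF A(1), of cs 1 h] A l by (auto simp: ok)
  have fgA: "(bs @ [a'], d, subst U [a, a'] d 0 bs f g) \<in> m_arr M"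
    and fhA: "(a # cs, d, subst U [a, a'] d 1 cs f h) \<in> m_arr M"
    unfolding fg fh using A by auto
  have "(bs @ cs, d, subst U (bs @ [a']) d (length bs) cs (subst U [a, a'] d 0 bs f g) h)
      = m_sb M (m_sb M ([a, a'], d, f) 0 (bs, a, g)) (length bs) (cs, a', h)"
    using subst_U[OF fgA, of cs "length bs" h] A l fg plug_append[of bs a' "[]" cs] by (auto simp: ok)
  also have "\<dots> = m_sb M (m_sb M ([a, a'], d, f) 1 (cs, a', h)) 0 (bs, a, g)"
    using par[of "([a, a'], d, f)" "(bs, a, g)" "(cs, a', h)" 0 1] A by simp
  also have "\<dots> = (bs @ cs, d, subst U (a # cs) d 0 bs (subst U [a, a'] d 1 cs f h) g)"
    using subst_U[OF fhA, of bs 0 g] A l fh by (auto simp: ok)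
  finally show "subst U (bs @ [a']) d (length bs) cs (subst U [a, a'] d 0 bs f g) h
          = subst U (a # cs) d 0 bs (subst U [a, a'] d 1 cs f h) g" by simp
qed simp_all

end


section \<open>The functor \<open>U\<close> is fully faithful\<close>

text \<open>The counterpart of \<open>left_universal\<close>, without bound on the arities: of the classifiers of a left
  representable multicategory only the binary and nullary ones are retained.\<close>

definition m_universal :: "('o, 'm) multi \<Rightarrow> ('o, 'm) lrchoice \<Rightarrow> bool" where
  "m_universal M r \<longleftrightarrow>
     (\<forall>a\<in>mOb M. \<forall>b\<in>mOb M. tobj r a b \<in> mOb M \<and> theta r a b \<in> mHom M [a, b] (tobj r a b)) \<and>
     uobj r \<in> mOb M \<and> umap r \<in> mHom M [] (uobj r) \<and>
     (\<forall>a\<in>mOb M. \<forall>b\<in>mOb M. \<forall>xs\<in>lists (mOb M). \<forall>d\<in>mOb M.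
        bij_betw (\<lambda>f. mSub M (tobj r a b # xs) d 0 [a, b] f (theta r a b))
          (mHom M (tobj r a b # xs) d) (mHom M (a # b # xs) d)) \<and>
     (\<forall>xs\<in>lists (mOb M). \<forall>d\<in>mOb M.
        bij_betw (\<lambda>f. mSub M (uobj r # xs) d 0 [] f (umap r)) (mHom M (uobj r # xs) d) (mHom M xs d))"

lemma m_universal_exists:
  assumes "multi_left_representable M"
  shows "\<exists>r. m_universal M r"
proof -
  let ?P = "\<lambda>as m th. m \<in> mOb M \<and> th \<in> mHom M as m \<and> (\<forall>ys\<in>lists (mOb M). \<forall>d\<in>mOb M.
        bij_betw (\<lambda>f. mSub M (m # ys) d 0 as f th) (mHom M (m # ys) d) (mHom M (as @ ys) d))"
  have "\<forall>as. \<exists>m th. as \<in> lists (mOb M) \<longrightarrow> ?P as m th"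
    using assms unfolding multi_left_representable_def by blast
  then obtain m th where mt: "\<And>as. as \<in> lists (mOb M) \<Longrightarrow> ?P as (m as) (th as)" by metis
  have "m_universal M \<lparr>tobj = (\<lambda>a b. m [a, b]), theta = (\<lambda>a b. th [a, b]), uobj = m [], umap = th []\<rparr>"
    unfolding m_universal_def using mt[of "[]"] mt[of "[_, _]"] by simp
  then show ?thesis ..
qed

context multicategory_arrows
begin

lemma sh_arr_U: "sh_arr U = {f \<in> m_arr M. length (fst f) \<le> 4}"
  by (auto simp: sh_arr_def m_arr_def split: if_splits)

lemma sh_sb_U:
  assumes "g \<in> m_arr M" "f \<in> m_arr M" "i < length (fst g)" "fst g ! i = cod f"
    "ok_ar False (length (fst g)) (length (fst f))"
  shows "sh_sb U g i f = m_sb M g i f"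
  using subst_U[of "fst g" "cod g" "mor g" "fst f" i "mor f"] assms
  by (cases g; cases f) (auto simp: sh_sb_def)

lemma sh_idn_U: "sh_idn U = m_idn M"
  by (simp add: sh_idn_def m_idn_def fun_eq_iff)

lemma left_universal_U:
  assumes "m_universal M r"
  shows "left_universal U r"
proof -
  have t: "tobj r a b \<in> mOb M \<and> theta r a b \<in> mHom M [a, b] (tobj r a b)" if "a \<in> mOb M" "b \<in> mOb M" for a b
    using assms that unfolding m_universal_def by blast
  have u: "uobj r \<in> mOb M" "umap r \<in> mHom M [] (uobj r)"
    using assms unfolding m_universal_def by blast+
  have bt: "bij_betw (\<lambda>f. mSub M (tobj r a b # xs) d 0 [a, b] f (theta r a b))
          (mHom M (tobj r a b # xs) d) (mHom M (a # b # xs) d)"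
    if "a \<in> mOb M" "b \<in> mOb M" "xs \<in> lists (mOb M)" "d \<in> mOb M" for a b xs d
    using assms that unfolding m_universal_def by blast
  have bu: "bij_betw (\<lambda>f. mSub M (uobj r # xs) d 0 [] f (umap r)) (mHom M (uobj r # xs) d) (mHom M xs d)"
    if "xs \<in> lists (mOb M)" "d \<in> mOb M" for xs d
    using assms that unfolding m_universal_def by blast
  have "bij_betw (\<lambda>f. subst U (tobj r a b # xs) d 0 [a, b] f (theta r a b))
          (MHom U (tobj r a b # xs) d) (MHom U (a # b # xs) d)"
    if *: "a \<in> mOb M" "b \<in> mOb M" "xs \<in> lists (mOb M)" "d \<in> mOb M" "length xs \<le> 2" for a b xs d
  proof -
    have eq: "subst U (tobj r a b # xs) d 0 [a, b] f (theta r a b)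
        = mSub M (tobj r a b # xs) d 0 [a, b] f (theta r a b)" if "f \<in> mHom M (tobj r a b # xs) d" for f
      using subst_U[of "tobj r a b # xs" d f "[a, b]" 0 "theta r a b"] t[of a b] * that
      by (auto simp: m_arr_iff m_sb_def ok_ar_def sub_arities_def le_Suc_eq numeral_2_eq_2)
    then show ?thesis
      using bt[OF *(1-4)] bij_betw_cong[OF eq, of "mHom M (tobj r a b # xs) d" "\<lambda>f. f"] * by simp
  qed
  moreover have "bij_betw (\<lambda>f. subst U (uobj r # xs) d 0 [] f (umap r))
          (MHom U (uobj r # xs) d) (MHom U xs d)"
    if *: "xs \<in> lists (mOb M)" "d \<in> mOb M" "length xs \<le> 2" for xs d
  proof -
    have eq: "subst U (uobj r # xs) d 0 [] f (umap r) = mSub M (uobj r # xs) d 0 [] f (umap r)"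
      if "f \<in> mHom M (uobj r # xs) d" for f
      using subst_U[of "uobj r # xs" d f "[]" 0 "umap r"] u * that
      by (auto simp: m_arr_iff m_sb_def ok_ar_def sub_arities_def le_Suc_eq numeral_2_eq_2)
    then show ?thesis
      using bu[OF *(1-2)] bij_betw_cong[OF eq, of "mHom M (uobj r # xs) d" "\<lambda>f. f"] * by simp
  qed
  ultimately show ?thesis using t u by (simp add: left_universal_def)
qed

lemma lr_multi_M:
  assumes r: "m_universal M r"
  shows "lr_multi (mOb M) (m_arr M) fst cod (m_idn M) (m_sb M) True
    (tobj r) (\<lambda>a b. ([a, b], tobj r a b, theta r a b)) (uobj r) ([], uobj r, umap r)"
proof -
  have t: "tobj r a b \<in> mOb M" "theta r a b \<in> mHom M [a, b] (tobj r a b)" if "a \<in> mOb M" "b \<in> mOb M" for a b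
    using assms that unfolding m_universal_def by blast+
  have u: "uobj r \<in> mOb M" "umap r \<in> mHom M [] (uobj r)"
    using assms unfolding m_universal_def by blast+
  have bt: "bij_betw (\<lambda>f. mSub M (tobj r a b # xs) d 0 [a, b] f (theta r a b))
          (mHom M (tobj r a b # xs) d) (mHom M (a # b # xs) d)"
    if "a \<in> mOb M" "b \<in> mOb M" "xs \<in> lists (mOb M)" "d \<in> mOb M" for a b xs d
    using assms that unfolding m_universal_def by blast
  have bu: "bij_betw (\<lambda>f. mSub M (uobj r # xs) d 0 [] f (umap r)) (mHom M (uobj r # xs) d) (mHom M xs d)"
    if "xs \<in> lists (mOb M)" "d \<in> mOb M" for xs d
    using assms that unfolding m_universal_def by blast
  show ?thesis
  proof
    fix f :: "('o, 'm) arrow" and a b xs assume "f \<in> m_arr M" "fst f = a # b # xs"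
    then obtain d m where f: "f = (a # b # xs, d, m)" "a \<in> mOb M" "b \<in> mOb M" "xs \<in> lists (mOb M)"
        "d \<in> mOb M" "m \<in> mHom M (a # b # xs) d"
      by (cases f) (auto simp: m_arr_iff)
    then have "m \<in> (\<lambda>f. mSub M (tobj r a b # xs) d 0 [a, b] f (theta r a b)) `
        mHom M (tobj r a b # xs) d"
      using bt[of a b xs d] by (simp add: bij_betw_def)
    then obtain h where "h \<in> mHom M (tobj r a b # xs) d"
        "m = mSub M (tobj r a b # xs) d 0 [a, b] h (theta r a b)" by (rule imageE)
    then show "\<exists>h\<in>m_arr M. fst h = tobj r a b # xs \<and> cod h = cod f \<and>
        m_sb M h 0 ([a, b], tobj r a b, theta r a b) = f"
      using f t by (intro bexI[of _ "(tobj r a b # xs, d, h)"]) (auto simp: m_sb_def m_arr_iff)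
  next
    fix h h' :: "('o, 'm) arrow" and a b xs
    assume "m_sb M h 0 ([a, b], tobj r a b, theta r a b) = m_sb M h' 0 ([a, b], tobj r a b, theta r a b)"
      "a \<in> mOb M" "b \<in> mOb M" "h \<in> m_arr M" "h' \<in> m_arr M" "fst h = tobj r a b # xs"
      "fst h' = tobj r a b # xs" "cod h = cod h'"
    then show "h = h'"
      using bt[of a b xs "cod h"]
      by (cases h; cases h') (auto simp: m_sb_def m_arr_iff bij_betw_def inj_on_def)
  next
    fix f :: "('o, 'm) arrow" assume "f \<in> m_arr M"
    then obtain xs d m where f: "f = (xs, d, m)" "xs \<in> lists (mOb M)" "d \<in> mOb M" "m \<in> mHom M xs d"
      by (cases f) (auto simp: m_arr_iff)
    then have "m \<in> (\<lambda>f. mSub M (uobj r # xs) d 0 [] f (umap r)) ` mHom M (uobj r # xs) d"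
      using bu[of xs d] by (simp add: bij_betw_def)
    then obtain h where "h \<in> mHom M (uobj r # xs) d" "m = mSub M (uobj r # xs) d 0 [] h (umap r)"
      by (rule imageE)
    then show "\<exists>h\<in>m_arr M. fst h = uobj r # fst f \<and> cod h = cod f \<and>
        m_sb M h 0 ([], uobj r, umap r) = f"
      using f u by (intro bexI[of _ "(uobj r # xs, d, h)"]) (auto simp: m_sb_def m_arr_iff)
  next
    fix h h' :: "('o, 'm) arrow" and xs
    assume "m_sb M h 0 ([], uobj r, umap r) = m_sb M h' 0 ([], uobj r, umap r)"
      "h \<in> m_arr M" "h' \<in> m_arr M" "fst h = uobj r # xs"
      "fst h' = uobj r # xs" "cod h = cod h'"
    then show "h = h'"
      using bu[of xs "cod h"]
      by (cases h; cases h') (auto simp: m_sb_def m_arr_iff bij_betw_def inj_on_def)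
  qed (use t u in \<open>auto simp: m_arr_iff\<close>)
qed

end

lemma multicategory_arrowsI: "multicategory M \<Longrightarrow> multicategory_arrows M"
  by (simp add: multicategory_arrows_def)

definition mlift :: "('o, 'm, 'p, 'n) mfun \<Rightarrow> ('o, 'm) arrow \<Rightarrow> ('p, 'n) arrow" where
  "mlift F f = (map (mFOb F) (fst f), mFOb F (cod f), mFM F (fst f) (cod f) (mor f))"

definition mfun_of ::
  "('o, 'm) multi \<Rightarrow> ('o \<Rightarrow> 'p) \<Rightarrow> (('o, 'm) arrow \<Rightarrow> ('p, 'n) arrow) \<Rightarrow> ('o, 'm, 'p, 'n) mfun"
where
  "mfun_of M \<phi> E = mfun_restrict M \<lparr>mFOb = \<phi>, mFM = (\<lambda>as b f. mor (E (as, b, f)))\<rparr>"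

text \<open>As for short multicategories, multifunctors are translated into morphisms that act on multimaps
  with domain and codomain, and back.\<close>

lemma multifunctor_lift:
  assumes M: "multicategory M" and N: "multicategory N" and F: "multifunctor M N F"
  shows "m_multi_morphism M N (mFOb F) (mlift F)"
proof -
  interpret M: multicategory_arrows M using M by (rule multicategory_arrowsI)
  interpret N: multicategory_arrows N using N by (rule multicategory_arrowsI)
  show ?thesis
  proof
    fix a assume "a \<in> mOb M"
    then show "mFOb F a \<in> mOb N" "mlift F (m_idn M a) = m_idn N (mFOb F a)"
      using F by (auto simp: multifunctor_def mlift_def m_idn_def)
  next
    fix f assume "f \<in> m_arr M"
    then show "mlift F f \<in> m_arr N"
      using F by (auto simp: multifunctor_def mlift_def m_arr_def intro!: map_lists)
  next
    fix g f :: "('a, 'b) arrow" and i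
    assume "g \<in> m_arr M" "f \<in> m_arr M" "i < length (fst g)" "fst g ! i = cod f"
    moreover have "\<forall>bs\<in>lists (mOb M). \<forall>as\<in>lists (mOb M). \<forall>c\<in>mOb M. \<forall>i<length bs.
        \<forall>g\<in>mHom M bs c. \<forall>f\<in>mHom M as (bs ! i).
        mFM F (plug bs i as) c (mSub M bs c i as g f)
          = mSub N (map (mFOb F) bs) (mFOb F c) i (map (mFOb F) as)
              (mFM F bs c g) (mFM F as (bs ! i) f)"
      using F unfolding multifunctor_def by blast
    ultimately show "mlift F (m_sb M g i f) = m_sb N (mlift F g) i (mlift F f)"
      by (auto simp: mlift_def m_sb_def m_arr_def map_plug)
  qed (auto simp: mlift_def)
qed

lemma mfun_of:
  assumes M: "multicategory M" and N: "multicategory N" and E: "m_multi_morphism M N \<phi> E"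
  shows "multifunctor M N (mfun_of M \<phi> E)" "mfun_ext M (mfun_of M \<phi> E)"
    "f \<in> m_arr M \<Longrightarrow> mlift (mfun_of M \<phi> E) f = E f" "a \<in> mOb M \<Longrightarrow> mFOb (mfun_of M \<phi> E) a = \<phi> a"
proof -
  interpret M: multicategory_arrows M using M by (rule multicategory_arrowsI)
  interpret N: multicategory_arrows N using N by (rule multicategory_arrowsI)
  interpret E: multi_morphism "mOb M" "m_arr M" fst cod "m_idn M" "m_sb M" True
    "mOb N" "m_arr N" fst cod "m_idn N" "m_sb N" \<phi> E by fact
  let ?F = "mfun_of M \<phi> E"
  show ext: "mfun_ext M ?F" by (simp add: mfun_ext_def mfun_of_def mfun_restrict_def)
  show FO [simp]: "mFOb ?F a = \<phi> a" if "a \<in> mOb M" for a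
    using that by (simp add: mfun_of_def mfun_restrict_def)
  have mFO: "map (mFOb ?F) as = map \<phi> as" if "as \<in> lists (mOb M)" for as
    using that by (intro map_cong_lists) auto
  have FM: "mFM ?F as b f = mor (E (as, b, f))" if "(as, b, f) \<in> m_arr M" for as b f
    using that by (simp add: mfun_of_def mfun_restrict_def m_arr_iff)
  have Eq: "E (as, b, f) = (map \<phi> as, \<phi> b, mFM ?F as b f)" if "(as, b, f) \<in> m_arr M" for as b f
    using E.dm_E[OF that] E.cd_E[OF that] FM[OF that] by (simp add: prod_eq_iff)
  show lift: "mlift ?F f = E f" if "f \<in> m_arr M" for f
    using that Eq[of "fst f" "cod f" "mor f"] mFO[of "fst f"]
    by (auto simp: mlift_def m_arr_def)
  have c: "mFM ?F as b f \<in> mHom N (map \<phi> as) (\<phi> b)" if "(as, b, f) \<in> m_arr M" for as b f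
    using E.E_Arr[OF that] Eq[OF that] by (simp add: m_arr_iff)
  show "multifunctor M N ?F"
    unfolding multifunctor_def
  proof (intro conjI ballI allI impI)
    fix a assume a: "a \<in> mOb M"
    show "mFOb ?F a \<in> mOb N" using a E.\<phi>_Obj by simp
    have "([a], a, mIdn M a) \<in> m_arr M" using a by (simp add: m_arr_iff)
    then show "mFM ?F [a] a (mIdn M a) = mIdn N (mFOb ?F a)"
      using E.E_idn[OF a] Eq[of "[a]" a "mIdn M a"] a by (simp add: m_idn_def)
  next
    fix as b f assume "as \<in> lists (mOb M)" "b \<in> mOb M" "f \<in> mHom M as b"
    then show "mFM ?F as b f \<in> mHom N (map (mFOb ?F) as) (mFOb ?F b)"
      using c[of as b f] by (simp add: m_arr_iff mFO)
  next
    fix bs as c i g f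
    assume *: "bs \<in> lists (mOb M)" "as \<in> lists (mOb M)" "c \<in> mOb M" "i < length bs"
      "g \<in> mHom M bs c" "f \<in> mHom M as (bs ! i)"
    then have g: "(bs, c, g) \<in> m_arr M" and f: "(as, bs ! i, f) \<in> m_arr M"
      by (auto simp: m_arr_iff nth_lists)
    have "m_sb M (bs, c, g) i (as, bs ! i, f) \<in> m_arr M" using g f * by simp
    then show "mFM ?F (plug bs i as) c (mSub M bs c i as g f)
          = mSub N (map (mFOb ?F) bs) (mFOb ?F c) i (map (mFOb ?F) as)
              (mFM ?F bs c g) (mFM ?F as (bs ! i) f)"
      using E.E_sb[OF g f, of i] * by (simp add: m_sb_def Eq[OF g] Eq[OF f] Eq mFO)
  qed
qed

lemma mfun_eqI:
  assumes F: "mfun_ext M F" and G: "mfun_ext M G"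
    and O: "\<And>a. a \<in> mOb M \<Longrightarrow> mFOb F a = mFOb G a" and L: "\<And>f. f \<in> m_arr M \<Longrightarrow> mlift F f = mlift G f"
  shows "F = (G :: ('o, 'm, 'p, 'n) mfun)"
proof (intro mfun.equality HOL.ext)
  show "mFOb F a = mFOb G a" for a
    using O F G by (cases "a \<in> mOb M") (auto simp: mfun_ext_def)
  show "mFM F as b f = mFM G as b f" for as b f
    using L[of "(as, b, f)"] F G
    by (cases "(as, b, f) \<in> m_arr M") (auto simp: mfun_ext_def m_arr_iff mlift_def)
qed simp

lemma Multi_sel:
  "M \<in> Ob Multi_lr \<longleftrightarrow> multicategory M \<and> multi_left_representable M"
  "F \<in> Hom Multi_lr M N \<longleftrightarrow> multifunctor M N F \<and> mfun_ext M F"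
  "Idn Multi_lr M = mfun_of M (\<lambda>a. a) (\<lambda>f. f)"
  "Comp Multi_lr M N P G F = mfun_of M (\<lambda>a. mFOb G (mFOb F a)) (\<lambda>f. mlift G (mlift F f))"
  by (simp_all add: Multi_lr_def mfun_of_def mlift_def)

lemma Multi_comp_lift:
  assumes M: "multicategory M" "multicategory N" "multicategory P"
    and F: "multifunctor M N F" and G: "multifunctor N P G"
  shows "multifunctor M P (Comp Multi_lr M N P G F)" "mfun_ext M (Comp Multi_lr M N P G F)"
    "f \<in> m_arr M \<Longrightarrow> mlift (Comp Multi_lr M N P G F) f = mlift G (mlift F f)"
    "a \<in> mOb M \<Longrightarrow> mFOb (Comp Multi_lr M N P G F) a = mFOb G (mFOb F a)"
  unfolding Multi_sel
  using mfun_of[OF M(1,3) multi_morphism_comp[OF multifunctor_lift[OF M(1,2) F] multifunctor_lift[OF M(2,3) G]]]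
  by auto

lemma Multi_id_lift:
  assumes M: "multicategory M"
  shows "multifunctor M M (Idn Multi_lr M)" "mfun_ext M (Idn Multi_lr M)"
    "f \<in> m_arr M \<Longrightarrow> mlift (Idn Multi_lr M) f = f" "a \<in> mOb M \<Longrightarrow> mFOb (Idn Multi_lr M) a = a"
  unfolding Multi_sel using mfun_of[OF M M multi_morphism_id[OF multi_bounded[OF M]]] by auto

lemma category_Multi_lr: "category (Multi_lr :: (('o, 'm) multi, ('o, 'm, 'o, 'm) mfun) cat)"
proof
  fix M :: "('o, 'm) multi"
  assume "M \<in> Ob Multi_lr"
  then show "Idn Multi_lr M \<in> Hom Multi_lr M M"
    using Multi_id_lift[of M] by (simp add: Multi_sel(1,2))
next
  fix M N P :: "('o, 'm) multi" and F G
  assume "M \<in> Ob Multi_lr" "N \<in> Ob Multi_lr" "P \<in> Ob Multi_lr" "F \<in> Hom Multi_lr M N" "G \<in> Hom Multi_lr N P"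
  then show "Comp Multi_lr M N P G F \<in> Hom Multi_lr M P"
    using Multi_comp_lift[of M N P F G] by (simp add: Multi_sel(1,2))
next
  fix M N :: "('o, 'm) multi" and F
  assume "M \<in> Ob Multi_lr" "N \<in> Ob Multi_lr" "F \<in> Hom Multi_lr M N"
  then have *: "multicategory M" "multicategory N" "multifunctor M N F" "mfun_ext M F"
    by (auto simp: Multi_sel(1,2))
  interpret F: multi_morphism "mOb M" "m_arr M" fst cod "m_idn M" "m_sb M" True
    "mOb N" "m_arr N" fst cod "m_idn N" "m_sb N" "mFOb F" "mlift F"
    using multifunctor_lift * by blast
  show "Comp Multi_lr M N N (Idn Multi_lr N) F = F"
    using * Multi_comp_lift[OF *(1,2,2,3) Multi_id_lift(1)[OF *(2)]] Multi_id_lift[OF *(2)]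
    by (intro mfun_eqI[of M]) (simp_all add: F.E_Arr F.\<phi>_Obj)
  show "Comp Multi_lr M M N F (Idn Multi_lr M) = F"
    using * Multi_comp_lift[OF *(1,1,2) Multi_id_lift(1)[OF *(1)] *(3)] Multi_id_lift[OF *(1)]
    by (intro mfun_eqI[of M]) simp_all
next
  fix M N P Q :: "('o, 'm) multi" and F G K
  assume "M \<in> Ob Multi_lr" "N \<in> Ob Multi_lr" "P \<in> Ob Multi_lr" "Q \<in> Ob Multi_lr"
    "F \<in> Hom Multi_lr M N" "G \<in> Hom Multi_lr N P" "K \<in> Hom Multi_lr P Q"
  then have *: "multicategory M" "multicategory N" "multicategory P" "multicategory Q"
    "multifunctor M N F" "multifunctor N P G" "multifunctor P Q K"
    by (auto simp: Multi_sel(1,2))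
  interpret F: multi_morphism "mOb M" "m_arr M" fst cod "m_idn M" "m_sb M" True
    "mOb N" "m_arr N" fst cod "m_idn N" "m_sb N" "mFOb F" "mlift F"
    using multifunctor_lift * by blast
  note GF = Multi_comp_lift[OF *(1,2,3,5,6)] and KG = Multi_comp_lift[OF *(2,3,4,6,7)]
  note KGF = Multi_comp_lift[OF *(1,3,4) GF(1) *(7)] and KGF' = Multi_comp_lift[OF *(1,2,4,5) KG(1)]
  show "Comp Multi_lr M P Q K (Comp Multi_lr M N P G F) = Comp Multi_lr M N Q (Comp Multi_lr N P Q K G) F"
    using GF KG KGF KGF' by (intro mfun_eqI[of M]) (simp_all add: F.E_Arr F.\<phi>_Obj)
qed

lemma sh_multi_morphism_U:
  assumes M: "multicategory M" and N: "multicategory N" and E: "m_multi_morphism M N \<phi> E"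
  shows "sh_multi_morphism (U_obj M) (U_obj N) \<phi> E"
proof -
  interpret M: multicategory_arrows M using M by (rule multicategory_arrowsI)
  interpret N: multicategory_arrows N using N by (rule multicategory_arrowsI)
  interpret E: multi_morphism "mOb M" "m_arr M" fst cod "m_idn M" "m_sb M" True
    "mOb N" "m_arr N" fst cod "m_idn N" "m_sb N" \<phi> E by fact
  note B = short_multicategory.bounded[OF M.short_U] short_multicategory.bounded[OF N.short_U]
  show ?thesis
    unfolding multi_morphism_def multi_morphism_axioms_def
    using B by (auto simp: E.\<phi>_Obj E.E_Arr E.dm_E E.cd_E E.E_idn E.E_sb M.sh_arr_U N.sh_arr_U
        M.sh_idn_U N.sh_idn_U M.sh_sb_U N.sh_sb_U)
qed

lemma U_mor_eq:
  assumes M: "multicategory M" and F: "mfun_ext M F"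
  shows "U_mor F = mor_of (U_obj M) (mFOb F) (mlift F)"
proof (intro shmor.equality HOL.ext)
  interpret M: multicategory_arrows M using M by (rule multicategory_arrowsI)
  show "FOb (U_mor F) a = FOb (mor_of (U_obj M) (mFOb F) (mlift F)) a" for a
    using F by (simp add: U_mor_def mor_of_def shmor_restrict_def mfun_ext_def)
  show "FHom (U_mor F) a b f = FHom (mor_of (U_obj M) (mFOb F) (mlift F)) a b f" for a b f
    using F by (auto simp: U_mor_def mor_of_def shmor_restrict_def mfun_ext_def mlift_def)
  show "FM (U_mor F) as b f = FM (mor_of (U_obj M) (mFOb F) (mlift F)) as b f" for as b f
    using F by (auto simp: U_mor_def mor_of_def shmor_restrict_def mfun_ext_def mlift_def)
qed simp

lemma U_mor:
  assumes M: "multicategory M" and N: "multicategory N" and F: "multifunctor M N F" "mfun_ext M F"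
  shows "sh_morphism (U_obj M) (U_obj N) (U_mor F)" "shmor_ext (U_obj M) (U_mor F)"
    "f \<in> sh_arr (U_obj M) \<Longrightarrow> lift (U_mor F) f = mlift F f" "FOb (U_mor F) = mFOb F"
proof -
  interpret M: multicategory_arrows M using M by (rule multicategory_arrowsI)
  interpret N: multicategory_arrows N using N by (rule multicategory_arrowsI)
  note m = mor_of[OF M.short_U N.short_U sh_multi_morphism_U[OF M N multifunctor_lift[OF M N F(1)]]]
  show "sh_morphism (U_obj M) (U_obj N) (U_mor F)" "shmor_ext (U_obj M) (U_mor F)"
    "f \<in> sh_arr (U_obj M) \<Longrightarrow> lift (U_mor F) f = mlift F f"
    using m U_mor_eq[OF M F(2)] by auto
  show "FOb (U_mor F) = mFOb F" by (simp add: U_mor_def)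
qed

lemma U_obj_in: "M \<in> Ob Multi_lr \<Longrightarrow> U_obj M \<in> Ob ShMulti_lr"
  using m_universal_exists[of M] multicategory_arrows.short_U[of M] multicategory_arrows.left_universal_U[of M]
  by (auto simp: Multi_sel(1) ShMulti_sel sh_left_representable_def multicategory_arrowsI)

lemma U_functor: "is_functor (Multi_lr :: (('o, 'm) multi, ('o, 'm, 'o, 'm) mfun) cat) ShMulti_lr U_lr"
  unfolding is_functor_def
proof (intro conjI ballI)
  fix M :: "('o, 'm) multi" assume M: "M \<in> Ob Multi_lr"
  then show "FOb U_lr M \<in> Ob ShMulti_lr" by (simp add: U_lr_def U_obj_in)
  have mM: "multicategory M" using M by (simp add: Multi_sel)
  interpret M: multicategory_arrows M using mM by (rule multicategory_arrowsI)
  note i = Multi_id_lift[OF mM]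
  note Ui = U_mor[OF mM mM i(1,2)] and si = ShMulti_id_lift[OF M.short_U]
  show "FHom U_lr M M (Idn Multi_lr M) = Idn ShMulti_lr (FOb U_lr M)"
    using Ui si i M.sh_arr_U
    by (simp add: U_lr_def del: M.U_sel(5)) (intro shmor_eqI[OF M.short_U], auto)
next
  fix M N :: "('o, 'm) multi" and F
  assume "M \<in> Ob Multi_lr" "N \<in> Ob Multi_lr" "F \<in> Hom Multi_lr M N"
  then show "FHom U_lr M N F \<in> Hom ShMulti_lr (FOb U_lr M) (FOb U_lr N)"
    using U_mor[of M N F] by (simp add: U_lr_def ShMulti_sel Multi_sel)
next
  fix M N P :: "('o, 'm) multi" and F G
  assume *: "M \<in> Ob Multi_lr" "N \<in> Ob Multi_lr" "P \<in> Ob Multi_lr" "F \<in> Hom Multi_lr M N" "G \<in> Hom Multi_lr N P"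
  then have m: "multicategory M" "multicategory N" "multicategory P" and F: "multifunctor M N F" "mfun_ext M F"
    and G: "multifunctor N P G" "mfun_ext N G" by (auto simp: Multi_sel)
  interpret M: multicategory_arrows M using m(1) by (rule multicategory_arrowsI)
  interpret N: multicategory_arrows N using m(2) by (rule multicategory_arrowsI)
  interpret P: multicategory_arrows P using m(3) by (rule multicategory_arrowsI)
  note UF = U_mor[OF m(1,2) F] and UG = U_mor[OF m(2,3) G]
  note GF = Multi_comp_lift[OF m F(1) G(1)]
  note UGF = U_mor[OF m(1,3) GF(1,2)]
  note c = ShMulti_comp_lift[OF M.short_U N.short_U P.short_U UF(1) UG(1)]
  interpret E: multi_morphism "Ob (U_obj M)" "sh_arr (U_obj M)" fst cod "sh_idn (U_obj M)"
    "sh_sb (U_obj M)" False "Ob (U_obj N)" "sh_arr (U_obj N)" fst cod "sh_idn (U_obj N)"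
    "sh_sb (U_obj N)" "FOb (U_mor F)" "lift (U_mor F)"
    by (rule multi_morphism_lift[OF M.short_U N.short_U UF(1)])
  have "U_mor (Comp Multi_lr M N P G F) = Comp ShMulti_lr (U_obj M) (U_obj N) (U_obj P) (U_mor G) (U_mor F)"
  proof (rule shmor_eqI[OF M.short_U UGF(1,2) c(1,2)])
    fix f assume f: "f \<in> sh_arr (U_obj M)"
    then have "f \<in> m_arr M" by (simp add: M.sh_arr_U)
    then show "lift (U_mor (Comp Multi_lr M N P G F)) f
        = lift (Comp ShMulti_lr (U_obj M) (U_obj N) (U_obj P) (U_mor G) (U_mor F)) f"
      using UGF(3)[OF f] GF(3) c(4)[OF f] UF(3)[OF f] UG(3)[OF E.E_Arr[OF f]] by simp
  next
    fix a assume "a \<in> Ob (U_obj M)"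
    then show "FOb (U_mor (Comp Multi_lr M N P G F)) a
        = FOb (Comp ShMulti_lr (U_obj M) (U_obj N) (U_obj P) (U_mor G) (U_mor F)) a"
      using UGF(4) GF(4) c(3) UF(4) UG(4) by simp
  qed
  then show "FHom U_lr M P (Comp Multi_lr M N P G F)
      = Comp ShMulti_lr (FOb U_lr M) (FOb U_lr N) (FOb U_lr P) (FHom U_lr N P G) (FHom U_lr M N F)"
    by (simp add: U_lr_def)
qed

text \<open>The values that determine a multifunctor are taken at maps of arity at most 2.\<close>

lemma U_mor_faithful:
  assumes M: "multicategory M" "multi_left_representable M" and N: "multicategory N"
    and F: "multifunctor M N F" "mfun_ext M F" and G: "multifunctor M N G" "mfun_ext M G"
    and eq: "U_mor F = U_mor G"
  shows "F = G"
proof -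
  interpret M: multicategory_arrows M using M(1) by (rule multicategory_arrowsI)
  obtain r where r: "m_universal M r" using m_universal_exists[OF M(2)] by blast
  interpret L: lr_multi "mOb M" "m_arr M" fst cod "m_idn M" "m_sb M" True
    "tobj r" "\<lambda>a b. ([a, b], tobj r a b, theta r a b)" "uobj r" "([], uobj r, umap r)"
    by (rule M.lr_multi_M[OF r])
  have small: "mlift F f = mlift G f" if "f \<in> m_arr M" "length (fst f) \<le> 4" for f
    using U_mor(3)[OF M(1) N F, of f] U_mor(3)[OF M(1) N G, of f] eq that by (simp add: M.sh_arr_U)
  show ?thesis
  proof (rule mfun_eqI[OF F(2) G(2)])
    show "mFOb F a = mFOb G a" for a
      using arg_cong[OF eq, of FOb] by (simp add: U_mor_def)
    show "mlift F f = mlift G f" if "f \<in> m_arr M" for f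
      using multi_morphism_unique[OF L.lr_multi_axioms multifunctor_lift[OF M(1) N F(1)]
          multifunctor_lift[OF M(1) N G(1)] _ _ _ that] L.th_Arr L.u_Arr small by simp
  qed
qed

text \<open>The restriction of \<open>F\<close> to unary maps and classifiers extends to all arities, since \<open>F\<close> preserves
  the substitutions that occur in \<open>extension_data\<close>. On maps of arity at most 4 the extension agrees
  with \<open>F\<close>, both being morphisms of short multicategories with the same values on unary maps and
  classifiers.\<close>

lemma U_mor_full:
  assumes M: "multicategory M" "multi_left_representable M" and N: "multicategory N"
    and F: "sh_morphism (U_obj M) (U_obj N) F" "shmor_ext (U_obj M) F"
  shows "\<exists>G. multifunctor M N G \<and> mfun_ext M G \<and> U_mor G = F"
proof -
  interpret M: multicategory_arrows M using M(1) by (rule multicategory_arrowsI)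
  interpret N: multicategory_arrows N using N by (rule multicategory_arrowsI)
  obtain r where r: "m_universal M r" using m_universal_exists[OF M(2)] by blast
  let ?th = "\<lambda>a b. ([a, b], tobj r a b, theta r a b)" and ?u = "([], uobj r, umap r)"
  interpret L: lr_multi "mOb M" "m_arr M" fst cod "m_idn M" "m_sb M" True
    "tobj r" ?th "uobj r" ?u by (rule M.lr_multi_M[OF r])
  interpret SL: lr_multi "Ob (U_obj M)" "sh_arr (U_obj M)" fst cod "sh_idn (U_obj M)"
    "sh_sb (U_obj M)" False "tobj r" ?th "uobj r" ?u
    by (rule lr_multi_short[OF M.short_U M.left_universal_U[OF r]])
  interpret E: multi_morphism "Ob (U_obj M)" "sh_arr (U_obj M)" fst cod "sh_idn (U_obj M)"
    "sh_sb (U_obj M)" False "Ob (U_obj N)" "sh_arr (U_obj N)" fst cod "sh_idn (U_obj N)"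
    "sh_sb (U_obj N)" "FOb F" "lift F"
    by (rule multi_morphism_lift[OF M.short_U N.short_U F(1)])
  have arr: "lift F f \<in> m_arr N \<and> fst (lift F f) = map (FOb F) (fst f) \<and> cod (lift F f) = FOb F (cod f)"
    if "f \<in> m_arr M" "length (fst f) \<le> 4" for f
    using E.E_Arr[of f] E.dm_E[of f] E.cd_E[of f] that by (simp add: M.sh_arr_U N.sh_arr_U)
  have E_sb: "lift F (m_sb M g i f) = m_sb N (lift F g) i (lift F f)"
    if "g \<in> m_arr M" "f \<in> m_arr M" "i < length (fst g)" "fst g ! i = cod f"
      "ok_ar False (length (fst g)) (length (fst f))" for g i f
  proof -
    have len: "length (fst g) \<le> 4" "length (fst f) \<le> 4" using that(5) by (auto simp: ok_ar_def)
    then have "lift F (sh_sb (U_obj M) g i f) = sh_sb (U_obj N) (lift F g) i (lift F f)"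
      using that by (intro E.E_sb) (auto simp: M.sh_arr_U)
    then show ?thesis
      using that len arr[of g] arr[of f] by (simp add: M.sh_sb_U N.sh_sb_U)
  qed
  have FO: "FOb F a \<in> mOb N" if "a \<in> mOb M" for a using E.\<phi>_Obj[of a] that by simp
  have E_idn: "lift F (m_idn M a) = m_idn N (FOb F a)" if "a \<in> mOb M" for a
    using E.E_idn[of a] that by (simp add: M.sh_idn_U N.sh_idn_U)
  note th = L.th_Arr and u = L.u_Arr
  interpret X: extension_data "mOb M" "m_arr M" fst cod "m_idn M" "m_sb M" True
    "tobj r" ?th "uobj r" ?u "mOb N" "m_arr N" fst cod "m_idn N" "m_sb N"
    "FOb F" "lift F" "\<lambda>a b. lift F (?th a b)" "lift F ?u"
  proof
    fix f a g assume "f \<in> m_arr M" "fst f = [a]" "g \<in> m_arr M" "fst g = [cod f]"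
    then show "lift F (m_sb M g 0 f) = m_sb N (lift F g) 0 (lift F f)"
      by (intro E_sb) auto
  next
    fix p a c k
    assume *: "p \<in> m_arr M" "fst p = [a]" "c \<in> mOb M" "k \<in> m_arr M" "fst k = [tobj r a c]"
      "cod k = tobj r (cod p) c" "m_sb M k 0 (?th a c) = m_sb M (?th (cod p) c) 0 p"
    have "a \<in> mOb M" "cod p \<in> mOb M" using M.dm_Obj[of p] M.cd_Obj[of p] * by auto
    then show "m_sb N (lift F k) 0 (lift F (?th a c)) = m_sb N (lift F (?th (cod p) c)) 0 (lift F p)"
      using * th by (simp flip: E_sb)
  next
    fix p a c k
    assume *: "p \<in> m_arr M" "fst p = [c]" "a \<in> mOb M" "k \<in> m_arr M" "fst k = [tobj r a c]"
      "cod k = tobj r a (cod p)" "m_sb M k 0 (?th a c) = m_sb M (?th a (cod p)) 1 p"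
    have "c \<in> mOb M" "cod p \<in> mOb M" using M.dm_Obj[of p] M.cd_Obj[of p] * by auto
    then show "m_sb N (lift F k) 0 (lift F (?th a c)) = m_sb N (lift F (?th a (cod p))) 1 (lift F p)"
      using * th by (simp flip: E_sb)
  next
    fix a b c k
    assume *: "a \<in> mOb M" "b \<in> mOb M" "c \<in> mOb M" "k \<in> m_arr M" "fst k = [tobj r (tobj r a b) c]"
      "cod k = tobj r a (tobj r b c)"
      "m_sb M (m_sb M k 0 (?th (tobj r a b) c)) 0 (?th a b) = m_sb M (?th a (tobj r b c)) 1 (?th b c)"
    then show "m_sb N (m_sb N (lift F k) 0 (lift F (?th (tobj r a b) c))) 0 (lift F (?th a b))
      = m_sb N (lift F (?th a (tobj r b c))) 1 (lift F (?th b c))"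
      using th by (simp flip: E_sb)
  next
    fix a k
    assume *: "a \<in> mOb M" "k \<in> m_arr M" "fst k = [tobj r (uobj r) a]" "cod k = a"
      "m_sb M (m_sb M k 0 (?th (uobj r) a)) 0 ?u = m_idn M a"
    then show "m_sb N (m_sb N (lift F k) 0 (lift F (?th (uobj r) a))) 0 (lift F ?u) = m_idn N (FOb F a)"
      using th u by (simp flip: E_sb E_idn)
  next
    fix a assume "a \<in> mOb M"
    then show "lift F (m_sb M (?th a (uobj r)) 1 ?u) = m_sb N (lift F (?th a (uobj r))) 1 (lift F ?u)"
      using th u by (intro E_sb) auto
  qed (use arr th u FO E_idn in auto)
  let ?G = "mfun_of M (FOb F) X.ext"
  note G = mfun_of[OF M(1) N X.ext_morphism]
  note UG = U_mor[OF M(1) N G(1,2)]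
  have "U_mor ?G = F"
  proof (rule shmor_eqI[OF M.short_U UG(1,2) F])
    fix a assume "a \<in> Ob (U_obj M)"
    then show "FOb (U_mor ?G) a = FOb F a" using UG(4) G(4) by simp
  next
    fix f assume f: "f \<in> sh_arr (U_obj M)"
    show "lift (U_mor ?G) f = lift F f"
    proof (rule multi_morphism_unique[OF SL.lr_multi_axioms
          multi_morphism_lift[OF M.short_U N.short_U UG(1)] E.multi_morphism_axioms _ _ _ f])
      fix f a assume "f \<in> sh_arr (U_obj M)" "fst f = [a]"
      then show "lift (U_mor ?G) f = lift F f"
        using UG(3)[of f] G(3)[of f] X.ext_unary[of f a] by (simp add: M.sh_arr_U)
    next
      show "lift (U_mor ?G) ?u = lift F ?u"
        using UG(3)[of ?u] G(3)[of ?u] X.ext_u_eq u by (simp add: M.sh_arr_U)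
    next
      fix a b assume "a \<in> Ob (U_obj M)" "b \<in> Ob (U_obj M)"
      then show "lift (U_mor ?G) (?th a b) = lift F (?th a b)"
        using UG(3)[of "?th a b"] G(3)[of "?th a b"] X.ext_th_eq[of a b] th[of a b] by (simp add: M.sh_arr_U)
    qed
  qed
  then show ?thesis using G(1,2) by blast
qed


section \<open>The multicategory of a left normal skew monoidal category\<close>

locale ln_skew_monoidal = skew_monoidal C for C :: "('o, 'm) skmon" (structure) +
  assumes left_normal: "left_normal C"
begin

abbreviation cmp (infixr "\<bullet>" 60) where "g \<bullet> f \<equiv> sk_cmp C g f"
abbreviation tns (infixl "\<boxtimes>" 70) where "f \<boxtimes> g \<equiv> sk_tns C f g"
abbreviation idA ("\<iota>") where "\<iota> \<equiv> sk_idn C"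
abbreviation e :: 'o where "e \<equiv> Unit C"
abbreviation al where "al \<equiv> sk_al C"
abbreviation la where "la \<equiv> sk_la C"
abbreviation ro where "ro \<equiv> sk_ro C"
abbreviation A where "A \<equiv> sk_arr C"

text \<open>\<open>M x [y\<^sub>1, \<dots>, y\<^sub>n]\<close> is \<open>(x \<otimes> y\<^sub>1) \<otimes> \<dots> \<otimes> y\<^sub>n\<close>, and \<open>L\<close> is the action of \<open>M\<close> on maps in \<open>x\<close>.\<close>

definition M :: "'o \<Rightarrow> 'o list \<Rightarrow> 'o" where "M x ys = foldl (Ten C) x ys"

definition L :: "'o list \<Rightarrow> 'o \<times> 'o \<times> 'm \<Rightarrow> 'o \<times> 'o \<times> 'm" where
  "L ys f = foldl (\<lambda>f y. f \<boxtimes> \<iota> y) f ys"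

lemma M_simps [simp]: "M x [] = x" "M x (y # ys) = M (x \<otimes> y) ys" "M x (ys @ zs) = M (M x ys) zs"
  by (simp_all add: M_def)

lemma L_simps [simp]: "L [] f = f" "L (y # ys) f = L ys (f \<boxtimes> \<iota> y)" "L (ys @ zs) f = L zs (L ys f)"
  by (simp_all add: L_def)

lemma lists_simps [simp]:
  "[] \<in> lists B" "x # xs \<in> lists B \<longleftrightarrow> x \<in> B \<and> xs \<in> lists B"
  "xs @ ys \<in> lists B \<longleftrightarrow> xs \<in> lists B \<and> ys \<in> lists B"
  by auto

lemma M_Ob [simp]: "x \<in> Ob C \<Longrightarrow> ys \<in> lists (Ob C) \<Longrightarrow> M x ys \<in> Ob C"
  by (induction ys arbitrary: x) auto

lemma L_arr [simp]: "f \<in> A \<Longrightarrow> ys \<in> lists (Ob C) \<Longrightarrow> L ys f \<in> A"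
  by (induction ys arbitrary: f) auto

lemma src_L [simp]: "fst (L ys f) = M (fst f) ys" and trg_L [simp]: "cod (L ys f) = M (cod f) ys"
  by (induction ys arbitrary: f) auto

lemma L_idn [simp]: "x \<in> Ob C \<Longrightarrow> ys \<in> lists (Ob C) \<Longrightarrow> L ys (\<iota> x) = \<iota> (M x ys)"
  by (induction ys arbitrary: x) auto

lemma L_cmp:
  "g \<in> A \<Longrightarrow> f \<in> A \<Longrightarrow> fst g = cod f \<Longrightarrow> ys \<in> lists (Ob C) \<Longrightarrow> L ys (g \<bullet> f) = L ys g \<bullet> L ys f"
proof (induction ys arbitrary: g f)
  case (Cons y ys)
  have "(g \<bullet> f) \<boxtimes> \<iota> y = (g \<boxtimes> \<iota> y) \<bullet> (f \<boxtimes> \<iota> y)"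
    using sk_tns_cmp[of g f "\<iota> y" "\<iota> y"] Cons.prems by simp
  then show ?case using Cons by simp
qed simp

lemma tns_cmp_left:
  "g \<in> A \<Longrightarrow> f \<in> A \<Longrightarrow> fst g = cod f \<Longrightarrow> y \<in> Ob C \<Longrightarrow> (g \<bullet> f) \<boxtimes> \<iota> y = (g \<boxtimes> \<iota> y) \<bullet> (f \<boxtimes> \<iota> y)"
  using sk_tns_cmp[of g f "\<iota> y" "\<iota> y"] by simp

lemma tns_cmp_right:
  "g \<in> A \<Longrightarrow> f \<in> A \<Longrightarrow> fst g = cod f \<Longrightarrow> y \<in> Ob C \<Longrightarrow> \<iota> y \<boxtimes> (g \<bullet> f) = (\<iota> y \<boxtimes> g) \<bullet> (\<iota> y \<boxtimes> f)"
  using sk_tns_cmp[of "\<iota> y" "\<iota> y" g f] by simp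

text \<open>The map \<open>((x \<otimes> y) \<otimes> a\<^sub>1) \<otimes> \<dots> \<otimes> a\<^sub>n \<rightarrow> x \<otimes> ((y \<otimes> a\<^sub>1) \<otimes> \<dots> \<otimes> a\<^sub>n)\<close> composed of associators.\<close>

primrec assocs :: "'o \<Rightarrow> 'o \<Rightarrow> 'o list \<Rightarrow> 'o \<times> 'o \<times> 'm" where
  "assocs x y [] = \<iota> (x \<otimes> y)"
| "assocs x y (a # as) = assocs x (y \<otimes> a) as \<bullet> L as (al x y a)"

text \<open>The map \<open>(x \<otimes> a\<^sub>1) \<otimes> \<dots> \<otimes> a\<^sub>n \<rightarrow> x \<otimes> ((e \<otimes> a\<^sub>1) \<otimes> \<dots> \<otimes> a\<^sub>n)\<close> by which a block of inputs is separated from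
  those before it.\<close>

definition phi :: "'o \<Rightarrow> 'o list \<Rightarrow> 'o \<times> 'o \<times> 'm" where
  "phi x as = assocs x e as \<bullet> L as (ro x)"

lemma assocs_typed:
  "x \<in> Ob C \<Longrightarrow> y \<in> Ob C \<Longrightarrow> as \<in> lists (Ob C)
    \<Longrightarrow> assocs x y as \<in> A \<and> fst (assocs x y as) = M (x \<otimes> y) as \<and> cod (assocs x y as) = x \<otimes> M y as"
  by (induction as arbitrary: y) auto

lemma assocs_simps [simp]:
  assumes "x \<in> Ob C" "y \<in> Ob C" "as \<in> lists (Ob C)"
  shows "assocs x y as \<in> A" "fst (assocs x y as) = M (x \<otimes> y) as" "cod (assocs x y as) = x \<otimes> M y as"
  using assocs_typed[OF assms] by auto

lemma phi_simps [simp]: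
  assumes "x \<in> Ob C" "as \<in> lists (Ob C)"
  shows "phi x as \<in> A" "fst (phi x as) = M x as" "cod (phi x as) = x \<otimes> M e as"
  using assms by (simp_all add: phi_def)

lemma assocs_nat_right:
  assumes "f \<in> A" "x \<in> Ob C" "as \<in> lists (Ob C)"
  shows "assocs x (cod f) as \<bullet> L as (\<iota> x \<boxtimes> f) = (\<iota> x \<boxtimes> L as f) \<bullet> assocs x (fst f) as"
  using assms
proof (induction as arbitrary: f)
  case (Cons a as)
  then have [simp]: "a \<in> Ob C" "as \<in> lists (Ob C)" "f \<in> A" "x \<in> Ob C" by auto
  have "assocs x (cod f) (a # as) \<bullet> L (a # as) (\<iota> x \<boxtimes> f)
      = assocs x (cod f \<otimes> a) as \<bullet> L as (al (cod (\<iota> x)) (cod f) (cod (\<iota> a)) \<bullet> (\<iota> x \<boxtimes> f \<boxtimes> \<iota> a))"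
    by (simp add: L_cmp)
  also have "\<dots> = (assocs x (cod (f \<boxtimes> \<iota> a)) as \<bullet> L as (\<iota> x \<boxtimes> (f \<boxtimes> \<iota> a))) \<bullet> L as (al x (fst f) a)"
    by (subst sk_al_nat) (auto simp: L_cmp)
  also have "\<dots> = ((\<iota> x \<boxtimes> L as (f \<boxtimes> \<iota> a)) \<bullet> assocs x (fst (f \<boxtimes> \<iota> a)) as) \<bullet> L as (al x (fst f) a)"
    by (subst Cons.IH) auto
  finally show ?case by simp
qed simp

lemma assocs_nat_left:
  assumes "f \<in> A" "y \<in> Ob C" "as \<in> lists (Ob C)"
  shows "assocs (cod f) y as \<bullet> L as (f \<boxtimes> \<iota> y) = (f \<boxtimes> \<iota> (M y as)) \<bullet> assocs (fst f) y as"
  using assms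
proof (induction as arbitrary: y)
  case (Cons a as)
  then have [simp]: "a \<in> Ob C" "as \<in> lists (Ob C)" "f \<in> A" "y \<in> Ob C" by auto
  have "assocs (cod f) y (a # as) \<bullet> L (a # as) (f \<boxtimes> \<iota> y)
      = assocs (cod f) (y \<otimes> a) as \<bullet> L as (al (cod f) (cod (\<iota> y)) (cod (\<iota> a)) \<bullet> (f \<boxtimes> \<iota> y \<boxtimes> \<iota> a))"
    by (simp add: L_cmp)
  also have "\<dots> = (assocs (cod f) (y \<otimes> a) as \<bullet> L as (f \<boxtimes> \<iota> (y \<otimes> a))) \<bullet> L as (al (fst f) y a)"
    by (subst sk_al_nat) (auto simp: L_cmp)
  also have "\<dots> = ((f \<boxtimes> \<iota> (M (y \<otimes> a) as)) \<bullet> assocs (fst f) (y \<otimes> a) as) \<bullet> L as (al (fst f) y a)"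
    by (subst Cons.IH) auto
  finally show ?case by simp
qed simp

lemma assocs_append:
  assumes "x \<in> Ob C" "y \<in> Ob C" "as \<in> lists (Ob C)" "bs \<in> lists (Ob C)"
  shows "assocs x y (as @ bs) = assocs x (M y as) bs \<bullet> L bs (assocs x y as)"
  using assms by (induction as arbitrary: y) (auto simp: L_cmp)

lemma phi_append:
  assumes "x \<in> Ob C" "as \<in> lists (Ob C)" "bs \<in> lists (Ob C)"
  shows "phi x (as @ bs) = assocs x (M e as) bs \<bullet> L bs (phi x as)"
  using assms by (simp add: phi_def assocs_append L_cmp)

lemma phi_snoc:
  assumes "x \<in> Ob C" "as \<in> lists (Ob C)" "b \<in> Ob C"
  shows "phi x (as @ [b]) = al x (M e as) b \<bullet> (phi x as \<boxtimes> \<iota> b)"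
  using assms by (simp add: phi_append)

lemma phi_nat:
  assumes [simp]: "f \<in> A" "as \<in> lists (Ob C)"
  shows "phi (cod f) as \<bullet> L as f = (f \<boxtimes> \<iota> (M e as)) \<bullet> phi (fst f) as"
proof -
  have "phi (cod f) as \<bullet> L as f = assocs (cod f) e as \<bullet> L as (ro (cod f) \<bullet> f)"
    by (simp add: phi_def L_cmp)
  also have "\<dots> = (assocs (cod f) e as \<bullet> L as (f \<boxtimes> \<iota> e)) \<bullet> L as (ro (fst f))"
    by (simp add: sk_ro_nat L_cmp)
  finally show ?thesis by (simp add: assocs_nat_left phi_def)
qed

lemma la_assocs:
  assumes "y \<in> Ob C" "as \<in> lists (Ob C)"
  shows "la (M y as) \<bullet> assocs e y as = L as (la y)"
  using assms
proof (induction as arbitrary: y)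
  case (Cons a as)
  then have [simp]: "a \<in> Ob C" "as \<in> lists (Ob C)" "y \<in> Ob C" by auto
  have "la (M y (a # as)) \<bullet> assocs e y (a # as) = (la (M (y \<otimes> a) as) \<bullet> assocs e (y \<otimes> a) as) \<bullet> L as (al e y a)"
    by simp
  also have "\<dots> = L as (la (y \<otimes> a) \<bullet> al e y a)"
    by (simp add: Cons.IH L_cmp)
  finally show ?case by (simp add: sk_la_al)
qed simp

lemma la_phi:
  assumes [simp]: "as \<in> lists (Ob C)"
  shows "la (M e as) \<bullet> phi e as = \<iota> (M e as)"
proof -
  have "la (M e as) \<bullet> phi e as = (la (M e as) \<bullet> assocs e e as) \<bullet> L as (ro e)"
    by (simp add: phi_def)
  also have "\<dots> = L as (la e \<bullet> ro e)"
    by (simp add: la_assocs L_cmp)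
  finally show ?thesis by (simp add: sk_la_ro)
qed

text \<open>The pentagon for blocks: separating \<open>y # cs\<close> from \<open>x \<otimes> u\<close> amounts, up to an associator, to separating
  it from \<open>u\<close> after both have been separated from \<open>x\<close>.\<close>

lemma al_assocs:
  assumes "x \<in> Ob C" "u \<in> Ob C" "y \<in> Ob C" "cs \<in> lists (Ob C)"
  shows "al x u (M y cs) \<bullet> assocs (x \<otimes> u) y cs
    = (\<iota> x \<boxtimes> assocs u y cs) \<bullet> (assocs x (u \<otimes> y) cs \<bullet> L cs (al x u y))"
  using assms
proof (induction cs arbitrary: y)
  case (Cons c cs)
  then have [simp]: "c \<in> Ob C" "cs \<in> lists (Ob C)" "x \<in> Ob C" "u \<in> Ob C" "y \<in> Ob C" by auto
  have "al x u (M y (c # cs)) \<bullet> assocs (x \<otimes> u) y (c # cs)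
      = (al x u (M (y \<otimes> c) cs) \<bullet> assocs (x \<otimes> u) (y \<otimes> c) cs) \<bullet> L cs (al (x \<otimes> u) y c)"
    by simp
  also have "\<dots> = (\<iota> x \<boxtimes> assocs u (y \<otimes> c) cs) \<bullet> assocs x (u \<otimes> (y \<otimes> c)) cs \<bullet>
      L cs (al x u (y \<otimes> c) \<bullet> al (x \<otimes> u) y c)"
    by (subst Cons.IH) (auto simp: L_cmp)
  also have "\<dots> = (\<iota> x \<boxtimes> assocs u (y \<otimes> c) cs) \<bullet>
      (assocs x (cod (al u y c)) cs \<bullet> L cs (\<iota> x \<boxtimes> al u y c)) \<bullet>
      L cs (al x (u \<otimes> y) c \<bullet> (al x u y \<boxtimes> \<iota> c))"
    by (simp add: sk_pentagon L_cmp)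
  also have "\<dots> = (\<iota> x \<boxtimes> assocs u (y \<otimes> c) cs) \<bullet>
      ((\<iota> x \<boxtimes> L cs (al u y c)) \<bullet> assocs x (fst (al u y c)) cs) \<bullet>
      L cs (al x (u \<otimes> y) c \<bullet> (al x u y \<boxtimes> \<iota> c))"
    by (subst assocs_nat_right) auto
  finally show ?case by (simp add: L_cmp tns_cmp_right)
qed simp

text \<open>The same for \<open>phi\<close>, by the axiom on \<open>\<alpha>\<close> and \<open>\<rho>\<close>.\<close>

lemma al_phi:
  assumes [simp]: "x \<in> Ob C" "u \<in> Ob C" "cs \<in> lists (Ob C)"
  shows "al x u (M e cs) \<bullet> phi (x \<otimes> u) cs = (\<iota> x \<boxtimes> phi u cs) \<bullet> assocs x u cs"
proof -
  have "al x u (M e cs) \<bullet> phi (x \<otimes> u) cs = (al x u (M e cs) \<bullet> assocs (x \<otimes> u) e cs) \<bullet> L cs (ro (x \<otimes> u))"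
    by (simp add: phi_def)
  also have "\<dots> = (\<iota> x \<boxtimes> assocs u e cs) \<bullet> assocs x (u \<otimes> e) cs \<bullet> L cs (al x u e \<bullet> ro (x \<otimes> u))"
    by (subst al_assocs) (auto simp: L_cmp)
  also have "\<dots> = (\<iota> x \<boxtimes> assocs u e cs) \<bullet> (assocs x (cod (ro u)) cs \<bullet> L cs (\<iota> x \<boxtimes> ro u))"
    by (simp add: sk_ro_al)
  also have "\<dots> = (\<iota> x \<boxtimes> assocs u e cs) \<bullet> (\<iota> x \<boxtimes> L cs (ro u)) \<bullet> assocs x u cs"
    by (subst assocs_nat_right) auto
  finally show ?thesis by (simp add: phi_def tns_cmp_right)
qed

text \<open>The map \<open>M x as \<rightarrow> x \<otimes> b\<close> given by a multimap \<open>f : as \<rightarrow> b\<close> that is to be substituted to the right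
  of inputs whose product is \<open>x\<close>.\<close>

definition ins :: "'o \<Rightarrow> 'o list \<Rightarrow> 'o \<times> 'o \<times> 'm \<Rightarrow> 'o \<times> 'o \<times> 'm" where
  "ins x as f = (\<iota> x \<boxtimes> f) \<bullet> phi x as"

lemma ins_simps [simp]:
  assumes "x \<in> Ob C" "as \<in> lists (Ob C)" "f \<in> A" "fst f = M e as"
  shows "ins x as f \<in> A" "fst (ins x as f) = M x as" "cod (ins x as f) = x \<otimes> cod f"
  using assms by (simp_all add: ins_def)

text \<open>The parallel associativity law: \<open>f\<close> acts on inputs to the left of those of \<open>h\<close>.\<close>

lemma ins_nat:
  assumes [simp]: "f \<in> A" "as \<in> lists (Ob C)" "h \<in> A" "fst h = M e as"
  shows "ins (cod f) as h \<bullet> L as f = (f \<boxtimes> \<iota> (cod h)) \<bullet> ins (fst f) as h"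
proof -
  have "ins (cod f) as h \<bullet> L as f = (\<iota> (cod f) \<boxtimes> h) \<bullet> (phi (cod f) as \<bullet> L as f)"
    by (simp add: ins_def)
  also have "\<dots> = ((\<iota> (cod f) \<boxtimes> h) \<bullet> (f \<boxtimes> \<iota> (M e as))) \<bullet> phi (fst f) as"
    by (simp add: phi_nat)
  also have "\<dots> = ((f \<boxtimes> \<iota> (cod h)) \<bullet> (\<iota> (fst f) \<boxtimes> h)) \<bullet> phi (fst f) as"
    using sk_interchange[of f h] by simp
  finally show ?thesis by (simp add: ins_def)
qed

text \<open>The sequential associativity law, \<open>h\<close> being substituted into \<open>g\<close> between \<open>us\<close> and \<open>vs\<close>. The inputs \<open>vs\<close>
  are carried along by naturality of \<open>assocs\<close>; the core is the case without them, where the inputs of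
  \<open>h\<close> are separated either from \<open>us\<close> inside the block of \<open>g\<close> or from \<open>x\<close> and \<open>us\<close> at once.\<close>

lemma ins_ins:
  assumes [simp]: "x \<in> Ob C" "us \<in> lists (Ob C)" "vs \<in> lists (Ob C)" "cs \<in> lists (Ob C)"
    and [simp]: "h \<in> A" "fst h = M e cs" "g \<in> A" and g: "fst g = M e (us @ cod h # vs)"
  shows "ins x (us @ cs @ vs) (g \<bullet> L vs (ins (M e us) cs h))
    = ins x (us @ cod h # vs) g \<bullet> L vs (ins (M x us) cs h)"
proof -
  let ?u = "M e us" and ?b = "cod h" and ?z = "M x us"
  have [simp]: "fst g = M (?u \<otimes> ?b) vs" using g by simp
  have core: "(\<iota> x \<boxtimes> ins ?u cs h) \<bullet> phi x (us @ cs) = phi x (us @ [?b]) \<bullet> ins ?z cs h"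
  proof -
    have "phi x (us @ [?b]) \<bullet> ins ?z cs h = al x ?u ?b \<bullet> ((phi x us \<boxtimes> \<iota> ?b) \<bullet> (\<iota> (fst (phi x us)) \<boxtimes> h)) \<bullet> phi ?z cs"
      by (subst phi_snoc) (auto simp: ins_def)
    also have "\<dots> = al x ?u ?b \<bullet> (\<iota> (x \<otimes> ?u) \<boxtimes> h) \<bullet> ((phi x us \<boxtimes> \<iota> (M e cs)) \<bullet> phi (fst (phi x us)) cs)"
      using sk_interchange[of "phi x us" h ?z "x \<otimes> ?u" "M e cs" ?b] by simp
    also have "\<dots> = (al (cod (\<iota> x)) (cod (\<iota> ?u)) (cod h) \<bullet> (\<iota> x \<boxtimes> \<iota> ?u \<boxtimes> h)) \<bullet> (phi (cod (phi x us)) cs \<bullet> L cs (phi x us))"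
      by (subst phi_nat) auto
    also have "\<dots> = (\<iota> x \<boxtimes> (\<iota> ?u \<boxtimes> h)) \<bullet> (al x ?u (M e cs) \<bullet> phi (x \<otimes> ?u) cs) \<bullet> L cs (phi x us)"
      by (subst sk_al_nat) auto
    also have "\<dots> = (\<iota> x \<boxtimes> (\<iota> ?u \<boxtimes> h)) \<bullet> (\<iota> x \<boxtimes> phi ?u cs) \<bullet> assocs x ?u cs \<bullet> L cs (phi x us)"
      by (subst al_phi) auto
    also have "\<dots> = (\<iota> x \<boxtimes> ins ?u cs h) \<bullet> phi x (us @ cs)"
      by (simp add: ins_def tns_cmp_right phi_append)
    finally show ?thesis ..
  qed
  have "ins x (us @ cs @ vs) (g \<bullet> L vs (ins ?u cs h))
      = (\<iota> x \<boxtimes> g) \<bullet> ((\<iota> x \<boxtimes> L vs (ins ?u cs h)) \<bullet> assocs x (fst (ins ?u cs h)) vs) \<bullet> L vs (phi x (us @ cs))"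
    using phi_append[of x "us @ cs" vs] by (simp add: ins_def[of x "us @ cs @ vs"] tns_cmp_right)
  also have "\<dots> = (\<iota> x \<boxtimes> g) \<bullet> (assocs x (cod (ins ?u cs h)) vs \<bullet> L vs (\<iota> x \<boxtimes> ins ?u cs h)) \<bullet> L vs (phi x (us @ cs))"
    by (subst assocs_nat_right) auto
  also have "\<dots> = (\<iota> x \<boxtimes> g) \<bullet> assocs x (?u \<otimes> ?b) vs \<bullet> L vs ((\<iota> x \<boxtimes> ins ?u cs h) \<bullet> phi x (us @ cs))"
    by (simp add: L_cmp)
  also have "\<dots> = (\<iota> x \<boxtimes> g) \<bullet> assocs x (?u \<otimes> ?b) vs \<bullet> L vs (phi x (us @ [?b]) \<bullet> ins ?z cs h)"
    by (simp only: core)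
  also have "\<dots> = ins x (us @ ?b # vs) g \<bullet> L vs (ins ?z cs h)"
    using phi_append[of x "us @ [?b]" vs] by (simp add: ins_def[of x "us @ ?b # vs"] L_cmp)
  finally show ?thesis .
qed

text \<open>This lemma and the next one are the two unit laws; the identity multimap of \<open>a\<close> is \<open>la a : e \<otimes> a \<rightarrow> a\<close>.\<close>

lemma ins_idn:
  assumes [simp]: "x \<in> Ob C" "a \<in> Ob C"
  shows "ins x [a] (la a) = \<iota> (x \<otimes> a)"
  using sk_la_ro_al[of x a] by (simp add: ins_def phi_def)

lemma ins_unit:
  assumes "as \<in> lists (Ob C)" "f \<in> A" "fst f = M e as"
  shows "la (cod f) \<bullet> ins e as f = f"
proof -
  have "la (cod f) \<bullet> ins e as f = (la (cod f) \<bullet> (\<iota> e \<boxtimes> f)) \<bullet> phi e as"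
    using assms by (simp add: ins_def)
  also have "\<dots> = f \<bullet> (la (M e as) \<bullet> phi e as)"
    using assms by (simp add: sk_la_nat)
  finally show ?thesis using assms by (simp add: la_phi)
qed

definition li :: "'o \<Rightarrow> 'o \<times> 'o \<times> 'm" where
  "li a = (SOME h. h \<in> A \<and> fst h = a \<and> cod h = e \<otimes> a \<and> la a \<bullet> h = \<iota> a \<and> h \<bullet> la a = \<iota> (e \<otimes> a))"

lemma li:
  assumes "a \<in> Ob C"
  shows "li a \<in> A" "fst (li a) = a" "cod (li a) = e \<otimes> a" "la a \<bullet> li a = \<iota> a" "li a \<bullet> la a = \<iota> (e \<otimes> a)"
proof -
  obtain h where h: "h \<in> Hom C a (e \<otimes> a)" "Comp C (e \<otimes> a) a (e \<otimes> a) h (LUnit C a) = Idn C (e \<otimes> a)"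
      "Comp C a (e \<otimes> a) a (LUnit C a) h = Idn C a"
    using left_normal assms by (auto simp: left_normal_def iso_def)
  let ?P = "\<lambda>h. h \<in> A \<and> fst h = a \<and> cod h = e \<otimes> a \<and> la a \<bullet> h = \<iota> a \<and> h \<bullet> la a = \<iota> (e \<otimes> a)"
  have "?P (a, e \<otimes> a, h)"
    using h assms by (simp add: sk_arr_iff sk_cmp_def sk_la_def sk_idn_def)
  then have "?P (SOME h. ?P h)" by (rule someI[of ?P])
  then show "li a \<in> A" "fst (li a) = a" "cod (li a) = e \<otimes> a" "la a \<bullet> li a = \<iota> a" "li a \<bullet> la a = \<iota> (e \<otimes> a)"
    by (simp_all add: li_def)
qed

declare li [simp]

lemma li_nat:
  assumes [simp]: "f \<in> A"
  shows "(\<iota> e \<boxtimes> f) \<bullet> li (fst f) = li (cod f) \<bullet> f"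
proof -
  have "(\<iota> e \<boxtimes> f) \<bullet> li (fst f) = (li (cod f) \<bullet> la (cod f)) \<bullet> (\<iota> e \<boxtimes> f) \<bullet> li (fst f)"
    by (simp del: sk_assoc)
  also have "\<dots> = li (cod f) \<bullet> (la (cod f) \<bullet> (\<iota> e \<boxtimes> f)) \<bullet> li (fst f)"
    by (simp del: li(4,5))
  also have "\<dots> = li (cod f) \<bullet> f"
    by (simp add: sk_la_nat)
  finally show ?thesis .
qed

lemma phi_e:
  assumes [simp]: "as \<in> lists (Ob C)"
  shows "phi e as = li (M e as)"
proof -
  have "phi e as = (li (M e as) \<bullet> la (M e as)) \<bullet> phi e as"
    by (simp del: sk_assoc)
  also have "\<dots> = li (M e as) \<bullet> (la (M e as) \<bullet> phi e as)"
    by (simp del: li(4,5))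
  finally show ?thesis by (simp add: la_phi)
qed

lemma ins_e:
  assumes "as \<in> lists (Ob C)" "f \<in> A" "fst f = M e as"
  shows "ins e as f = li (cod f) \<bullet> f"
  using assms li_nat[of f] by (simp add: ins_def phi_e)

text \<open>Multimaps \<open>a\<^sub>1, \<dots>, a\<^sub>n \<rightarrow> b\<close> are maps \<open>(e \<otimes> a\<^sub>1) \<otimes> \<dots> \<otimes> a\<^sub>n \<rightarrow> b\<close>. To substitute \<open>f\<close> at position \<open>i\<close>, it is
  inserted to the right of the product of \<open>e\<close> and the first \<open>i\<close> inputs, and the result is tensored
  with the inputs after it.\<close>

definition multi :: "('o, 'm) multi" where
  "multi = \<lparr>mOb = Ob C, mHom = (\<lambda>as b. Hom C (M e as) b), mIdn = LUnit C,
     mSub = (\<lambda>bs c i as g f. mor ((M e bs, c, g) \<bullet>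
        L (drop (Suc i) bs) (ins (M e (take i bs)) as (M e as, bs ! i, f))))\<rparr>"

lemma multi_sel [simp]:
  "mOb multi = Ob C" "mHom multi as b = Hom C (M e as) b" "mIdn multi = LUnit C"
  by (simp_all add: multi_def)

lemma mSub_arr:
  assumes "xs \<in> lists (Ob C)" "b \<in> Ob C" "ys \<in> lists (Ob C)" "as \<in> lists (Ob C)" "c \<in> Ob C"
    "g \<in> Hom C (M e (xs @ b # ys)) c" "f \<in> Hom C (M e as) b"
  shows "(M e (xs @ as @ ys), c, mSub multi (xs @ b # ys) c (length xs) as g f)
    = (M e (xs @ b # ys), c, g) \<bullet> L ys (ins (M e xs) as (M e as, b, f))"
  using assms
  by (simp add: multi_def prod_eq_iff sk_arr_iff)

lemma mSub_Hom:
  assumes "xs \<in> lists (Ob C)" "b \<in> Ob C" "ys \<in> lists (Ob C)" "as \<in> lists (Ob C)" "c \<in> Ob C"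
    "g \<in> Hom C (M e (xs @ b # ys)) c" "f \<in> Hom C (M e as) b"
  shows "mSub multi (xs @ b # ys) c (length xs) as g f \<in> Hom C (M e (xs @ as @ ys)) c"
proof -
  have "(M e (xs @ b # ys), c, g) \<bullet> L ys (ins (M e xs) as (M e as, b, f)) \<in> A"
    using assms by (simp add: sk_arr_iff)
  then show ?thesis
    unfolding mSub_arr[OF assms, symmetric] by (simp add: sk_arr_iff)
qed

lemma split_at:
  assumes "i < length as"
  obtains xs ys where "as = xs @ as ! i # ys" "i = length xs"
  using assms id_take_nth_drop[of i as] by (metis length_take min.absorb4)

lemma multicategory_multi: "multicategory multi"
proof
  fix a assume "a \<in> mOb multi"
  then show "mIdn multi a \<in> mHom multi [a] a" by (simp add: lunit_closed)
next
  fix bs as :: "'o list" and c g f and i :: nat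
  assume *: "bs \<in> lists (mOb multi)" "as \<in> lists (mOb multi)" "c \<in> mOb multi" "i < length bs"
    "g \<in> mHom multi bs c" "f \<in> mHom multi as (bs ! i)"
  obtain xs ys where bs: "bs = xs @ bs ! i # ys" "i = length xs" using split_at *(4) by blast
  define b where "b = bs ! i"
  have bs': "bs = xs @ b # ys" "i = length xs" using bs by (simp_all add: b_def)
  have "f \<in> Hom C (M e as) b" using *(6) by (simp add: b_def)
  then show "mSub multi bs c i as g f \<in> mHom multi (plug bs i as) c"
    using * mSub_Hom[of xs b ys as c g f] unfolding bs' plug_append by (simp del: M_simps)
next
  fix as b f assume *: "as \<in> lists (mOb multi)" "b \<in> mOb multi" "f \<in> mHom multi as b"
  have "(M e as, b, mSub multi [b] b 0 as (LUnit C b) f) = la b \<bullet> ins e as (M e as, b, f)"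
    using * mSub_arr[of "[]" b "[]" as b "LUnit C b" f] lunit_closed[of b] by (simp add: sk_la_def)
  then show "mSub multi [b] b 0 as (mIdn multi b) f = f"
    using * ins_unit[of as "(M e as, b, f)"] by (simp add: sk_arr_iff)
next
  fix as :: "'o list" and b f and i :: nat
  assume *: "as \<in> lists (mOb multi)" "b \<in> mOb multi" "f \<in> mHom multi as b" "i < length as"
  obtain xs ys where as: "as = xs @ as ! i # ys" "i = length xs" using split_at *(4) by blast
  define a where "a = as ! i"
  have as': "as = xs @ a # ys" "i = length xs" using as by (simp_all add: a_def)
  have L: "xs \<in> lists (Ob C)" "a \<in> Ob C" "ys \<in> lists (Ob C)" "b \<in> Ob C" "f \<in> Hom C (M e (xs @ a # ys)) b"
    using * by (simp_all add: as')
  have "(M e (xs @ [a] @ ys), b, mSub multi (xs @ a # ys) b (length xs) [a] f (LUnit C a))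
      = (M e (xs @ a # ys), b, f) \<bullet> L ys (ins (M e xs) [a] (M e [a], a, LUnit C a))"
    by (rule mSub_arr) (use L lunit_closed in auto)
  also have "\<dots> = (M e (xs @ a # ys), b, f)"
    using L ins_idn[of "M e xs" a] by (simp add: sk_la_def sk_arr_iff)
  finally show "mSub multi as b i [as ! i] f (mIdn multi (as ! i)) = f"
    by (simp add: as')
next
  fix as bs cs :: "'o list" and d f g h and i j :: nat
  assume *: "as \<in> lists (mOb multi)" "bs \<in> lists (mOb multi)" "cs \<in> lists (mOb multi)" "d \<in> mOb multi"
    "i < length as" "j < length bs"
    "f \<in> mHom multi as d" "g \<in> mHom multi bs (as ! i)" "h \<in> mHom multi cs (bs ! j)"
  obtain xs ys where as: "as = xs @ as ! i # ys" "i = length xs" using split_at *(5) by blast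
  obtain us vs where bs: "bs = us @ bs ! j # vs" "j = length us" using split_at *(6) by blast
  define a where "a = as ! i"
  define b where "b = bs ! j"
  have as': "as = xs @ a # ys" "i = length xs" using as by (simp_all add: a_def)
  have bs': "bs = us @ b # vs" "j = length us" using bs by (simp_all add: b_def)
  have Lx: "xs \<in> lists (Ob C)" "a \<in> Ob C" "ys \<in> lists (Ob C)" "us \<in> lists (Ob C)" "b \<in> Ob C"
    "vs \<in> lists (Ob C)" "cs \<in> lists (Ob C)" "d \<in> Ob C"
    and m: "f \<in> Hom C (M e (xs @ a # ys)) d" "g \<in> Hom C (M e (us @ b # vs)) a" "h \<in> Hom C (M e cs) b"
    using * by (simp_all add: as' bs')
  have gh: "mSub multi (us @ b # vs) a (length us) cs g h \<in> Hom C (M e (us @ cs @ vs)) a"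
    and fg: "mSub multi (xs @ a # ys) d (length xs) (us @ b # vs) f g \<in> Hom C (M e (xs @ (us @ b # vs) @ ys)) d"
    using Lx m by (intro mSub_Hom; simp)+
  let ?f = "(M e (xs @ a # ys), d, f)" and ?g = "(M e (us @ b # vs), a, g)" and ?h = "(M e cs, b, h)"
  have A: "?f \<in> A" "?g \<in> A" "?h \<in> A" using Lx m by (simp_all add: sk_arr_iff)
  have "(M e (xs @ (us @ cs @ vs) @ ys), d, mSub multi (xs @ a # ys) d (length xs) (us @ cs @ vs) f
        (mSub multi (us @ b # vs) a (length us) cs g h))
      = ?f \<bullet> L ys (ins (M e xs) (us @ cs @ vs) (?g \<bullet> L vs (ins (M e us) cs ?h)))"
    using mSub_arr[of xs a ys "us @ cs @ vs" d f "mSub multi (us @ b # vs) a (length us) cs g h"]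
      mSub_arr[of us b vs cs a g h] Lx m gh by (simp del: M_simps)
  also have "\<dots> = ?f \<bullet> L ys (ins (M e xs) (us @ b # vs) ?g \<bullet> L vs (ins (M (M e xs) us) cs ?h))"
    using ins_ins[of "M e xs" us vs cs ?h ?g] A Lx by simp
  also have "\<dots> = (?f \<bullet> L ys (ins (M e xs) (us @ b # vs) ?g)) \<bullet> L (vs @ ys) (ins (M e (xs @ us)) cs ?h)"
    using A Lx by (simp add: L_cmp)
  also have "\<dots> = (M e ((xs @ us) @ cs @ (vs @ ys)), d, mSub multi ((xs @ us) @ b # (vs @ ys)) d (length (xs @ us)) cs
        (mSub multi (xs @ a # ys) d (length xs) (us @ b # vs) f g) h)"
    using mSub_arr[of xs a ys "us @ b # vs" d f g]
      mSub_arr[of "xs @ us" b "vs @ ys" cs d "mSub multi (xs @ a # ys) d (length xs) (us @ b # vs) f g" h] Lx m fg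
    by (simp del: M_simps)
  finally show "mSub multi as d i (plug bs j cs) f (mSub multi bs (as ! i) j cs g h)
          = mSub multi (plug as i bs) d (j + i) cs (mSub multi as d i bs f g) h"
    unfolding a_def[symmetric] by (simp add: as' bs' plug_append add.commute del: M_simps)
next
  fix as bs cs :: "'o list" and d f g h and i k :: nat
  assume *: "as \<in> lists (mOb multi)" "bs \<in> lists (mOb multi)" "cs \<in> lists (mOb multi)" "d \<in> mOb multi"
    "i < k" "k < length as"
    "f \<in> mHom multi as d" "g \<in> mHom multi bs (as ! i)" "h \<in> mHom multi cs (as ! k)"
  have "i < length as" using * by simp
  then obtain xs ws where as: "as = xs @ as ! i # ws" "i = length xs" using split_at by blast
  define a where "a = as ! i"
  define n where "n = k - Suc i"
  have k: "k = length xs + Suc n" using *(5) as by (simp add: n_def)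
  have asi: "as = xs @ a # ws" using as by (simp add: a_def)
  have n: "n < length ws" using *(6) k asi by simp
  obtain ys zs where ws: "ws = ys @ ws ! n # zs" "n = length ys" using split_at n by blast
  define b where "b = ws ! n"
  have ai: "as ! i = a" by (simp add: a_def)
  have b: "as ! k = b" using n by (simp add: asi k b_def nth_append)
  have as': "as = xs @ a # ys @ b # zs" using asi ws by (simp add: b_def)
  have Lx: "xs \<in> lists (Ob C)" "a \<in> Ob C" "ys \<in> lists (Ob C)" "b \<in> Ob C" "zs \<in> lists (Ob C)"
    "bs \<in> lists (Ob C)" "cs \<in> lists (Ob C)" "d \<in> Ob C"
    and m: "f \<in> Hom C (M e (xs @ a # ys @ b # zs)) d" "g \<in> Hom C (M e bs) a" "h \<in> Hom C (M e cs) b"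
    using * unfolding ai b by (simp_all add: as')
  have fg: "mSub multi (xs @ a # (ys @ b # zs)) d (length xs) bs f g \<in> Hom C (M e (xs @ bs @ ys @ b # zs)) d"
    and fh: "mSub multi ((xs @ a # ys) @ b # zs) d (length (xs @ a # ys)) cs f h
      \<in> Hom C (M e ((xs @ a # ys) @ cs @ zs)) d"
    using Lx m by (intro mSub_Hom; simp)+
  let ?f = "(M e (xs @ a # ys @ b # zs), d, f)" and ?g = "(M e bs, a, g)" and ?h = "(M e cs, b, h)"
  have A: "?f \<in> A" "?g \<in> A" "?h \<in> A" using Lx m by (simp_all add: sk_arr_iff)
  let ?G = "ins (M e xs) bs ?g"
  have "(M e ((xs @ bs @ ys) @ cs @ zs), d, mSub multi ((xs @ bs @ ys) @ b # zs) d (length (xs @ bs @ ys)) cs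
        (mSub multi (xs @ a # (ys @ b # zs)) d (length xs) bs f g) h)
      = (?f \<bullet> L (ys @ b # zs) ?G) \<bullet> L zs (ins (M e (xs @ bs @ ys)) cs ?h)"
    using mSub_arr[of xs a "ys @ b # zs" bs d f g]
      mSub_arr[of "xs @ bs @ ys" b zs cs d "mSub multi (xs @ a # (ys @ b # zs)) d (length xs) bs f g" h] Lx m fg
    by (simp del: M_simps L_simps)
  also have "\<dots> = ?f \<bullet> L zs ((L ys ?G \<boxtimes> \<iota> (cod ?h)) \<bullet> ins (fst (L ys ?G)) cs ?h)"
    using A Lx by (simp add: L_cmp)
  also have "\<dots> = ?f \<bullet> L zs (ins (cod (L ys ?G)) cs ?h \<bullet> L cs (L ys ?G))"
    using A Lx by (subst ins_nat) auto
  also have "\<dots> = (?f \<bullet> L zs (ins (M e (xs @ a # ys)) cs ?h)) \<bullet> L (ys @ cs @ zs) ?G"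
    using A Lx by (simp add: L_cmp)
  also have "\<dots> = (M e (xs @ bs @ (ys @ cs @ zs)), d, mSub multi (xs @ a # (ys @ cs @ zs)) d (length xs) bs
        (mSub multi ((xs @ a # ys) @ b # zs) d (length (xs @ a # ys)) cs f h) g)"
    using mSub_arr[of "xs @ a # ys" b zs cs d f h]
      mSub_arr[of xs a "ys @ cs @ zs" bs d "mSub multi ((xs @ a # ys) @ b # zs) d (length (xs @ a # ys)) cs f h" g] Lx m fh
    by (simp del: M_simps L_simps)
  finally have eq: "mSub multi ((xs @ bs @ ys) @ b # zs) d (length (xs @ bs @ ys)) cs
        (mSub multi (xs @ a # (ys @ b # zs)) d (length xs) bs f g) h
      = mSub multi (xs @ a # (ys @ cs @ zs)) d (length xs) bs
        (mSub multi ((xs @ a # ys) @ b # zs) d (length (xs @ a # ys)) cs f h) g" by simp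
  have p1: "plug as i bs = (xs @ bs @ ys) @ b # zs" "plug as k cs = xs @ a # (ys @ cs @ zs)"
    using plug_append[of xs a "ys @ b # zs" bs] plug_append[of "xs @ a # ys" b zs cs] as(2) k ws(2)
    by (simp_all add: as')
  have p2: "k + length bs - 1 = length (xs @ bs @ ys)" "k = length (xs @ a # ys)" "i = length xs"
    using k ws(2) as(2) by simp_all
  show "mSub multi (plug as i bs) d (k + length bs - 1) cs (mSub multi as d i bs f g) h
          = mSub multi (plug as k cs) d i bs (mSub multi as d k cs f h) g"
    using eq p1[unfolded as'] unfolding p2(1) as' unfolding p2(2,3) by simp
qed

lemma mSub_first:
  assumes "t \<in> Ob C" "ys \<in> lists (Ob C)" "as \<in> lists (Ob C)" "d \<in> Ob C"
    "g \<in> Hom C (M e (t # ys)) d" "f \<in> Hom C (M e as) t"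
  shows "(M e (as @ ys), d, mSub multi (t # ys) d 0 as g f) = (M e (t # ys), d, g) \<bullet> L ys (li t \<bullet> (M e as, t, f))"
  using mSub_arr[of "[]" t ys as d g f] ins_e[of as "(M e as, t, f)"] assms by (simp add: sk_arr_iff)

text \<open>Substituting an isomorphism into the first input is composing with \<open>li t\<close> and this isomorphism,
  both tensored with \<open>ys\<close>; left normality makes \<open>li t\<close> invertible.\<close>

lemma mSub_first_bij:
  assumes t: "t \<in> Ob C" "ys \<in> lists (Ob C)" "as \<in> lists (Ob C)" "d \<in> Ob C"
    and f: "f \<in> Hom C (M e as) t"
    and k: "k \<in> A" "fst k = t" "cod k = M e as" "k \<bullet> (M e as, t, f) = \<iota> (M e as)" "(M e as, t, f) \<bullet> k = \<iota> t"
  shows "bij_betw (\<lambda>g. mSub multi (t # ys) d 0 as g f) (mHom multi (t # ys) d) (mHom multi (as @ ys) d)"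
proof -
  let ?f = "(M e as, t, f)"
  let ?i = "li t \<bullet> ?f" and ?j = "k \<bullet> la t"
  have fA [simp]: "?f \<in> A" using assms by (simp add: sk_arr_iff)
  note [simp] = t k(1-3)
  have "?i \<bullet> ?j = li t \<bullet> (?f \<bullet> k) \<bullet> la t" by simp
  then have ij: "?i \<bullet> ?j = \<iota> (e \<otimes> t)" by (simp add: k(5))
  have "?j \<bullet> ?i = k \<bullet> (la t \<bullet> li t) \<bullet> ?f" by (simp del: li(4,5))
  then have ji: "?j \<bullet> ?i = \<iota> (M e as)" by (simp add: k(4))
  have Lij: "L ys ?i \<bullet> L ys ?j = \<iota> (M (e \<otimes> t) ys)" "L ys ?j \<bullet> L ys ?i = \<iota> (M (M e as) ys)"
    using arg_cong[OF ij, of "L ys"] arg_cong[OF ji, of "L ys"] by (simp_all add: L_cmp del: sk_assoc)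
  have Lt [simp]: "L ys ?i \<in> A" "L ys ?j \<in> A" "fst (L ys ?i) = M (M e as) ys" "cod (L ys ?i) = M (e \<otimes> t) ys"
     "fst (L ys ?j) = M (e \<otimes> t) ys" "cod (L ys ?j) = M (M e as) ys"
    by simp_all
  show ?thesis
  proof (rule bij_betw_byWitness[where f' = "\<lambda>h. mor ((M e (as @ ys), d, h) \<bullet> L ys ?j)"])
    show "\<forall>g\<in>mHom multi (t # ys) d. mor ((M e (as @ ys), d, mSub multi (t # ys) d 0 as g f) \<bullet> L ys ?j) = g"
    proof
      fix g assume g: "g \<in> mHom multi (t # ys) d"
      then have gA: "(M (e \<otimes> t) ys, d, g) \<in> A" by (simp add: sk_arr_iff)
      have "(M e (as @ ys), d, mSub multi (t # ys) d 0 as g f) \<bullet> L ys ?j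
          = (M (e \<otimes> t) ys, d, g) \<bullet> (L ys ?i \<bullet> L ys ?j)"
        using g mSub_first[of t ys as d g f] gA assms by (simp del: L_cmp M_simps(3))
      also have "\<dots> = (M (e \<otimes> t) ys, d, g)" using gA by (simp only: Lij) simp
      finally show "mor ((M e (as @ ys), d, mSub multi (t # ys) d 0 as g f) \<bullet> L ys ?j) = g" by simp
    qed
    show "\<forall>h\<in>mHom multi (as @ ys) d. mSub multi (t # ys) d 0 as (mor ((M e (as @ ys), d, h) \<bullet> L ys ?j)) f = h"
    proof
      fix h assume "h \<in> mHom multi (as @ ys) d"
      then have hA: "(M (M e as) ys, d, h) \<in> A" by (simp add: sk_arr_iff)
      let ?g = "(M e (as @ ys), d, h) \<bullet> L ys ?j"
      have g: "?g \<in> A" "?g = (M e (t # ys), d, mor ?g)" using hA by (simp_all add: prod_eq_iff)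
      then have "mor ?g \<in> Hom C (M e (t # ys)) d" by (metis sk_arr_iff)
      then have "(M e (as @ ys), d, mSub multi (t # ys) d 0 as (mor ?g) f) = ?g \<bullet> L ys ?i"
        using mSub_first[of t ys as d "mor ?g" f] g(2) assms by metis
      also have "\<dots> = (M (M e as) ys, d, h) \<bullet> (L ys ?j \<bullet> L ys ?i)" using hA by (simp del: L_cmp)
      also have "\<dots> = (M e (as @ ys), d, h)" using hA by (simp only: Lij) simp
      finally show "mSub multi (t # ys) d 0 as (mor ?g) f = h" by simp
    qed
    show "(\<lambda>g. mSub multi (t # ys) d 0 as g f) ` mHom multi (t # ys) d \<subseteq> mHom multi (as @ ys) d"
      using mSub_Hom[of "[]" t ys as d _ f] assms by auto
    show "(\<lambda>h. mor ((M e (as @ ys), d, h) \<bullet> L ys ?j)) ` mHom multi (as @ ys) d \<subseteq> mHom multi (t # ys) d"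
    proof
      fix g assume "g \<in> (\<lambda>h. mor ((M e (as @ ys), d, h) \<bullet> L ys ?j)) ` mHom multi (as @ ys) d"
      then obtain h where h: "h \<in> mHom multi (as @ ys) d" "g = mor ((M e (as @ ys), d, h) \<bullet> L ys ?j)" by blast
      then have hA: "(M (M e as) ys, d, h) \<in> A" by (simp add: sk_arr_iff)
      then have "(M e (as @ ys), d, h) \<bullet> L ys ?j \<in> A" by simp
      moreover have "(M e (as @ ys), d, h) \<bullet> L ys ?j = (M e (t # ys), d, g)"
        using h by (simp add: prod_eq_iff)
      ultimately show "g \<in> mHom multi (t # ys) d" by (metis sk_arr_iff multi_sel(2))
    qed
  qed
qed

text \<open>The classifier of \<open>as\<close> is the identity of \<open>M e as\<close>, regarded as a multimap \<open>as \<rightarrow> M e as\<close>.\<close>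

lemma left_representable_multi: "multi_left_representable multi"
  unfolding multi_left_representable_def
proof
  fix as assume "as \<in> lists (mOb multi)"
  then have as: "as \<in> lists (Ob C)" by simp
  show "\<exists>m\<in>mOb multi. \<exists>th\<in>mHom multi as m. \<forall>ys\<in>lists (mOb multi). \<forall>d\<in>mOb multi.
        bij_betw (\<lambda>f. mSub multi (m # ys) d 0 as f th) (mHom multi (m # ys) d) (mHom multi (as @ ys) d)"
  proof (intro bexI ballI)
    fix ys d assume "ys \<in> lists (mOb multi)" "d \<in> mOb multi"
    then show "bij_betw (\<lambda>f. mSub multi (M e as # ys) d 0 as f (Idn C (M e as)))
        (mHom multi (M e as # ys) d) (mHom multi (as @ ys) d)"
      using as by (intro mSub_first_bij[where k = "\<iota> (M e as)"]) (auto simp: idn_closed simp flip: sk_idn_def)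
  qed (use as in \<open>auto simp: idn_closed\<close>)
qed

text \<open>The choice of classifiers for which \<open>K\<close> recovers \<open>C\<close>, up to the identification of unary
  maps \<open>e \<otimes> a \<rightarrow> b\<close> with maps \<open>a \<rightarrow> b\<close>.\<close>

definition canonical :: "('o, 'm) lrchoice" where
  "canonical = \<lparr>tobj = Ten C, theta = (\<lambda>a b. mor (la a \<boxtimes> \<iota> b)), uobj = e, umap = Idn C e\<rparr>"

lemma canonical_theta:
  "a \<in> Ob C \<Longrightarrow> b \<in> Ob C \<Longrightarrow> ((e \<otimes> a) \<otimes> b, a \<otimes> b, theta canonical a b) = la a \<boxtimes> \<iota> b"
  by (simp add: canonical_def prod_eq_iff)

lemma canonical_sel [simp]: "tobj canonical = Ten C" "uobj canonical = e" "umap canonical = Idn C e"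
  by (simp_all add: canonical_def)

lemma m_universal_canonical: "m_universal multi canonical"
proof -
  have th: "theta canonical a b \<in> Hom C ((e \<otimes> a) \<otimes> b) (a \<otimes> b)" if "a \<in> Ob C" "b \<in> Ob C" for a b
  proof -
    have "la a \<boxtimes> \<iota> b \<in> A" using that by simp
    then show ?thesis by (simp add: sk_arr_iff flip: canonical_theta[OF that])
  qed
  have bt: "bij_betw (\<lambda>f. mSub multi ((a \<otimes> b) # xs) d 0 [a, b] f (theta canonical a b))
          (mHom multi ((a \<otimes> b) # xs) d) (mHom multi ([a, b] @ xs) d)"
    if [simp]: "a \<in> Ob C" "b \<in> Ob C" "xs \<in> lists (Ob C)" "d \<in> Ob C" for a b xs d
  proof (rule mSub_first_bij[where k = "li a \<boxtimes> \<iota> b"])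
    have "(li a \<boxtimes> \<iota> b) \<bullet> (la a \<boxtimes> \<iota> b) = (li a \<bullet> la a) \<boxtimes> \<iota> b"
      by (subst tns_cmp_left) auto
    then show "(li a \<boxtimes> \<iota> b) \<bullet> (M e [a, b], a \<otimes> b, theta canonical a b) = \<iota> (M e [a, b])"
      by (simp add: canonical_theta)
    have "(la a \<boxtimes> \<iota> b) \<bullet> (li a \<boxtimes> \<iota> b) = (la a \<bullet> li a) \<boxtimes> \<iota> b"
      by (subst tns_cmp_left) auto
    then show "(M e [a, b], a \<otimes> b, theta canonical a b) \<bullet> (li a \<boxtimes> \<iota> b) = \<iota> (a \<otimes> b)"
      by (simp add: canonical_theta)
  qed (auto simp: th)
  have bu: "bij_betw (\<lambda>f. mSub multi (e # xs) d 0 [] f (Idn C e)) (mHom multi (e # xs) d) (mHom multi ([] @ xs) d)"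
    if [simp]: "xs \<in> lists (Ob C)" "d \<in> Ob C" for xs d
    by (rule mSub_first_bij[where k = "\<iota> e"]) (auto simp: idn_closed simp flip: sk_idn_def)
  show ?thesis
    unfolding m_universal_def using bt bu th by (simp add: idn_closed)
qed

end


section \<open>Essential surjectivity\<close>

lemma (in category) iso_trans:
  assumes "a \<in> Ob C" "b \<in> Ob C" "c \<in> Ob C" "iso C a b f" "iso C b c g"
  shows "iso C a c (Comp C a b c g f)"
proof -
  obtain f' g' where f: "f \<in> Hom C a b" "f' \<in> Hom C b a" "Comp C a b a f' f = Idn C a"
      "Comp C b a b f f' = Idn C b"
    and g: "g \<in> Hom C b c" "g' \<in> Hom C c b" "Comp C b c b g' g = Idn C b" "Comp C c b c g g' = Idn C c"
    using assms by (auto simp: iso_def)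
  note [simp] = assms(1-3) f(1,2) g(1,2) comp_closed[of _ a] comp_closed[of _ b] comp_closed[of _ c]
  have "Comp C a c a (Comp C c b a f' g') (Comp C a b c g f)
      = Comp C a b a f' (Comp C a b b (Comp C b c b g' g) f)"
    by (simp add: comp_assoc)
  also have "\<dots> = Idn C a" by (simp add: g f idn_left)
  finally have 1: "Comp C a c a (Comp C c b a f' g') (Comp C a b c g f) = Idn C a" .
  have "Comp C c a c (Comp C a b c g f) (Comp C c b a f' g')
      = Comp C c b c g (Comp C c b b (Comp C b a b f f') g')"
    by (simp add: comp_assoc)
  also have "\<dots> = Idn C c" by (simp add: g f idn_left)
  finally show ?thesis
    unfolding iso_def using 1 by (auto intro!: bexI[of _ "Comp C c b a f' g'"])
qed

definition on_arrows :: "('o \<Rightarrow> 'o \<Rightarrow> 'm \<Rightarrow> 'n) \<Rightarrow> 'o \<times> 'o \<times> 'm \<Rightarrow> 'o \<times> 'o \<times> 'n" where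
  "on_arrows h f = (fst f, cod f, h (fst f) (cod f) (mor f))"

text \<open>\<open>h\<close> is a functor that is the identity on objects and preserves the structure on the nose. If it is
  also bijective on hom-sets, then it is an isomorphism of \<open>SkMon_ln\<close> (\<open>strict_iso\<close>).\<close>

definition strict :: "('o, 'm) skmon \<Rightarrow> ('o, 'n) skmon \<Rightarrow> ('o \<Rightarrow> 'o \<Rightarrow> 'm \<Rightarrow> 'n) \<Rightarrow> bool" where
  "strict C D h \<longleftrightarrow> Ob D = Ob C \<and> Ten D = Ten C \<and> Unit D = Unit C \<and>
     (\<forall>f\<in>sk_arr C. on_arrows h f \<in> sk_arr D) \<and>
     (\<forall>a\<in>Ob C. on_arrows h (sk_idn C a) = sk_idn D a) \<and>
     (\<forall>f\<in>sk_arr C. \<forall>g\<in>sk_arr C. fst g = cod f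
        \<longrightarrow> on_arrows h (sk_cmp C g f) = sk_cmp D (on_arrows h g) (on_arrows h f)) \<and>
     (\<forall>f\<in>sk_arr C. \<forall>g\<in>sk_arr C.
        on_arrows h (sk_tns C f g) = sk_tns D (on_arrows h f) (on_arrows h g)) \<and>
     (\<forall>a\<in>Ob C. \<forall>b\<in>Ob C. \<forall>c\<in>Ob C. on_arrows h (sk_al C a b c) = sk_al D a b c) \<and>
     (\<forall>a\<in>Ob C. on_arrows h (sk_la C a) = sk_la D a) \<and>
     (\<forall>a\<in>Ob C. on_arrows h (sk_ro C a) = sk_ro D a)"

definition strict_lax :: "('o, 'n) skmon \<Rightarrow> ('o \<Rightarrow> 'o \<Rightarrow> 'm \<Rightarrow> 'n) \<Rightarrow> ('o, 'm, 'o, 'n) laxfun" where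
  "strict_lax D h = \<lparr>FOb = (\<lambda>a. a), FHom = h, F0 = Idn D (Unit D), F2 = (\<lambda>a b. Idn D (Ten D a b))\<rparr>"

lemma strict_lax_arrows:
  assumes C: "skew_monoidal C" and D: "skew_monoidal D" and h: "strict C D h"
  shows "lax_arrows C D (strict_lax D h)"
proof -
  interpret C: skew_monoidal C by fact
  interpret D: skew_monoidal D by fact
  have [simp]: "sk_map (strict_lax D h) f = on_arrows h f" for f
    by (simp add: sk_map_def strict_lax_def on_arrows_def)
  have eq [simp]: "Ob D = Ob C" "Ten D = Ten C" "Unit D = Unit C" using h by (simp_all add: strict_def)
  have [simp]: "FOb (strict_lax D h) a = a" "sk_f0 C D (strict_lax D h) = sk_idn D (Unit C)"
    "sk_f2 C D (strict_lax D h) a b = sk_idn D (Ten C a b)" for a b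
    by (simp_all add: strict_lax_def sk_f0_def sk_f2_def sk_idn_def)
  have [simp]: "fst (on_arrows h f) = fst f" "cod (on_arrows h f) = cod f" for f
    by (simp_all add: on_arrows_def)
  note D.ten_closed [simp del]
  have [simp]: "sk_tns D (sk_idn D a) (sk_idn D b) = sk_idn D (Ten C a b)" if "a \<in> Ob C" "b \<in> Ob C" for a b
    using D.sk_tns_idn[of a b] that by simp
  have [simp]: "sk_idn D a \<in> sk_arr D" if "a \<in> Ob C" for a using D.sk_idn_arr[of a] that by simp
  have hs: "f \<in> sk_arr C \<Longrightarrow> on_arrows h f \<in> sk_arr D"
    "a \<in> Ob C \<Longrightarrow> on_arrows h (sk_idn C a) = sk_idn D a"
    "f \<in> sk_arr C \<Longrightarrow> g \<in> sk_arr C \<Longrightarrow> fst g = cod f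
        \<Longrightarrow> on_arrows h (sk_cmp C g f) = sk_cmp D (on_arrows h g) (on_arrows h f)"
    "f \<in> sk_arr C \<Longrightarrow> g \<in> sk_arr C \<Longrightarrow>
        on_arrows h (sk_tns C f g) = sk_tns D (on_arrows h f) (on_arrows h g)"
    "a \<in> Ob C \<Longrightarrow> b \<in> Ob C \<Longrightarrow> c \<in> Ob C \<Longrightarrow> on_arrows h (sk_al C a b c) = sk_al D a b c"
    "a \<in> Ob C \<Longrightarrow> on_arrows h (sk_la C a) = sk_la D a"
    "a \<in> Ob C \<Longrightarrow> on_arrows h (sk_ro C a) = sk_ro D a" for f g a b c
    using h unfolding strict_def by blast+
  note [simp] = hs
  have [simp]: "sk_al D a b c \<in> sk_arr D" "sk_la D a \<in> sk_arr D" "sk_ro D a \<in> sk_arr D"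
    if "a \<in> Ob C" "b \<in> Ob C" "c \<in> Ob C" for a b c
    using that by simp_all
  show ?thesis
    unfolding lax_arrows_def by simp
qed

text \<open>An equation in \<open>C\<close> may be checked after applying \<open>h\<close>, which has \<open>k\<close> as inverse.\<close>

lemma strict_inverse:
  assumes C: "skew_monoidal C" and D: "skew_monoidal D" and h: "strict C D h"
    and k: "\<And>f. f \<in> sk_arr D \<Longrightarrow> on_arrows k f \<in> sk_arr C \<and> on_arrows h (on_arrows k f) = f"
    and hk: "\<And>f. f \<in> sk_arr C \<Longrightarrow> on_arrows k (on_arrows h f) = f"
  shows "strict D C k"
proof -
  interpret C: skew_monoidal C by fact
  interpret D: skew_monoidal D by fact
  have eq: "Ob D = Ob C" "Ten D = Ten C" "Unit D = Unit C" using h by (simp_all add: strict_def)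
  have ft: "fst (on_arrows k f) = fst f" "cod (on_arrows k f) = cod f" for f
    by (simp_all add: on_arrows_def)
  have hs: "a \<in> Ob C \<Longrightarrow> on_arrows h (sk_idn C a) = sk_idn D a"
    "f \<in> sk_arr C \<Longrightarrow> g \<in> sk_arr C \<Longrightarrow> fst g = cod f
        \<Longrightarrow> on_arrows h (sk_cmp C g f) = sk_cmp D (on_arrows h g) (on_arrows h f)"
    "f \<in> sk_arr C \<Longrightarrow> g \<in> sk_arr C \<Longrightarrow>
        on_arrows h (sk_tns C f g) = sk_tns D (on_arrows h f) (on_arrows h g)"
    "a \<in> Ob C \<Longrightarrow> b \<in> Ob C \<Longrightarrow> c \<in> Ob C \<Longrightarrow> on_arrows h (sk_al C a b c) = sk_al D a b c"
    "a \<in> Ob C \<Longrightarrow> on_arrows h (sk_la C a) = sk_la D a"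
    "a \<in> Ob C \<Longrightarrow> on_arrows h (sk_ro C a) = sk_ro D a" for f g a b c
    using h unfolding strict_def by blast+
  show ?thesis
    unfolding strict_def
  proof (intro conjI ballI impI)
    fix f g assume *: "f \<in> sk_arr D" "g \<in> sk_arr D"
    show "on_arrows k (sk_tns D f g) = sk_tns C (on_arrows k f) (on_arrows k g)"
      using hk[of "sk_tns C (on_arrows k f) (on_arrows k g)"] hs(3)[of "on_arrows k f" "on_arrows k g"] k * by simp
    assume "fst g = cod f"
    then show "on_arrows k (sk_cmp D g f) = sk_cmp C (on_arrows k g) (on_arrows k f)"
      using hk[of "sk_cmp C (on_arrows k g) (on_arrows k f)"] hs(2)[of "on_arrows k f" "on_arrows k g"] k * ft
      by simp
  next
    fix a assume "a \<in> Ob D"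
    then show "on_arrows k (sk_idn D a) = sk_idn C a" "on_arrows k (sk_la D a) = sk_la C a"
      "on_arrows k (sk_ro D a) = sk_ro C a"
      using hk[of "sk_idn C a"] hk[of "sk_la C a"] hk[of "sk_ro C a"] hs(1,5,6)[of a] eq by simp_all
  next
    fix a b c assume "a \<in> Ob D" "b \<in> Ob D" "c \<in> Ob D"
    then show "on_arrows k (sk_al D a b c) = sk_al C a b c"
      using hk[of "sk_al C a b c"] hs(4)[of a b c] eq by simp
  qed (use k eq in auto)
qed

lemma strict_comp_id:
  assumes C: "skew_monoidal C" and D: "skew_monoidal D" and h: "strict C D h" and k: "strict D C k"
    and kh: "\<And>f. f \<in> sk_arr C \<Longrightarrow> on_arrows k (on_arrows h f) = f"
  shows "Comp SkMon_ln C D C (laxfun_restrict D (strict_lax C k)) (laxfun_restrict C (strict_lax D h))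
    = Idn SkMon_ln C"
proof -
  interpret C: skew_monoidal C by fact
  interpret D: skew_monoidal D by fact
  have eq: "Ob D = Ob C" "Ten D = Ten C" "Unit D = Unit C" using h by (simp_all add: strict_def)
  have k_idn: "k a a (Idn D a) = Idn C a" if "a \<in> Ob C" for a
    using k eq that by (auto simp: strict_def on_arrows_def sk_idn_def)
  have h_in: "h a b f \<in> Hom D a b" if "a \<in> Ob C" "b \<in> Ob C" "f \<in> Hom C a b" for a b f
    using h that eq by (auto simp: strict_def on_arrows_def sk_arr_def)
  have kh': "k a b (h a b f) = f" if "a \<in> Ob C" "b \<in> Ob C" "f \<in> Hom C a b" for a b f
    using kh[of "(a, b, f)"] that by (simp add: on_arrows_def sk_arr_iff)
  have idD: "Idn D a \<in> Hom D a a" if "a \<in> Ob C" for a using D.idn_closed[of a] eq that by simp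
  let ?F = "laxfun_restrict C (strict_lax D h)" and ?G = "laxfun_restrict D (strict_lax C k)"
  let ?GF = "laxfun_restrict C (lax_comp C D C ?G ?F)" and ?I = "laxfun_restrict C (lax_id C)"
  note defs = laxfun_restrict_def lax_comp_def sk_cmp_def sk_map_def sk_f0_def sk_f2_def strict_lax_def
    lax_id_def eq
  show ?thesis
    unfolding SkMon_Comp SkMon_Idn
  proof (rule laxfun_eqI[of C])
    show "F0 ?GF = F0 ?I"
      using k_idn idD by (simp add: defs C.idn_left C.idn_closed)
    fix a b assume ab: "a \<in> Ob C" "b \<in> Ob C"
    then show "F2 ?GF a b = F2 ?I a b"
      using k_idn idD by (simp add: defs C.idn_left C.idn_closed)
    show "FHom ?GF a b f = FHom ?I a b f" if "f \<in> Hom C a b" for f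
      using ab that h_in kh' by (simp add: defs)
  qed (simp_all add: defs laxfun_ext_def functr_ext_def)
qed

lemma strict_iso:
  assumes C: "skew_monoidal C" and D: "skew_monoidal D" and h: "strict C D h"
    and k: "\<And>f. f \<in> sk_arr D \<Longrightarrow> on_arrows k f \<in> sk_arr C \<and> on_arrows h (on_arrows k f) = f"
    and hk: "\<And>f. f \<in> sk_arr C \<Longrightarrow> on_arrows k (on_arrows h f) = f"
  shows "iso SkMon_ln C D (laxfun_restrict C (strict_lax D h))"
proof -
  have ks: "strict D C k" by (rule strict_inverse[OF C D h k hk])
  show ?thesis
    unfolding iso_def
    using strict_comp_id[OF C D h ks hk] strict_comp_id[OF D C ks h] k
      strict_lax_arrows[OF C D h] strict_lax_arrows[OF D C ks] C D
    by (auto simp: SkMon_sel lax_monoidal_arrows laxfun_restrict_arrows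
        intro!: bexI[of _ "laxfun_restrict D (strict_lax C k)"])
qed

context ln_skew_monoidal
begin

interpretation MM: multicategory_arrows multi
  by (rule multicategory_arrowsI[OF multicategory_multi])

lemma short_lr_canonical: "short_lr (U_obj multi) canonical"
  using MM.short_U MM.left_universal_U[OF m_universal_canonical]
  by (simp add: short_lr_def short_lr_axioms_def)

interpretation K: short_lr "U_obj multi" canonical
  by (rule short_lr_canonical)

definition fl :: "('o, 'm) arrow \<Rightarrow> 'o \<times> 'o \<times> 'm" where
  "fl f = (M e (fst f), cod f, mor f)"

lemma fl_simps [simp]: "fst (fl f) = M e (fst f)" "cod (fl f) = cod f"
  by (simp_all add: fl_def)

lemma fl_arr [simp]: "f \<in> m_arr multi \<Longrightarrow> fl f \<in> A"
  by (cases f) (auto simp: fl_def m_arr_iff sk_arr_iff)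

text \<open>Substitution in \<open>multi\<close> at the first and, for a binary map, at the second input.\<close>

lemma fl_first:
  assumes g: "g \<in> m_arr multi" "fst g = t # ys" and f: "f \<in> m_arr multi" "cod f = t"
  shows "fl (m_sb multi g 0 f) = fl g \<bullet> L ys (li t \<bullet> fl f)"
  using mSub_first[of t ys "fst f" "cod g" "mor g" "mor f"] assms
  by (cases g; cases f) (auto simp: m_arr_iff m_sb_def fl_def simp del: M_simps)

lemma fl_second:
  assumes g: "g \<in> m_arr multi" "fst g = [a, b]" and f: "f \<in> m_arr multi" "cod f = b"
  shows "fl (m_sb multi g 1 f) = fl g \<bullet> ins (e \<otimes> a) (fst f) (fl f)"
  using mSub_arr[of "[a]" b "[]" "fst f" "cod g" "mor g" "mor f"] assms
  by (cases g; cases f) (auto simp: m_arr_iff m_sb_def fl_def simp del: M_simps(3))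

lemma sh_m [simp]: "f \<in> sh_arr (U_obj multi) \<Longrightarrow> f \<in> m_arr multi"
  by (simp add: MM.sh_arr_U)

lemma th_m: "a \<in> Ob C \<Longrightarrow> b \<in> Ob C \<Longrightarrow> K.thA a b \<in> m_arr multi"
  using K.theta_in[of a b] by simp

lemma fl_th: "a \<in> Ob C \<Longrightarrow> b \<in> Ob C \<Longrightarrow> fl ([a, b], a \<otimes> b, theta canonical a b) = la a \<boxtimes> \<iota> b"
  by (simp add: fl_def canonical_theta)

lemmas [simp] = th_m[simplified]

lemma fl_u: "fl ([], uobj canonical, umap canonical) = \<iota> e"
  by (simp add: fl_def sk_idn_def)

lemma u_m [simp]: "([], e, Idn C e) \<in> m_arr multi"
  using K.umap_in by simp

text \<open>The identification of unary multimaps \<open>e \<otimes> a \<rightarrow> b\<close> with maps \<open>a \<rightarrow> b\<close>.\<close>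

definition un :: "('o, 'm) arrow \<Rightarrow> 'o \<times> 'o \<times> 'm" where
  "un f = fl f \<bullet> li (hd (fst f))"

lemma un_simps [simp]:
  assumes "f \<in> m_arr multi" "fst f = [a]"
  shows "un f \<in> A" "fst (un f) = a" "cod (un f) = cod f" "un f \<bullet> la a = fl f"
proof -
  have [simp]: "a \<in> Ob C" using assms by (cases f) (auto simp: m_arr_iff)
  note fl_arr [OF assms(1), simp]
  show "un f \<in> A" "fst (un f) = a" "cod (un f) = cod f" "un f \<bullet> la a = fl f"
    using assms by (simp_all add: un_def)
qed

text \<open>The canonical classifier \<open>la a \<boxtimes> \<iota> b\<close> is a split epimorphism.\<close>

lemma la_tns_epi:
  assumes "f \<bullet> (la a \<boxtimes> \<iota> b) = g \<bullet> (la a \<boxtimes> \<iota> b)" and [simp]: "a \<in> Ob C" "b \<in> Ob C"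
    and [simp]: "f \<in> A" "g \<in> A" "fst f = a \<otimes> b" "fst g = a \<otimes> b"
  shows "f = g"
proof -
  have "(la a \<boxtimes> \<iota> b) \<bullet> (li a \<boxtimes> \<iota> b) = \<iota> (a \<otimes> b)"
    using tns_cmp_left[of "la a" "li a" b] by simp
  then have *: "x = (x \<bullet> (la a \<boxtimes> \<iota> b)) \<bullet> (li a \<boxtimes> \<iota> b)" if "x \<in> A" "fst x = a \<otimes> b" for x
    using that by simp
  show ?thesis using *[of f] *[of g] assms(1) by simp
qed

lemma fl_th_comp:
  assumes "k \<in> m_arr multi" "fst k = [a \<otimes> b]" and [simp]: "a \<in> Ob C" "b \<in> Ob C"
  shows "fl (m_sb multi k 0 (K.thA a b)) = un k \<bullet> (la a \<boxtimes> \<iota> b)"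
proof -
  have [simp]: "fl k \<in> A" using assms by simp
  show ?thesis
    using fl_first[of k "a \<otimes> b" "[]" "K.thA a b"] assms by (simp add: fl_th un_def)
qed

lemma un_idn: "a \<in> Ob C \<Longrightarrow> un (m_idn multi a) = \<iota> a"
  by (simp add: un_def fl_def m_idn_def) (simp flip: sk_la_def)

lemma un_comp:
  assumes "f \<in> m_arr multi" "fst f = [a]" "g \<in> m_arr multi" "fst g = [cod f]"
  shows "un (m_sb multi g 0 f) = un g \<bullet> un f"
proof -
  have [simp]: "a \<in> Ob C" "cod f \<in> Ob C" using assms by (cases f; auto simp: m_arr_iff)+
  have [simp]: "fl f \<in> A" "fl g \<in> A" using assms by simp_all
  show ?thesis using fl_first[of g "cod f" "[]" f] assms by (simp add: un_def)
qed

text \<open>The next four lemmas say that \<open>un\<close> carries the tensor product and the constraints of \<open>K\<close> to those of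
  \<open>C\<close>. The defining equation in the multicategory is expressed through composition in \<open>C\<close>; the classifiers
  \<open>la a \<boxtimes> \<iota> b\<close> in it are invertible and cancel.\<close>

lemma un_tn:
  assumes p: "p \<in> K.L.hom [a] b" and q: "q \<in> K.L.hom [c] d"
  shows "un (K.L.tn p q) = un p \<boxtimes> un q"
proof -
  have [simp]: "p \<in> m_arr multi" "fst p = [a]" "cod p = b" "q \<in> m_arr multi" "fst q = [c]" "cod q = d"
    "a \<in> Ob C" "b \<in> Ob C" "c \<in> Ob C" "d \<in> Ob C"
    using K.L.homD[OF p] K.L.homD[OF q] by auto
  have tn: "K.L.tn p q \<in> m_arr multi" "fst (K.L.tn p q) = [a \<otimes> c]" "cod (K.L.tn p q) = b \<otimes> d"
    using K.L.tn(1)[OF p q] by (auto simp: K.L.hom_iff)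
  note [simp] = tn[simplified]
  have tp: "m_sb multi (K.thA b d) 0 p \<in> m_arr multi" by simp
  have "m_sb multi (K.L.tn p q) 0 (K.thA a c) = m_sb multi (m_sb multi (K.thA b d) 0 p) 1 q"
    using K.L.tn(2)[OF p q] by (simp add: MM.sh_sb_U ok_ar_def)
  then have "un (K.L.tn p q) \<bullet> (la a \<boxtimes> \<iota> c) = fl (m_sb multi (K.thA b d) 0 p) \<bullet> ins (e \<otimes> a) [c] (fl q)"
    using fl_th_comp[of "K.L.tn p q" a c] fl_second[OF tp, of a d q] by simp
  also have "fl (m_sb multi (K.thA b d) 0 p) = fl p \<boxtimes> \<iota> d"
  proof -
    have "fl (m_sb multi (K.thA b d) 0 p) = (la b \<boxtimes> \<iota> d) \<bullet> ((li b \<bullet> fl p) \<boxtimes> \<iota> d)"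
      using fl_first[of "K.thA b d" b "[d]" p] by (simp add: fl_th)
    also have "\<dots> = ((la b \<bullet> li b) \<bullet> fl p) \<boxtimes> \<iota> d"
      by (subst tns_cmp_left[symmetric]) (auto simp del: li(4))
    finally show ?thesis by simp
  qed
  also have "ins (e \<otimes> a) [c] (fl q) = \<iota> (e \<otimes> a) \<boxtimes> un q"
  proof -
    have "ins (e \<otimes> a) [c] (fl q) = ins (e \<otimes> a) [c] (un q \<bullet> la c)" by simp
    also have "\<dots> = (\<iota> (e \<otimes> a) \<boxtimes> un q) \<bullet> ins (e \<otimes> a) [c] (la c)"
      by (simp add: ins_def tns_cmp_right del: un_simps(4))
    finally show ?thesis by (simp add: ins_idn)
  qed
  also have "(fl p \<boxtimes> \<iota> d) \<bullet> (\<iota> (e \<otimes> a) \<boxtimes> un q) = fl p \<boxtimes> un q"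
    using sk_tns_cmp[of "fl p" "\<iota> (e \<otimes> a)" "\<iota> d" "un q"] by simp
  also have "\<dots> = (un p \<boxtimes> un q) \<bullet> (la a \<boxtimes> \<iota> c)"
    using sk_tns_cmp[of "un p" "la a" "un q" "\<iota> c"] by simp
  finally show ?thesis by (rule la_tns_epi) auto
qed

lemma un_al:
  assumes [simp]: "a \<in> Ob C" "b \<in> Ob C" "c \<in> Ob C"
  shows "un (K.L.al a b c) = al a b c"
proof -
  have k: "K.L.al a b c \<in> m_arr multi" "fst (K.L.al a b c) = [a \<otimes> b \<otimes> c]"
    "cod (K.L.al a b c) = a \<otimes> (b \<otimes> c)"
    using K.L.al_simps[of a b c] by simp_all
  note [simp] = k[simplified]
  let ?k = "m_sb multi (K.L.al a b c) 0 (K.thA (a \<otimes> b) c)" and ?x = "e \<otimes> a"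
  have kA: "?k \<in> m_arr multi" by simp
  have "m_sb multi ?k 0 (K.thA a b) = m_sb multi (K.thA a (b \<otimes> c)) 1 (K.thA b c)"
    using K.L.al(2)[of a b c] by (simp add: MM.sh_sb_U ok_ar_def sub_arities_def)
  then have "fl ?k \<bullet> L [c] (li (a \<otimes> b) \<bullet> fl (K.thA a b)) = fl (K.thA a (b \<otimes> c)) \<bullet> ins ?x [b, c] (fl (K.thA b c))"
    using fl_first[OF kA, of "a \<otimes> b" "[c]" "K.thA a b"] fl_second[of "K.thA a (b \<otimes> c)" a "b \<otimes> c" "K.thA b c"]
    by simp
  also have "fl ?k \<bullet> L [c] (li (a \<otimes> b) \<bullet> fl (K.thA a b))
      = un (K.L.al a b c) \<bullet> ((la (a \<otimes> b) \<boxtimes> \<iota> c) \<bullet> ((li (a \<otimes> b) \<bullet> (la a \<boxtimes> \<iota> b)) \<boxtimes> \<iota> c))"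
    using fl_th_comp[of "K.L.al a b c" "a \<otimes> b" c] un_simps[OF k(1,2)] by (simp add: fl_th)
  also have "(la (a \<otimes> b) \<boxtimes> \<iota> c) \<bullet> ((li (a \<otimes> b) \<bullet> (la a \<boxtimes> \<iota> b)) \<boxtimes> \<iota> c)
      = ((la (a \<otimes> b) \<bullet> li (a \<otimes> b)) \<bullet> (la a \<boxtimes> \<iota> b)) \<boxtimes> \<iota> c"
    by (subst tns_cmp_left[symmetric]) (auto simp del: li(4))
  also have "fl (K.thA a (b \<otimes> c)) \<bullet> ins ?x [b, c] (fl (K.thA b c))
      = (la a \<boxtimes> \<iota> (b \<otimes> c)) \<bullet> (\<iota> ?x \<boxtimes> (la b \<boxtimes> \<iota> c)) \<bullet> phi ?x [b, c]"
    by (simp add: fl_th ins_def)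
  also have "phi ?x [b, c] = al (fst (\<iota> ?x)) (fst (la b)) (fst (\<iota> c)) \<bullet> (phi ?x [b] \<boxtimes> \<iota> c)"
    using phi_snoc[of ?x "[b]" c] by simp
  also have "(\<iota> ?x \<boxtimes> (la b \<boxtimes> \<iota> c)) \<bullet> al (fst (\<iota> ?x)) (fst (la b)) (fst (\<iota> c)) \<bullet> (phi ?x [b] \<boxtimes> \<iota> c)
      = (al (cod (\<iota> ?x)) (cod (la b)) (cod (\<iota> c)) \<bullet> (\<iota> ?x \<boxtimes> la b \<boxtimes> \<iota> c)) \<bullet> (phi ?x [b] \<boxtimes> \<iota> c)"
    by (subst sk_al_nat) auto
  also have "\<dots> = al ?x b c \<bullet> (ins ?x [b] (la b) \<boxtimes> \<iota> c)"
    by (simp add: ins_def tns_cmp_left)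
  also have "\<dots> = al (fst (la a)) (fst (\<iota> b)) (fst (\<iota> c))"
    by (simp add: ins_idn)
  also have "(la a \<boxtimes> \<iota> (b \<otimes> c)) \<bullet> \<dots> = al a b c \<bullet> (la a \<boxtimes> \<iota> b \<boxtimes> \<iota> c)"
    using sk_al_nat[of "la a" "\<iota> b" "\<iota> c"] by simp
  finally have eq: "un (K.L.al a b c) \<bullet> (la a \<boxtimes> \<iota> b \<boxtimes> \<iota> c) = al a b c \<bullet> (la a \<boxtimes> \<iota> b \<boxtimes> \<iota> c)"
    by simp
  have "(la a \<boxtimes> \<iota> b) \<bullet> (li a \<boxtimes> \<iota> b) = \<iota> (a \<otimes> b)"
    using tns_cmp_left[of "la a" "li a" b] by simp
  then have "(la a \<boxtimes> \<iota> b \<boxtimes> \<iota> c) \<bullet> (li a \<boxtimes> \<iota> b \<boxtimes> \<iota> c) = \<iota> (a \<otimes> b \<otimes> c)"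
    by (subst tns_cmp_left[symmetric]) auto
  then have *: "x = (x \<bullet> (la a \<boxtimes> \<iota> b \<boxtimes> \<iota> c)) \<bullet> (li a \<boxtimes> \<iota> b \<boxtimes> \<iota> c)" if "x \<in> A" "fst x = a \<otimes> b \<otimes> c" for x
    using that by simp
  have "un (K.L.al a b c) = (un (K.L.al a b c) \<bullet> (la a \<boxtimes> \<iota> b \<boxtimes> \<iota> c)) \<bullet> (li a \<boxtimes> \<iota> b \<boxtimes> \<iota> c)"
    by (rule *) (rule un_simps[OF k(1,2)])+
  also have "\<dots> = (al a b c \<bullet> (la a \<boxtimes> \<iota> b \<boxtimes> \<iota> c)) \<bullet> (li a \<boxtimes> \<iota> b \<boxtimes> \<iota> c)"
    by (simp only: eq)
  also have "\<dots> = al a b c"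
    by (rule *[symmetric]) auto
  finally show ?thesis .
qed

lemma un_la:
  assumes [simp]: "a \<in> Ob C"
  shows "un (K.L.la a) = la a"
proof -
  have k: "K.L.la a \<in> m_arr multi" "fst (K.L.la a) = [e \<otimes> a]" "cod (K.L.la a) = a"
    using K.L.la_simps[of a] by simp_all
  note [simp] = k[simplified]
  let ?k = "m_sb multi (K.L.la a) 0 (K.thA e a)"
  have kA: "?k \<in> m_arr multi" by simp
  have "m_sb multi ?k 0 ([], e, Idn C e) = m_idn multi a"
    using K.L.la(2)[of a] fun_cong[OF MM.sh_idn_U, of a]
    by (simp add: MM.sh_sb_U ok_ar_def sub_arities_def)
  then have "fl (m_idn multi a) = fl ?k \<bullet> L [a] (li e \<bullet> \<iota> e)"
    using fl_first[OF kA, of e "[a]" "([], e, Idn C e)"] fl_u by simp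
  also have "\<dots> = un (K.L.la a) \<bullet> ((la e \<boxtimes> \<iota> a) \<bullet> (li e \<boxtimes> \<iota> a))"
    using fl_th_comp[of "K.L.la a" e a] un_simps[OF k(1,2)] by simp
  also have "(la e \<boxtimes> \<iota> a) \<bullet> (li e \<boxtimes> \<iota> a) = \<iota> (e \<otimes> a)"
    using tns_cmp_left[of "la e" "li e" a] by simp
  finally show ?thesis
    using un_simps[OF k(1,2)] by (simp add: fl_def m_idn_def flip: sk_la_def)
qed

lemma un_ro:
  assumes [simp]: "a \<in> Ob C"
  shows "un (K.L.ro a) = ro a"
proof -
  have "K.L.ro a = m_sb multi (K.thA a e) 1 ([], e, Idn C e)"
    unfolding K.L.ro_def using K.theta_in[of a e] by (simp add: MM.sh_sb_U)
  then have "fl (K.L.ro a) = (la a \<boxtimes> \<iota> e) \<bullet> ins (e \<otimes> a) [] (\<iota> e)"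
    using fl_second[of "K.thA a e" a e "([], e, Idn C e)"] fl_u by (simp add: fl_th)
  also have "\<dots> = ro a \<bullet> la a"
    using sk_ro_nat[of "la a"] by (simp add: ins_def phi_def)
  finally show ?thesis using K.L.ro_simps(2)[of a] by (simp add: un_def)
qed

text \<open>The action of \<open>un\<close> on hom-sets and its inverse, which composes with \<open>la\<close>.\<close>

definition h1 :: "'o \<Rightarrow> 'o \<Rightarrow> 'm \<Rightarrow> 'm" where "h1 a b f = mor (un ([a], b, f))"

definition k1 :: "'o \<Rightarrow> 'o \<Rightarrow> 'm \<Rightarrow> 'm" where "k1 a b f = mor ((a, b, f) \<bullet> la a)"

lemma un_m: "(a, b, f) \<in> sk_arr K.K \<longleftrightarrow> ([a], b, f) \<in> m_arr multi"
  by (auto simp: sk_arr_iff m_arr_iff)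

lemma on_h1: "(a, b, f) \<in> sk_arr K.K \<Longrightarrow> on_arrows h1 (a, b, f) = un ([a], b, f)"
  by (simp add: on_arrows_def h1_def prod_eq_iff un_m)

lemma K_canonical_iso:
  "\<exists>f. iso SkMon_ln (K_obj (U_obj multi) canonical) C f"
proof -
  have Ob: "a \<in> Ob K.K \<longleftrightarrow> a \<in> Ob C" for a by simp
  have strict: "strict K.K C h1"
    unfolding strict_def
  proof (intro conjI ballI impI)
    fix f assume "f \<in> sk_arr K.K"
    then show "on_arrows h1 f \<in> A" by (cases f) (simp add: on_h1 un_m)
  next
    fix f g assume f: "f \<in> sk_arr K.K" and g: "g \<in> sk_arr K.K" and fg: "fst g = cod f"
    obtain a b f' where f': "f = (a, b, f')" by (cases f)
    obtain c g' where g': "g = (b, c, g')" using fg f' by (cases g) auto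
    have m: "([a], b, f') \<in> m_arr multi" "([b], c, g') \<in> m_arr multi" using f g f' g' un_m by auto
    have ob: "a \<in> Ob C" "b \<in> Ob C" "c \<in> Ob C" "f' \<in> Hom K.K a b" "g' \<in> Hom K.K b c"
      using f g by (simp_all add: f' g' sk_arr_iff)
    have eq: "([a], c, Comp K.K a b c g' f') = m_sb multi ([b], c, g') 0 ([a], b, f')"
      using ob m K.Comp_arr[of a b c f' g'] by (simp add: MM.sh_sb_U)
    have "(a, c, Comp K.K a b c g' f') \<in> sk_arr K.K" using ob K.comp_in[of a b c f' g'] by (simp add: sk_arr_iff)
    then have "on_arrows h1 (sk_cmp K.K g f) = un (m_sb multi ([b], c, g') 0 ([a], b, f'))"
      using on_h1[of a c "Comp K.K a b c g' f'"] by (simp add: f' g' sk_cmp_def m_sb_def)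
    then show "on_arrows h1 (sk_cmp K.K g f) = on_arrows h1 g \<bullet> on_arrows h1 f"
      using un_comp[of "([a], b, f')" a "([b], c, g')"] m f g by (simp add: f' g' on_h1)
  next
    fix f g assume f: "f \<in> sk_arr K.K" and g: "g \<in> sk_arr K.K"
    obtain a b f' c d g' where fg: "f = (a, b, f')" "g = (c, d, g')" by (cases f; cases g)
    have ob: "a \<in> Ob C" "b \<in> Ob C" "c \<in> Ob C" "d \<in> Ob C" "f' \<in> Hom K.K a b" "g' \<in> Hom K.K c d"
      using f g by (simp_all add: fg sk_arr_iff)
    then have hom: "([a], b, f') \<in> K.L.hom [a] b" "([c], d, g') \<in> K.L.hom [c] d"
      by (auto intro!: K.un_hom)
    have t: "([a \<otimes> c], b \<otimes> d, TenM K.K a b c d f' g') = K.L.tn ([a], b, f') ([c], d, g')"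
      "TenM K.K a b c d f' g' \<in> Hom K.K (a \<otimes> c) (b \<otimes> d)"
      using K.TenM_arr[of a b c d f' g'] ob by simp_all
    have "(a \<otimes> c, b \<otimes> d, TenM K.K a b c d f' g') \<in> sk_arr K.K" using t ob by (simp add: sk_arr_iff)
    then have "on_arrows h1 (sk_tns K.K f g) = un (K.L.tn ([a], b, f') ([c], d, g'))"
      using on_h1[of "a \<otimes> c" "b \<otimes> d" "TenM K.K a b c d f' g'"] by (simp add: fg sk_tns_def t)
    then show "on_arrows h1 (sk_tns K.K f g) = on_arrows h1 f \<boxtimes> on_arrows h1 g"
      using un_tn[OF hom] f g by (simp add: fg on_h1)
  next
    fix a assume "a \<in> Ob K.K"
    then have a [simp]: "a \<in> Ob C" by simp
    have "([a], a, Idn K.K a) = m_idn multi a" by (simp add: m_idn_def)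
    moreover have "(a, a, Idn K.K a) \<in> sk_arr K.K" by (simp add: sk_arr_iff lunit_closed)
    ultimately show "on_arrows h1 (sk_idn K.K a) = \<iota> a"
      using un_idn[of a] on_h1[of a a "Idn K.K a"] by (simp add: sk_idn_def)
    have "(e \<otimes> a, a, LUnit K.K a) \<in> sk_arr K.K"
      using K.LUnit_arr(2)[of a] by (simp add: sk_arr_iff)
    then show "on_arrows h1 (sk_la K.K a) = la a"
      using K.LUnit_arr(1)[of a] un_la[of a] on_h1[of "e \<otimes> a" a "LUnit K.K a"]
      by (simp add: sk_la_def)
    have "(a, a \<otimes> e, RUnit K.K a) \<in> sk_arr K.K"
      using K.RUnit_arr(2)[of a] by (simp add: sk_arr_iff)
    then show "on_arrows h1 (sk_ro K.K a) = ro a"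
      using K.RUnit_arr(1)[of a] un_ro[of a] on_h1[of a "a \<otimes> e" "RUnit K.K a"]
      by (simp add: sk_ro_def)
  next
    fix a b c assume "a \<in> Ob K.K" "b \<in> Ob K.K" "c \<in> Ob K.K"
    then have [simp]: "a \<in> Ob C" "b \<in> Ob C" "c \<in> Ob C" by simp_all
    have "(a \<otimes> b \<otimes> c, a \<otimes> (b \<otimes> c), Assoc K.K a b c) \<in> sk_arr K.K"
      using K.Assoc_arr(2)[of a b c] by (simp add: sk_arr_iff)
    then show "on_arrows h1 (sk_al K.K a b c) = al a b c"
      using K.Assoc_arr(1)[of a b c] un_al[of a b c] on_h1[of "a \<otimes> b \<otimes> c" "a \<otimes> (b \<otimes> c)" "Assoc K.K a b c"]
      by (simp add: sk_al_def)
  qed simp_all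
  have k1: "on_arrows k1 f \<in> sk_arr K.K \<and> on_arrows h1 (on_arrows k1 f) = f" if f: "f \<in> A" for f
  proof -
    obtain a b f' where f': "f = (a, b, f')" by (cases f)
    have [simp]: "a \<in> Ob C" "b \<in> Ob C" "(a, b, f') \<in> A" using f by (auto simp: f' sk_arr_iff)
    have x: "(a, b, f') \<bullet> la a = (e \<otimes> a, b, k1 a b f')" by (simp add: k1_def prod_eq_iff)
    have "(a, b, f') \<bullet> la a \<in> A" by simp
    then have m: "([a], b, k1 a b f') \<in> m_arr multi" by (simp add: x m_arr_iff sk_arr_iff)
    then have "(a, b, k1 a b f') \<in> sk_arr K.K" by (simp add: un_m)
    moreover have "un ([a], b, k1 a b f') = ((a, b, f') \<bullet> la a) \<bullet> li a"
      by (simp add: un_def fl_def x)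
    ultimately show ?thesis
      using on_h1[of a b "k1 a b f'"] by (simp add: f' on_arrows_def[of k1])
  qed
  have h1: "on_arrows k1 (on_arrows h1 f) = f" if f: "f \<in> sk_arr K.K" for f
  proof -
    obtain a b f' where f': "f = (a, b, f')" by (cases f)
    have m: "([a], b, f') \<in> m_arr multi" using f by (simp add: f' un_m)
    then have "un ([a], b, f') \<bullet> la a = fl ([a], b, f')" by simp
    moreover have "un ([a], b, f') = (a, b, h1 a b f')"
      using m by (simp add: h1_def prod_eq_iff)
    ultimately show ?thesis
      by (simp add: f' on_arrows_def k1_def fl_def)
  qed
  show ?thesis
    using strict_iso[OF K.skew_monoidal_K skew_monoidal_axioms strict k1 h1] by blast
qed

end

section \<open>The equivalences\<close>

context
  fixes ch :: "('o, 'm) shmulti \<Rightarrow> ('o, 'm) lrchoice"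
  assumes ch: "\<And>C. \<lbrakk>short_multicategory C; sh_left_representable C\<rbrakk> \<Longrightarrow> left_universal C (ch C)"
begin

lemma short_lr_ch: "C \<in> Ob ShMulti_lr \<Longrightarrow> short_lr C (ch C)"
  using ch[of C] by (simp add: ShMulti_sel short_lr_def short_lr_axioms_def)

lemma K_obj_SkMon: "short_lr C r \<Longrightarrow> K_obj C r \<in> Ob SkMon_ln"
  using short_lr.skew_monoidal_K[of C r] short_lr.left_normal_K[of C r] by (simp add: SkMon_sel)

lemma K_functor: "is_functor ShMulti_lr SkMon_ln (K_lr ch)"
  unfolding is_functor_def
proof (intro conjI ballI)
  fix C :: "('o, 'm) shmulti" assume "C \<in> Ob ShMulti_lr"
  then show "FOb (K_lr ch) C \<in> Ob SkMon_ln"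
    "FHom (K_lr ch) C C (Idn ShMulti_lr C) = Idn SkMon_ln (FOb (K_lr ch) C)"
    using K_mor_Idn[OF short_lr_ch, of C] K_obj_SkMon[OF short_lr_ch, of C] by (simp_all add: K_lr_def)
next
  fix C D :: "('o, 'm) shmulti" and F
  assume "C \<in> Ob ShMulti_lr" "D \<in> Ob ShMulti_lr" "F \<in> Hom ShMulti_lr C D"
  then have "short_lr_pair C (ch C) D (ch D)" and F: "sh_morphism C D F" "shmor_ext C F"
    using short_lr_ch by (auto intro!: short_lr_pairI simp: ShMulti_sel(2))
  then interpret P: short_lr_pair C "ch C" D "ch D" by simp
  show "FHom (K_lr ch) C D F \<in> Hom SkMon_ln (FOb (K_lr ch) C) (FOb (K_lr ch) D)"
    using P.K_mor_lax[OF F] P.K_mor(2)[OF F] by (simp add: K_lr_def SkMon_sel)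
next
  fix C D E :: "('o, 'm) shmulti" and F G
  assume "C \<in> Ob ShMulti_lr" "D \<in> Ob ShMulti_lr" "E \<in> Ob ShMulti_lr"
    "F \<in> Hom ShMulti_lr C D" "G \<in> Hom ShMulti_lr D E"
  then show "FHom (K_lr ch) C E (Comp ShMulti_lr C D E G F)
      = Comp SkMon_ln (FOb (K_lr ch) C) (FOb (K_lr ch) D) (FOb (K_lr ch) E)
          (FHom (K_lr ch) D E G) (FHom (K_lr ch) C D F)"
    using K_mor_Comp[OF short_lr_ch short_lr_ch short_lr_ch, of C D E F G]
    by (simp add: K_lr_def ShMulti_sel(2))
qed

lemma K_full_faithful: "full_faithful ShMulti_lr SkMon_ln (K_lr ch)"
  unfolding full_faithful_def
proof (intro ballI)
  fix C D :: "('o, 'm) shmulti"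
  assume CD: "C \<in> Ob ShMulti_lr" "D \<in> Ob ShMulti_lr"
  then interpret P: short_lr_pair C "ch C" D "ch D"
    using short_lr_ch by (intro short_lr_pairI)
  show "bij_betw (FHom (K_lr ch) C D) (Hom ShMulti_lr C D) (Hom SkMon_ln (FOb (K_lr ch) C) (FOb (K_lr ch) D))"
    unfolding bij_betw_def
  proof
    show "inj_on (FHom (K_lr ch) C D) (Hom ShMulti_lr C D)"
      using P.K_mor_faithful by (auto simp: inj_on_def K_lr_def ShMulti_sel(2))
    show "FHom (K_lr ch) C D ` Hom ShMulti_lr C D = Hom SkMon_ln (FOb (K_lr ch) C) (FOb (K_lr ch) D)"
    proof (intro equalityI subsetI)
      fix G assume "G \<in> FHom (K_lr ch) C D ` Hom ShMulti_lr C D"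
      then show "G \<in> Hom SkMon_ln (FOb (K_lr ch) C) (FOb (K_lr ch) D)"
        using K_functor CD by (auto simp: is_functor_def)
    next
      fix G assume "G \<in> Hom SkMon_ln (FOb (K_lr ch) C) (FOb (K_lr ch) D)"
      then obtain F where "sh_morphism C D F" "shmor_ext C F" "K_mor C (ch C) D (ch D) F = G"
        using P.K_mor_full[of G] by (auto simp: K_lr_def SkMon_sel(2))
      then show "G \<in> FHom (K_lr ch) C D ` Hom ShMulti_lr C D"
        by (intro image_eqI[of _ _ F]) (simp_all add: K_lr_def ShMulti_sel(2))
    qed
  qed
qed

text \<open>\<open>K\<close> of the identity, formed with two different choices. By functoriality the two directions are
  inverse to each other.\<close>

lemma K_change_of_choice:
  fixes C :: "('o, 'm) shmulti"
  assumes r: "short_lr C r" and s: "short_lr C s" and C: "C \<in> Ob ShMulti_lr"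
  shows "iso SkMon_ln (K_obj C r) (K_obj C s) (K_mor C r C s (Idn ShMulti_lr C))"
proof -
  interpret P: short_lr_pair C r C s using r s by (rule short_lr_pairI)
  interpret Q: short_lr_pair C s C r using s r by (rule short_lr_pairI)
  interpret Sh: category "ShMulti_lr :: (('o, 'm) shmulti, ('o, 'm, 'o, 'm) shmor) cat"
    by (rule category_ShMulti_lr)
  have I: "sh_morphism C C (Idn ShMulti_lr C)" "shmor_ext C (Idn ShMulti_lr C)"
    using Sh.idn_closed[OF C] by (simp_all only: ShMulti_sel(2))
  have II: "Comp ShMulti_lr C C C (Idn ShMulti_lr C) (Idn ShMulti_lr C) = Idn ShMulti_lr C"
    using Sh.idn_left[OF C C Sh.idn_closed[OF C]] .
  show ?thesis
    unfolding iso_def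
    using K_mor_Comp[OF r s r I I] K_mor_Comp[OF s r s I I] II K_mor_Idn[OF r] K_mor_Idn[OF s]
      P.K_mor_lax[OF I] P.K_mor(2)[OF I] Q.K_mor_lax[OF I] Q.K_mor(2)[OF I]
    by (auto simp: SkMon_sel(2) intro!: bexI[of _ "K_mor C s C r (Idn ShMulti_lr C)"])
qed

lemma K_of_multicategory:
  fixes C :: "('o, 'm) skmon"
  assumes C: "C \<in> Ob SkMon_ln"
  shows "\<exists>M\<in>Ob Multi_lr. \<exists>f. iso SkMon_ln (FOb (K_lr ch) (U_obj M)) C f"
proof -
  interpret ln_skew_monoidal C
    using C by (simp add: SkMon_sel ln_skew_monoidal_def ln_skew_monoidal_axioms_def)
  interpret Sk: category "SkMon_ln :: (('o, 'm) skmon, ('o, 'm, 'o, 'm) laxfun) cat"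
    by (rule category_SkMon_ln)
  have M: "multi \<in> Ob Multi_lr"
    using multicategory_multi left_representable_multi by (simp add: Multi_sel(1))
  then have S: "U_obj multi \<in> Ob ShMulti_lr" by (rule U_obj_in)
  obtain f where f: "iso SkMon_ln (K_obj (U_obj multi) canonical) C f"
    using K_canonical_iso by blast
  have "iso SkMon_ln (K_obj (U_obj multi) (ch (U_obj multi))) C
      (Comp SkMon_ln (K_obj (U_obj multi) (ch (U_obj multi))) (K_obj (U_obj multi) canonical) C f
        (K_mor (U_obj multi) (ch (U_obj multi)) (U_obj multi) canonical (Idn ShMulti_lr (U_obj multi))))"
    by (rule Sk.iso_trans[OF K_obj_SkMon[OF short_lr_ch[OF S]] K_obj_SkMon[OF short_lr_canonical] C
          K_change_of_choice[OF short_lr_ch[OF S] short_lr_canonical S] f])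
  then show ?thesis using M by (auto simp: K_lr_def)
qed

lemma K_equivalence: "equivalence_of_categories ShMulti_lr SkMon_ln (K_lr ch)"
proof (rule equivalence_if_full_faithful_ess_surjective)
  show "ess_surjective ShMulti_lr SkMon_ln (K_lr ch)"
    unfolding ess_surjective_def using K_of_multicategory U_obj_in by blast
qed (rule category_ShMulti_lr category_SkMon_ln K_functor K_full_faithful)+

text \<open>If \<open>M\<close> is the multicategory constructed from \<open>K S\<close>, then \<open>K (U M)\<close> is isomorphic to \<open>K S\<close>, and the
  fully faithful functor \<open>K\<close> reflects this to an isomorphism between \<open>U M\<close> and \<open>S\<close>.\<close>

lemma U_ess_surjective:
  "ess_surjective Multi_lr (ShMulti_lr :: (('o, 'm) shmulti, ('o, 'm, 'o, 'm) shmor) cat) U_lr"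
  unfolding ess_surjective_def
proof
  fix S :: "('o, 'm) shmulti" assume S: "S \<in> Ob ShMulti_lr"
  have "FOb (K_lr ch) S \<in> Ob SkMon_ln" using K_functor S by (simp add: is_functor_def)
  then obtain M f where M: "M \<in> Ob Multi_lr" and f: "iso SkMon_ln (FOb (K_lr ch) (U_obj M)) (FOb (K_lr ch) S) f"
    using K_of_multicategory by blast
  show "\<exists>M\<in>Ob Multi_lr. \<exists>e. iso ShMulti_lr (FOb U_lr M) S e"
    using iso_reflected[OF category_ShMulti_lr K_functor K_full_faithful U_obj_in[OF M] S f] M
    by (auto simp: U_lr_def)
qed

end

lemma U_full_faithful:
  "full_faithful (Multi_lr :: (('o, 'm) multi, ('o, 'm, 'o, 'm) mfun) cat) ShMulti_lr U_lr"
  unfolding full_faithful_def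
proof (intro ballI)
  fix M N :: "('o, 'm) multi"
  assume "M \<in> Ob Multi_lr" "N \<in> Ob Multi_lr"
  then have MN: "multicategory M" "multi_left_representable M" "multicategory N" by (auto simp: Multi_sel(1))
  show "bij_betw (FHom U_lr M N) (Hom Multi_lr M N) (Hom ShMulti_lr (FOb U_lr M) (FOb U_lr N))"
    unfolding bij_betw_def
  proof
    show "inj_on (FHom U_lr M N) (Hom Multi_lr M N)"
      using U_mor_faithful[OF MN] by (auto simp: inj_on_def U_lr_def Multi_sel(2))
    show "FHom U_lr M N ` Hom Multi_lr M N = Hom ShMulti_lr (FOb U_lr M) (FOb U_lr N)"
    proof (intro equalityI subsetI)
      fix F assume "F \<in> FHom U_lr M N ` Hom Multi_lr M N"
      then show "F \<in> Hom ShMulti_lr (FOb U_lr M) (FOb U_lr N)"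
        using U_mor(1,2)[OF MN(1,3)] by (auto simp: U_lr_def Multi_sel(2) ShMulti_sel(2))
    next
      fix F assume "F \<in> Hom ShMulti_lr (FOb U_lr M) (FOb U_lr N)"
      then obtain G where "multifunctor M N G" "mfun_ext M G" "U_mor G = F"
        using U_mor_full[OF MN, of F] by (auto simp: U_lr_def ShMulti_sel(2))
      then show "F \<in> FHom U_lr M N ` Hom Multi_lr M N"
        by (intro image_eqI[of _ _ G]) (simp_all add: U_lr_def Multi_sel(2))
    qed
  qed
qed

theorem theorem4p5:
  fixes ch :: "('o, 'm) shmulti \<Rightarrow> ('o, 'm) lrchoice"
  assumes "\<And>C. \<lbrakk>short_multicategory C; sh_left_representable C\<rbrakk> \<Longrightarrow> left_universal C (ch C)"
  shows "equivalence_of_categories ShMulti_lr SkMon_ln (K_lr ch) \<and>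
         equivalence_of_categories Multi_lr ShMulti_lr
           (U_lr :: (('o, 'm) multi, ('o, 'm, 'o, 'm) mfun,
                     ('o, 'm) shmulti, ('o, 'm, 'o, 'm) shmor) functr)"
proof
  show "equivalence_of_categories ShMulti_lr SkMon_ln (K_lr ch)"
    by (rule K_equivalence) (rule assms)
  have "ess_surjective Multi_lr (ShMulti_lr :: (('o, 'm) shmulti, ('o, 'm, 'o, 'm) shmor) cat) U_lr"
    by (rule U_ess_surjective) (rule assms)
  then show "equivalence_of_categories Multi_lr ShMulti_lr
           (U_lr :: (('o, 'm) multi, ('o, 'm, 'o, 'm) mfun,
                     ('o, 'm) shmulti, ('o, 'm, 'o, 'm) shmor) functr)"
    by (intro equivalence_if_full_faithful_ess_surjective category_Multi_lr category_ShMulti_lr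
        U_functor U_full_faithful)
qed


end
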